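(* Let $\mathcal{M}$ be a model category with functorial factorizations in which sequential colimits of cofibrations are homotopical. Assume that $\mathcal{M}$ is equipped with a Quillen adjunction $T\colon\mathcal{M}\rightleftarrows\mathcal{M}\colon\Omega$ such that $\Omega$ sends sequential colimits of cofibrations to homotopy colimits. Then the level model structure on the category $\mathsf{Spt}_T(\mathcal{M})$ of $T$-prespectra admits a left Bousfield localization among coSpitzweck right semimodel categories which presents the homotopy theory of $\Omega$-spectra over $\mathcal{M}$.
   Context: A $T$-prespectrum $\mathcal{X}$ in $\mathcal{M}$ is a sequence of objects $\mathcal{X}(n)$, $n\ge 0$, with structure maps $T\mathcal{X}(n)\to\mathcal{X}(n+1)$; maps are sequences of maps commuting with structure maps. In the level model structure a map $\mathcal{X}\to\mathcal{Y}$ is an equivalence (resp. fibration) iff every $\mathcal{X}(n)\to\mathcal{Y}(n)$ is an equivalence (resp. fibration) in $\mathcal{M}$. An $\Omega$-spectrum is a $T$-prespectrum such that all adjoint structure maps $\mathcal{X}(n)\to\Omega\mathcal{X}(n+1)$ are equivalences. "Sequential colimits of cofibrations are homotopical" means that the colimit functor sends levelwise equivalences between sequences of cofibrations $X_0\to X_1\to X_2\to\cdots$ to equivalences. "$\Omega$ sends sequential colimits of cofibrations to homotopy colimits" means that for such a sequence, $\Omega(\mathrm{colim}_i X_i)$ is, via the canonical map, the homotopy colimit of the sequence $\Omega X_i$. "Presents the homotopy theory of $\Omega$-spectra" means that the fibrant objects of the localization are the level-fibrant $\Omega$-spectra, so that its homotopy category is the full subcategory of the homotopy category of the level model structure on the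 level-fibrant $\Omega$-spectra. A Fresse right semimodel category is a bicomplete category with classes $\mathrm{Cof},\mathrm{Eq},\mathrm{Fib}$, where $\mathrm{Eq}$ is closed under retracts and satisfies 2-out-of-3, $\mathrm{Cof}$ is closed under retracts and pushouts, $\mathrm{Fib}$ is closed under retracts and pullbacks, such that: (i) acyclic cofibrations lift against fibrations with fibrant target and cofibrations lift against acyclic fibrations with fibrant target; (ii) any map with fibrant target factors as an acyclic cofibration followed by a fibration, and as a cofibration followed by an acyclic fibration; (iii) the terminal object is fibrant. It is coSpitzweck if moreover $(\mathrm{Cof},\mathrm{Fib}\cap\mathrm{Eq})$ is a weak factorization system. Left Quillen functors between right semimodel categories are left adjoints preserving cofibrations and acyclic cofibrations. A left Bousfield localization of $\mathcal{N}$ (at a class of maps $W$) among coSpitzweck right semimodel categories is such a semimodel category $L_W\mathcal{N}$ with a left Quillen functor $\mathcal{N}\to L_W\mathcal{N}$ initial among left Quillen functors to coSpitzweck right semimodel categories sending $W$ to equivalences.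
   Formalization: The condition that Ω sends sequential colimits of cofibrations to homotopy colimits is imposed on the right derived functor (after fibrant replacement), as the claim fails for underived Ω; initiality is tested against semimodel categories of an arbitrary but fixed size. *)

theory Defs
  imports "HOL-Library.Equipollence" "HOL-Library.Countable_Set"
begin

section \<open>Categories, functors, adjunctions\<close>

record ('o, 'a) cat =
  ob :: "'o set"
  arr :: "'a set"
  src :: "'a \<Rightarrow> 'o"
  tgt :: "'a \<Rightarrow> 'o"
  idn :: "'o \<Rightarrow> 'a"
  cmp :: "'a \<Rightarrow> 'a \<Rightarrow> 'a"

abbreviation cmp_in :: "'a \<Rightarrow> ('o, 'a, 'z) cat_scheme \<Rightarrow> 'a \<Rightarrow> 'a"  ("(_ \<cdot>\<^bsub>_\<^esub>/ _)" [66, 0, 65] 65)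
  where "g \<cdot>\<^bsub>C\<^esub> f \<equiv> cmp C g f"

definition hom :: "('o, 'a, 'z) cat_scheme \<Rightarrow> 'o \<Rightarrow> 'o \<Rightarrow> 'a set" where
  "hom C x y = {f \<in> arr C. src C f = x \<and> tgt C f = y}"

definition category :: "('o, 'a, 'z) cat_scheme \<Rightarrow> bool" where
  "category C \<longleftrightarrow>
     (\<forall>f\<in>arr C. src C f \<in> ob C \<and> tgt C f \<in> ob C) \<and>
     (\<forall>x\<in>ob C. idn C x \<in> hom C x x) \<and>
     (\<forall>f\<in>arr C. \<forall>g\<in>arr C. tgt C f = src C g \<longrightarrow> g \<cdot>\<^bsub>C\<^esub> f \<in> hom C (src C f) (tgt C g)) \<and>
     (\<forall>f\<in>arr C. f \<cdot>\<^bsub>C\<^esub> idn C (src C f) = f \<and> idn C (tgt C f) \<cdot>\<^bsub>C\<^esub> f = f) \<and>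
     (\<forall>f\<in>arr C. \<forall>g\<in>arr C. \<forall>h\<in>arr C. tgt C f = src C g \<longrightarrow> tgt C g = src C h \<longrightarrow>
        h \<cdot>\<^bsub>C\<^esub> (g \<cdot>\<^bsub>C\<^esub> f) = (h \<cdot>\<^bsub>C\<^esub> g) \<cdot>\<^bsub>C\<^esub> f)"

definition full_subcategory ::
  "('o, 'a, 'z) cat_scheme \<Rightarrow> 'o set \<Rightarrow> ('o, 'a) cat" where
  "full_subcategory C S =
     \<lparr>ob = S, arr = {f \<in> arr C. src C f \<in> S \<and> tgt C f \<in> S},
      src = src C, tgt = tgt C, idn = idn C, cmp = cmp C\<rparr>"

record ('o, 'a, 'p, 'b) ftr =
  omap :: "'o \<Rightarrow> 'p"
  amap :: "'a \<Rightarrow> 'b"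

definition is_functor ::
  "('o, 'a, 'z) cat_scheme \<Rightarrow> ('p, 'b, 'y) cat_scheme \<Rightarrow> ('o, 'a, 'p, 'b) ftr \<Rightarrow> bool" where
  "is_functor C D F \<longleftrightarrow> category C \<and> category D \<and>
     (\<forall>x\<in>ob C. omap F x \<in> ob D) \<and>
     (\<forall>f\<in>arr C. amap F f \<in> hom D (omap F (src C f)) (omap F (tgt C f))) \<and>
     (\<forall>x\<in>ob C. amap F (idn C x) = idn D (omap F x)) \<and>
     (\<forall>f\<in>arr C. \<forall>g\<in>arr C. tgt C f = src C g \<longrightarrow>
        amap F (g \<cdot>\<^bsub>C\<^esub> f) = amap F g \<cdot>\<^bsub>D\<^esub> amap F f)"

definition id_ftr :: "('o, 'a, 'o, 'a) ftr" where
  "id_ftr = \<lparr>omap = (\<lambda>x. x), amap = (\<lambda>f. f)\<rparr>"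

definition comp_ftr ::
  "('p, 'b, 'q, 'c) ftr \<Rightarrow> ('o, 'a, 'p, 'b) ftr \<Rightarrow> ('o, 'a, 'q, 'c) ftr" where
  "comp_ftr G F = \<lparr>omap = omap G \<circ> omap F, amap = amap G \<circ> amap F\<rparr>"

text \<open>Values of a functor outside its source category are irrelevant, so functors are
  compared on the carrier only.\<close>
definition same_functor ::
  "('o, 'a, 'z) cat_scheme \<Rightarrow> ('o, 'a, 'p, 'b) ftr \<Rightarrow> ('o, 'a, 'p, 'b) ftr \<Rightarrow> bool" where
  "same_functor C F G \<longleftrightarrow>
     (\<forall>x\<in>ob C. omap F x = omap G x) \<and> (\<forall>f\<in>arr C. amap F f = amap G f)"

definition nat_trans ::
  "('o, 'a, 'z) cat_scheme \<Rightarrow> ('p, 'b, 'y) cat_scheme \<Rightarrow>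
   ('o, 'a, 'p, 'b) ftr \<Rightarrow> ('o, 'a, 'p, 'b) ftr \<Rightarrow> ('o \<Rightarrow> 'b) \<Rightarrow> bool" where
  "nat_trans C D F G \<theta> \<longleftrightarrow>
     (\<forall>x\<in>ob C. \<theta> x \<in> hom D (omap F x) (omap G x)) \<and>
     (\<forall>f\<in>arr C. \<theta> (tgt C f) \<cdot>\<^bsub>D\<^esub> amap F f = amap G f \<cdot>\<^bsub>D\<^esub> \<theta> (src C f))"

definition adjunction ::
  "('o, 'a, 'z) cat_scheme \<Rightarrow> ('p, 'b, 'y) cat_scheme \<Rightarrow>
   ('o, 'a, 'p, 'b) ftr \<Rightarrow> ('p, 'b, 'o, 'a) ftr \<Rightarrow> ('o \<Rightarrow> 'a) \<Rightarrow> ('p \<Rightarrow> 'b) \<Rightarrow> bool" where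
  "adjunction C D F G \<eta> \<epsilon> \<longleftrightarrow> is_functor C D F \<and> is_functor D C G \<and>
     nat_trans C C id_ftr (comp_ftr G F) \<eta> \<and>
     nat_trans D D (comp_ftr F G) id_ftr \<epsilon> \<and>
     (\<forall>x\<in>ob C. \<epsilon> (omap F x) \<cdot>\<^bsub>D\<^esub> amap F (\<eta> x) = idn D (omap F x)) \<and>
     (\<forall>y\<in>ob D. amap G (\<epsilon> y) \<cdot>\<^bsub>C\<^esub> \<eta> (omap G y) = idn C (omap G y))"

definition iso_objects :: "('o, 'a, 'z) cat_scheme \<Rightarrow> 'o \<Rightarrow> 'o \<Rightarrow> bool" where
  "iso_objects C x y \<longleftrightarrow>
     (\<exists>f\<in>hom C x y. \<exists>g\<in>hom C y x. g \<cdot>\<^bsub>C\<^esub> f = idn C x \<and> f \<cdot>\<^bsub>C\<^esub> g = idn C y)"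

definition equivalence_of_categories ::
  "('o, 'a, 'z) cat_scheme \<Rightarrow> ('p, 'b, 'y) cat_scheme \<Rightarrow> ('o, 'a, 'p, 'b) ftr \<Rightarrow> bool" where
  "equivalence_of_categories C D F \<longleftrightarrow> is_functor C D F \<and>
     (\<forall>x\<in>ob C. \<forall>y\<in>ob C. bij_betw (amap F) (hom C x y) (hom D (omap F x) (omap F y))) \<and>
     (\<forall>d\<in>ob D. \<exists>x\<in>ob C. iso_objects D (omap F x) d)"


section \<open>Limits and colimits\<close>

definition cone ::
  "('j, 'k, 'y) cat_scheme \<Rightarrow> ('o, 'a, 'z) cat_scheme \<Rightarrow> ('j, 'k, 'o, 'a) ftr \<Rightarrow>
   'o \<Rightarrow> ('j \<Rightarrow> 'a) \<Rightarrow> bool" where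
  "cone J C D c \<pi> \<longleftrightarrow> c \<in> ob C \<and> (\<forall>j\<in>ob J. \<pi> j \<in> hom C c (omap D j)) \<and>
     (\<forall>k\<in>arr J. amap D k \<cdot>\<^bsub>C\<^esub> \<pi> (src J k) = \<pi> (tgt J k))"

definition limit_cone ::
  "('j, 'k, 'y) cat_scheme \<Rightarrow> ('o, 'a, 'z) cat_scheme \<Rightarrow> ('j, 'k, 'o, 'a) ftr \<Rightarrow>
   'o \<Rightarrow> ('j \<Rightarrow> 'a) \<Rightarrow> bool" where
  "limit_cone J C D c \<pi> \<longleftrightarrow> cone J C D c \<pi> \<and>
     (\<forall>c' \<pi>'. cone J C D c' \<pi>' \<longrightarrow> (\<exists>!h. h \<in> hom C c' c \<and> (\<forall>j\<in>ob J. \<pi> j \<cdot>\<^bsub>C\<^esub> h = \<pi>' j)))"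

definition cocone ::
  "('j, 'k, 'y) cat_scheme \<Rightarrow> ('o, 'a, 'z) cat_scheme \<Rightarrow> ('j, 'k, 'o, 'a) ftr \<Rightarrow>
   'o \<Rightarrow> ('j \<Rightarrow> 'a) \<Rightarrow> bool" where
  "cocone J C D c \<iota> \<longleftrightarrow> c \<in> ob C \<and> (\<forall>j\<in>ob J. \<iota> j \<in> hom C (omap D j) c) \<and>
     (\<forall>k\<in>arr J. \<iota> (tgt J k) \<cdot>\<^bsub>C\<^esub> amap D k = \<iota> (src J k))"

definition colimit_cocone ::
  "('j, 'k, 'y) cat_scheme \<Rightarrow> ('o, 'a, 'z) cat_scheme \<Rightarrow> ('j, 'k, 'o, 'a) ftr \<Rightarrow>
   'o \<Rightarrow> ('j \<Rightarrow> 'a) \<Rightarrow> bool" where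
  "colimit_cocone J C D c \<iota> \<longleftrightarrow> cocone J C D c \<iota> \<and>
     (\<forall>c' \<iota>'. cocone J C D c' \<iota>' \<longrightarrow> (\<exists>!h. h \<in> hom C c c' \<and> (\<forall>j\<in>ob J. h \<cdot>\<^bsub>C\<^esub> \<iota> j = \<iota>' j)))"

text \<open>Smallness is measured by a type \<open>'u\<close>: a category is small if it has strictly fewer
  arrows than \<open>'u\<close> has elements. For \<open>'u\<close> of inaccessible cardinality these are, up to
  isomorphism, the small categories of a Grothendieck universe. Every small shape is isomorphic
  to one whose objects and arrows are elements of \<open>'u\<close>.\<close>
definition bicomplete :: "'u itself \<Rightarrow> ('o, 'a, 'z) cat_scheme \<Rightarrow> bool" where
  "bicomplete U C \<longleftrightarrow> category C \<and>
     (\<forall>(J :: ('u, 'u) cat) D. is_functor J C D \<and> arr J \<prec> (UNIV :: 'u set) \<longrightarrow>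
        (\<exists>c \<pi>. limit_cone J C D c \<pi>) \<and> (\<exists>c \<iota>. colimit_cocone J C D c \<iota>))"

definition terminal :: "('o, 'a, 'z) cat_scheme \<Rightarrow> 'o \<Rightarrow> bool" where
  "terminal C t \<longleftrightarrow> t \<in> ob C \<and> (\<forall>x\<in>ob C. \<exists>!f. f \<in> hom C x t)"

definition initial :: "('o, 'a, 'z) cat_scheme \<Rightarrow> 'o \<Rightarrow> bool" where
  "initial C i \<longleftrightarrow> i \<in> ob C \<and> (\<forall>x\<in>ob C. \<exists>!f. f \<in> hom C i x)"

text \<open>In both squares, \<open>f'\<close> is the (co)base change of \<open>f\<close> along \<open>g\<close>.\<close>
definition pushout_square :: "('o, 'a, 'z) cat_scheme \<Rightarrow> 'a \<Rightarrow> 'a \<Rightarrow> 'a \<Rightarrow> 'a \<Rightarrow> bool" where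
  "pushout_square C f g f' g' \<longleftrightarrow>
     f \<in> arr C \<and> g \<in> arr C \<and> f' \<in> arr C \<and> g' \<in> arr C \<and>
     src C f = src C g \<and> src C f' = tgt C g \<and> src C g' = tgt C f \<and> tgt C f' = tgt C g' \<and>
     g' \<cdot>\<^bsub>C\<^esub> f = f' \<cdot>\<^bsub>C\<^esub> g \<and>
     (\<forall>u\<in>arr C. \<forall>v\<in>arr C. src C u = tgt C f \<and> src C v = tgt C g \<and> tgt C u = tgt C v \<and>
        u \<cdot>\<^bsub>C\<^esub> f = v \<cdot>\<^bsub>C\<^esub> g \<longrightarrow>
        (\<exists>!h. h \<in> hom C (tgt C f') (tgt C u) \<and> h \<cdot>\<^bsub>C\<^esub> g' = u \<and> h \<cdot>\<^bsub>C\<^esub> f' = v))"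

definition pullback_square :: "('o, 'a, 'z) cat_scheme \<Rightarrow> 'a \<Rightarrow> 'a \<Rightarrow> 'a \<Rightarrow> 'a \<Rightarrow> bool" where
  "pullback_square C f g f' g' \<longleftrightarrow>
     f \<in> arr C \<and> g \<in> arr C \<and> f' \<in> arr C \<and> g' \<in> arr C \<and>
     tgt C f = tgt C g \<and> tgt C f' = src C g \<and> tgt C g' = src C f \<and> src C f' = src C g' \<and>
     f \<cdot>\<^bsub>C\<^esub> g' = g \<cdot>\<^bsub>C\<^esub> f' \<and>
     (\<forall>u\<in>arr C. \<forall>v\<in>arr C. tgt C u = src C f \<and> tgt C v = src C g \<and> src C u = src C v \<and>
        f \<cdot>\<^bsub>C\<^esub> u = g \<cdot>\<^bsub>C\<^esub> v \<longrightarrow>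
        (\<exists>!h. h \<in> hom C (src C u) (src C f') \<and> g' \<cdot>\<^bsub>C\<^esub> h = u \<and> f' \<cdot>\<^bsub>C\<^esub> h = v))"


section \<open>Classes of maps\<close>

definition retract_of :: "('o, 'a, 'z) cat_scheme \<Rightarrow> 'a \<Rightarrow> 'a \<Rightarrow> bool" where
  "retract_of C f g \<longleftrightarrow> f \<in> arr C \<and> g \<in> arr C \<and>
     (\<exists>i\<in>hom C (src C f) (src C g). \<exists>r\<in>hom C (src C g) (src C f).
      \<exists>j\<in>hom C (tgt C f) (tgt C g). \<exists>s\<in>hom C (tgt C g) (tgt C f).
        r \<cdot>\<^bsub>C\<^esub> i = idn C (src C f) \<and> s \<cdot>\<^bsub>C\<^esub> j = idn C (tgt C f) \<and>
        g \<cdot>\<^bsub>C\<^esub> i = j \<cdot>\<^bsub>C\<^esub> f \<and> f \<cdot>\<^bsub>C\<^esub> r = s \<cdot>\<^bsub>C\<^esub> g)"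

definition closed_under_retracts :: "('o, 'a, 'z) cat_scheme \<Rightarrow> 'a set \<Rightarrow> bool" where
  "closed_under_retracts C S \<longleftrightarrow> (\<forall>f g. g \<in> S \<and> retract_of C f g \<longrightarrow> f \<in> S)"

definition closed_under_pushouts :: "('o, 'a, 'z) cat_scheme \<Rightarrow> 'a set \<Rightarrow> bool" where
  "closed_under_pushouts C S \<longleftrightarrow> (\<forall>f g f' g'. f \<in> S \<and> pushout_square C f g f' g' \<longrightarrow> f' \<in> S)"

definition closed_under_pullbacks :: "('o, 'a, 'z) cat_scheme \<Rightarrow> 'a set \<Rightarrow> bool" where
  "closed_under_pullbacks C S \<longleftrightarrow> (\<forall>f g f' g'. f \<in> S \<and> pullback_square C f g f' g' \<longrightarrow> f' \<in> S)"

definition two_out_of_three :: "('o, 'a, 'z) cat_scheme \<Rightarrow> 'a set \<Rightarrow> bool" where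
  "two_out_of_three C S \<longleftrightarrow>
     (\<forall>f\<in>arr C. \<forall>g\<in>arr C. tgt C f = src C g \<longrightarrow>
        (f \<in> S \<and> g \<in> S \<longrightarrow> g \<cdot>\<^bsub>C\<^esub> f \<in> S) \<and>
        (f \<in> S \<and> g \<cdot>\<^bsub>C\<^esub> f \<in> S \<longrightarrow> g \<in> S) \<and>
        (g \<in> S \<and> g \<cdot>\<^bsub>C\<^esub> f \<in> S \<longrightarrow> f \<in> S))"

definition lifts_against :: "('o, 'a, 'z) cat_scheme \<Rightarrow> 'a \<Rightarrow> 'a \<Rightarrow> bool" where
  "lifts_against C i p \<longleftrightarrow>
     (\<forall>u\<in>hom C (src C i) (src C p). \<forall>v\<in>hom C (tgt C i) (tgt C p).
        p \<cdot>\<^bsub>C\<^esub> u = v \<cdot>\<^bsub>C\<^esub> i \<longrightarrow>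
        (\<exists>h\<in>hom C (tgt C i) (src C p). h \<cdot>\<^bsub>C\<^esub> i = u \<and> p \<cdot>\<^bsub>C\<^esub> h = v))"

definition factors_as :: "('o, 'a, 'z) cat_scheme \<Rightarrow> 'a set \<Rightarrow> 'a set \<Rightarrow> 'a \<Rightarrow> bool" where
  "factors_as C A B f \<longleftrightarrow> (\<exists>i\<in>A. \<exists>p\<in>B. i \<in> arr C \<and> p \<in> arr C \<and>
     src C i = src C f \<and> tgt C i = src C p \<and> tgt C p = tgt C f \<and> p \<cdot>\<^bsub>C\<^esub> i = f)"

definition weak_factorization_system ::
  "('o, 'a, 'z) cat_scheme \<Rightarrow> 'a set \<Rightarrow> 'a set \<Rightarrow> bool" where
  "weak_factorization_system C A B \<longleftrightarrow>
     A = {i \<in> arr C. \<forall>p\<in>B. lifts_against C i p} \<and>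
     B = {p \<in> arr C. \<forall>i\<in>A. lifts_against C i p} \<and>
     (\<forall>f\<in>arr C. factors_as C A B f)"

text \<open>\<open>m f\<close> is the middle object of the factorization \<open>r f \<circ> l f\<close> of \<open>f\<close>, and \<open>e f g u v\<close> is the
  map \<open>m f \<rightarrow> m g\<close> induced by a commutative square \<open>(u, v)\<close> from \<open>f\<close> to \<open>g\<close>.\<close>
definition functorial_factorization ::
  "('o, 'a, 'z) cat_scheme \<Rightarrow> 'a set \<Rightarrow> 'a set \<Rightarrow> bool" where
  "functorial_factorization C A B \<longleftrightarrow>
     (\<exists>(m :: 'a \<Rightarrow> 'o) (l :: 'a \<Rightarrow> 'a) (r :: 'a \<Rightarrow> 'a) (e :: 'a \<Rightarrow> 'a \<Rightarrow> 'a \<Rightarrow> 'a \<Rightarrow> 'a).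
        (\<forall>f\<in>arr C. l f \<in> A \<and> r f \<in> B \<and> l f \<in> hom C (src C f) (m f) \<and>
           r f \<in> hom C (m f) (tgt C f) \<and> r f \<cdot>\<^bsub>C\<^esub> l f = f \<and>
           e f f (idn C (src C f)) (idn C (tgt C f)) = idn C (m f)) \<and>
        (\<forall>f\<in>arr C. \<forall>g\<in>arr C. \<forall>u\<in>hom C (src C f) (src C g). \<forall>v\<in>hom C (tgt C f) (tgt C g).
           g \<cdot>\<^bsub>C\<^esub> u = v \<cdot>\<^bsub>C\<^esub> f \<longrightarrow>
             e f g u v \<in> hom C (m f) (m g) \<and>
             e f g u v \<cdot>\<^bsub>C\<^esub> l f = l g \<cdot>\<^bsub>C\<^esub> u \<and> r g \<cdot>\<^bsub>C\<^esub> e f g u v = v \<cdot>\<^bsub>C\<^esub> r f \<and>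
             (\<forall>k\<in>arr C. \<forall>u'\<in>hom C (src C g) (src C k). \<forall>v'\<in>hom C (tgt C g) (tgt C k).
                k \<cdot>\<^bsub>C\<^esub> u' = v' \<cdot>\<^bsub>C\<^esub> g \<longrightarrow>
                e f k (u' \<cdot>\<^bsub>C\<^esub> u) (v' \<cdot>\<^bsub>C\<^esub> v) = e g k u' v' \<cdot>\<^bsub>C\<^esub> e f g u v)))"


section \<open>Model categories and right semimodel categories\<close>

record ('o, 'a) mcat = "('o, 'a) cat" +
  Cof :: "'a set"
  Eqv :: "'a set"
  Fib :: "'a set"

definition fibrant :: "('o, 'a, 'z) mcat_scheme \<Rightarrow> 'o \<Rightarrow> bool" where
  "fibrant M x \<longleftrightarrow> x \<in> ob M \<and> (\<exists>t. terminal M t \<and> (\<exists>f\<in>hom M x t. f \<in> Fib M))"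

definition cofibrant :: "('o, 'a, 'z) mcat_scheme \<Rightarrow> 'o \<Rightarrow> bool" where
  "cofibrant M x \<longleftrightarrow> x \<in> ob M \<and> (\<exists>i. initial M i \<and> (\<exists>f\<in>hom M i x. f \<in> Cof M))"

definition model_category :: "'u itself \<Rightarrow> ('o, 'a, 'z) mcat_scheme \<Rightarrow> bool" where
  "model_category U M \<longleftrightarrow> bicomplete U M \<and>
     Cof M \<subseteq> arr M \<and> Eqv M \<subseteq> arr M \<and> Fib M \<subseteq> arr M \<and>
     two_out_of_three M (Eqv M) \<and>
     closed_under_retracts M (Cof M) \<and> closed_under_retracts M (Eqv M) \<and>
     closed_under_retracts M (Fib M) \<and>
     (\<forall>i\<in>Cof M \<inter> Eqv M. \<forall>p\<in>Fib M. lifts_against M i p) \<and>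
     (\<forall>i\<in>Cof M. \<forall>p\<in>Fib M \<inter> Eqv M. lifts_against M i p) \<and>
     (\<forall>f\<in>arr M. factors_as M (Cof M \<inter> Eqv M) (Fib M) f) \<and>
     (\<forall>f\<in>arr M. factors_as M (Cof M) (Fib M \<inter> Eqv M) f)"

definition has_functorial_factorizations :: "('o, 'a, 'z) mcat_scheme \<Rightarrow> bool" where
  "has_functorial_factorizations M \<longleftrightarrow>
     functorial_factorization M (Cof M \<inter> Eqv M) (Fib M) \<and>
     functorial_factorization M (Cof M) (Fib M \<inter> Eqv M)"

definition right_semimodel_category :: "'u itself \<Rightarrow> ('o, 'a, 'z) mcat_scheme \<Rightarrow> bool" where
  "right_semimodel_category U M \<longleftrightarrow> bicomplete U M \<and>
     Cof M \<subseteq> arr M \<and> Eqv M \<subseteq> arr M \<and> Fib M \<subseteq> arr M \<and>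
     closed_under_retracts M (Eqv M) \<and> two_out_of_three M (Eqv M) \<and>
     closed_under_retracts M (Cof M) \<and> closed_under_pushouts M (Cof M) \<and>
     closed_under_retracts M (Fib M) \<and> closed_under_pullbacks M (Fib M) \<and>
     (\<forall>i\<in>Cof M \<inter> Eqv M. \<forall>p\<in>Fib M. fibrant M (tgt M p) \<longrightarrow> lifts_against M i p) \<and>
     (\<forall>i\<in>Cof M. \<forall>p\<in>Fib M \<inter> Eqv M. fibrant M (tgt M p) \<longrightarrow> lifts_against M i p) \<and>
     (\<forall>f\<in>arr M. fibrant M (tgt M f) \<longrightarrow>
        factors_as M (Cof M \<inter> Eqv M) (Fib M) f \<and> factors_as M (Cof M) (Fib M \<inter> Eqv M) f) \<and>
     (\<forall>t. terminal M t \<longrightarrow> fibrant M t)"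

definition coSpitzweck :: "'u itself \<Rightarrow> ('o, 'a, 'z) mcat_scheme \<Rightarrow> bool" where
  "coSpitzweck U M \<longleftrightarrow> right_semimodel_category U M \<and>
     weak_factorization_system M (Cof M) (Fib M \<inter> Eqv M)"

definition preserves_cofibrations ::
  "('o, 'a, 'z) mcat_scheme \<Rightarrow> ('p, 'b, 'y) mcat_scheme \<Rightarrow> ('o, 'a, 'p, 'b) ftr \<Rightarrow> bool" where
  "preserves_cofibrations N P F \<longleftrightarrow>
     amap F ` Cof N \<subseteq> Cof P \<and> amap F ` (Cof N \<inter> Eqv N) \<subseteq> Cof P \<inter> Eqv P"

definition Quillen_adjunction ::
  "('o, 'a, 'z) mcat_scheme \<Rightarrow> ('p, 'b, 'y) mcat_scheme \<Rightarrow>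
   ('o, 'a, 'p, 'b) ftr \<Rightarrow> ('p, 'b, 'o, 'a) ftr \<Rightarrow> ('o \<Rightarrow> 'a) \<Rightarrow> ('p \<Rightarrow> 'b) \<Rightarrow> bool" where
  "Quillen_adjunction N P F G \<eta> \<epsilon> \<longleftrightarrow> adjunction N P F G \<eta> \<epsilon> \<and> preserves_cofibrations N P F"

definition left_Quillen ::
  "'u itself \<Rightarrow> ('o, 'a, 'z) mcat_scheme \<Rightarrow> ('p, 'b, 'y) mcat_scheme \<Rightarrow>
   ('o, 'a, 'p, 'b) ftr \<Rightarrow> bool" where
  "left_Quillen U N P F \<longleftrightarrow> right_semimodel_category U N \<and> right_semimodel_category U P \<and>
     (\<exists>G \<eta> \<epsilon>. adjunction N P F G \<eta> \<epsilon>) \<and> preserves_cofibrations N P F"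

text \<open>\<open>P\<close> ranges over the coSpitzweck right semimodel categories whose objects and arrows form
  sets of the types \<open>'p\<close> and \<open>'q\<close>; these types are arbitrary parameters.\<close>
definition left_Bousfield_localization ::
  "'u itself \<Rightarrow> 'p itself \<Rightarrow> 'q itself \<Rightarrow> ('o, 'a) mcat \<Rightarrow> 'a set \<Rightarrow>
   ('c, 'd) mcat \<Rightarrow> ('o, 'a, 'c, 'd) ftr \<Rightarrow> bool" where
  "left_Bousfield_localization U _ _ N W L j \<longleftrightarrow>
     W \<subseteq> arr N \<and> coSpitzweck U L \<and> left_Quillen U N L j \<and> amap j ` W \<subseteq> Eqv L \<and>
     (\<forall>(P :: ('p, 'q) mcat) F.
        coSpitzweck U P \<and> left_Quillen U N P F \<and> amap F ` W \<subseteq> Eqv P \<longrightarrow>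
        (\<exists>G. left_Quillen U L P G \<and> same_functor N (comp_ftr G j) F \<and>
           (\<forall>G'. left_Quillen U L P G' \<and> same_functor N (comp_ftr G' j) F \<longrightarrow>
              same_functor L G' G)))"


section \<open>Sequential colimits and homotopy colimits\<close>

definition is_seq :: "('o, 'a, 'z) cat_scheme \<Rightarrow> (nat \<Rightarrow> 'o) \<Rightarrow> (nat \<Rightarrow> 'a) \<Rightarrow> bool" where
  "is_seq C X s \<longleftrightarrow> (\<forall>i. X i \<in> ob C \<and> s i \<in> hom C (X i) (X (Suc i)))"

definition seq_map ::
  "('o, 'a, 'z) cat_scheme \<Rightarrow> (nat \<Rightarrow> 'o) \<Rightarrow> (nat \<Rightarrow> 'a) \<Rightarrow> (nat \<Rightarrow> 'o) \<Rightarrow> (nat \<Rightarrow> 'a) \<Rightarrow>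
   (nat \<Rightarrow> 'a) \<Rightarrow> bool" where
  "seq_map C X s Y t f \<longleftrightarrow>
     (\<forall>i. f i \<in> hom C (X i) (Y i) \<and> f (Suc i) \<cdot>\<^bsub>C\<^esub> s i = t i \<cdot>\<^bsub>C\<^esub> f i)"

definition seq_cocone ::
  "('o, 'a, 'z) cat_scheme \<Rightarrow> (nat \<Rightarrow> 'o) \<Rightarrow> (nat \<Rightarrow> 'a) \<Rightarrow> 'o \<Rightarrow> (nat \<Rightarrow> 'a) \<Rightarrow> bool" where
  "seq_cocone C X s c \<iota> \<longleftrightarrow>
     c \<in> ob C \<and> (\<forall>i. \<iota> i \<in> hom C (X i) c \<and> \<iota> (Suc i) \<cdot>\<^bsub>C\<^esub> s i = \<iota> i)"

definition seq_colimit ::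
  "('o, 'a, 'z) cat_scheme \<Rightarrow> (nat \<Rightarrow> 'o) \<Rightarrow> (nat \<Rightarrow> 'a) \<Rightarrow> 'o \<Rightarrow> (nat \<Rightarrow> 'a) \<Rightarrow> bool" where
  "seq_colimit C X s c \<iota> \<longleftrightarrow> seq_cocone C X s c \<iota> \<and>
     (\<forall>c' \<iota>'. seq_cocone C X s c' \<iota>' \<longrightarrow> (\<exists>!h. h \<in> hom C c c' \<and> (\<forall>i. h \<cdot>\<^bsub>C\<^esub> \<iota> i = \<iota>' i)))"

definition cof_seq :: "('o, 'a, 'z) mcat_scheme \<Rightarrow> (nat \<Rightarrow> 'o) \<Rightarrow> (nat \<Rightarrow> 'a) \<Rightarrow> bool" where
  "cof_seq M X s \<longleftrightarrow> is_seq M X s \<and> (\<forall>i. s i \<in> Cof M)"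

definition levelwise_eqv ::
  "('o, 'a, 'z) mcat_scheme \<Rightarrow> (nat \<Rightarrow> 'o) \<Rightarrow> (nat \<Rightarrow> 'a) \<Rightarrow> (nat \<Rightarrow> 'o) \<Rightarrow> (nat \<Rightarrow> 'a) \<Rightarrow>
   (nat \<Rightarrow> 'a) \<Rightarrow> bool" where
  "levelwise_eqv M X s Y t f \<longleftrightarrow> seq_map M X s Y t f \<and> (\<forall>i. f i \<in> Eqv M)"

definition seq_colimits_of_cofibrations_homotopical :: "('o, 'a, 'z) mcat_scheme \<Rightarrow> bool" where
  "seq_colimits_of_cofibrations_homotopical M \<longleftrightarrow>
     (\<forall>X s Y t f c \<iota> d \<kappa> h.
        cof_seq M X s \<and> cof_seq M Y t \<and> levelwise_eqv M X s Y t f \<and>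
        seq_colimit M X s c \<iota> \<and> seq_colimit M Y t d \<kappa> \<and>
        h \<in> hom M c d \<and> (\<forall>i. h \<cdot>\<^bsub>M\<^esub> \<iota> i = \<kappa> i \<cdot>\<^bsub>M\<^esub> f i) \<longrightarrow> h \<in> Eqv M)"

text \<open>The homotopy colimit of a sequence \<open>D\<close> is the colimit of a projectively cofibrant
  replacement \<open>Y\<close> of \<open>D\<close>, i.e. of a levelwise equivalent sequence of cofibrations with cofibrant
  initial term. A cocone on \<open>D\<close> is a homotopy colimit if the induced map from the colimit of
  \<open>Y\<close> to its vertex is an equivalence.\<close>
definition seq_hocolim ::
  "('o, 'a, 'z) mcat_scheme \<Rightarrow> (nat \<Rightarrow> 'o) \<Rightarrow> (nat \<Rightarrow> 'a) \<Rightarrow> 'o \<Rightarrow> (nat \<Rightarrow> 'a) \<Rightarrow> bool" where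
  "seq_hocolim M D d c \<iota> \<longleftrightarrow> is_seq M D d \<and> seq_cocone M D d c \<iota> \<and>
     (\<forall>Y y f e \<kappa> h.
        cofibrant M (Y 0) \<and> cof_seq M Y y \<and> levelwise_eqv M Y y D d f \<and>
        seq_colimit M Y y e \<kappa> \<and>
        h \<in> hom M e c \<and> (\<forall>i. h \<cdot>\<^bsub>M\<^esub> \<kappa> i = \<iota> i \<cdot>\<^bsub>M\<^esub> f i) \<longrightarrow> h \<in> Eqv M)"

text \<open>The right Quillen functor \<open>\<Omega>\<close> is homotopically meaningful only through its right derived
  functor, so it is evaluated on fibrant replacements: \<open>F\<close> replaces the sequence \<open>X\<close> and \<open>Z\<close>
  replaces its colimit \<open>c\<close>. When the \<open>X i\<close> and \<open>c\<close> are fibrant one may take \<open>F = X\<close> and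
  \<open>Z = c\<close>, and the condition says that \<open>\<Omega> c\<close> is the homotopy colimit of the \<open>\<Omega> (X i)\<close>.

  The condition on the underived functor would not be enough. Consider the large poset
  consisting of the ordinals, an extra element \<open>l-\<close> immediately below each limit ordinal \<open>l\<close>,
  and, above all of these, the opposite of the ordinals. Let all maps be cofibrations, let the
  equivalences be the identities and \<open>l- \<le> l\<close>, and let \<open>\<Omega> a = a + 1\<close> on ordinals and
  \<open>\<Omega> x = x\<close> otherwise. Then \<open>\<Omega>\<close> is right Quillen and preserves sequential colimits strictly, but
  the level-fibrant \<open>\<Omega>\<close>-spectra form the opposite of the ordinals, which has no initial
  object and so is not the category of fibrant objects of a localization.\<close>
definition sends_seq_colimits_to_hocolims ::
  "('o, 'a, 'z) mcat_scheme \<Rightarrow> ('o, 'a, 'o, 'a) ftr \<Rightarrow> bool" where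
  "sends_seq_colimits_to_hocolims M \<Omega> \<longleftrightarrow>
     (\<forall>X s c \<iota> F u r Z \<zeta> z.
        cof_seq M X s \<and> seq_colimit M X s c \<iota> \<and>
        is_seq M F u \<and> (\<forall>i. fibrant M (F i)) \<and> levelwise_eqv M X s F u r \<and>
        fibrant M Z \<and> seq_cocone M F u Z \<zeta> \<and>
        z \<in> hom M c Z \<and> z \<in> Eqv M \<and> (\<forall>i. z \<cdot>\<^bsub>M\<^esub> \<iota> i = \<zeta> i \<cdot>\<^bsub>M\<^esub> r i) \<longrightarrow>
        seq_hocolim M (\<lambda>i. omap \<Omega> (F i)) (\<lambda>i. amap \<Omega> (u i)) (omap \<Omega> Z) (\<lambda>i. amap \<Omega> (\<zeta> i)))"


section \<open>Prespectra\<close>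

record ('o, 'a) prespectrum =
  lev :: "nat \<Rightarrow> 'o"
  bond :: "nat \<Rightarrow> 'a"

definition is_prespectrum ::
  "('o, 'a, 'z) cat_scheme \<Rightarrow> ('o, 'a, 'o, 'a) ftr \<Rightarrow> ('o, 'a) prespectrum \<Rightarrow> bool" where
  "is_prespectrum M T X \<longleftrightarrow>
     (\<forall>n. lev X n \<in> ob M \<and> bond X n \<in> hom M (omap T (lev X n)) (lev X (Suc n)))"

type_synonym ('o, 'a) spt_map = "('o, 'a) prespectrum \<times> (nat \<Rightarrow> 'a) \<times> ('o, 'a) prespectrum"

definition is_spt_map ::
  "('o, 'a, 'z) cat_scheme \<Rightarrow> ('o, 'a, 'o, 'a) ftr \<Rightarrow> ('o, 'a) spt_map \<Rightarrow> bool" where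
  "is_spt_map M T = (\<lambda>(X, f, Y). is_prespectrum M T X \<and> is_prespectrum M T Y \<and>
     (\<forall>n. f n \<in> hom M (lev X n) (lev Y n) \<and>
          f (Suc n) \<cdot>\<^bsub>M\<^esub> bond X n = bond Y n \<cdot>\<^bsub>M\<^esub> amap T (f n)))"

definition Spt ::
  "('o, 'a, 'z) cat_scheme \<Rightarrow> ('o, 'a, 'o, 'a) ftr \<Rightarrow>
   (('o, 'a) prespectrum, ('o, 'a) spt_map) cat" where
  "Spt M T =
     \<lparr>ob = {X. is_prespectrum M T X}, arr = {\<phi>. is_spt_map M T \<phi>},
      src = (\<lambda>(X, f, Y). X), tgt = (\<lambda>(X, f, Y). Y),
      idn = (\<lambda>X. (X, \<lambda>n. idn M (lev X n), X)),
      cmp = (\<lambda>(Y, g, Z) (X, f, Y'). (X, \<lambda>n. g n \<cdot>\<^bsub>M\<^esub> f n, Z))\<rparr>"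

definition levelwise_in ::
  "('o, 'a, 'z) cat_scheme \<Rightarrow> ('o, 'a, 'o, 'a) ftr \<Rightarrow> 'a set \<Rightarrow> ('o, 'a) spt_map set" where
  "levelwise_in M T S = {\<phi> \<in> arr (Spt M T). \<forall>n. fst (snd \<phi>) n \<in> S}"

text \<open>The level model structure; its cofibrations are determined by the lifting property.\<close>
definition level_structure ::
  "('o, 'a, 'z) mcat_scheme \<Rightarrow> ('o, 'a, 'o, 'a) ftr \<Rightarrow>
   (('o, 'a) prespectrum, ('o, 'a) spt_map) mcat" where
  "level_structure M T = cat.extend (Spt M T)
     \<lparr>Cof = {i \<in> arr (Spt M T).
        \<forall>p \<in> levelwise_in M T (Fib M) \<inter> levelwise_in M T (Eqv M). lifts_against (Spt M T) i p},
      Eqv = levelwise_in M T (Eqv M),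
      Fib = levelwise_in M T (Fib M)\<rparr>"

text \<open>The adjoint structure map \<open>X n \<rightarrow> \<Omega> (X (n + 1))\<close>; \<open>\<eta>\<close> is the unit of \<open>T \<stileturn> \<Omega>\<close>.\<close>
definition adjoint_bond ::
  "('o, 'a, 'z) cat_scheme \<Rightarrow> ('o, 'a, 'o, 'a) ftr \<Rightarrow> ('o \<Rightarrow> 'a) \<Rightarrow>
   ('o, 'a) prespectrum \<Rightarrow> nat \<Rightarrow> 'a" where
  "adjoint_bond M \<Omega> \<eta> X n = amap \<Omega> (bond X n) \<cdot>\<^bsub>M\<^esub> \<eta> (lev X n)"

definition is_Omega_spectrum ::
  "('o, 'a, 'z) mcat_scheme \<Rightarrow> ('o, 'a, 'o, 'a) ftr \<Rightarrow> ('o, 'a, 'o, 'a) ftr \<Rightarrow> ('o \<Rightarrow> 'a) \<Rightarrow>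
   ('o, 'a) prespectrum \<Rightarrow> bool" where
  "is_Omega_spectrum M T \<Omega> \<eta> X \<longleftrightarrow>
     is_prespectrum M T X \<and> (\<forall>n. adjoint_bond M \<Omega> \<eta> X n \<in> Eqv M)"


section \<open>Homotopy categories\<close>

text \<open>The localization of a category at a class \<open>W\<close> of its maps: morphisms are zigzags modulo the
  congruence that turns composites and identities of the category into those of zigzags and makes
  the backward copy of each \<open>w \<in> W\<close> inverse to the forward copy. A list of zigzag steps is read in
  the order in which the steps are traversed.\<close>

datatype 'a zig = Fwd 'a | Bwd 'a

inductive zpath ::
  "('o, 'a, 'z) cat_scheme \<Rightarrow> 'a set \<Rightarrow> 'o \<Rightarrow> 'a zig list \<Rightarrow> 'o \<Rightarrow> bool" for C W where
  zpath_nil: "x \<in> ob C \<Longrightarrow> zpath C W x [] x"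
| zpath_fwd: "f \<in> arr C \<Longrightarrow> zpath C W (tgt C f) p y \<Longrightarrow> zpath C W (src C f) (Fwd f # p) y"
| zpath_bwd: "w \<in> arr C \<Longrightarrow> w \<in> W \<Longrightarrow> zpath C W (src C w) p y \<Longrightarrow> zpath C W (tgt C w) (Bwd w # p) y"

inductive zeq ::
  "('o, 'a, 'z) cat_scheme \<Rightarrow> 'a set \<Rightarrow> 'o \<Rightarrow> 'o \<Rightarrow> 'a zig list \<Rightarrow> 'a zig list \<Rightarrow> bool"
  for C W x y where
  zeq_refl: "zpath C W x p y \<Longrightarrow> zeq C W x y p p"
| zeq_sym: "zeq C W x y p q \<Longrightarrow> zeq C W x y q p"
| zeq_trans: "zeq C W x y p q \<Longrightarrow> zeq C W x y q r \<Longrightarrow> zeq C W x y p r"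
| zeq_idn: "z \<in> ob C \<Longrightarrow> zpath C W x (p @ [Fwd (idn C z)] @ q) y \<Longrightarrow>
    zeq C W x y (p @ [Fwd (idn C z)] @ q) (p @ q)"
| zeq_cmp: "zpath C W x (p @ [Fwd f, Fwd g] @ q) y \<Longrightarrow>
    zeq C W x y (p @ [Fwd f, Fwd g] @ q) (p @ [Fwd (g \<cdot>\<^bsub>C\<^esub> f)] @ q)"
| zeq_fwd_bwd: "zpath C W x (p @ [Fwd w, Bwd w] @ q) y \<Longrightarrow>
    zeq C W x y (p @ [Fwd w, Bwd w] @ q) (p @ q)"
| zeq_bwd_fwd: "zpath C W x (p @ [Bwd w, Fwd w] @ q) y \<Longrightarrow>
    zeq C W x y (p @ [Bwd w, Fwd w] @ q) (p @ q)"

definition localized_category ::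
  "('o, 'a, 'z) cat_scheme \<Rightarrow> 'a set \<Rightarrow> ('o, 'o \<times> 'a zig list set \<times> 'o) cat" where
  "localized_category C W =
     \<lparr>ob = ob C,
      arr = {(x, {q. zeq C W x y p q}, y) | x p y. zpath C W x p y},
      src = (\<lambda>(x, K, y). x), tgt = (\<lambda>(x, K, y). y),
      idn = (\<lambda>x. (x, {q. zeq C W x x [] q}, x)),
      cmp = (\<lambda>(y, K', z) (x, K, y'). (x, {r. \<exists>p\<in>K. \<exists>q\<in>K'. zeq C W x z (p @ q) r}, z))\<rparr>"

definition Ho ::
  "('o, 'a, 'z) mcat_scheme \<Rightarrow> ('o, 'o \<times> 'a zig list set \<times> 'o) cat" where
  "Ho M = localized_category M (Eqv M)"

text \<open>If \<open>L\<close> has the same underlying category as \<open>N\<close> and at least as many equivalences, the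
  identity functor induces \<open>Ho N \<rightarrow> Ho L\<close>, taking the class of a zigzag in \<open>N\<close> to the class of
  the same zigzag in \<open>L\<close>.\<close>
definition Ho_comparison ::
  "('o, 'a, 'z) mcat_scheme \<Rightarrow>
   ('o, 'o \<times> 'a zig list set \<times> 'o, 'o, 'o \<times> 'a zig list set \<times> 'o) ftr" where
  "Ho_comparison L =
     \<lparr>omap = (\<lambda>x. x),
      amap = (\<lambda>(x, K, y). (x, {q. \<exists>p\<in>K. zeq L (Eqv L) x y p q}, y))\<rparr>"

definition presents_Omega_spectra ::
  "('o, 'a, 'z) mcat_scheme \<Rightarrow> ('o, 'a, 'o, 'a) ftr \<Rightarrow> ('o, 'a, 'o, 'a) ftr \<Rightarrow> ('o \<Rightarrow> 'a) \<Rightarrow>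
   (('o, 'a) prespectrum, ('o, 'a) spt_map) mcat \<Rightarrow> bool" where
  "presents_Omega_spectra M T \<Omega> \<eta> L \<longleftrightarrow>
     cat.truncate L = Spt M T \<and>
     (let N = level_structure M T;
          S = {X. fibrant N X \<and> is_Omega_spectrum M T \<Omega> \<eta> X}
      in {X. fibrant L X} = S \<and>
         equivalence_of_categories (full_subcategory (Ho N) S) (Ho L) (Ho_comparison L))"

end

theory Submission
  imports Defs
begin

text \<open>Write \<open>\<Theta>\<close> for the shifted loop functor on prespectra, \<open>(\<Theta> X) n = \<Omega> (X (n + 1))\<close>, and
  \<open>\<sigma> : X \<rightarrow> \<Theta> X\<close> for the adjoint structure maps; then \<open>\<Theta> \<sigma> = \<sigma> \<Theta>\<close>, and the level-fibrant
  \<open>\<Omega>\<close>-spectra are the fibrant \<open>X\<close> whose \<open>\<sigma>\<close> is a level equivalence. The functor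
  \<open>Q X = R (hocolim \<Theta>\<^sup>k (R X))\<close>, with \<open>R\<close> a functorial fibrant replacement, takes values in
  \<open>\<Omega>\<close>-spectra because \<open>\<Theta>\<close> commutes with the homotopy colimit and cofinal subsequences have the
  same homotopy colimit; it preserves level equivalences and inverts its unit \<open>q : X \<rightarrow> Q X\<close>. The
  localization has the cofibrations of the level structure and the maps inverted by \<open>Q\<close> as
  equivalences. As in the theorem of Bousfield and Friedlander, but without right properness,
  level fibrations between level-fibrant \<open>\<Omega>\<close>-spectra lift against its acyclic cofibrations, which yields the
  factorizations of maps with fibrant target. The localized maps are all \<open>Q\<close>-equivalences, so that
  the universal property is immediate, and \<open>q\<close> exhibits the local objects as a reflective
  subcategory on homotopy categories.\<close>

section \<open>Categories and lifting properties\<close>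

text \<open>That \<open>Q x\<close> is local makes \<open>q (Q x)\<close> an equivalence, but the
  localization needs \<open>Q (q x)\<close> to be one, and this is a different map. The two are
  related through two maps from stage \<open>k\<close> of the telescope to its \<open>k\<close>-fold
  loops: one is built from the structure maps of the stage, the other from the loops of the
  inclusion of stage 0. They agree after an equivalence. The sequence of the \<Theta>^k X need not
  consist of cofibrations, while both hypotheses on sequential colimits speak of cofibrations. So
  each sequence is replaced functorially by one of cofibrations with the same first term, and its
  homotopy colimit is the colimit of the replacement. Without right properness only maps with local
  target are factored. A map to a local \<open>y\<close> extends along a cofibration and
  \<open>Q\<close>-equivalence into some local \<open>z\<close>; a level factorization of
  \<open>z\<close> over \<open>y\<close> then has a local middle object, and level fibrations
  between local objects are fibrations of the localization. This is why the result is a right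
  semimodel category.\<close>

locale categ =
  fixes C :: "('o, 'a, 'z) cat_scheme"
  assumes category: "category C"
begin

abbreviation comp (infixr "\<bullet>" 65) where "g \<bullet> f \<equiv> cmp C g f"

lemma src_ob [simp]: "f \<in> arr C \<Longrightarrow> src C f \<in> ob C"
  and tgt_ob [simp]: "f \<in> arr C \<Longrightarrow> tgt C f \<in> ob C"
  using category by (auto simp: category_def)

lemma hom_ob: "f \<in> hom C x y \<Longrightarrow> x \<in> ob C" "f \<in> hom C x y \<Longrightarrow> y \<in> ob C"
  by (auto simp: hom_def)

lemma id_hom: "x \<in> ob C \<Longrightarrow> idn C x \<in> hom C x x"
  using category by (auto simp: category_def)

lemma id_simps [simp]:
  "x \<in> ob C \<Longrightarrow> idn C x \<in> arr C" "x \<in> ob C \<Longrightarrow> src C (idn C x) = x"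
  "x \<in> ob C \<Longrightarrow> tgt C (idn C x) = x"
  using id_hom by (auto simp: hom_def)

lemma comp_hom: "g \<in> hom C y z \<Longrightarrow> f \<in> hom C x y \<Longrightarrow> g \<bullet> f \<in> hom C x z"
  using category by (auto simp: category_def hom_def)

lemma comp_simps [simp]:
  assumes "f \<in> arr C" "g \<in> arr C" "tgt C f = src C g"
  shows "g \<bullet> f \<in> arr C" "src C (g \<bullet> f) = src C f" "tgt C (g \<bullet> f) = tgt C g"
  using comp_hom[of g "src C g" "tgt C g" f "src C f"] assms by (auto simp: hom_def)

lemma id_left [simp]: "f \<in> arr C \<Longrightarrow> tgt C f = y \<Longrightarrow> idn C y \<bullet> f = f"
  and id_right [simp]: "f \<in> arr C \<Longrightarrow> src C f = x \<Longrightarrow> f \<bullet> idn C x = f"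
  using category by (auto simp: category_def)

lemma assoc [simp]:
  "f \<in> arr C \<Longrightarrow> g \<in> arr C \<Longrightarrow> h \<in> arr C \<Longrightarrow> tgt C f = src C g \<Longrightarrow> tgt C g = src C h \<Longrightarrow>
   (h \<bullet> g) \<bullet> f = h \<bullet> g \<bullet> f"
  using category by (auto simp: category_def)

text \<open>\<open>assoc\<close> normalizes composites to the right, which hides an inner
  \<open>g \<bullet> f\<close> from rewriting; this form applies the equation in front of a further
  factor \<open>w\<close>.\<close>

lemma comp_ext:
  "g \<bullet> f = k \<Longrightarrow> w \<in> arr C \<Longrightarrow> f \<in> arr C \<Longrightarrow> g \<in> arr C \<Longrightarrow> tgt C w = src C f \<Longrightarrow> tgt C f = src C g \<Longrightarrow>
   g \<bullet> f \<bullet> w = k \<bullet> w"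
  by (metis assoc)

lemma liftsE:
  assumes "lifts_against C i p" "i \<in> hom C a b" "p \<in> hom C x y"
    and "u \<in> hom C a x" "v \<in> hom C b y" "p \<bullet> u = v \<bullet> i"
  obtains h where "h \<in> hom C b x" "h \<bullet> i = u" "p \<bullet> h = v"
  using assms by (auto simp: lifts_against_def hom_def)

lemma liftsI:
  assumes "i \<in> hom C a b" "p \<in> hom C x y"
    and "\<And>u v. u \<in> hom C a x \<Longrightarrow> v \<in> hom C b y \<Longrightarrow> p \<bullet> u = v \<bullet> i \<Longrightarrow>
           \<exists>h. h \<in> hom C b x \<and> h \<bullet> i = u \<and> p \<bullet> h = v"
  shows "lifts_against C i p"
  using assms by (auto simp: lifts_against_def hom_def)

lemma hom_self: "f \<in> arr C \<Longrightarrow> f \<in> hom C (src C f) (tgt C f)"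
  by (simp add: hom_def)

lemma lifts_comp_left:
  assumes i: "i \<in> hom C a b" and j: "j \<in> hom C b c" and p: "p \<in> arr C"
    and li: "lifts_against C i p" and lj: "lifts_against C j p"
  shows "lifts_against C (j \<bullet> i) p"
proof (rule liftsI[OF comp_hom[OF j i] hom_self[OF p]])
  fix u v assume u: "u \<in> hom C a (src C p)" and v: "v \<in> hom C c (tgt C p)" and e: "p \<bullet> u = v \<bullet> j \<bullet> i"
  have "p \<bullet> u = (v \<bullet> j) \<bullet> i" using e i j v by (simp add: hom_def)
  then obtain h where h: "h \<in> hom C b (src C p)" "h \<bullet> i = u" "p \<bullet> h = v \<bullet> j"
    using liftsE[OF li i hom_self[OF p] u comp_hom[OF v j]] by blast
  obtain k where k: "k \<in> hom C c (src C p)" "k \<bullet> j = h" "p \<bullet> k = v"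
    using liftsE[OF lj j hom_self[OF p] h(1) v h(3)] by blast
  have "k \<bullet> j \<bullet> i = u" using k h i j comp_ext[OF k(2), of i] by (simp add: hom_def)
  then show "\<exists>h. h \<in> hom C c (src C p) \<and> h \<bullet> j \<bullet> i = u \<and> p \<bullet> h = v" using k by blast
qed

lemma lifts_comp_right:
  assumes i: "i \<in> arr C" and p: "p \<in> hom C x y" and q: "q \<in> hom C y z"
    and lp: "lifts_against C i p" and lq: "lifts_against C i q"
  shows "lifts_against C i (q \<bullet> p)"
proof (rule liftsI[OF hom_self[OF i] comp_hom[OF q p]])
  fix u v assume u: "u \<in> hom C (src C i) x" and v: "v \<in> hom C (tgt C i) z" and e: "(q \<bullet> p) \<bullet> u = v \<bullet> i"
  have "q \<bullet> p \<bullet> u = v \<bullet> i" using e p q u by (simp add: hom_def)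
  then obtain h where h: "h \<in> hom C (tgt C i) y" "h \<bullet> i = p \<bullet> u" "q \<bullet> h = v"
    using liftsE[OF lq hom_self[OF i] q comp_hom[OF p u] v] by blast
  obtain k where k: "k \<in> hom C (tgt C i) x" "k \<bullet> i = u" "p \<bullet> k = h"
    using liftsE[OF lp hom_self[OF i] p u h(1) h(2)[symmetric]] by blast
  have "(q \<bullet> p) \<bullet> k = v" using k h p q by (simp add: hom_def)
  then show "\<exists>h. h \<in> hom C (tgt C i) x \<and> h \<bullet> i = u \<and> (q \<bullet> p) \<bullet> h = v" using k by blast
qed

lemma lifts_id_left: "x \<in> ob C \<Longrightarrow> p \<in> arr C \<Longrightarrow> lifts_against C (idn C x) p"
  by (rule liftsI[of _ x x _ "src C p" "tgt C p"]) (auto simp: hom_def)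

lemma lifts_id_right: "x \<in> ob C \<Longrightarrow> i \<in> arr C \<Longrightarrow> lifts_against C i (idn C x)"
  by (rule liftsI[of _ "src C i" "tgt C i" _ x x]) (auto simp: hom_def)

lemma pushout_hom:
  assumes sq: "pushout_square C f g f' g'" and f: "f \<in> hom C z x" and g: "g \<in> hom C z y"
  shows "f' \<in> hom C y (tgt C f')" "g' \<in> hom C x (tgt C f')" "g' \<bullet> f = f' \<bullet> g"
  using assms by (auto simp: pushout_square_def hom_def)

lemma pushout_univ:
  assumes sq: "pushout_square C f g f' g'" and f: "f \<in> hom C z x" and g: "g \<in> hom C z y"
    and u: "u \<in> hom C x c" and v: "v \<in> hom C y c" and e: "u \<bullet> f = v \<bullet> g"
  shows "\<exists>!h. h \<in> hom C (tgt C f') c \<and> h \<bullet> g' = u \<and> h \<bullet> f' = v"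
proof -
  have "\<forall>u\<in>arr C. \<forall>v\<in>arr C. src C u = tgt C f \<and> src C v = tgt C g \<and> tgt C u = tgt C v \<and>
      u \<bullet> f = v \<bullet> g \<longrightarrow> (\<exists>!h. h \<in> hom C (tgt C f') (tgt C u) \<and> h \<bullet> g' = u \<and> h \<bullet> f' = v)"
    using sq unfolding pushout_square_def by (elim conjE)
  from this[rule_format, of u v] show ?thesis using f g u v e by (simp add: hom_def)
qed

lemma pushout_unique:
  assumes sq: "pushout_square C f g f' g'" and f: "f \<in> hom C z x" and g: "g \<in> hom C z y"
    and h: "h \<in> hom C (tgt C f') c" and k: "k \<in> hom C (tgt C f') c"
    and e: "h \<bullet> g' = k \<bullet> g'" "h \<bullet> f' = k \<bullet> f'"
  shows "h = k"
proof -
  note s = pushout_hom[OF sq f g]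
  have "(k \<bullet> g') \<bullet> f = (k \<bullet> f') \<bullet> g" using s f g k by (simp add: hom_def)
  from pushout_univ[OF sq f g comp_hom[OF k s(2)] comp_hom[OF k s(1)] this]
  show ?thesis using h k e by blast
qed

lemma pullback_hom:
  assumes sq: "pullback_square C f g f' g'" and f: "f \<in> hom C x z" and g: "g \<in> hom C y z"
  shows "f' \<in> hom C (src C f') y" "g' \<in> hom C (src C f') x" "f \<bullet> g' = g \<bullet> f'"
  using assms by (auto simp: pullback_square_def hom_def)

lemma pullback_univ:
  assumes sq: "pullback_square C f g f' g'" and f: "f \<in> hom C x z" and g: "g \<in> hom C y z"
    and u: "u \<in> hom C c x" and v: "v \<in> hom C c y" and e: "f \<bullet> u = g \<bullet> v"
  shows "\<exists>!h. h \<in> hom C c (src C f') \<and> g' \<bullet> h = u \<and> f' \<bullet> h = v"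
proof -
  have "\<forall>u\<in>arr C. \<forall>v\<in>arr C. tgt C u = src C f \<and> tgt C v = src C g \<and> src C u = src C v \<and>
      f \<bullet> u = g \<bullet> v \<longrightarrow> (\<exists>!h. h \<in> hom C (src C u) (src C f') \<and> g' \<bullet> h = u \<and> f' \<bullet> h = v)"
    using sq unfolding pullback_square_def by (elim conjE)
  from this[rule_format, of u v] show ?thesis using f g u v e by (simp add: hom_def)
qed

lemma pullback_unique:
  assumes sq: "pullback_square C f g f' g'" and f: "f \<in> hom C x z" and g: "g \<in> hom C y z"
    and h: "h \<in> hom C c (src C f')" and k: "k \<in> hom C c (src C f')"
    and e: "g' \<bullet> h = g' \<bullet> k" "f' \<bullet> h = f' \<bullet> k"
  shows "h = k"
proof -
  note s = pullback_hom[OF sq f g]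
  have "f \<bullet> g' \<bullet> k = g \<bullet> f' \<bullet> k" using s f g k comp_ext[OF s(3), of k] by (simp add: hom_def)
  from pullback_univ[OF sq f g comp_hom[OF s(2) k] comp_hom[OF s(1) k] this]
  show ?thesis using h k e by blast
qed

lemma lifts_pushout:
  assumes sq: "pushout_square C f g f' g'" and p: "p \<in> arr C" and l: "lifts_against C f p"
  shows "lifts_against C f' p"
proof -
  have "f \<in> arr C" "g \<in> arr C" "src C f = src C g"
    using sq by (auto simp: pushout_square_def)
  then have f: "f \<in> hom C (src C f) (tgt C f)" and g: "g \<in> hom C (src C f) (tgt C g)"
    by (auto simp: hom_def)
  note a = pushout_hom[OF sq f g]
  show ?thesis
  proof (rule liftsI[OF a(1) hom_self[OF p]])
    fix u v assume u: "u \<in> hom C (tgt C g) (src C p)" and v: "v \<in> hom C (tgt C f') (tgt C p)"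
      and e: "p \<bullet> u = v \<bullet> f'"
    have 1: "p \<bullet> u \<bullet> g = (v \<bullet> g') \<bullet> f"
      using a f g u v p comp_ext[OF e, of g] by (simp add: hom_def)
    obtain h where h: "h \<in> hom C (tgt C f) (src C p)" "h \<bullet> f = u \<bullet> g" "p \<bullet> h = v \<bullet> g'"
      by (rule liftsE[OF l f hom_self[OF p] comp_hom[OF u g] comp_hom[OF v a(2)] 1])
    obtain k where k: "k \<in> hom C (tgt C f') (src C p)" "k \<bullet> g' = h" "k \<bullet> f' = u"
      using pushout_univ[OF sq f g h(1) u h(2)] by blast
    have "p \<bullet> k = v"
      by (rule pushout_unique[OF sq f g comp_hom[OF hom_self[OF p] k(1)] v])
        (use k h u v a p e in \<open>auto simp: hom_def\<close>)
    then show "\<exists>h. h \<in> hom C (tgt C f') (src C p) \<and> h \<bullet> f' = u \<and> p \<bullet> h = v"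
      using k by blast
  qed
qed

lemma lifts_pullback:
  assumes sq: "pullback_square C f g f' g'" and i: "i \<in> arr C" and l: "lifts_against C i f"
  shows "lifts_against C i f'"
proof -
  have "f \<in> arr C" "g \<in> arr C" "tgt C f = tgt C g"
    using sq by (auto simp: pullback_square_def)
  then have f: "f \<in> hom C (src C f) (tgt C f)" and g: "g \<in> hom C (src C g) (tgt C f)"
    by (auto simp: hom_def)
  note a = pullback_hom[OF sq f g]
  show ?thesis
  proof (rule liftsI[OF hom_self[OF i] a(1)])
    fix u v assume u: "u \<in> hom C (src C i) (src C f')" and v: "v \<in> hom C (tgt C i) (src C g)"
      and e: "f' \<bullet> u = v \<bullet> i"
    have 1: "f \<bullet> g' \<bullet> u = (g \<bullet> v) \<bullet> i"
      using a f g u v i e comp_ext[OF a(3), of u] by (simp add: hom_def)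
    obtain h where h: "h \<in> hom C (tgt C i) (src C f)" "h \<bullet> i = g' \<bullet> u" "f \<bullet> h = g \<bullet> v"
      by (rule liftsE[OF l hom_self[OF i] f comp_hom[OF a(2) u] comp_hom[OF g v] 1])
    obtain k where k: "k \<in> hom C (tgt C i) (src C f')" "g' \<bullet> k = h" "f' \<bullet> k = v"
      using pullback_univ[OF sq f g h(1) v h(3)] by blast
    have "k \<bullet> i = u"
      by (rule pullback_unique[OF sq f g comp_hom[OF k(1) hom_self[OF i]] u])
        (use k h u v a i e comp_ext[OF k(2), of i] comp_ext[OF k(3), of i] in \<open>auto simp: hom_def\<close>)
    then show "\<exists>h. h \<in> hom C (tgt C i) (src C f') \<and> h \<bullet> i = u \<and> f' \<bullet> h = v"
      using k by blast
  qed
qed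

lemma lifts_retract_left:
  assumes "retract_of C f g" and p: "p \<in> arr C" and l: "lifts_against C g p"
  shows "lifts_against C f p"
proof -
  obtain i r j s where fg: "f \<in> arr C" "g \<in> arr C"
    and h: "i \<in> hom C (src C f) (src C g)" "r \<in> hom C (src C g) (src C f)"
    "j \<in> hom C (tgt C f) (tgt C g)" "s \<in> hom C (tgt C g) (tgt C f)"
    and e: "r \<bullet> i = idn C (src C f)" "s \<bullet> j = idn C (tgt C f)" "g \<bullet> i = j \<bullet> f" "f \<bullet> r = s \<bullet> g"
    using assms(1) by (auto simp: retract_of_def)
  show ?thesis
  proof (rule liftsI[OF hom_self[OF fg(1)] hom_self[OF p]])
    fix u v assume u: "u \<in> hom C (src C f) (src C p)" and v: "v \<in> hom C (tgt C f) (tgt C p)"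
      and c: "p \<bullet> u = v \<bullet> f"
    have 1: "p \<bullet> u \<bullet> r = (v \<bullet> s) \<bullet> g"
      using u v h fg p e c comp_ext[OF c] by (simp add: hom_def)
    obtain k where k: "k \<in> hom C (tgt C g) (src C p)" "k \<bullet> g = u \<bullet> r" "p \<bullet> k = v \<bullet> s"
      by (rule liftsE[OF l hom_self[OF fg(2)] hom_self[OF p] _ _ 1]) (use h fg u v in \<open>auto simp: hom_def\<close>)
    have "(k \<bullet> j) \<bullet> f = u"
      using k h fg u e comp_ext[OF k(2), of i] by (simp add: hom_def e(3)[symmetric])
    moreover have "p \<bullet> k \<bullet> j = v"
      using k h fg v p e comp_ext[OF k(3), of j] by (simp add: hom_def)
    ultimately show "\<exists>k. k \<in> hom C (tgt C f) (src C p) \<and> k \<bullet> f = u \<and> p \<bullet> k = v"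
      using comp_hom[OF k(1) h(3)] by blast
  qed
qed

lemma lifts_retract_right:
  assumes "retract_of C f g" and q: "q \<in> arr C" and l: "lifts_against C q g"
  shows "lifts_against C q f"
proof -
  obtain i r j s where fg: "f \<in> arr C" "g \<in> arr C"
    and h: "i \<in> hom C (src C f) (src C g)" "r \<in> hom C (src C g) (src C f)"
    "j \<in> hom C (tgt C f) (tgt C g)" "s \<in> hom C (tgt C g) (tgt C f)"
    and e: "r \<bullet> i = idn C (src C f)" "s \<bullet> j = idn C (tgt C f)" "g \<bullet> i = j \<bullet> f" "f \<bullet> r = s \<bullet> g"
    using assms(1) by (auto simp: retract_of_def)
  show ?thesis
  proof (rule liftsI[OF hom_self[OF q] hom_self[OF fg(1)]])
    fix u v assume u: "u \<in> hom C (src C q) (src C f)" and v: "v \<in> hom C (tgt C q) (tgt C f)"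
      and c: "f \<bullet> u = v \<bullet> q"
    have 1: "g \<bullet> i \<bullet> u = (j \<bullet> v) \<bullet> q"
      using u v h fg q e c comp_ext[OF e(3)] by (simp add: hom_def)
    obtain k where k: "k \<in> hom C (tgt C q) (src C g)" "k \<bullet> q = i \<bullet> u" "g \<bullet> k = j \<bullet> v"
      by (rule liftsE[OF l hom_self[OF q] hom_self[OF fg(2)] _ _ 1]) (use h fg u v in \<open>auto simp: hom_def\<close>)
    have "(r \<bullet> k) \<bullet> q = u"
      using k h fg u q e comp_ext[OF e(1), of u] by (simp add: hom_def)
    moreover have "f \<bullet> r \<bullet> k = v"
      using k h fg v q e comp_ext[OF e(4), of k] comp_ext[OF e(2), of v] by (simp add: hom_def)
    ultimately show "\<exists>k. k \<in> hom C (tgt C q) (src C f) \<and> k \<bullet> q = u \<and> f \<bullet> k = v"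
      using comp_hom[OF h(2) k(1)] by blast
  qed
qed

text \<open>Lifting the identity through \<open>p\<close> exhibits \<open>p \<bullet> j\<close> as a
  retract of \<open>j\<close>, and a retract inherits lifting properties.\<close>

lemma lifts_factor_left:
  assumes j: "j \<in> hom C a b" and p: "p \<in> hom C b c" and q: "q \<in> arr C"
    and l: "lifts_against C (p \<bullet> j) p" and lj: "lifts_against C j q"
  shows "lifts_against C (p \<bullet> j) q"
proof (rule liftsI[OF comp_hom[OF p j] hom_self[OF q]])
  fix u v assume u: "u \<in> hom C a (src C q)" and v: "v \<in> hom C c (tgt C q)" and e: "q \<bullet> u = v \<bullet> p \<bullet> j"
  obtain h where h: "h \<in> hom C c b" "h \<bullet> p \<bullet> j = j" "p \<bullet> h = idn C c"
    by (rule liftsE[OF l comp_hom[OF p j] p j id_hom[OF hom_ob(2)[OF p]]]) (use p j in \<open>auto simp: hom_def\<close>)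
  have e': "q \<bullet> u = (v \<bullet> p) \<bullet> j" using e p j v by (simp add: hom_def)
  obtain k where k: "k \<in> hom C b (src C q)" "k \<bullet> j = u" "q \<bullet> k = v \<bullet> p"
    by (rule liftsE[OF lj j hom_self[OF q] u comp_hom[OF v p] e'])
  have "(k \<bullet> h) \<bullet> p \<bullet> j = u" using k h p j by (simp add: hom_def)
  moreover have "q \<bullet> k \<bullet> h = v" using k h p v q comp_ext[OF k(3), of h] by (simp add: hom_def)
  ultimately show "\<exists>h. h \<in> hom C c (src C q) \<and> h \<bullet> p \<bullet> j = u \<and> q \<bullet> h = v"
    using comp_hom[OF k(1) h(1)] by blast
qed

end

section \<open>Limits and colimits of countable shape\<close>

lemma countable_lesspoll_uncountable:
  assumes "countable A" "uncountable B"
  shows "A \<prec> B"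
proof -
  have "infinite B" using assms(2) uncountable_infinite by blast
  then obtain f :: "nat \<Rightarrow> 'b" where f: "inj f" "range f \<subseteq> B" using infinite_countable_subset by blast
  obtain g :: "'a \<Rightarrow> nat" where g: "inj_on g A" using assms(1) by (auto simp: countable_def)
  have "inj_on (f \<circ> g) A" using f g by (meson comp_inj_on inj_on_subset subset_UNIV)
  then have "A \<lesssim> B" using f(2) unfolding lepoll_def by (intro exI[of _ "f \<circ> g"]) auto
  moreover have "\<not> B \<lesssim> A"
  proof
    assume "B \<lesssim> A"
    then obtain h where "inj_on h B" "h ` B \<subseteq> A" by (auto simp: lepoll_def)
    then show False using assms by (meson countable_image_inj_on countable_subset)
  qed
  ultimately show ?thesis
    using eqpoll_imp_lepoll eqpoll_sym unfolding lesspoll_def by blast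
qed

text \<open>\<open>bicomplete\<close> quantifies over shapes whose objects and arrows have type
  \<open>'u\<close>. A countable shape is copied into \<open>'u\<close> along an injection of the
  natural numbers; the copy has strictly fewer arrows than the uncountable
  \<open>'u\<close>.\<close>

lemma (in categ) countable_limits:
  fixes J :: "('j::countable, 'k::countable) cat"
  assumes bi: "bicomplete (U :: 'u itself) C" and unc: "uncountable (UNIV :: 'u set)"
    and D: "is_functor J C D"
  shows "\<exists>c \<pi>. limit_cone J C D c \<pi>" "\<exists>c \<iota>. colimit_cocone J C D c \<iota>"
proof -
  have "infinite (UNIV :: 'u set)" using unc uncountable_infinite by blast
  then obtain f :: "nat \<Rightarrow> 'u" where f: "inj f" using infinite_countable_subset by blast
  define eo :: "'j \<Rightarrow> 'u" where "eo = f \<circ> to_nat"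
  define ea :: "'k \<Rightarrow> 'u" where "ea = f \<circ> to_nat"
  have io: "inj eo" "inj ea" using f by (simp_all add: eo_def ea_def inj_compose)
  have v[simp]: "inv eo (eo x) = x" "inv ea (ea y) = y" for x y using io by (simp_all add: inv_f_f)
  have i[simp]: "eo x = eo x' \<longleftrightarrow> x = x'" "ea y = ea y' \<longleftrightarrow> y = y'" for x x' y y'
    using io by (auto dest: injD)
  define J' :: "('u, 'u) cat" where "J' = \<lparr>ob = eo ` ob J, arr = ea ` arr J,
    src = (\<lambda>a. eo (src J (inv ea a))), tgt = (\<lambda>a. eo (tgt J (inv ea a))),
    idn = (\<lambda>x. ea (idn J (inv eo x))), cmp = (\<lambda>a b. ea (cmp J (inv ea a) (inv ea b)))\<rparr>"
  define D' where "D' = \<lparr>omap = omap D \<circ> inv eo, amap = amap D \<circ> inv ea\<rparr>"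
  have J: "category J" using D by (simp add: is_functor_def)
  have J': "category J'"
    using J unfolding category_def J'_def hom_def by auto
  have D': "is_functor J' C D'"
    using D J' unfolding is_functor_def by (auto simp: J'_def D'_def hom_def)
  have "countable (arr J')" by (simp add: J'_def)
  then have "arr J' \<prec> (UNIV :: 'u set)" using unc countable_lesspoll_uncountable by blast
  then obtain c \<pi> d \<iota> where l: "limit_cone J' C D' c \<pi>" and r: "colimit_cocone J' C D' d \<iota>"
    using bi D' unfolding bicomplete_def by blast
  have c1: "cone J' C D' x (p \<circ> inv eo)" if "cone J C D x p" for x p
    using that by (auto simp: cone_def J'_def D'_def)
  have c2: "cone J C D x (p \<circ> eo)" if "cone J' C D' x p" for x p
    using that by (auto simp: cone_def J'_def D'_def)
  have "limit_cone J C D c (\<pi> \<circ> eo)"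
    unfolding limit_cone_def
  proof (intro conjI allI impI)
    show "cone J C D c (\<pi> \<circ> eo)" using l c2 by (auto simp: limit_cone_def)
    fix x p assume "cone J C D x p"
    then have "\<exists>!h. h \<in> hom C x c \<and> (\<forall>j\<in>ob J'. \<pi> j \<bullet> h = (p \<circ> inv eo) j)"
      using l c1 unfolding limit_cone_def by blast
    then show "\<exists>!h. h \<in> hom C x c \<and> (\<forall>j\<in>ob J. (\<pi> \<circ> eo) j \<bullet> h = p j)"
      by (simp add: J'_def)
  qed
  then show "\<exists>c \<pi>. limit_cone J C D c \<pi>" by blast
  have c1: "cocone J' C D' x (p \<circ> inv eo)" if "cocone J C D x p" for x p
    using that by (auto simp: cocone_def J'_def D'_def)
  have c2: "cocone J C D x (p \<circ> eo)" if "cocone J' C D' x p" for x p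
    using that by (auto simp: cocone_def J'_def D'_def)
  have "colimit_cocone J C D d (\<iota> \<circ> eo)"
    unfolding colimit_cocone_def
  proof (intro conjI allI impI)
    show "cocone J C D d (\<iota> \<circ> eo)" using r c2 by (auto simp: colimit_cocone_def)
    fix x p assume "cocone J C D x p"
    then have "\<exists>!h. h \<in> hom C d x \<and> (\<forall>j\<in>ob J'. h \<bullet> \<iota> j = (p \<circ> inv eo) j)"
      using r c1 unfolding colimit_cocone_def by blast
    then show "\<exists>!h. h \<in> hom C d x \<and> (\<forall>j\<in>ob J. h \<bullet> (\<iota> \<circ> eo) j = p j)"
      by (simp add: J'_def)
  qed
  then show "\<exists>c \<iota>. colimit_cocone J C D c \<iota>" by blast
qed

text \<open>One encoding serves the empty shape, the cospan, the span and the shape of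
  sequences.\<close>

definition poset_cat :: "nat set \<Rightarrow> (nat \<Rightarrow> nat \<Rightarrow> bool) \<Rightarrow> (nat, nat \<times> nat) cat" where
  "poset_cat P le = \<lparr>ob = P, arr = {(i, j). i \<in> P \<and> j \<in> P \<and> le i j}, src = fst, tgt = snd,
     idn = (\<lambda>i. (i, i)), cmp = (\<lambda>b a. (fst a, snd b))\<rparr>"

lemma poset_cat_category:
  assumes "\<And>i. i \<in> P \<Longrightarrow> le i i" "\<And>i j k. le i j \<Longrightarrow> le j k \<Longrightarrow> le i k"
  shows "category (poset_cat P le)"
  using assms(1) unfolding category_def poset_cat_def hom_def by (auto intro: assms(2))

locale bicomplete_categ = categ C for C :: "('o, 'a, 'z) cat_scheme" +
  fixes U :: "'u itself"
  assumes bicomplete: "bicomplete U C" and uncountable: "uncountable (UNIV :: 'u set)"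
begin

lemmas limits = countable_limits[OF bicomplete uncountable]

lemma terminal_ex: "\<exists>t. terminal C t"
proof -
  let ?J = "poset_cat {} (=)"
  let ?D = "\<lparr>omap = undefined, amap = undefined\<rparr> :: (nat, nat \<times> nat, 'o, 'a) ftr"
  have "is_functor ?J C ?D"
    using category poset_cat_category[of "{}" "(=)"] by (auto simp: is_functor_def poset_cat_def)
  from limits(1)[OF this] show ?thesis
    by (simp add: limit_cone_def cone_def terminal_def poset_cat_def) blast
qed

lemma initial_ex: "\<exists>t. initial C t"
proof -
  let ?J = "poset_cat {} (=)"
  let ?D = "\<lparr>omap = undefined, amap = undefined\<rparr> :: (nat, nat \<times> nat, 'o, 'a) ftr"
  have "is_functor ?J C ?D"
    using category poset_cat_category[of "{}" "(=)"] by (auto simp: is_functor_def poset_cat_def)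
  from limits(2)[OF this] show ?thesis
    by (simp add: colimit_cocone_def cocone_def initial_def poset_cat_def) blast
qed

lemma pullback_ex:
  assumes f: "f \<in> hom C x z" and g: "g \<in> hom C y z"
  shows "\<exists>f' g'. pullback_square C f g f' g'"
proof -
  define le :: "nat \<Rightarrow> nat \<Rightarrow> bool" where "le i j \<longleftrightarrow> i = j \<or> j = 2" for i j
  define O3 where "O3 i = (if i = 0 then x else if i = 1 then y else z)" for i :: nat
  define A3 where "A3 a = (if fst a = snd a then idn C (O3 (fst a)) else if fst a = 0 then f else g)"
    for a :: "nat \<times> nat"
  let ?J = "poset_cat {0, 1, 2} le"
  let ?D = "\<lparr>omap = O3, amap = A3\<rparr>"
  have x: "x \<in> ob C" "y \<in> ob C" "z \<in> ob C" using f g hom_ob by auto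
  have fg: "f \<in> arr C" "src C f = x" "tgt C f = z" "g \<in> arr C" "src C g = y" "tgt C g = z"
    using f g by (auto simp: hom_def)
  have J: "category ?J" by (rule poset_cat_category) (auto simp: le_def)
  have D: "is_functor ?J C ?D"
    unfolding is_functor_def
    using category J x fg by (auto simp: poset_cat_def le_def O3_def A3_def hom_def)
  obtain c \<pi> where l: "limit_cone ?J C ?D c \<pi>" using limits(1)[OF D] by blast
  have co: "cone ?J C ?D c \<pi>" using l by (simp add: limit_cone_def)
  have m: "amap ?D k \<bullet> \<pi> (src ?J k) = \<pi> (tgt ?J k)" if "k \<in> arr ?J" for k
    using co that unfolding cone_def by blast
  have c: "c \<in> ob C" "\<pi> 0 \<in> hom C c x" "\<pi> 1 \<in> hom C c y" "f \<bullet> \<pi> 0 = \<pi> 2" "g \<bullet> \<pi> 1 = \<pi> 2"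
    using co m[of "(0, 2)"] m[of "(1, 2)"] unfolding cone_def
    by (simp_all add: poset_cat_def le_def O3_def A3_def)
  have "\<exists>!h. h \<in> hom C (src C u) c \<and> \<pi> 0 \<bullet> h = u \<and> \<pi> 1 \<bullet> h = v"
    if u: "u \<in> arr C" "v \<in> arr C" "tgt C u = x" "tgt C v = y" "src C u = src C v" "f \<bullet> u = g \<bullet> v" for u v
  proof -
    let ?p = "\<lambda>i :: nat. if i = 0 then u else if i = 1 then v else f \<bullet> u"
    have "cone ?J C ?D (src C u) ?p"
      using u fg unfolding cone_def by (auto simp: poset_cat_def le_def O3_def A3_def hom_def)
    then have "\<exists>!h. h \<in> hom C (src C u) c \<and> (\<forall>j\<in>ob ?J. \<pi> j \<bullet> h = ?p j)"
      using l unfolding limit_cone_def by blast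
    then have ex: "\<exists>!h. h \<in> hom C (src C u) c \<and> (\<forall>j\<in>{0,1,2}. \<pi> j \<bullet> h = ?p j)"
      by (simp add: poset_cat_def)
    \<comment> \<open>The leg at 2 is \<open>f\<close> after the leg at 0, so the condition on three
      legs is the condition on two.\<close>
    have "h \<in> hom C (src C u) c \<and> (\<forall>j\<in>{0,1,2}. \<pi> j \<bullet> h = ?p j) \<longleftrightarrow>
      h \<in> hom C (src C u) c \<and> \<pi> 0 \<bullet> h = u \<and> \<pi> 1 \<bullet> h = v" for h
      using c(2) fg c(4)[symmetric] by (auto simp: hom_def)
    then show ?thesis using ex by simp
  qed
  then have "pullback_square C f g (\<pi> 1) (\<pi> 0)"
    unfolding pullback_square_def using c fg by (simp add: hom_def)
  then show ?thesis by blast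
qed

lemma pushout_ex:
  assumes f: "f \<in> hom C z x" and g: "g \<in> hom C z y"
  shows "\<exists>f' g'. pushout_square C f g f' g'"
proof -
  define le :: "nat \<Rightarrow> nat \<Rightarrow> bool" where "le i j \<longleftrightarrow> i = j \<or> i = 2" for i j
  define O3 where "O3 i = (if i = 0 then x else if i = 1 then y else z)" for i :: nat
  define A3 where "A3 a = (if fst a = snd a then idn C (O3 (fst a)) else if snd a = 0 then f else g)"
    for a :: "nat \<times> nat"
  let ?J = "poset_cat {0, 1, 2} le"
  let ?D = "\<lparr>omap = O3, amap = A3\<rparr>"
  have x: "x \<in> ob C" "y \<in> ob C" "z \<in> ob C" using f g hom_ob by auto
  have fg: "f \<in> arr C" "src C f = z" "tgt C f = x" "g \<in> arr C" "src C g = z" "tgt C g = y"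
    using f g by (auto simp: hom_def)
  have J: "category ?J" by (rule poset_cat_category) (auto simp: le_def)
  have D: "is_functor ?J C ?D"
    unfolding is_functor_def
    using category J x fg by (auto simp: poset_cat_def le_def O3_def A3_def hom_def)
  obtain c \<pi> where l: "colimit_cocone ?J C ?D c \<pi>" using limits(2)[OF D] by blast
  have co: "cocone ?J C ?D c \<pi>" using l by (simp add: colimit_cocone_def)
  have m: "\<pi> (tgt ?J k) \<bullet> amap ?D k = \<pi> (src ?J k)" if "k \<in> arr ?J" for k
    using co that unfolding cocone_def by blast
  have c: "c \<in> ob C" "\<pi> 0 \<in> hom C x c" "\<pi> 1 \<in> hom C y c" "\<pi> 0 \<bullet> f = \<pi> 2" "\<pi> 1 \<bullet> g = \<pi> 2"
    using co m[of "(2, 0)"] m[of "(2, 1)"] unfolding cocone_def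
    by (simp_all add: poset_cat_def le_def O3_def A3_def)
  have "\<exists>!h. h \<in> hom C c (tgt C u) \<and> h \<bullet> \<pi> 0 = u \<and> h \<bullet> \<pi> 1 = v"
    if u: "u \<in> arr C" "v \<in> arr C" "src C u = x" "src C v = y" "tgt C u = tgt C v" "u \<bullet> f = v \<bullet> g" for u v
  proof -
    let ?p = "\<lambda>i :: nat. if i = 0 then u else if i = 1 then v else u \<bullet> f"
    have "cocone ?J C ?D (tgt C u) ?p"
      using u fg unfolding cocone_def by (auto simp: poset_cat_def le_def O3_def A3_def hom_def)
    then have "\<exists>!h. h \<in> hom C c (tgt C u) \<and> (\<forall>j\<in>ob ?J. h \<bullet> \<pi> j = ?p j)"
      using l unfolding colimit_cocone_def by blast
    then have ex: "\<exists>!h. h \<in> hom C c (tgt C u) \<and> (\<forall>j\<in>{0,1,2}. h \<bullet> \<pi> j = ?p j)"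
      by (simp add: poset_cat_def)
    have "h \<in> hom C c (tgt C u) \<and> (\<forall>j\<in>{0,1,2}. h \<bullet> \<pi> j = ?p j) \<longleftrightarrow>
      h \<in> hom C c (tgt C u) \<and> h \<bullet> \<pi> 0 = u \<and> h \<bullet> \<pi> 1 = v" for h
      using c(2) fg c(4)[symmetric] comp_ext[of h "\<pi> 0" u f] by (auto simp: hom_def)
    then show ?thesis using ex by simp
  qed
  then have "pushout_square C f g (\<pi> 1) (\<pi> 0)"
    unfolding pushout_square_def using c fg by (simp add: hom_def)
  then show ?thesis by blast
qed

end

section \<open>Sequences as diagrams indexed by the natural numbers\<close>

context categ
begin

text \<open>Indexed by start and length, so that the recursion is primitive and needs no order
  condition; \<open>path\<close> is the version by start and end.\<close>

primrec chain :: "(nat \<Rightarrow> 'o) \<Rightarrow> (nat \<Rightarrow> 'a) \<Rightarrow> nat \<Rightarrow> nat \<Rightarrow> 'a" where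
  "chain X s i 0 = idn C (X i)"
| "chain X s i (Suc k) = s (i + k) \<bullet> chain X s i k"

lemma chain_hom: "is_seq C X s \<Longrightarrow> chain X s i k \<in> hom C (X i) (X (i + k))"
  by (induction k) (auto simp: is_seq_def id_hom intro!: comp_hom)

lemma chain_add: "is_seq C X s \<Longrightarrow> chain X s (i + k) l \<bullet> chain X s i k = chain X s i (k + l)"
proof (induction l)
  case 0
  have "chain X s i k \<in> hom C (X i) (X (i + k))" using 0 chain_hom by blast
  then show ?case by (simp add: hom_def)
next
  case (Suc l)
  have "chain X s i k \<in> hom C (X i) (X (i + k))"
    "chain X s (i + k) l \<in> hom C (X (i + k)) (X (i + k + l))"
    "s (i + k + l) \<in> hom C (X (i + k + l)) (X (Suc (i + k + l)))"
    using Suc chain_hom by (auto simp: is_seq_def)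
  then show ?case using Suc by (simp add: hom_def add.assoc)
qed

lemma chain_nat:
  assumes "seq_map C X s Y t f" "is_seq C X s" "is_seq C Y t"
  shows "f (i + k) \<bullet> chain X s i k = chain Y t i k \<bullet> f i"
proof (induction k)
  case 0
  have "f i \<in> hom C (X i) (Y i)" using assms by (auto simp: seq_map_def)
  then show ?case by (simp add: hom_def)
next
  case (Suc k)
  have h: "chain X s i k \<in> hom C (X i) (X (i + k))" "chain Y t i k \<in> hom C (Y i) (Y (i + k))"
    "s (i + k) \<in> hom C (X (i + k)) (X (Suc (i + k)))" "t (i + k) \<in> hom C (Y (i + k)) (Y (Suc (i + k)))"
    "f i \<in> hom C (X i) (Y i)" "f (i + k) \<in> hom C (X (i + k)) (Y (i + k))"
    "f (Suc (i + k)) \<in> hom C (X (Suc (i + k))) (Y (Suc (i + k)))"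
    using assms chain_hom by (auto simp: is_seq_def seq_map_def)
  have e: "f (Suc (i + k)) \<bullet> s (i + k) = t (i + k) \<bullet> f (i + k)" using assms by (auto simp: seq_map_def)
  show ?case using h Suc comp_ext[OF e] by (simp add: hom_def)
qed

lemma chain_cocone:
  assumes "seq_cocone C X s c \<iota>" "is_seq C X s"
  shows "\<iota> (i + k) \<bullet> chain X s i k = \<iota> i"
proof (induction k)
  case 0
  have "\<iota> i \<in> hom C (X i) c" using assms by (auto simp: seq_cocone_def)
  then show ?case by (simp add: hom_def)
next
  case (Suc k)
  have h: "chain X s i k \<in> hom C (X i) (X (i + k))"
    "s (i + k) \<in> hom C (X (i + k)) (X (Suc (i + k)))" "\<iota> (Suc (i + k)) \<in> hom C (X (Suc (i + k))) c"
    using assms chain_hom by (auto simp: is_seq_def seq_cocone_def)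
  have e: "\<iota> (Suc (i + k)) \<bullet> s (i + k) = \<iota> (i + k)" using assms by (auto simp: seq_cocone_def)
  show ?case using h Suc comp_ext[OF e] by (simp add: hom_def)
qed

definition seq_ftr :: "(nat \<Rightarrow> 'o) \<Rightarrow> (nat \<Rightarrow> 'a) \<Rightarrow> (nat, nat \<times> nat, 'o, 'a) ftr" where
  "seq_ftr X s = \<lparr>omap = X, amap = (\<lambda>(i, j). chain X s i (j - i))\<rparr>"

lemma seq_ftr_functor: "is_seq C X s \<Longrightarrow> is_functor (poset_cat UNIV (\<le>)) C (seq_ftr X s)"
proof -
  assume X: "is_seq C X s"
  have h: "chain X s i (j - i) \<in> hom C (X i) (X j)" if "i \<le> j" for i j
    using chain_hom[OF X, of i "j - i"] that by simp
  have a: "chain X s j (k - j) \<bullet> chain X s i (j - i) = chain X s i (k - i)" if "i \<le> j" "j \<le> k" for i j k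
    using chain_add[OF X, of i "j - i" "k - j"] that by simp
  show ?thesis
    unfolding is_functor_def
    using category poset_cat_category[of UNIV "(\<le>)"] X h a
    by (auto simp: poset_cat_def seq_ftr_def is_seq_def)
qed

lemma seq_cocone_iff:
  assumes X: "is_seq C X s"
  shows "seq_cocone C X s c \<iota> \<longleftrightarrow> cocone (poset_cat UNIV (\<le>)) C (seq_ftr X s) c \<iota>"
proof
  assume c: "seq_cocone C X s c \<iota>"
  have "\<iota> j \<bullet> chain X s i (j - i) = \<iota> i" if "i \<le> j" for i j
    using chain_cocone[OF c X, of i "j - i"] that by simp
  then show "cocone (poset_cat UNIV (\<le>)) C (seq_ftr X s) c \<iota>"
    using c by (auto simp: cocone_def poset_cat_def seq_ftr_def seq_cocone_def)
next
  assume c: "cocone (poset_cat UNIV (\<le>)) C (seq_ftr X s) c \<iota>"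
  have "\<iota> (Suc i) \<bullet> chain X s i (Suc i - i) = \<iota> i" for i
  proof -
    let ?J = "poset_cat UNIV (\<le>)"
    have "(i, Suc i) \<in> arr ?J" by (simp add: poset_cat_def)
    then have "\<iota> (tgt ?J (i, Suc i)) \<bullet> amap (seq_ftr X s) (i, Suc i) = \<iota> (src ?J (i, Suc i))"
      using c unfolding cocone_def by blast
    then show ?thesis by (simp add: poset_cat_def seq_ftr_def)
  qed
  moreover have "chain X s i (Suc i - i) = s i" for i
    using X by (auto simp: is_seq_def hom_def)
  ultimately show "seq_cocone C X s c \<iota>"
    using c by (auto simp: cocone_def poset_cat_def seq_ftr_def seq_cocone_def)
qed

lemma seq_colimit_iff:
  "is_seq C X s \<Longrightarrow> seq_colimit C X s c \<iota> \<longleftrightarrow> colimit_cocone (poset_cat UNIV (\<le>)) C (seq_ftr X s) c \<iota>"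
  unfolding seq_colimit_def colimit_cocone_def by (simp add: seq_cocone_iff) (simp add: poset_cat_def)

end

lemma (in bicomplete_categ) seq_colimit_ex: "is_seq C X s \<Longrightarrow> \<exists>c \<iota>. seq_colimit C X s c \<iota>"
  using limits(2)[OF seq_ftr_functor] seq_colimit_iff by metis

section \<open>Functors and functorial factorizations\<close>

lemma functor_ob: "is_functor C D F \<Longrightarrow> x \<in> ob C \<Longrightarrow> omap F x \<in> ob D"
  by (simp add: is_functor_def)

lemma functor_hom: "is_functor C D F \<Longrightarrow> f \<in> hom C x y \<Longrightarrow> amap F f \<in> hom D (omap F x) (omap F y)"
  by (auto simp: is_functor_def hom_def)

lemma functor_comp:
  "is_functor C D F \<Longrightarrow> g \<in> hom C y z \<Longrightarrow> f \<in> hom C x y \<Longrightarrow>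
   amap F (g \<cdot>\<^bsub>C\<^esub> f) = amap F g \<cdot>\<^bsub>D\<^esub> amap F f"
  by (auto simp: is_functor_def hom_def)

lemma functor_id: "is_functor C D F \<Longrightarrow> x \<in> ob C \<Longrightarrow> amap F (idn C x) = idn D (omap F x)"
  by (simp add: is_functor_def)

locale ffact = categ C for C :: "('o, 'a, 'z) cat_scheme" +
  fixes A B :: "'a set" and m :: "'a \<Rightarrow> 'o" and l r :: "'a \<Rightarrow> 'a"
    and e :: "'a \<Rightarrow> 'a \<Rightarrow> 'a \<Rightarrow> 'a \<Rightarrow> 'a"
  assumes fact: "f \<in> arr C \<Longrightarrow> l f \<in> A \<and> r f \<in> B \<and> l f \<in> hom C (src C f) (m f) \<and>
       r f \<in> hom C (m f) (tgt C f) \<and> r f \<bullet> l f = f \<and>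
       e f f (idn C (src C f)) (idn C (tgt C f)) = idn C (m f)"
    and mid: "f \<in> hom C a b \<Longrightarrow> g \<in> hom C a' b' \<Longrightarrow> u \<in> hom C a a' \<Longrightarrow> v \<in> hom C b b' \<Longrightarrow>
       g \<bullet> u = v \<bullet> f \<Longrightarrow>
       e f g u v \<in> hom C (m f) (m g) \<and> e f g u v \<bullet> l f = l g \<bullet> u \<and> r g \<bullet> e f g u v = v \<bullet> r f"
    and mid_comp: "f \<in> hom C a b \<Longrightarrow> g \<in> hom C a' b' \<Longrightarrow> k \<in> hom C a'' b'' \<Longrightarrow>
       u \<in> hom C a a' \<Longrightarrow> v \<in> hom C b b' \<Longrightarrow> u' \<in> hom C a' a'' \<Longrightarrow> v' \<in> hom C b' b'' \<Longrightarrow>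
       g \<bullet> u = v \<bullet> f \<Longrightarrow> k \<bullet> u' = v' \<bullet> g \<Longrightarrow>
       e f k (u' \<bullet> u) (v' \<bullet> v) = e g k u' v' \<bullet> e f g u v"
begin

lemma fact_hom:
  assumes "f \<in> hom C a b"
  shows "l f \<in> A" "r f \<in> B" "l f \<in> hom C a (m f)" "r f \<in> hom C (m f) b" "r f \<bullet> l f = f"
    "e f f (idn C a) (idn C b) = idn C (m f)"
  using fact[of f] assms by (auto simp: hom_def)

end

lemma ffact_ex:
  assumes C: "category C" and "functorial_factorization C A B"
  shows "\<exists>m l r e. ffact C A B m l r e"
proof -
  obtain m l r e where
    1: "\<forall>f\<in>arr C. l f \<in> A \<and> r f \<in> B \<and> l f \<in> hom C (src C f) (m f) \<and>
           r f \<in> hom C (m f) (tgt C f) \<and> r f \<cdot>\<^bsub>C\<^esub> l f = f \<and>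
           e f f (idn C (src C f)) (idn C (tgt C f)) = idn C (m f)" and
    2: "\<forall>f\<in>arr C. \<forall>g\<in>arr C. \<forall>u\<in>hom C (src C f) (src C g). \<forall>v\<in>hom C (tgt C f) (tgt C g).
           g \<cdot>\<^bsub>C\<^esub> u = v \<cdot>\<^bsub>C\<^esub> f \<longrightarrow>
             e f g u v \<in> hom C (m f) (m g) \<and>
             e f g u v \<cdot>\<^bsub>C\<^esub> l f = l g \<cdot>\<^bsub>C\<^esub> u \<and> r g \<cdot>\<^bsub>C\<^esub> e f g u v = v \<cdot>\<^bsub>C\<^esub> r f \<and>
             (\<forall>k\<in>arr C. \<forall>u'\<in>hom C (src C g) (src C k). \<forall>v'\<in>hom C (tgt C g) (tgt C k).
                k \<cdot>\<^bsub>C\<^esub> u' = v' \<cdot>\<^bsub>C\<^esub> g \<longrightarrow>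
                e f k (u' \<cdot>\<^bsub>C\<^esub> u) (v' \<cdot>\<^bsub>C\<^esub> v) = e g k u' v' \<cdot>\<^bsub>C\<^esub> e f g u v)"
    using assms(2) unfolding functorial_factorization_def by auto
  have "ffact C A B m l r e"
  proof
    show "category C" by (rule C)
    show "l f \<in> A \<and> r f \<in> B \<and> l f \<in> hom C (src C f) (m f) \<and>
           r f \<in> hom C (m f) (tgt C f) \<and> r f \<cdot>\<^bsub>C\<^esub> l f = f \<and>
           e f f (idn C (src C f)) (idn C (tgt C f)) = idn C (m f)" if "f \<in> arr C" for f
      using 1 that by blast
    fix f a b g a' b' u v
    assume h: "f \<in> hom C a b" "g \<in> hom C a' b'" "u \<in> hom C a a'" "v \<in> hom C b b'"
      "g \<cdot>\<^bsub>C\<^esub> u = v \<cdot>\<^bsub>C\<^esub> f"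
    note 3 = 2[rule_format, of f g u v]
    show "e f g u v \<in> hom C (m f) (m g) \<and> e f g u v \<cdot>\<^bsub>C\<^esub> l f = l g \<cdot>\<^bsub>C\<^esub> u \<and>
        r g \<cdot>\<^bsub>C\<^esub> e f g u v = v \<cdot>\<^bsub>C\<^esub> r f"
      using h 3 by (auto simp: hom_def)
    fix k a'' b'' u' v'
    assume h': "k \<in> hom C a'' b''" "u' \<in> hom C a' a''" "v' \<in> hom C b' b''" "k \<cdot>\<^bsub>C\<^esub> u' = v' \<cdot>\<^bsub>C\<^esub> g"
    show "e f k (u' \<cdot>\<^bsub>C\<^esub> u) (v' \<cdot>\<^bsub>C\<^esub> v) = e g k u' v' \<cdot>\<^bsub>C\<^esub> e f g u v"
      using h h' 3 by (auto simp: hom_def)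
  qed
  then show ?thesis by blast
qed

section \<open>Model categories\<close>

lemma retract_ofI:
  assumes "f \<in> hom C a b" "g \<in> hom C a' b'" "i \<in> hom C a a'" "r \<in> hom C a' a"
    "j \<in> hom C b b'" "s \<in> hom C b' b" "r \<cdot>\<^bsub>C\<^esub> i = idn C a" "s \<cdot>\<^bsub>C\<^esub> j = idn C b"
    "g \<cdot>\<^bsub>C\<^esub> i = j \<cdot>\<^bsub>C\<^esub> f" "f \<cdot>\<^bsub>C\<^esub> r = s \<cdot>\<^bsub>C\<^esub> g"
  shows "retract_of C f g"
  unfolding retract_of_def using assms
  by (auto simp: hom_def intro!: bexI[of _ i] bexI[of _ r] bexI[of _ j] bexI[of _ s])

lemma two_out_of_threeD:
  assumes "two_out_of_three C S" "f \<in> hom C x y" "g \<in> hom C y z"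
  shows "f \<in> S \<Longrightarrow> g \<in> S \<Longrightarrow> g \<cdot>\<^bsub>C\<^esub> f \<in> S" "f \<in> S \<Longrightarrow> g \<cdot>\<^bsub>C\<^esub> f \<in> S \<Longrightarrow> g \<in> S"
    "g \<in> S \<Longrightarrow> g \<cdot>\<^bsub>C\<^esub> f \<in> S \<Longrightarrow> f \<in> S"
  using assms unfolding two_out_of_three_def hom_def by auto

text \<open>The retract argument: a lift of the identity of \<open>c\<close> through
  \<open>p\<close> is a section of \<open>p\<close> under \<open>a\<close>.\<close>

lemma (in categ) retract_left:
  assumes j: "j \<in> hom C a b" and p: "p \<in> hom C b c" and l: "lifts_against C (p \<bullet> j) p"
  shows "retract_of C (p \<bullet> j) j"
proof -
  obtain h where h: "h \<in> hom C c b" "h \<bullet> p \<bullet> j = j" "p \<bullet> h = idn C c"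
    by (rule liftsE[OF l comp_hom[OF p j] p j id_hom[OF hom_ob(2)[OF p]]]) (use p j in \<open>auto simp: hom_def\<close>)
  have "a \<in> ob C" "c \<in> ob C" using j p hom_ob by auto
  then show ?thesis using h j p
    by (intro retract_ofI[OF comp_hom[OF p j] j, of "idn C a" "idn C a" h p]) (auto simp: hom_def)
qed

lemma (in categ) retract_right:
  assumes j: "j \<in> hom C a b" and p: "p \<in> hom C b c" and l: "lifts_against C j (p \<bullet> j)"
  shows "retract_of C (p \<bullet> j) p"
proof -
  obtain h where h: "h \<in> hom C b a" "h \<bullet> j = idn C a" "(p \<bullet> j) \<bullet> h = p"
    by (rule liftsE[OF l j comp_hom[OF p j] id_hom[OF hom_ob(1)[OF j]] p]) (use p j in \<open>auto simp: hom_def\<close>)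
  have "a \<in> ob C" "c \<in> ob C" using j p hom_ob by auto
  then show ?thesis using h j p
    by (intro retract_ofI[OF comp_hom[OF p j] p, of j h "idn C c" "idn C c"]) (auto simp: hom_def)
qed

locale model_cat = bicomplete_categ N U for N :: "('o, 'a, 'z) mcat_scheme" and U :: "'u itself" +
  assumes model: "model_category U N"
begin

notation comp (infixr "\<bullet>" 65)

lemma class_arr: "i \<in> Cof N \<Longrightarrow> i \<in> arr N" "w \<in> Eqv N \<Longrightarrow> w \<in> arr N" "p \<in> Fib N \<Longrightarrow> p \<in> arr N"
  using model by (auto simp: model_category_def)

lemma lift_acof: "i \<in> Cof N \<Longrightarrow> i \<in> Eqv N \<Longrightarrow> p \<in> Fib N \<Longrightarrow> lifts_against N i p"
  and lift_afib: "i \<in> Cof N \<Longrightarrow> p \<in> Fib N \<Longrightarrow> p \<in> Eqv N \<Longrightarrow> lifts_against N i p"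
  using model by (auto simp: model_category_def)

lemma factor_acof:
  assumes "f \<in> hom N x y"
  obtains z j p where "j \<in> hom N x z" "p \<in> hom N z y" "j \<in> Cof N" "j \<in> Eqv N" "p \<in> Fib N" "p \<bullet> j = f"
proof -
  have "factors_as N (Cof N \<inter> Eqv N) (Fib N) f"
    using model assms by (auto simp: model_category_def hom_def)
  then obtain i p where ip: "i \<in> Cof N \<inter> Eqv N" "p \<in> Fib N" "i \<in> arr N" "p \<in> arr N"
    "src N i = src N f" "tgt N i = src N p" "tgt N p = tgt N f" "p \<bullet> i = f"
    unfolding factors_as_def by blast
  show ?thesis by (rule that[of i "tgt N i" p]) (use ip assms in \<open>simp_all add: hom_def\<close>)
qed

lemma factor_afib:
  assumes "f \<in> hom N x y"
  obtains z j p where "j \<in> hom N x z" "p \<in> hom N z y" "j \<in> Cof N" "p \<in> Fib N" "p \<in> Eqv N" "p \<bullet> j = f"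
proof -
  have "factors_as N (Cof N) (Fib N \<inter> Eqv N) f"
    using model assms by (auto simp: model_category_def hom_def)
  then obtain i p where ip: "i \<in> Cof N" "p \<in> Fib N \<inter> Eqv N" "i \<in> arr N" "p \<in> arr N"
    "src N i = src N f" "tgt N i = src N p" "tgt N p = tgt N f" "p \<bullet> i = f"
    unfolding factors_as_def by blast
  show ?thesis by (rule that[of i "tgt N i" p]) (use ip assms in \<open>simp_all add: hom_def\<close>)
qed

lemma eqv_comp: "f \<in> hom N x y \<Longrightarrow> g \<in> hom N y z \<Longrightarrow> f \<in> Eqv N \<Longrightarrow> g \<in> Eqv N \<Longrightarrow> g \<bullet> f \<in> Eqv N"
  and eqv_cancel_right: "f \<in> hom N x y \<Longrightarrow> g \<in> hom N y z \<Longrightarrow> f \<in> Eqv N \<Longrightarrow> g \<bullet> f \<in> Eqv N \<Longrightarrow> g \<in> Eqv N"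
  and eqv_cancel_left: "f \<in> hom N x y \<Longrightarrow> g \<in> hom N y z \<Longrightarrow> g \<in> Eqv N \<Longrightarrow> g \<bullet> f \<in> Eqv N \<Longrightarrow> f \<in> Eqv N"
proof -
  have "two_out_of_three N (Eqv N)" using model by (simp add: model_category_def)
  then show "f \<in> hom N x y \<Longrightarrow> g \<in> hom N y z \<Longrightarrow> f \<in> Eqv N \<Longrightarrow> g \<in> Eqv N \<Longrightarrow> g \<bullet> f \<in> Eqv N"
    "f \<in> hom N x y \<Longrightarrow> g \<in> hom N y z \<Longrightarrow> f \<in> Eqv N \<Longrightarrow> g \<bullet> f \<in> Eqv N \<Longrightarrow> g \<in> Eqv N"
    "f \<in> hom N x y \<Longrightarrow> g \<in> hom N y z \<Longrightarrow> g \<in> Eqv N \<Longrightarrow> g \<bullet> f \<in> Eqv N \<Longrightarrow> f \<in> Eqv N"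
    by (auto simp: two_out_of_three_def hom_def)
qed

lemma closed_retracts:
  "closed_under_retracts N (Cof N)" "closed_under_retracts N (Eqv N)" "closed_under_retracts N (Fib N)"
  using model by (simp_all add: model_category_def)

lemma retract_classes:
  assumes "retract_of N f g"
  shows "g \<in> Cof N \<Longrightarrow> f \<in> Cof N" "g \<in> Eqv N \<Longrightarrow> f \<in> Eqv N" "g \<in> Fib N \<Longrightarrow> f \<in> Fib N"
  using closed_retracts assms unfolding closed_under_retracts_def by blast+

text \<open>Factor the map and apply the retract argument. This and its three companions determine
  the classes by lifting properties, from which closure under composition, cobase change and base
  change is read off.\<close>

lemma cof_iff: "i \<in> Cof N \<longleftrightarrow> i \<in> arr N \<and> (\<forall>p\<in>Fib N \<inter> Eqv N. lifts_against N i p)"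
proof
  assume i: "i \<in> arr N \<and> (\<forall>p\<in>Fib N \<inter> Eqv N. lifts_against N i p)"
  then obtain z j p where jp: "j \<in> hom N (src N i) z" "p \<in> hom N z (tgt N i)" "j \<in> Cof N"
    "p \<in> Fib N" "p \<in> Eqv N" "p \<bullet> j = i"
    using factor_afib[OF hom_self] by metis
  then show "i \<in> Cof N" using retract_left[OF jp(1,2)] i retract_classes by auto
qed (auto simp: class_arr lift_afib)

lemma acof_iff: "i \<in> Cof N \<and> i \<in> Eqv N \<longleftrightarrow> i \<in> arr N \<and> (\<forall>p\<in>Fib N. lifts_against N i p)"
proof
  assume i: "i \<in> arr N \<and> (\<forall>p\<in>Fib N. lifts_against N i p)"
  then obtain z j p where jp: "j \<in> hom N (src N i) z" "p \<in> hom N z (tgt N i)" "j \<in> Cof N"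
    "j \<in> Eqv N" "p \<in> Fib N" "p \<bullet> j = i"
    using factor_acof[OF hom_self] by metis
  then show "i \<in> Cof N \<and> i \<in> Eqv N" using retract_left[OF jp(1,2)] i retract_classes by auto
qed (auto simp: class_arr lift_acof)

lemma fib_iff: "p \<in> Fib N \<longleftrightarrow> p \<in> arr N \<and> (\<forall>i\<in>Cof N \<inter> Eqv N. lifts_against N i p)"
proof
  assume p: "p \<in> arr N \<and> (\<forall>i\<in>Cof N \<inter> Eqv N. lifts_against N i p)"
  then obtain z j q where jq: "j \<in> hom N (src N p) z" "q \<in> hom N z (tgt N p)" "j \<in> Cof N"
    "j \<in> Eqv N" "q \<in> Fib N" "q \<bullet> j = p"
    using factor_acof[OF hom_self] by metis
  then show "p \<in> Fib N" using retract_right[OF jq(1,2)] p retract_classes by auto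
qed (auto simp: class_arr lift_acof)

lemma afib_iff: "p \<in> Fib N \<and> p \<in> Eqv N \<longleftrightarrow> p \<in> arr N \<and> (\<forall>i\<in>Cof N. lifts_against N i p)"
proof
  assume p: "p \<in> arr N \<and> (\<forall>i\<in>Cof N. lifts_against N i p)"
  then obtain z j q where jq: "j \<in> hom N (src N p) z" "q \<in> hom N z (tgt N p)" "j \<in> Cof N"
    "q \<in> Fib N" "q \<in> Eqv N" "q \<bullet> j = p"
    using factor_afib[OF hom_self] by metis
  then show "p \<in> Fib N \<and> p \<in> Eqv N" using retract_right[OF jq(1,2)] p retract_classes by auto
qed (auto simp: class_arr lift_afib)

lemma id_classes:
  assumes "x \<in> ob N"
  shows "idn N x \<in> Cof N" "idn N x \<in> Eqv N" "idn N x \<in> Fib N"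
  using acof_iff[of "idn N x"] fib_iff[of "idn N x"] assms lifts_id_left lifts_id_right class_arr by auto

lemma cof_comp: "i \<in> hom N a b \<Longrightarrow> j \<in> hom N b c \<Longrightarrow> i \<in> Cof N \<Longrightarrow> j \<in> Cof N \<Longrightarrow> j \<bullet> i \<in> Cof N"
  unfolding cof_iff[of "j \<bullet> i"] using lifts_comp_left lift_afib class_arr by (auto simp: hom_def)

lemma fib_comp: "p \<in> hom N a b \<Longrightarrow> q \<in> hom N b c \<Longrightarrow> p \<in> Fib N \<Longrightarrow> q \<in> Fib N \<Longrightarrow> q \<bullet> p \<in> Fib N"
  unfolding fib_iff[of "q \<bullet> p"] using lifts_comp_right lift_acof class_arr by (auto simp: hom_def)

lemma cof_pushout: "pushout_square N f g f' g' \<Longrightarrow> f \<in> Cof N \<Longrightarrow> f' \<in> Cof N"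
  unfolding cof_iff[of f'] using lifts_pushout lift_afib class_arr pushout_square_def
  by (metis IntD1 IntD2)

lemma acof_pushout: "pushout_square N f g f' g' \<Longrightarrow> f \<in> Cof N \<Longrightarrow> f \<in> Eqv N \<Longrightarrow> f' \<in> Eqv N"
  using acof_iff[of f'] lifts_pushout lift_acof class_arr pushout_square_def by metis

lemma fib_pullback: "pullback_square N f g f' g' \<Longrightarrow> f \<in> Fib N \<Longrightarrow> f' \<in> Fib N"
  unfolding fib_iff[of f'] using lifts_pullback lift_acof class_arr pullback_square_def
  by (metis IntD1 IntD2)

lemma afib_pullback: "pullback_square N f g f' g' \<Longrightarrow> f \<in> Fib N \<Longrightarrow> f \<in> Eqv N \<Longrightarrow> f' \<in> Eqv N"
  using afib_iff[of f'] lifts_pullback lift_afib class_arr pullback_square_def by metis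

text \<open>\<open>pullback_square\<close> singles out the base change of its first leg; exchanging
  the legs lets \<open>fib_pullback\<close> speak about the other projection as well.\<close>

lemma pullback_swap:
  assumes sq: "pullback_square N f g f' g'"
  shows "pullback_square N g f g' f'"
proof -
  have "f \<in> arr N" "g \<in> arr N" "tgt N f = tgt N g" "src N f' = src N g'"
    using sq unfolding pullback_square_def by auto
  then have f: "f \<in> hom N (src N f) (tgt N f)" and g: "g \<in> hom N (src N g) (tgt N f)"
    and s: "src N f' = src N g'" by (auto simp: hom_def)
  note h = pullback_hom[OF sq f g]
  have "\<exists>!k. k \<in> hom N (src N u) (src N g') \<and> f' \<bullet> k = u \<and> g' \<bullet> k = v"
    if "u \<in> arr N" "v \<in> arr N" "tgt N u = src N g" "tgt N v = src N f" "src N u = src N v"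
      "g \<bullet> u = f \<bullet> v" for u v
    using pullback_univ[OF sq f g, of v "src N u" u] that s by (auto simp: hom_def)
  then show ?thesis
    unfolding pullback_square_def using h f g s by (simp add: hom_def)
qed

lemma terminal_hom: "terminal N t \<Longrightarrow> x \<in> ob N \<Longrightarrow> \<exists>f. f \<in> hom N x t"
  and terminal_unique: "terminal N t \<Longrightarrow> f \<in> hom N x t \<Longrightarrow> g \<in> hom N x t \<Longrightarrow> f = g"
  using hom_ob(1) unfolding terminal_def by blast+

lemma initial_hom: "initial N t \<Longrightarrow> x \<in> ob N \<Longrightarrow> \<exists>f. f \<in> hom N t x"
  and initial_unique: "initial N t \<Longrightarrow> f \<in> hom N t x \<Longrightarrow> g \<in> hom N t x \<Longrightarrow> f = g"
  using hom_ob(2) unfolding initial_def by blast+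

text \<open>\<open>fibrant\<close> lets the terminal object vary, but the maps from \<open>x\<close>
  to two terminal objects are retracts of each other, so any single one decides.\<close>

lemma fibrant_terminal:
  assumes t: "terminal N t" and f: "f \<in> hom N x t"
  shows "fibrant N x \<longleftrightarrow> f \<in> Fib N"
proof
  assume "fibrant N x"
  then obtain t' f' where t': "terminal N t'" "f' \<in> hom N x t'" "f' \<in> Fib N" by (auto simp: fibrant_def)
  have id: "idn N x \<in> hom N x x" using f hom_ob id_hom by blast
  obtain j s where j: "j \<in> hom N t t'" and s: "s \<in> hom N t' t"
    using t t' terminal_hom by (meson terminal_def)
  have "s \<bullet> j = idn N t" by (rule terminal_unique[OF t comp_hom[OF s j] id_hom[OF hom_ob(1)[OF j]]])
  moreover have "f' \<bullet> idn N x = j \<bullet> f"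
    by (rule terminal_unique[OF t'(1) comp_hom[OF t'(2) id] comp_hom[OF j f]])
  moreover have "f \<bullet> idn N x = s \<bullet> f'"
    by (rule terminal_unique[OF t comp_hom[OF f id] comp_hom[OF s t'(2)]])
  moreover have "idn N x \<bullet> idn N x = idn N x" using id by (simp add: hom_def)
  ultimately have "retract_of N f f'" by (intro retract_ofI[OF f t'(2) id id j s])
  then show "f \<in> Fib N" using t' retract_classes by auto
qed (use assms hom_ob in \<open>auto simp: fibrant_def\<close>)

lemma cofibrant_initial:
  assumes t: "initial N t" and f: "f \<in> hom N t x"
  shows "cofibrant N x \<longleftrightarrow> f \<in> Cof N"
proof
  assume "cofibrant N x"
  then obtain t' f' where t': "initial N t'" "f' \<in> hom N t' x" "f' \<in> Cof N" by (auto simp: cofibrant_def)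
  have id: "idn N x \<in> hom N x x" using f hom_ob id_hom by blast
  obtain j s where j: "j \<in> hom N t t'" and s: "s \<in> hom N t' t"
    using t t' initial_hom by (meson initial_def)
  have "s \<bullet> j = idn N t" by (rule initial_unique[OF t comp_hom[OF s j] id_hom[OF hom_ob(1)[OF j]]])
  moreover have "f' \<bullet> j = idn N x \<bullet> f"
    by (rule initial_unique[OF t comp_hom[OF t'(2) j] comp_hom[OF id f]])
  moreover have "f \<bullet> s = idn N x \<bullet> f'"
    by (rule initial_unique[OF t'(1) comp_hom[OF f s] comp_hom[OF id t'(2)]])
  moreover have "idn N x \<bullet> idn N x = idn N x" using id by (simp add: hom_def)
  ultimately have "retract_of N f f'" by (intro retract_ofI[OF f t'(2) j s id id])
  then show "f \<in> Cof N" using t' retract_classes by auto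
qed (use assms hom_ob in \<open>auto simp: cofibrant_def\<close>)

lemma fibrant_ob: "fibrant N x \<Longrightarrow> x \<in> ob N"
  by (simp add: fibrant_def)

lemma fibrant_extend:
  assumes "fibrant N z" "i \<in> hom N a b" "i \<in> Cof N" "i \<in> Eqv N" "u \<in> hom N a z"
  obtains h where "h \<in> hom N b z" "h \<bullet> i = u"
proof -
  obtain t f where t: "terminal N t" "f \<in> hom N z t" "f \<in> Fib N" using assms by (auto simp: fibrant_def)
  obtain v where v: "v \<in> hom N b t" using t assms(2) terminal_hom hom_ob by blast
  have "f \<bullet> u = v \<bullet> i"
    by (rule terminal_unique[OF t(1) comp_hom[OF t(2) assms(5)] comp_hom[OF v assms(2)]])
  from liftsE[OF lift_acof[OF assms(3,4) t(3)] assms(2) t(2) assms(5) v this] that show ?thesis by blast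
qed

lemma fib_fibrant: "p \<in> hom N x y \<Longrightarrow> p \<in> Fib N \<Longrightarrow> fibrant N y \<Longrightarrow> fibrant N x"
  unfolding fibrant_def by (elim conjE exE bexE) (auto intro: hom_ob(1) comp_hom fib_comp)

lemma fibrant_retract:
  assumes s: "s \<in> hom N x y" and r: "r \<in> hom N y x" and e: "r \<bullet> s = idn N x" and y: "fibrant N y"
  shows "fibrant N x"
proof -
  obtain t f where t: "terminal N t" "f \<in> hom N y t" "f \<in> Fib N" using y by (auto simp: fibrant_def)
  have "t \<in> ob N" using t by (simp add: terminal_def)
  have c: "f \<bullet> s \<in> hom N x t" using comp_hom[OF t(2) s] .
  have "(f \<bullet> s) \<bullet> r = f" using terminal_unique[OF t(1) comp_hom[OF c r] t(2)] .
  then have "retract_of N (f \<bullet> s) f"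
    using t(2) s r e \<open>t \<in> ob N\<close>
    by (intro retract_ofI[OF c t(2), of s r "idn N t" "idn N t"]) (auto simp: hom_def)
  then show ?thesis using fibrant_terminal[OF t(1) c] t(3) retract_classes by blast
qed

text \<open>The graph of \<open>f\<close> is a map from \<open>x\<close> to the product of
  \<open>x\<close> and \<open>y\<close>, built as a pullback over the terminal object; fibrancy
  makes both projections fibrations. Factoring the graph as an acyclic cofibration \<open>j\<close>
  and a fibration \<open>k\<close> makes \<open>p \<bullet> k\<close> and
  \<open>q \<bullet> k\<close> acyclic fibrations, with \<open>j\<close> a section of the first and
  \<open>f\<close> the composite of \<open>j\<close> with the second.\<close>

lemma ken_brown:
  assumes F: "is_functor N P F" and P: "two_out_of_three P (Eqv P)" "\<And>x. x \<in> ob P \<Longrightarrow> idn P x \<in> Eqv P"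
    and pres: "\<And>p. p \<in> Fib N \<Longrightarrow> p \<in> Eqv N \<Longrightarrow> amap F p \<in> Eqv P"
    and f: "f \<in> hom N x y" "f \<in> Eqv N" and x: "fibrant N x" and y: "fibrant N y"
  shows "amap F f \<in> Eqv P"
proof -
  obtain t where t: "terminal N t" using terminal_ex by blast
  obtain a b where a: "a \<in> hom N x t" and b: "b \<in> hom N y t"
    using terminal_hom[OF t] x y fibrant_ob by meson
  have ab: "a \<in> Fib N" "b \<in> Fib N" using fibrant_terminal[OF t] x y a b by auto
  obtain q p where sq: "pullback_square N a b q p" using pullback_ex[OF a b] by blast
  note pq = pullback_hom[OF sq a b]
  have fq: "q \<in> Fib N" "p \<in> Fib N" using fib_pullback sq pullback_swap[OF sq] ab by auto
  have id: "idn N x \<in> hom N x x" using id_hom fibrant_ob[OF x] .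
  obtain g where g: "g \<in> hom N x (src N q)" "p \<bullet> g = idn N x" "q \<bullet> g = f"
    using pullback_univ[OF sq a b id f(1) terminal_unique[OF t comp_hom[OF a id] comp_hom[OF b f(1)]]]
    by blast
  obtain z j k where jk: "j \<in> hom N x z" "k \<in> hom N z (src N q)" "j \<in> Cof N" "j \<in> Eqv N" "k \<in> Fib N" "k \<bullet> j = g"
    using factor_acof[OF g(1)] by metis
  have 1: "(p \<bullet> k) \<bullet> j = idn N x" "(q \<bullet> k) \<bullet> j = f" using jk pq g by (auto simp: hom_def)
  have pk: "p \<bullet> k \<in> hom N z x" and qk: "q \<bullet> k \<in> hom N z y" using comp_hom[OF _ jk(2)] pq by auto
  have "p \<bullet> k \<in> Eqv N" "q \<bullet> k \<in> Eqv N"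
    using eqv_cancel_right[OF jk(1) pk jk(4)] eqv_cancel_right[OF jk(1) qk jk(4)] 1 f
      id_classes[OF fibrant_ob[OF x]] by auto
  moreover have "p \<bullet> k \<in> Fib N" "q \<bullet> k \<in> Fib N" using fib_comp[OF jk(2)] pq jk fq by auto
  ultimately have F1: "amap F (p \<bullet> k) \<in> Eqv P" "amap F (q \<bullet> k) \<in> Eqv P" using pres by auto
  have e: "amap F (p \<bullet> k) \<cdot>\<^bsub>P\<^esub> amap F j = idn P (omap F x)" "amap F (q \<bullet> k) \<cdot>\<^bsub>P\<^esub> amap F j = amap F f"
    using functor_comp[OF F pk jk(1)] functor_comp[OF F qk jk(1)] 1 functor_id[OF F fibrant_ob[OF x]] by auto
  have h: "amap F j \<in> hom P (omap F x) (omap F z)" "amap F (p \<bullet> k) \<in> hom P (omap F z) (omap F x)"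
    "amap F (q \<bullet> k) \<in> hom P (omap F z) (omap F y)"
    using functor_hom[OF F] jk(1) pk qk by auto
  have "idn P (omap F x) \<in> Eqv P" using P(2) functor_ob[OF F fibrant_ob[OF x]] .
  then have "amap F j \<in> Eqv P" using two_out_of_threeD(3)[OF P(1) h(1,2)] e(1) F1 by simp
  then show ?thesis using two_out_of_threeD(1)[OF P(1) h(1,3)] e(2) F1 by simp
qed

text \<open>\<open>left_Quillen\<close> is stated between right semimodel categories, so the level
  structure has to be viewed as one.\<close>

lemma right_semimodel: "right_semimodel_category U N"
  unfolding right_semimodel_category_def
proof (intro conjI)
  show "closed_under_pushouts N (Cof N)" "closed_under_pullbacks N (Fib N)"
    using cof_pushout fib_pullback by (auto simp: closed_under_pushouts_def closed_under_pullbacks_def)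
  show "\<forall>t. terminal N t \<longrightarrow> fibrant N t"
    using fibrant_terminal id_hom id_classes by (metis terminal_def)
qed (use model in \<open>auto simp: model_category_def\<close>)

end

lemma model_cat_intro:
  "model_category (U :: 'u itself) N \<Longrightarrow> uncountable (UNIV :: 'u set) \<Longrightarrow> model_cat N U"
  by unfold_locales (auto simp: model_category_def bicomplete_def)

section \<open>Localization at a functor with values in local objects\<close>

abbreviation zcls :: "('o, 'a, 'z) cat_scheme \<Rightarrow> 'a set \<Rightarrow> 'o \<Rightarrow> 'o \<Rightarrow> 'a zig list \<Rightarrow> 'a zig list set" where
  "zcls C W x y p \<equiv> {q. zeq C W x y p q}"

text \<open>A model structure and its localization are different records with the same category
  fields. Zigzags depend on these fields alone, so both homotopy categories can be handled inside
  one \<open>categ\<close>.\<close>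

lemma zpath_cong:
  assumes "zpath C W x p y"
    and "ob D = ob C" "arr D = arr C" "src D = src C" "tgt D = tgt C"
  shows "zpath D W x p y"
  using assms(1)
proof induction
  case (zpath_fwd f p y)
  then show ?case using zpath.zpath_fwd[of f D W p y] assms by simp
next
  case (zpath_bwd w p y)
  then show ?case using zpath.zpath_bwd[of w D W p y] assms by simp
qed (use assms in \<open>auto intro: zpath.intros\<close>)

lemma zeq_cong:
  assumes "zeq C W x y p q"
    and s: "ob D = ob C" "arr D = arr C" "src D = src C" "tgt D = tgt C" "idn D = idn C" "cmp D = cmp C"
  shows "zeq D W x y p q"
  using assms(1)
proof induction
  case (zeq_refl p)
  then show ?case using zpath_cong[OF _ s(1-4)] zeq.zeq_refl by metis
next
  case (zeq_sym p q)
  then show ?case using zeq.zeq_sym by metis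
next
  case (zeq_trans p q r)
  then show ?case using zeq.zeq_trans by metis
next
  case (zeq_idn z p q)
  then show ?case
    using zeq.zeq_idn[of z D W x p q y] zpath_cong[OF zeq_idn(2) s(1-4)] s by simp
next
  case (zeq_cmp p f g q)
  then show ?case using zeq.zeq_cmp[of D W x p f g q y] zpath_cong[OF zeq_cmp s(1-4)] s by simp
next
  case (zeq_fwd_bwd p w q)
  then show ?case using zeq.zeq_fwd_bwd[of D W x p w q y] zpath_cong[OF zeq_fwd_bwd s(1-4)] by simp
next
  case (zeq_bwd_fwd p w q)
  then show ?case using zeq.zeq_bwd_fwd[of D W x p w q y] zpath_cong[OF zeq_bwd_fwd s(1-4)] by simp
qed

lemma localized_cong:
  assumes s: "ob D = ob C" "arr D = arr C" "src D = src C" "tgt D = tgt C" "idn D = idn C" "cmp D = cmp C"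
  shows "zpath D W = zpath C W" "zeq D W = zeq C W" "localized_category D W = localized_category C W"
proof -
  show p: "zpath D W = zpath C W"
    using zpath_cong[of C W _ _ _ D] zpath_cong[of D W _ _ _ C] s by (intro ext) auto
  show e: "zeq D W = zeq C W"
    using zeq_cong[of C W _ _ _ _ D] zeq_cong[of D W _ _ _ _ C] s by (intro ext) auto
  show "localized_category D W = localized_category C W"
    by (simp add: localized_category_def p e s)
qed

section \<open>The calculus of zigzags and the localized category\<close>

context categ
begin

lemma zpath_ob: "zpath C W x p y \<Longrightarrow> x \<in> ob C \<and> y \<in> ob C"
  by (induction rule: zpath.induct) auto

lemma zpath_Nil: "zpath C W x [] y \<longleftrightarrow> x = y \<and> x \<in> ob C"
  by (auto elim: zpath.cases intro: zpath.intros)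

lemma zpath_Fwd: "zpath C W x (Fwd f # p) y \<longleftrightarrow> f \<in> arr C \<and> x = src C f \<and> zpath C W (tgt C f) p y"
  by (auto elim: zpath.cases intro: zpath.intros)

lemma zpath_Bwd:
  "zpath C W x (Bwd w # p) y \<longleftrightarrow> w \<in> arr C \<and> w \<in> W \<and> x = tgt C w \<and> zpath C W (src C w) p y"
  by (auto elim: zpath.cases intro: zpath.intros)

lemma zpath_append: "zpath C W x (p @ q) z \<longleftrightarrow> (\<exists>y. zpath C W x p y \<and> zpath C W y q z)"
proof (induction p arbitrary: x)
  case Nil
  then show ?case by (auto simp: zpath_Nil dest: zpath_ob)
next
  case (Cons a p)
  then show ?case by (cases a) (auto simp: zpath_Fwd zpath_Bwd)
qed

lemmas zpath_simps = zpath_Nil zpath_Fwd zpath_Bwd zpath_append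

lemma zpath_mono: "zpath C W x p y \<Longrightarrow> W \<subseteq> W' \<Longrightarrow> zpath C W' x p y"
  by (induction rule: zpath.induct) (auto simp: zpath_simps)

lemma zeq_zpath: "zeq C W x y p q \<Longrightarrow> zpath C W x p y \<and> zpath C W x q y"
  by (induction rule: zeq.induct) (auto simp: zpath_simps)

lemma zeq_ob: "zeq C W x y p q \<Longrightarrow> x \<in> ob C \<and> y \<in> ob C"
  using zeq_zpath zpath_ob by blast

lemma zeq_mono:
  assumes "zeq C W x y p q" "W \<subseteq> W'"
  shows "zeq C W' x y p q"
  using assms(1)
proof (induction rule: zeq.induct)
  case (zeq_trans p q r)
  show ?case by (rule zeq.zeq_trans[OF zeq_trans.IH])
next
  case (zeq_refl p)
  show ?case by (rule zeq.zeq_refl[OF zpath_mono[OF zeq_refl assms(2)]])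
next
  case (zeq_sym p q)
  show ?case by (rule zeq.zeq_sym[OF zeq_sym.IH])
next
  case (zeq_idn z p q)
  show ?case by (rule zeq.zeq_idn[OF zeq_idn(1) zpath_mono[OF zeq_idn(2) assms(2)]])
next
  case (zeq_cmp p f g q)
  show ?case by (rule zeq.zeq_cmp[OF zpath_mono[OF zeq_cmp assms(2)]])
next
  case (zeq_fwd_bwd p w q)
  show ?case by (rule zeq.zeq_fwd_bwd[OF zpath_mono[OF zeq_fwd_bwd assms(2)]])
next
  case (zeq_bwd_fwd p w q)
  show ?case by (rule zeq.zeq_bwd_fwd[OF zpath_mono[OF zeq_bwd_fwd assms(2)]])
qed

lemma zpath_context:
  "zpath C W x p y \<Longrightarrow> zpath C W x' a x \<Longrightarrow> zpath C W y b y' \<Longrightarrow> zpath C W x' (a @ p @ b) y'"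
  by (auto simp only: zpath_append)

lemma zeq_context:
  assumes "zeq C W x y p q" "zpath C W x' a x" "zpath C W y b y'"
  shows "zeq C W x' y' (a @ p @ b) (a @ q @ b)"
  using assms(1)
proof (induction rule: zeq.induct)
  case (zeq_refl p)
  show ?case by (rule zeq.zeq_refl[OF zpath_context[OF zeq_refl assms(2,3)]])
next
  case (zeq_sym p q)
  show ?case by (rule zeq.zeq_sym[OF zeq_sym.IH])
next
  case (zeq_trans p q r)
  show ?case by (rule zeq.zeq_trans[OF zeq_trans.IH])
next
  case (zeq_idn z p q)
  have "zpath C W x' ((a @ p) @ [Fwd (idn C z)] @ q @ b) y'"
    using zpath_context[OF zeq_idn(2) assms(2,3)] by simp
  from zeq.zeq_idn[OF zeq_idn(1) this] show ?case by simp
next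
  case (zeq_cmp p f g q)
  have "zpath C W x' ((a @ p) @ [Fwd f, Fwd g] @ q @ b) y'"
    using zpath_context[OF zeq_cmp assms(2,3)] by simp
  from zeq.zeq_cmp[OF this] show ?case by simp
next
  case (zeq_fwd_bwd p w q)
  have "zpath C W x' ((a @ p) @ [Fwd w, Bwd w] @ q @ b) y'"
    using zpath_context[OF zeq_fwd_bwd assms(2,3)] by simp
  from zeq.zeq_fwd_bwd[OF this] show ?case by simp
next
  case (zeq_bwd_fwd p w q)
  have "zpath C W x' ((a @ p) @ [Bwd w, Fwd w] @ q @ b) y'"
    using zpath_context[OF zeq_bwd_fwd assms(2,3)] by simp
  from zeq.zeq_bwd_fwd[OF this] show ?case by simp
qed

lemma zeq_prefix: "zeq C W x y p q \<Longrightarrow> zpath C W x' a x \<Longrightarrow> zeq C W x' y (a @ p) (a @ q)"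
  using zeq_context[of W x y p q x' a "[]" y] zeq_ob by (auto simp: zpath_Nil)

lemma zeq_suffix: "zeq C W x y p q \<Longrightarrow> zpath C W y b y' \<Longrightarrow> zeq C W x y' (p @ b) (q @ b)"
  using zeq_context[of W x y p q x "[]" b y'] zeq_ob by (auto simp: zpath_Nil)

lemma zeq_append:
  assumes "zeq C W x y p p'" "zeq C W y z q q'"
  shows "zeq C W x z (p @ q) (p' @ q')"
  using zeq_trans[OF zeq_suffix[OF assms(1)] zeq_prefix[OF assms(2)]] zeq_zpath assms by blast

lemma zcls_eq: "zeq C W x y p q \<Longrightarrow> zcls C W x y p = zcls C W x y q"
  by (auto intro: zeq_trans zeq_sym)

lemma zcls_iff: "zpath C W x p y \<Longrightarrow> zcls C W x y p = zcls C W x y q \<longleftrightarrow> zeq C W x y p q"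
  using zcls_eq[of W x y p q] zeq_refl[of C W x p y] by (metis mem_Collect_eq zeq_sym)

text \<open>\<open>zeq\<close> is a congruence for concatenation, so any representatives compute the
  composite of two classes.\<close>

lemma zcls_comp:
  assumes "zpath C W x p y" "zpath C W y q z"
  shows "{r. \<exists>p'\<in>zcls C W x y p. \<exists>q'\<in>zcls C W y z q. zeq C W x z (p' @ q') r} = zcls C W x z (p @ q)"
proof (intro set_eqI iffI)
  fix r assume "r \<in> {r. \<exists>p'\<in>zcls C W x y p. \<exists>q'\<in>zcls C W y z q. zeq C W x z (p' @ q') r}"
  then obtain p' q' where "zeq C W x y p p'" "zeq C W y z q q'" "zeq C W x z (p' @ q') r" by blast
  then show "r \<in> zcls C W x z (p @ q)" using zeq_trans[OF zeq_append] by blast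
qed (use zeq_refl[OF assms(1)] zeq_refl[OF assms(2)] in blast)

lemma localized_hom:
  "hom (localized_category C W) x y = {(x, zcls C W x y p, y) | p. zpath C W x p y}"
  by (auto simp: hom_def localized_category_def)

lemma localized_comp:
  "zpath C W x p y \<Longrightarrow> zpath C W y q z \<Longrightarrow>
   (y, zcls C W y z q, z) \<cdot>\<^bsub>localized_category C W\<^esub> (x, zcls C W x y p, y) = (x, zcls C W x z (p @ q), z)"
  unfolding localized_category_def using zcls_comp[of W x p y q z] by simp

lemma localized_category: "category (localized_category C W)"
proof -
  let ?H = "localized_category C W"
  have arr: "f \<in> arr ?H \<longleftrightarrow> (\<exists>x p y. f = (x, zcls C W x y p, y) \<and> zpath C W x p y)" for f
    by (auto simp: localized_category_def)
  have s: "src ?H (x, K, y) = x" "tgt ?H (x, K, y) = y" "idn ?H x = (x, zcls C W x x [], x)" "ob ?H = ob C"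
    for x K y by (auto simp: localized_category_def)
  show ?thesis
    unfolding category_def
  proof (intro conjI ballI impI)
    fix f assume f: "f \<in> arr ?H"
    then obtain x p y where f': "f = (x, zcls C W x y p, y)" "zpath C W x p y" using arr by blast
    show "src ?H f \<in> ob ?H" "tgt ?H f \<in> ob ?H"
      using f' s zpath_ob by auto
    have i: "zpath C W x [] x" "zpath C W y [] y" using f' zpath_ob by (auto simp: zpath_Nil)
    show "f \<cdot>\<^bsub>?H\<^esub> idn ?H (src ?H f) = f" "idn ?H (tgt ?H f) \<cdot>\<^bsub>?H\<^esub> f = f"
      using localized_comp[OF i(1) f'(2)] localized_comp[OF f'(2) i(2)] f' s by auto
    fix g assume "g \<in> arr ?H" and fg: "tgt ?H f = src ?H g"
    then obtain q z where g: "g = (y, zcls C W y z q, z)" "zpath C W y q z" using arr f' s by fastforce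
    have gf: "g \<cdot>\<^bsub>?H\<^esub> f = (x, zcls C W x z (p @ q), z)" "zpath C W x (p @ q) z"
      using localized_comp[OF f'(2) g(2)] f' g by (auto simp: zpath_append)
    show "g \<cdot>\<^bsub>?H\<^esub> f \<in> hom ?H (src ?H f) (tgt ?H g)"
      using gf f' g s by (auto simp: localized_hom)
    fix h assume "h \<in> arr ?H" and "tgt ?H g = src ?H h"
    then obtain r w where h: "h = (z, zcls C W z w r, w)" "zpath C W z r w" using arr g s by fastforce
    have "zpath C W y (q @ r) w" using g h by (auto simp: zpath_append)
    then show "h \<cdot>\<^bsub>?H\<^esub> g \<cdot>\<^bsub>?H\<^esub> f = (h \<cdot>\<^bsub>?H\<^esub> g) \<cdot>\<^bsub>?H\<^esub> f"
      using localized_comp[OF gf(2) h(2)] localized_comp[OF g(2) h(2)] localized_comp[OF f'(2), of "q @ r" w]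
        gf f' g h by simp
  next
    fix x assume "x \<in> ob ?H"
    then show "idn ?H x \<in> hom ?H x x" using s by (auto simp: localized_hom zpath_Nil)
  qed
qed

end

lemma full_subcategory_category:
  assumes "category C" "S \<subseteq> ob C"
  shows "category (full_subcategory C S)"
  using assms unfolding category_def full_subcategory_def hom_def by auto

section \<open>The action of a pointed endofunctor on zigzags, and the comparison of homotopy
  categories\<close>

locale pointed_functor = categ C for C :: "('o, 'a, 'z) cat_scheme" +
  fixes Q :: "('o, 'a, 'o, 'a) ftr" and q :: "'o \<Rightarrow> 'a"
  assumes Q: "is_functor C C Q" and q: "nat_trans C C id_ftr Q q"
begin

lemma Q_arr: "f \<in> arr C \<Longrightarrow> amap Q f \<in> arr C \<and> src C (amap Q f) = omap Q (src C f) \<and>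
    tgt C (amap Q f) = omap Q (tgt C f)"
  using functor_hom[OF Q, of f "src C f" "tgt C f"] by (auto simp: hom_def)

lemma q_hom: "x \<in> ob C \<Longrightarrow> q x \<in> hom C x (omap Q x)"
  using q by (auto simp: nat_trans_def id_ftr_def)

lemma q_arr: "x \<in> ob C \<Longrightarrow> q x \<in> arr C \<and> src C (q x) = x \<and> tgt C (q x) = omap Q x"
  using q_hom by (auto simp: hom_def)

lemma q_nat: "f \<in> arr C \<Longrightarrow> q (tgt C f) \<bullet> f = amap Q f \<bullet> q (src C f)"
  using q by (auto simp: nat_trans_def id_ftr_def)

abbreviation Qz :: "'a zig list \<Rightarrow> 'a zig list" where "Qz \<equiv> map (map_zig (amap Q))"

lemma zpath_Q:
  assumes "amap Q ` W \<subseteq> W'" "zpath C W x p y"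
  shows "zpath C W' (omap Q x) (Qz p) (omap Q y)"
  using assms(2,1) by (induction rule: zpath.induct) (auto simp: zpath_simps Q_arr functor_ob[OF Q])

lemma zeq_Q:
  assumes "zeq C W x y p p'" "amap Q ` W \<subseteq> W'"
  shows "zeq C W' (omap Q x) (omap Q y) (Qz p) (Qz p')"
  using assms(1)
proof (induction rule: zeq.induct)
  case (zeq_refl p)
  then show ?case by (intro zeq.zeq_refl zpath_Q[OF assms(2)])
next
  case (zeq_sym p q)
  show ?case by (rule zeq.zeq_sym[OF zeq_sym.IH])
next
  case (zeq_trans p q r)
  show ?case by (rule zeq.zeq_trans[OF zeq_trans.IH])
next
  case (zeq_idn z p q)
  show ?case
    using zeq.zeq_idn[OF functor_ob[OF Q zeq_idn(1)], of W' "omap Q x" "Qz p" "Qz q" "omap Q y"]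
      zpath_Q[OF assms(2) zeq_idn(2)] functor_id[OF Q zeq_idn(1)] by simp
next
  case (zeq_cmp p f g q)
  have "f \<in> arr C" "g \<in> arr C" "src C g = tgt C f" using zeq_cmp by (auto simp: zpath_simps)
  then have "amap Q (g \<bullet> f) = amap Q g \<bullet> amap Q f" 
    using functor_comp[OF Q, of g "src C g" "tgt C g" f "src C f"] by (simp add: hom_def)
  then show ?case
    using zeq.zeq_cmp[of C W' "omap Q x" "Qz p" "amap Q f" "amap Q g" "Qz q" "omap Q y"]
      zpath_Q[OF assms(2) zeq_cmp] by simp
next
  case (zeq_fwd_bwd p w q)
  show ?case
    using zeq.zeq_fwd_bwd[of C W' "omap Q x" "Qz p" "amap Q w" "Qz q" "omap Q y"]
      zpath_Q[OF assms(2) zeq_fwd_bwd] by simp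
next
  case (zeq_bwd_fwd p w q)
  show ?case
    using zeq.zeq_bwd_fwd[of C W' "omap Q x" "Qz p" "amap Q w" "Qz q" "omap Q y"]
      zpath_Q[OF assms(2) zeq_bwd_fwd] by simp
qed

lemma zeq_swap_fwd:
  assumes f: "f \<in> arr C" and r: "zpath C W (omap Q (tgt C f)) r y"
  shows "zeq C W (src C f) y (Fwd f # Fwd (q (tgt C f)) # r) (Fwd (q (src C f)) # Fwd (amap Q f) # r)"
proof -
  have 1: "zeq C W (src C f) y (Fwd f # Fwd (q (tgt C f)) # r) (Fwd (q (tgt C f) \<bullet> f) # r)"
    using zeq_cmp[of C W "src C f" "[]" f "q (tgt C f)" r y] f r by (simp add: zpath_simps q_arr)
  have 2: "zeq C W (src C f) y (Fwd (q (src C f)) # Fwd (amap Q f) # r) (Fwd (amap Q f \<bullet> q (src C f)) # r)"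
    using zeq_cmp[of C W "src C f" "[]" "q (src C f)" "amap Q f" r y] f r by (simp add: zpath_simps q_arr Q_arr)
  show ?thesis using zeq_trans[OF 1] zeq_sym[OF 2] q_nat[OF f] by simp
qed

text \<open>Naturality of \<open>q\<close> is extended from arrows to zigzags by induction. A
  forward step slides past \<open>q\<close> by \<open>zeq_swap_fwd\<close>. For a backward step
  \<open>w\<close> the pair \<open>Q w\<close> and its formal inverse is inserted first, so that the
  naturality square of \<open>w\<close> applies; this is where \<open>Q\<close> must map
  \<open>W\<close> into itself.\<close>

lemma zeq_nat:
  assumes QW: "amap Q ` W \<subseteq> W" and "zpath C W x p y"
  shows "zeq C W x (omap Q y) (p @ [Fwd (q y)]) (Fwd (q x) # Qz p)"
  using assms(2)
proof (induction rule: zpath.induct)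
  case (zpath_nil x)
  then show ?case by (auto intro!: zeq.zeq_refl simp: zpath_simps q_arr functor_ob[OF Q])
next
  case (zpath_fwd f p y)
  have p: "zpath C W (omap Q (tgt C f)) (Qz p) (omap Q y)" using zpath_Q[OF QW zpath_fwd(2)] .
  have "zpath C W (src C f) [Fwd f] (tgt C f)" using zpath_fwd(1) by (simp add: zpath_simps)
  from zeq_prefix[OF zpath_fwd(3) this] show ?case
    using zeq_trans zeq_swap_fwd[OF zpath_fwd(1) p] by simp
next
  case (zpath_bwd w p y)
  note w = zpath_bwd(1,2)
  have Qw: "amap Q w \<in> W" using QW w by auto
  have p: "zpath C W (omap Q (src C w)) (Qz p) (omap Q y)" using zpath_Q[OF QW zpath_bwd(3)] .
  let ?x = "tgt C w" and ?z = "omap Q y"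
  have "zpath C W ?x [Bwd w] (src C w)" using w by (simp add: zpath_simps)
  from zeq_prefix[OF zpath_bwd(4) this]
  have 1: "zeq C W ?x ?z (Bwd w # p @ [Fwd (q y)]) ([Bwd w, Fwd (q (src C w))] @ Qz p)" by simp
  have 2: "zeq C W ?x ?z ([Bwd w, Fwd (q (src C w))] @ [Fwd (amap Q w), Bwd (amap Q w)] @ Qz p)
     ([Bwd w, Fwd (q (src C w))] @ Qz p)"
    by (rule zeq_fwd_bwd) (use w p Qw in \<open>simp add: zpath_simps q_arr Q_arr\<close>)
  have "zpath C W (omap Q (tgt C w)) (Bwd (amap Q w) # Qz p) (omap Q y)"
    using w p Qw by (simp add: zpath_simps Q_arr)
  from zeq_prefix[OF zeq_swap_fwd[OF w(1) this] \<open>zpath C W ?x [Bwd w] (src C w)\<close>]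
  have 3: "zeq C W ?x ?z ([Bwd w, Fwd w] @ Fwd (q ?x) # Bwd (amap Q w) # Qz p)
     ([Bwd w, Fwd (q (src C w))] @ [Fwd (amap Q w), Bwd (amap Q w)] @ Qz p)" by simp
  have 4: "zeq C W ?x ?z ([Bwd w, Fwd w] @ Fwd (q ?x) # Bwd (amap Q w) # Qz p)
     (Fwd (q ?x) # Bwd (amap Q w) # Qz p)"
    using zeq_bwd_fwd[of C W ?x "[]" w "Fwd (q ?x) # Bwd (amap Q w) # Qz p" ?z] w p Qw
    by (simp add: zpath_simps q_arr Q_arr)
  show ?case
    using zeq_trans[OF 1 zeq_trans[OF zeq_sym[OF 2] zeq_trans[OF zeq_sym[OF 3] 4]]] by simp
qed

lemma zeq_conjugate:
  assumes QW: "amap Q ` W \<subseteq> W" and p: "zpath C W x p y" and qy: "q y \<in> W"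
  shows "zeq C W x y p (Fwd (q x) # Qz p @ [Bwd (q y)])"
proof -
  have y: "y \<in> ob C" using p zpath_ob by blast
  have "zeq C W x y (p @ [Fwd (q y), Bwd (q y)] @ []) (p @ [])"
    by (rule zeq_fwd_bwd) (use p y qy in \<open>auto simp: zpath_simps q_arr\<close>)
  moreover have "zpath C W (omap Q y) [Bwd (q y)] y" using y qy by (simp add: zpath_simps q_arr)
  from zeq_suffix[OF zeq_nat[OF QW p] this]
  have "zeq C W x y (p @ [Fwd (q y), Bwd (q y)]) (Fwd (q x) # Qz p @ [Bwd (q y)])" by simp
  ultimately show ?thesis using zeq_trans zeq_sym by fastforce
qed

text \<open>A zigzag \<open>p\<close> between local objects agrees with its conjugate \<open>q \<cdot> Q p \<cdot> q\<inverse>\<close>, and \<open>Q\<close> turns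
  the larger class of weak equivalences into the smaller one.\<close>

lemma Ho_comparison_equivalence:
  fixes N L :: "('o, 'a, 'y) mcat_scheme"
  assumes N: "ob N = ob C" "arr N = arr C" "src N = src C" "tgt N = tgt C" "idn N = idn C" "cmp N = cmp C"
    and L: "ob L = ob C" "arr L = arr C" "src L = src C" "tgt L = tgt C" "idn L = idn C" "cmp L = cmp C"
    and NL: "Eqv N \<subseteq> Eqv L" and QE: "amap Q ` Eqv L \<subseteq> Eqv N"
    and qL: "\<And>x. x \<in> ob C \<Longrightarrow> q x \<in> Eqv L" and S: "S \<subseteq> ob C"
    and qS: "\<And>x. x \<in> S \<Longrightarrow> q x \<in> Eqv N" and QS: "\<And>x. x \<in> ob C \<Longrightarrow> omap Q x \<in> S"
  shows "equivalence_of_categories (full_subcategory (Ho N) S) (Ho L) (Ho_comparison L)"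
proof -
  define V where "V = Eqv N"
  define W where "W = Eqv L"
  let ?H = "localized_category C V" and ?K = "localized_category C W"
  let ?S = "full_subcategory ?H S"
  let ?F = "Ho_comparison L"
  have Ho: "Ho N = ?H" "Ho L = ?K"
    using localized_cong(3)[OF N, of V] localized_cong(3)[OF L, of W]
    by (simp_all add: Ho_def V_def W_def)
  have VW: "V \<subseteq> W" "amap Q ` W \<subseteq> V" "amap Q ` V \<subseteq> V" "amap Q ` W \<subseteq> W"
    using NL QE by (auto simp: V_def W_def)
  have F: "amap ?F (x, zcls C V x y p, y) = (x, zcls C W x y p, y)" if "zpath C V x p y" for x p y
  proof -
    have "zeq L (Eqv L) = zeq C W" using localized_cong(2)[OF L] by (simp add: W_def)
    then have "amap ?F (x, zcls C V x y p, y) = (x, {r. \<exists>p'\<in>zcls C V x y p. zeq C W x y p' r}, y)"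
      by (simp add: Ho_comparison_def)
    also have "{r. \<exists>p'\<in>zcls C V x y p. zeq C W x y p' r} = zcls C W x y p"
    proof (intro set_eqI iffI)
      fix r assume "r \<in> {r. \<exists>p'\<in>zcls C V x y p. zeq C W x y p' r}"
      then obtain p' where "zeq C V x y p p'" "zeq C W x y p' r" by blast
      then show "r \<in> zcls C W x y p" using zeq_trans[OF zeq_mono[OF _ VW(1)]] by blast
    qed (use zeq_refl[OF that] in blast)
    finally show ?thesis .
  qed
  have homS: "hom ?S x y = (if x \<in> S \<and> y \<in> S then hom ?H x y else {})" for x y
    by (auto simp: hom_def full_subcategory_def)
  have obS: "ob ?S = S" by (simp add: full_subcategory_def)
  have obK: "ob ?K = ob C" "ob ?H = ob C" by (simp_all add: localized_category_def)
  have catS: "category ?S" using full_subcategory_category[OF localized_category] S obK by metis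
  have Fo: "omap ?F x = x" for x by (simp add: Ho_comparison_def)
  have homF: "amap ?F f \<in> hom ?K x y" if "f \<in> hom ?H x y" for f x y
    using that F zpath_mono[OF _ VW(1)] unfolding localized_hom by auto
  have arrS: "f \<in> arr ?S \<longleftrightarrow> (\<exists>x y p. f = (x, zcls C V x y p, y) \<and> zpath C V x p y \<and> x \<in> S \<and> y \<in> S)"
    for f by (auto simp: full_subcategory_def localized_category_def)
  have sS: "src ?S (x, K, y) = x" "tgt ?S (x, K, y) = y" for x K y
    by (auto simp: full_subcategory_def localized_category_def)
  have cS: "cmp ?S = cmp ?H" by (simp add: full_subcategory_def)
  have "is_functor ?S ?K ?F"
    unfolding is_functor_def
  proof (intro conjI ballI impI)
    show "category ?S" by fact
    show "category ?K" by (rule localized_category)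
    show "omap ?F x \<in> ob ?K" if "x \<in> ob ?S" for x using that S obS obK Fo by auto
    show "amap ?F f \<in> hom ?K (omap ?F (src ?S f)) (omap ?F (tgt ?S f))" if fS: "f \<in> arr ?S" for f
    proof -
      obtain x y p where f: "f = (x, zcls C V x y p, y)" "zpath C V x p y" using iffD1[OF arrS fS] by blast
      then have "f \<in> hom ?H x y" unfolding localized_hom by blast
      then show ?thesis using homF f Fo sS by simp
    qed
    show "amap ?F (idn ?S x) = idn ?K (omap ?F x)" if "x \<in> ob ?S" for x
      using F[of x "[]" x] that obS S Fo
      by (auto simp: zpath_Nil full_subcategory_def localized_category_def)
    fix f g assume f: "f \<in> arr ?S" and g: "g \<in> arr ?S" and fg: "tgt ?S f = src ?S g"
    obtain x y p where f': "f = (x, zcls C V x y p, y)" "zpath C V x p y" using iffD1[OF arrS f] by blast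
    obtain z r where g': "g = (y, zcls C V y z r, z)" "zpath C V y r z" using iffD1[OF arrS g] fg f' sS by auto
    have "zpath C V x (p @ r) z" using f' g' by (auto simp: zpath_append)
    then show "amap ?F (g \<cdot>\<^bsub>?S\<^esub> f) = amap ?F g \<cdot>\<^bsub>?K\<^esub> amap ?F f"
      using localized_comp[OF f'(2) g'(2)] f' g' F cS
        localized_comp[OF zpath_mono[OF f'(2) VW(1)] zpath_mono[OF g'(2) VW(1)]] by simp
  qed
  moreover have "bij_betw (amap ?F) (hom ?S x y) (hom ?K (omap ?F x) (omap ?F y))"
    if x: "x \<in> ob ?S" and y: "y \<in> ob ?S" for x y
  proof -
    have xy: "x \<in> S" "y \<in> S" using x y obS by auto
    have conj_V: "zeq C V x y p (Fwd (q x) # Qz p @ [Bwd (q y)])" if "zpath C V x p y" for p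
      using zeq_conjugate[OF VW(3) that] qS[OF xy(2)] by (simp add: V_def)
    have yC: "y \<in> ob C" "x \<in> ob C" using xy S by auto
    have conj_W: "zeq C W x y p (Fwd (q x) # Qz p @ [Bwd (q y)])" if "zpath C W x p y" for p
      using zeq_conjugate[OF VW(4) that] qL[OF yC(1)] by (simp add: W_def)
    \<comment> \<open>Surjectivity rests on this: the backward steps of the conjugate are
      \<open>q y\<close>, which is in \<open>V\<close> because \<open>y\<close> is in
      \<open>S\<close>, and images under \<open>Q\<close> of elements of \<open>W\<close>, which lie
      in \<open>V\<close>. So a zigzag for the larger class has a representative for the smaller
      one.\<close>
    have path_V: "zpath C V x (Fwd (q x) # Qz p @ [Bwd (q y)]) y" if "zpath C W x p y" for p
      using zpath_Q[OF VW(2) that] qS[OF xy(2)] yC by (auto simp: zpath_simps q_arr V_def)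
    \<comment> \<open>\<open>Q\<close> carries a congruence over \<open>W\<close> to one over
      \<open>V\<close>, and conjugation by \<open>q\<close> brings it back to the original
      zigzags.\<close>
    have inj: "zeq C V x y p p'" if "zpath C V x p y" "zpath C V x p' y" "zeq C W x y p p'" for p p'
    proof -
      have "zeq C V (omap Q x) (omap Q y) (Qz p) (Qz p')" using zeq_Q[OF that(3) VW(2)] .
      moreover have "zpath C V x [Fwd (q x)] (omap Q x)" "zpath C V (omap Q y) [Bwd (q y)] y"
        using qS[OF xy(2)] yC functor_ob[OF Q] by (auto simp: zpath_simps q_arr V_def)
      ultimately have "zeq C V x y ([Fwd (q x)] @ Qz p @ [Bwd (q y)]) ([Fwd (q x)] @ Qz p' @ [Bwd (q y)])"
        by (rule zeq_context)
      then show ?thesis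
        using conj_V[OF that(1)] conj_V[OF that(2)] zeq_trans zeq_sym by (metis append_Cons append_Nil)
    qed
    have "inj_on (amap ?F) (hom ?H x y)"
    proof (rule inj_onI)
      fix f g assume "f \<in> hom ?H x y" "g \<in> hom ?H x y" and e: "amap ?F f = amap ?F g"
      then obtain p p' where p: "f = (x, zcls C V x y p, y)" "zpath C V x p y"
        "g = (x, zcls C V x y p', y)" "zpath C V x p' y" unfolding localized_hom by blast
      then have "zcls C W x y p = zcls C W x y p'" using e F by simp
      then have "zeq C W x y p p'" using zcls_iff[OF zpath_mono[OF p(2) VW(1)]] by blast
      then show "f = g" using inj p zcls_eq by blast
    qed
    moreover have "hom ?K x y \<subseteq> amap ?F ` hom ?H x y"
    proof
      fix g assume "g \<in> hom ?K x y"
      then obtain p where p: "g = (x, zcls C W x y p, y)" "zpath C W x p y" unfolding localized_hom by blast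
      let ?p = "Fwd (q x) # Qz p @ [Bwd (q y)]"
      have "g = amap ?F (x, zcls C V x y ?p, y)"
        using F[OF path_V[OF p(2)]] zcls_eq[OF conj_W[OF p(2)]] p by simp
      then show "g \<in> amap ?F ` hom ?H x y" using path_V[OF p(2)] unfolding localized_hom by blast
    qed
    ultimately show ?thesis
      using homF xy by (auto simp: bij_betw_def homS Fo)
  qed
  moreover have "\<exists>x\<in>ob ?S. iso_objects ?K (omap ?F x) d" if d: "d \<in> ob ?K" for d
  proof -
    have d': "d \<in> ob C" using d obK by simp
    let ?x = "omap Q d"
    have qd: "q d \<in> W" using qL d' by (simp add: W_def)
    have p: "zpath C W ?x [Bwd (q d)] d" "zpath C W d [Fwd (q d)] ?x"
      using d' qd functor_ob[OF Q] by (auto simp: zpath_simps q_arr)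
    have "zeq C W ?x ?x ([] @ [Bwd (q d), Fwd (q d)] @ []) ([] @ [])"
      by (rule zeq_bwd_fwd) (use d' qd functor_ob[OF Q] in \<open>auto simp: zpath_simps q_arr\<close>)
    moreover have "zeq C W d d ([] @ [Fwd (q d), Bwd (q d)] @ []) ([] @ [])"
      by (rule zeq_fwd_bwd) (use d' qd functor_ob[OF Q] in \<open>auto simp: zpath_simps q_arr\<close>)
    ultimately have "(d, zcls C W d ?x [Fwd (q d)], ?x) \<cdot>\<^bsub>?K\<^esub> (?x, zcls C W ?x d [Bwd (q d)], d) = idn ?K ?x"
      "(?x, zcls C W ?x d [Bwd (q d)], d) \<cdot>\<^bsub>?K\<^esub> (d, zcls C W d ?x [Fwd (q d)], ?x) = idn ?K d"
      using localized_comp[OF p] localized_comp[OF p(2,1)] zcls_eq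
      by (auto simp: localized_category_def)
    moreover have "(?x, zcls C W ?x d [Bwd (q d)], d) \<in> hom ?K ?x d"
      "(d, zcls C W d ?x [Fwd (q d)], ?x) \<in> hom ?K d ?x"
      using p unfolding localized_hom by blast+
    ultimately have "iso_objects ?K ?x d" unfolding iso_objects_def by blast
    then show ?thesis using QS[OF d'] obS Fo by auto
  qed
  ultimately show ?thesis unfolding equivalence_of_categories_def Ho by blast
qed

end

section \<open>Homotopy colimits of sequences\<close>

context categ
begin

definition path :: "(nat \<Rightarrow> 'o) \<Rightarrow> (nat \<Rightarrow> 'a) \<Rightarrow> nat \<Rightarrow> nat \<Rightarrow> 'a" where
  "path X s i j = chain X s i (j - i)"

lemma path_hom: "is_seq C X s \<Longrightarrow> i \<le> j \<Longrightarrow> path X s i j \<in> hom C (X i) (X j)"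
  using chain_hom[of X s i "j - i"] by (simp add: path_def)

lemma path_comp: "is_seq C X s \<Longrightarrow> i \<le> j \<Longrightarrow> j \<le> k \<Longrightarrow> path X s j k \<bullet> path X s i j = path X s i k"
  using chain_add[of X s i "j - i" "k - j"] by (simp add: path_def)

lemma path_nat:
  "seq_map C X s Y t f \<Longrightarrow> is_seq C X s \<Longrightarrow> is_seq C Y t \<Longrightarrow> i \<le> j \<Longrightarrow>
   f j \<bullet> path X s i j = path Y t i j \<bullet> f i"
  using chain_nat[of X s Y t f i "j - i"] by (simp add: path_def)

lemma path_cocone: "seq_cocone C X s c \<iota> \<Longrightarrow> is_seq C X s \<Longrightarrow> i \<le> j \<Longrightarrow> \<iota> j \<bullet> path X s i j = \<iota> i"
  using chain_cocone[of X s c \<iota> i "j - i"] by (simp add: path_def)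

lemma path_Suc: "is_seq C X s \<Longrightarrow> i \<le> j \<Longrightarrow> path X s i (Suc j) = s j \<bullet> path X s i j"
  by (simp add: path_def Suc_diff_le)

lemma path_refl: "path X s i i = idn C (X i)"
  by (simp add: path_def)

lemma path_step: "is_seq C X s \<Longrightarrow> path X s i (Suc i) = s i"
  using path_Suc[of X s i i] by (simp add: path_refl is_seq_def hom_def)

lemma seq_colimit_unique:
  assumes "seq_colimit C X s c \<iota>" and h: "h \<in> hom C c d" "h' \<in> hom C c d"
    and e: "\<And>i. h \<bullet> \<iota> i = h' \<bullet> \<iota> i" and s: "is_seq C X s"
  shows "h = h'"
proof -
  have c: "\<iota> i \<in> hom C (X i) c" "\<iota> (Suc i) \<bullet> s i = \<iota> i" "s i \<in> hom C (X i) (X (Suc i))" for i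
    using assms by (auto simp: seq_colimit_def seq_cocone_def is_seq_def)
  have "seq_cocone C X s d (\<lambda>i. h' \<bullet> \<iota> i)"
    unfolding seq_cocone_def using h c hom_ob(2)[OF h(1)] comp_hom by (simp add: hom_def)
  then have "\<exists>!k. k \<in> hom C c d \<and> (\<forall>i. k \<bullet> \<iota> i = h' \<bullet> \<iota> i)"
    using assms(1) unfolding seq_colimit_def by blast
  then show ?thesis using h e by blast
qed

lemma seq_colimit_univ:
  assumes "seq_colimit C X s c \<iota>" "seq_cocone C X s d \<kappa>"
  obtains h where "h \<in> hom C c d" "\<And>i. h \<bullet> \<iota> i = \<kappa> i"
  using assms unfolding seq_colimit_def by blast

definition subseq_maps :: "(nat \<Rightarrow> 'o) \<Rightarrow> (nat \<Rightarrow> 'a) \<Rightarrow> (nat \<Rightarrow> nat) \<Rightarrow> nat \<Rightarrow> 'a" where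
  "subseq_maps X s \<phi> k = path X s (\<phi> k) (\<phi> (Suc k))"

lemma subseq_seq:
  assumes "is_seq C X s" "\<And>k. \<phi> k \<le> \<phi> (Suc k)"
  shows "is_seq C (X \<circ> \<phi>) (subseq_maps X s \<phi>)"
  using assms path_hom unfolding is_seq_def subseq_maps_def by (auto intro: path_hom simp: is_seq_def)

lemma subseq_map:
  assumes X: "is_seq C X s" and m: "\<And>k. \<phi> k \<le> \<phi> (Suc k)" and le: "\<And>k. k \<le> \<phi> k"
  shows "seq_map C X s (X \<circ> \<phi>) (subseq_maps X s \<phi>) (\<lambda>k. path X s k (\<phi> k))"
proof -
  have "path X s (Suc k) (\<phi> (Suc k)) \<bullet> s k = path X s (\<phi> k) (\<phi> (Suc k)) \<bullet> path X s k (\<phi> k)" for k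
    using path_comp[OF X, of k "Suc k" "\<phi> (Suc k)"] path_step[OF X, of k]
      path_comp[OF X, of k "\<phi> k" "\<phi> (Suc k)"] m[of k] le[of "Suc k"] le[of k] by simp
  then show ?thesis
    using path_hom[OF X] le by (auto simp: seq_map_def subseq_maps_def)
qed

text \<open>Cofinality: as \<open>k \<le> \<phi> k\<close>, a cocone on the subsequence extends to
  the whole sequence by composing with the paths from \<open>k\<close> to
  \<open>\<phi> k\<close>.\<close>

lemma subseq_colimit:
  assumes X: "is_seq C X s" and m: "\<And>k. \<phi> k \<le> \<phi> (Suc k)" and le: "\<And>k. k \<le> \<phi> k"
    and c: "seq_colimit C X s c \<iota>"
  shows "seq_colimit C (X \<circ> \<phi>) (subseq_maps X s \<phi>) c (\<iota> \<circ> \<phi>)"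
proof -
  have mono: "i \<le> j \<Longrightarrow> \<phi> i \<le> \<phi> j" for i j using m lift_Suc_mono_le by blast
  have co: "seq_cocone C X s c \<iota>" using c by (simp add: seq_colimit_def)
  have i: "\<iota> i \<in> hom C (X i) c" for i using co by (simp add: seq_cocone_def)
  have co': "seq_cocone C (X \<circ> \<phi>) (subseq_maps X s \<phi>) c (\<iota> \<circ> \<phi>)"
    using co path_cocone[OF co X m] by (auto simp: seq_cocone_def subseq_maps_def)
  have "\<exists>!h. h \<in> hom C c d \<and> (\<forall>k. h \<bullet> (\<iota> \<circ> \<phi>) k = \<kappa> k)"
    if k: "seq_cocone C (X \<circ> \<phi>) (subseq_maps X s \<phi>) d \<kappa>" for d \<kappa>
  proof -
    have kh: "\<kappa> i \<in> hom C (X (\<phi> i)) d" and ks: "\<kappa> (Suc i) \<bullet> path X s (\<phi> i) (\<phi> (Suc i)) = \<kappa> i" for i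
      using k by (auto simp: seq_cocone_def subseq_maps_def)
    have kp: "\<kappa> j \<bullet> path X s (\<phi> i) (\<phi> j) = \<kappa> i" if "i \<le> j" for i j
      using that
    proof (induction j rule: dec_induct)
      case base
      then show ?case using kh[of i] by (simp add: path_refl hom_def)
    next
      case (step j)
      have p: "path X s (\<phi> j) (\<phi> (Suc j)) \<in> hom C (X (\<phi> j)) (X (\<phi> (Suc j)))"
        "path X s (\<phi> i) (\<phi> j) \<in> hom C (X (\<phi> i)) (X (\<phi> j))"
        using path_hom[OF X] mono step by auto
      have "path X s (\<phi> i) (\<phi> (Suc j)) = path X s (\<phi> j) (\<phi> (Suc j)) \<bullet> path X s (\<phi> i) (\<phi> j)"
        using path_comp[OF X] mono step by simp
      then show ?case using comp_ext[OF ks[of j], of "path X s (\<phi> i) (\<phi> j)"] p kh[of "Suc j"] step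
        by (simp add: hom_def)
    qed
    have "seq_cocone C X s d (\<lambda>i. \<kappa> i \<bullet> path X s i (\<phi> i))"
    proof -
      have "(\<kappa> (Suc i) \<bullet> path X s (Suc i) (\<phi> (Suc i))) \<bullet> s i = \<kappa> i \<bullet> path X s i (\<phi> i)" for i
      proof -
        have p: "path X s (Suc i) (\<phi> (Suc i)) \<in> hom C (X (Suc i)) (X (\<phi> (Suc i)))"
          "path X s i (\<phi> i) \<in> hom C (X i) (X (\<phi> i))"
          "path X s (\<phi> i) (\<phi> (Suc i)) \<in> hom C (X (\<phi> i)) (X (\<phi> (Suc i)))"
          using path_hom[OF X] le m by auto
        have "path X s (Suc i) (\<phi> (Suc i)) \<bullet> s i = path X s (\<phi> i) (\<phi> (Suc i)) \<bullet> path X s i (\<phi> i)"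
          using subseq_map[OF X m le] by (simp add: seq_map_def subseq_maps_def)
        moreover have "s i \<in> hom C (X i) (X (Suc i))" using X by (simp add: is_seq_def)
        ultimately show ?thesis
          using comp_ext[OF ks[of i], of "path X s i (\<phi> i)"] p kh[of "Suc i"] by (simp add: hom_def)
      qed
      moreover have "\<kappa> i \<bullet> path X s i (\<phi> i) \<in> hom C (X i) d" for i
        by (rule comp_hom[OF kh path_hom[OF X le]])
      ultimately show ?thesis using k by (simp add: seq_cocone_def)
    qed
    then obtain h where h: "h \<in> hom C c d" "\<And>i. h \<bullet> \<iota> i = \<kappa> i \<bullet> path X s i (\<phi> i)"
      using seq_colimit_univ[OF c] by blast
    have 1: "h \<bullet> (\<iota> \<circ> \<phi>) k = \<kappa> k" for k
      using h(2)[of "\<phi> k"] kp[OF le[of k]] by simp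
    have "h' = h" if h': "h' \<in> hom C c d" "\<forall>k. h' \<bullet> (\<iota> \<circ> \<phi>) k = \<kappa> k" for h'
    proof (rule seq_colimit_unique[OF c h'(1) h(1) _ X])
      fix i
      have p: "path X s i (\<phi> i) \<in> hom C (X i) (X (\<phi> i))" using path_hom[OF X le] .
      have "(h' \<bullet> \<iota> (\<phi> i)) \<bullet> path X s i (\<phi> i) = h \<bullet> \<iota> i" using h' h by simp
      moreover have "(h' \<bullet> \<iota> (\<phi> i)) \<bullet> path X s i (\<phi> i) = h' \<bullet> \<iota> i"
        using p h'(1) i[of "\<phi> i"] path_cocone[OF co X le[of i]] by (simp add: hom_def)
      ultimately show "h' \<bullet> \<iota> i = h \<bullet> \<iota> i" by simp
    qed
    then show ?thesis using h(1) 1 by blast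
  qed
  then show ?thesis using co' unfolding seq_colimit_def by blast
qed

lemma seq_map_comp:
  assumes "seq_map C X s Y t f" "seq_map C Y t Z u g" "is_seq C X s" "is_seq C Y t" "is_seq C Z u"
  shows "seq_map C X s Z u (\<lambda>k. g k \<bullet> f k)"
proof -
  have h: "f k \<in> hom C (X k) (Y k)" "g k \<in> hom C (Y k) (Z k)" "s k \<in> hom C (X k) (X (Suc k))"
    "t k \<in> hom C (Y k) (Y (Suc k))" "u k \<in> hom C (Z k) (Z (Suc k))"
    and e: "f (Suc k) \<bullet> s k = t k \<bullet> f k" "g (Suc k) \<bullet> t k = u k \<bullet> g k" for k
    using assms by (auto simp: seq_map_def is_seq_def)
  have "(g (Suc k) \<bullet> f (Suc k)) \<bullet> s k = u k \<bullet> g k \<bullet> f k" for k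
    using h[of k] h[of "Suc k"] e(1)[of k] comp_ext[OF e(2)[of k], of "f k"] by (simp add: hom_def)
  then show ?thesis using comp_hom[OF h(2) h(1)] by (simp add: seq_map_def)
qed

lemma seq_map_id: "is_seq C X s \<Longrightarrow> seq_map C X s X s (\<lambda>k. idn C (X k))"
  unfolding seq_map_def is_seq_def using id_hom by (simp add: hom_def)

lemma const_seq: "x \<in> ob C \<Longrightarrow> is_seq C (\<lambda>_. x) (\<lambda>_. idn C x)"
  by (simp add: is_seq_def id_hom)

lemma const_colimit: "x \<in> ob C \<Longrightarrow> seq_colimit C (\<lambda>_. x) (\<lambda>_. idn C x) x (\<lambda>_. idn C x)"
  unfolding seq_colimit_def
proof (intro conjI allI impI)
  assume x: "x \<in> ob C"
  show "seq_cocone C (\<lambda>_. x) (\<lambda>_. idn C x) x (\<lambda>_. idn C x)"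
    using x id_hom by (simp add: seq_cocone_def hom_def)
  fix d \<kappa> assume "seq_cocone C (\<lambda>_. x) (\<lambda>_. idn C x) d \<kappa>"
  then have kh: "\<kappa> i \<in> hom C x d" and ks: "\<kappa> (Suc i) \<bullet> idn C x = \<kappa> i" for i
    by (simp_all add: seq_cocone_def)
  have k: "\<kappa> i \<in> hom C x d" "\<kappa> (Suc i) = \<kappa> i" for i
  proof -
    have "\<kappa> (Suc i) \<bullet> idn C x = \<kappa> (Suc i)" using kh[of "Suc i"] by (simp add: hom_def)
    then show "\<kappa> i \<in> hom C x d" "\<kappa> (Suc i) = \<kappa> i" using kh ks by auto
  qed
  have c: "\<kappa> 0 = \<kappa> i" for i by (induction i) (simp_all add: k(2))
  have "\<kappa> 0 \<bullet> idn C x = \<kappa> i" for i using c[of i] k(1)[of 0] by (simp add: hom_def)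
  moreover have "h = \<kappa> 0" if "h \<in> hom C x d" "h \<bullet> idn C x = \<kappa> 0" for h
    using that by (simp add: hom_def)
  ultimately show "\<exists>!h. h \<in> hom C x d \<and> (\<forall>i :: nat. h \<bullet> idn C x = \<kappa> i)"
    using k(1)[of 0] by blast
qed

end

section \<open>Functorial homotopy colimits of sequences\<close>

locale seq_model = model_cat N U + c: ffact N "Cof N" "Fib N \<inter> Eqv N" m l r e
  for N :: "('o, 'a, 'z) mcat_scheme" and U :: "'u itself" and m l r e +
  assumes homotopical: "seq_colimits_of_cofibrations_homotopical N"
begin

text \<open>The recursion carries only the comparison maps; the replaced object at \<open>k\<close>
  is the source of \<open>rep p s k\<close>. The start \<open>p\<close> is a parameter: an identity
  keeps the first term, while a cofibrant replacement of the first term makes the new sequence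
  projectively cofibrant.\<close>

primrec rep :: "'a \<Rightarrow> (nat \<Rightarrow> 'a) \<Rightarrow> nat \<Rightarrow> 'a" where
  "rep p s 0 = p"
| "rep p s (Suc k) = r (s k \<bullet> rep p s k)"

abbreviation "rob p s k \<equiv> src N (rep p s k)"
abbreviation "rarr p s k \<equiv> l (s k \<bullet> rep p s k)"

lemma rep_hom:
  assumes X: "is_seq N X s" and p: "p \<in> hom N a (X 0)"
  shows "rep p s k \<in> hom N (rob p s k) (X k)"
proof (induction k)
  case 0
  then show ?case using p by (auto simp: hom_def)
next
  case (Suc k)
  have "s k \<bullet> rep p s k \<in> hom N (rob p s k) (X (Suc k))"
    using X Suc comp_hom unfolding is_seq_def by blast
  from c.fact_hom(4)[OF this] show ?case by (auto simp: hom_def)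
qed

lemma rep_props:
  assumes X: "is_seq N X s" and p: "p \<in> hom N a (X 0)"
  shows "rarr p s k \<in> hom N (rob p s k) (rob p s (Suc k))" "rarr p s k \<in> Cof N"
    "rep p s (Suc k) \<in> Fib N" "rep p s (Suc k) \<in> Eqv N" "rep p s (Suc k) \<bullet> rarr p s k = s k \<bullet> rep p s k"
proof -
  have h: "s k \<bullet> rep p s k \<in> hom N (rob p s k) (X (Suc k))"
    using X rep_hom[OF X p] comp_hom unfolding is_seq_def by blast
  have m: "m (s k \<bullet> rep p s k) = rob p s (Suc k)"
    using c.fact_hom(4)[OF h] by (simp add: hom_def)
  show "rarr p s k \<in> hom N (rob p s k) (rob p s (Suc k))" "rarr p s k \<in> Cof N"
    "rep p s (Suc k) \<in> Fib N" "rep p s (Suc k) \<in> Eqv N" "rep p s (Suc k) \<bullet> rarr p s k = s k \<bullet> rep p s k"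
    using c.fact_hom[OF h] m by auto
qed

lemma rep_seq:
  assumes "is_seq N X s" "p \<in> hom N a (X 0)"
  shows "cof_seq N (rob p s) (rarr p s)" "is_seq N (rob p s) (rarr p s)"
    "seq_map N (rob p s) (rarr p s) X s (rep p s)"
  using rep_props[OF assms] rep_hom[OF assms] hom_ob(1)[OF rep_hom[OF assms]]
  by (auto simp: cof_seq_def is_seq_def seq_map_def simp del: rep.simps)

lemma rep_eqv:
  assumes "is_seq N X s" "p \<in> hom N a (X 0)" "p \<in> Eqv N"
  shows "levelwise_eqv N (rob p s) (rarr p s) X s (rep p s)"
proof -
  have "rep p s k \<in> Eqv N" for k using assms rep_props[OF assms(1,2)] by (cases k) auto
  then show ?thesis using rep_seq[OF assms(1,2)] by (simp add: levelwise_eqv_def)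
qed

primrec rmap :: "'a \<Rightarrow> (nat \<Rightarrow> 'a) \<Rightarrow> 'a \<Rightarrow> (nat \<Rightarrow> 'a) \<Rightarrow> 'a \<Rightarrow> (nat \<Rightarrow> 'a) \<Rightarrow> nat \<Rightarrow> 'a" where
  "rmap p s p' s' g f 0 = g"
| "rmap p s p' s' g f (Suc k) =
     e (s k \<bullet> rep p s k) (s' k \<bullet> rep p' s' k) (rmap p s p' s' g f k) (f (Suc k))"

lemma rmap_square:
  assumes X: "is_seq N X s" and X': "is_seq N X' s'" and f: "seq_map N X s X' s' f"
    and g: "rmap p s p' s' g0 f k \<in> hom N (rob p s k) (rob p' s' k)"
      "rep p' s' k \<bullet> rmap p s p' s' g0 f k = f k \<bullet> rep p s k"
    and p: "p \<in> hom N a (X 0)" and p': "p' \<in> hom N a' (X' 0)"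
  shows "(s' k \<bullet> rep p' s' k) \<bullet> rmap p s p' s' g0 f k = f (Suc k) \<bullet> s k \<bullet> rep p s k"
proof -
  have h: "f k \<in> hom N (X k) (X' k)" "f (Suc k) \<in> hom N (X (Suc k)) (X' (Suc k))"
    "s k \<in> hom N (X k) (X (Suc k))" "s' k \<in> hom N (X' k) (X' (Suc k))"
    and e: "s' k \<bullet> f k = f (Suc k) \<bullet> s k"
    using X X' f by (auto simp: seq_map_def is_seq_def)
  note q = rep_hom[OF X p, of k] rep_hom[OF X' p', of k]
  show ?thesis using h q g comp_ext[OF e, of "rep p s k"] by (simp add: hom_def)
qed

lemma rmap_props:
  assumes X: "is_seq N X s" and X': "is_seq N X' s'" and f: "seq_map N X s X' s' f"
    and p: "p \<in> hom N a (X 0)" and p': "p' \<in> hom N a' (X' 0)"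
    and g: "g \<in> hom N a a'" and pg: "p' \<bullet> g = f 0 \<bullet> p"
  shows "rmap p s p' s' g f k \<in> hom N (rob p s k) (rob p' s' k)"
    "rep p' s' k \<bullet> rmap p s p' s' g f k = f k \<bullet> rep p s k"
    "rmap p s p' s' g f (Suc k) \<bullet> rarr p s k = rarr p' s' k \<bullet> rmap p s p' s' g f k"
proof -
  have step: "rmap p s p' s' g f (Suc k) \<in> hom N (rob p s (Suc k)) (rob p' s' (Suc k)) \<and>
     rep p' s' (Suc k) \<bullet> rmap p s p' s' g f (Suc k) = f (Suc k) \<bullet> rep p s (Suc k) \<and>
     rmap p s p' s' g f (Suc k) \<bullet> rarr p s k = rarr p' s' k \<bullet> rmap p s p' s' g f k"
    if IH: "rmap p s p' s' g f k \<in> hom N (rob p s k) (rob p' s' k)"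
     "rep p' s' k \<bullet> rmap p s p' s' g f k = f k \<bullet> rep p s k" for k
  proof -
    have h: "s k \<bullet> rep p s k \<in> hom N (rob p s k) (X (Suc k))"
      "s' k \<bullet> rep p' s' k \<in> hom N (rob p' s' k) (X' (Suc k))"
      using X X' rep_hom[OF X p] rep_hom[OF X' p'] comp_hom unfolding is_seq_def by blast+
    have m: "m (s k \<bullet> rep p s k) = rob p s (Suc k)" "m (s' k \<bullet> rep p' s' k) = rob p' s' (Suc k)"
      using c.fact_hom(4)[OF h(1)] c.fact_hom(4)[OF h(2)] by (auto simp: hom_def)
    have fk: "f (Suc k) \<in> hom N (X (Suc k)) (X' (Suc k))" using f by (simp add: seq_map_def)
    show ?thesis using c.mid[OF h IH(1) fk rmap_square[OF X X' f IH p p']] m by simp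
  qed
  have 1: "rmap p s p' s' g f k \<in> hom N (rob p s k) (rob p' s' k) \<and>
    rep p' s' k \<bullet> rmap p s p' s' g f k = f k \<bullet> rep p s k" for k
  proof (induction k)
    case 0
    then show ?case using g pg p p' by (auto simp: hom_def)
  next
    case (Suc k)
    then show ?case using step by blast
  qed
  then show "rmap p s p' s' g f k \<in> hom N (rob p s k) (rob p' s' k)"
    "rep p' s' k \<bullet> rmap p s p' s' g f k = f k \<bullet> rep p s k"
    "rmap p s p' s' g f (Suc k) \<bullet> rarr p s k = rarr p' s' k \<bullet> rmap p s p' s' g f k"
    using step by blast+
qed

lemma rmap_comp:
  assumes X: "is_seq N X s" and X': "is_seq N X' s'" and X'': "is_seq N X'' s''"
    and f: "seq_map N X s X' s' f" and f': "seq_map N X' s' X'' s'' f'"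
    and p: "p \<in> hom N a (X 0)" and p': "p' \<in> hom N a' (X' 0)" and p'': "p'' \<in> hom N a'' (X'' 0)"
    and g: "g \<in> hom N a a'" and pg: "p' \<bullet> g = f 0 \<bullet> p"
    and g': "g' \<in> hom N a' a''" and pg': "p'' \<bullet> g' = f' 0 \<bullet> p'"
  shows "rmap p s p'' s'' (g' \<bullet> g) (\<lambda>k. f' k \<bullet> f k) k = rmap p' s' p'' s'' g' f' k \<bullet> rmap p s p' s' g f k"
proof (induction k)
  case (Suc k)
  have h: "s k \<bullet> rep p s k \<in> hom N (rob p s k) (X (Suc k))"
    "s' k \<bullet> rep p' s' k \<in> hom N (rob p' s' k) (X' (Suc k))"
    "s'' k \<bullet> rep p'' s'' k \<in> hom N (rob p'' s'' k) (X'' (Suc k))"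
    using X X' X'' rep_hom[OF X p] rep_hom[OF X' p'] rep_hom[OF X'' p''] comp_hom
    unfolding is_seq_def by blast+
  have fk: "f (Suc k) \<in> hom N (X (Suc k)) (X' (Suc k))" "f' (Suc k) \<in> hom N (X' (Suc k)) (X'' (Suc k))"
    using f f' by (simp_all add: seq_map_def)
  note r1 = rmap_props[OF X X' f p p' g pg] and r2 = rmap_props[OF X' X'' f' p' p'' g' pg']
  show ?case
    using c.mid_comp[OF h r1(1) fk(1) r2(1) fk(2) rmap_square[OF X X' f r1(1,2) p p']
      rmap_square[OF X' X'' f' r2(1,2) p' p'']] Suc by simp
qed simp

lemma rmap_id:
  assumes X: "is_seq N X s" and p: "p \<in> hom N a (X 0)"
  shows "rmap p s p s (idn N a) (\<lambda>k. idn N (X k)) k = idn N (rob p s k)"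
proof (induction k)
  case 0
  then show ?case using p by (simp add: hom_def)
next
  case (Suc k)
  have h: "s k \<bullet> rep p s k \<in> hom N (rob p s k) (X (Suc k))"
    using X rep_hom[OF X p] comp_hom unfolding is_seq_def by blast
  then show ?case using Suc c.fact_hom(6)[OF h] c.fact_hom(4)[OF h] by (simp add: hom_def)
qed

text \<open>The replacement of a sequence starts with its first term, unlike a projectively cofibrant
  one, so that the first term maps to \<open>K X s\<close>.\<close>

abbreviation "P X s \<equiv> rep (idn N (X 0)) s"
abbreviation "Yo X s \<equiv> rob (idn N (X 0)) s"
abbreviation "Ya X s \<equiv> rarr (idn N (X 0)) s"
abbreviation "Ym X s X' s' f \<equiv> rmap (idn N (X 0)) s (idn N (X' 0)) s' (f 0) f"

text \<open>Vertex and cocone are chosen together, once for each sequence, so that \<open>K\<close>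
  is a function of the sequence and the maps \<open>Km\<close> compose strictly.\<close>

definition Kc :: "(nat \<Rightarrow> 'o) \<Rightarrow> (nat \<Rightarrow> 'a) \<Rightarrow> 'o \<times> (nat \<Rightarrow> 'a)" where
  "Kc X s = (SOME c. seq_colimit N (Yo X s) (Ya X s) (fst c) (snd c))"

definition "K X s = fst (Kc X s)"
definition "kin X s = snd (Kc X s)"

definition "Km X s X' s' f = (THE h. h \<in> hom N (K X s) (K X' s') \<and>
  (\<forall>k. h \<bullet> kin X s k = kin X' s' k \<bullet> Ym X s X' s' f k))"

text \<open>The canonical map from the homotopy colimit, modelled by \<open>K X s\<close>, to the
  vertex of a cocone on the original sequence.\<close>

definition "kap X s c \<iota> = (THE h. h \<in> hom N (K X s) c \<and> (\<forall>k. h \<bullet> kin X s k = \<iota> k \<bullet> P X s k))"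

lemma id0: "is_seq N X s \<Longrightarrow> idn N (X 0) \<in> hom N (X 0) (X 0)"
  by (simp add: is_seq_def id_hom)

lemma Y_seq:
  assumes "is_seq N X s"
  shows "cof_seq N (Yo X s) (Ya X s)" "is_seq N (Yo X s) (Ya X s)" "seq_map N (Yo X s) (Ya X s) X s (P X s)"
  using rep_seq[OF assms id0[OF assms]] by blast+

lemma P_hom: "is_seq N X s \<Longrightarrow> P X s k \<in> hom N (Yo X s k) (X k)"
  by (rule rep_hom[OF _ id0])

lemma P_eqv: "is_seq N X s \<Longrightarrow> levelwise_eqv N (Yo X s) (Ya X s) X s (P X s)"
  using rep_eqv[of X s "idn N (X 0)" "X 0"] id0[of X s] id_classes by (simp add: is_seq_def)

lemma K_colimit:
  assumes "is_seq N X s"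
  shows "seq_colimit N (Yo X s) (Ya X s) (K X s) (kin X s)"
proof -
  have "\<exists>c. seq_colimit N (Yo X s) (Ya X s) (fst c) (snd c)"
    using seq_colimit_ex[OF Y_seq(2)[OF assms]] by auto
  from someI_ex[OF this] show ?thesis unfolding K_def kin_def Kc_def .
qed

lemma kin_hom: "is_seq N X s \<Longrightarrow> kin X s k \<in> hom N (Yo X s k) (K X s)"
  and kin_step: "is_seq N X s \<Longrightarrow> kin X s (Suc k) \<bullet> Ya X s k = kin X s k"
  using K_colimit by (auto simp: seq_colimit_def seq_cocone_def)

lemma K_ob: "is_seq N X s \<Longrightarrow> K X s \<in> ob N"
  using kin_hom hom_ob by blast

lemma K_ext:
  "is_seq N X s \<Longrightarrow> h \<in> hom N (K X s) d \<Longrightarrow> h' \<in> hom N (K X s) d \<Longrightarrow>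
   (\<And>k. h \<bullet> kin X s k = h' \<bullet> kin X s k) \<Longrightarrow> h = h'"
  by (rule seq_colimit_unique[OF K_colimit _ _ _ Y_seq(2)])

lemma K_induced:
  assumes X: "is_seq N X s" and k: "\<And>k. \<kappa> k \<in> hom N (Yo X s k) d"
    and e: "\<And>k. \<kappa> (Suc k) \<bullet> Ya X s k = \<kappa> k"
  shows "\<exists>!h. h \<in> hom N (K X s) d \<and> (\<forall>k. h \<bullet> kin X s k = \<kappa> k)"
proof -
  have "seq_cocone N (Yo X s) (Ya X s) d \<kappa>"
    using k e hom_ob(2)[OF k] by (simp add: seq_cocone_def)
  then show ?thesis using K_colimit[OF X] unfolding seq_colimit_def by blast
qed

lemma Ym_props:
  assumes "is_seq N X s" "is_seq N X' s'" "seq_map N X s X' s' f"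
  shows "Ym X s X' s' f k \<in> hom N (Yo X s k) (Yo X' s' k)"
    "P X' s' k \<bullet> Ym X s X' s' f k = f k \<bullet> P X s k"
    "Ym X s X' s' f (Suc k) \<bullet> Ya X s k = Ya X' s' k \<bullet> Ym X s X' s' f k"
proof -
  have f: "f 0 \<in> hom N (X 0) (X' 0)" using assms by (simp add: seq_map_def)
  then have "idn N (X' 0) \<bullet> f 0 = f 0 \<bullet> idn N (X 0)" by (simp add: hom_def)
  note r = rmap_props[OF assms id0[OF assms(1)] id0[OF assms(2)] f this]
  show "Ym X s X' s' f k \<in> hom N (Yo X s k) (Yo X' s' k)"
    "P X' s' k \<bullet> Ym X s X' s' f k = f k \<bullet> P X s k"
    "Ym X s X' s' f (Suc k) \<bullet> Ya X s k = Ya X' s' k \<bullet> Ym X s X' s' f k"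
    using r by blast+
qed

lemma Km:
  assumes X: "is_seq N X s" and X': "is_seq N X' s'" and f: "seq_map N X s X' s' f"
  shows "Km X s X' s' f \<in> hom N (K X s) (K X' s')"
    "Km X s X' s' f \<bullet> kin X s k = kin X' s' k \<bullet> Ym X s X' s' f k"
proof -
  note y = Ym_props[OF X X' f]
  have "(kin X' s' (Suc k) \<bullet> Ym X s X' s' f (Suc k)) \<bullet> Ya X s k = kin X' s' k \<bullet> Ym X s X' s' f k" for k
  proof -
    have "Ya X s k \<in> hom N (Yo X s k) (Yo X s (Suc k))" "Ya X' s' k \<in> hom N (Yo X' s' k) (Yo X' s' (Suc k))"
      using Y_seq(2)[OF X] Y_seq(2)[OF X'] unfolding is_seq_def by blast+
    then show ?thesis
      using y(1)[of k] y(1)[of "Suc k"] kin_hom[OF X', of "Suc k"] y(3)[of k]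
        comp_ext[OF kin_step[OF X', of k], of "Ym X s X' s' f k"] by (simp add: hom_def)
  qed
  from theI'[OF K_induced[OF X comp_hom[OF kin_hom[OF X'] y(1)] this]]
  show "Km X s X' s' f \<in> hom N (K X s) (K X' s')"
    "Km X s X' s' f \<bullet> kin X s k = kin X' s' k \<bullet> Ym X s X' s' f k"
    unfolding Km_def by blast+
qed

text \<open>The maps \<open>P\<close> to the original sequences are equivalences, so
  two-out-of-three makes the map of replacements a levelwise equivalence; these are sequences of
  cofibrations, where \<open>homotopical\<close> applies.\<close>

lemma Km_eqv:
  assumes X: "is_seq N X s" and X': "is_seq N X' s'" and f: "levelwise_eqv N X s X' s' f"
  shows "Km X s X' s' f \<in> Eqv N"
proof -
  have f': "seq_map N X s X' s' f" "\<And>k. f k \<in> Eqv N" using f by (auto simp: levelwise_eqv_def)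
  note y = Ym_props[OF X X' f'(1)] and k = Km[OF X X' f'(1)]
  have "Ym X s X' s' f k \<in> Eqv N" for k
  proof -
    have "P X s k \<in> Eqv N" "P X' s' k \<in> Eqv N" using P_eqv X X' by (auto simp: levelwise_eqv_def)
    moreover have "f k \<in> hom N (X k) (X' k)" using f' by (simp add: seq_map_def)
    ultimately have "f k \<bullet> P X s k \<in> Eqv N" using eqv_comp[OF P_hom[OF X]] f' by blast
    then show ?thesis using eqv_cancel_left[OF y(1) P_hom[OF X'] \<open>P X' s' k \<in> Eqv N\<close>] y(2) by simp
  qed
  then have "levelwise_eqv N (Yo X s) (Ya X s) (Yo X' s') (Ya X' s') (Ym X s X' s' f)"
    using y unfolding levelwise_eqv_def seq_map_def by blast
  then show ?thesis
    using homotopical Y_seq(1)[OF X] Y_seq(1)[OF X'] K_colimit[OF X] K_colimit[OF X'] k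
    unfolding seq_colimits_of_cofibrations_homotopical_def by blast
qed

lemma Km_comp:
  assumes X: "is_seq N X s" and X': "is_seq N X' s'" and X'': "is_seq N X'' s''"
    and f: "seq_map N X s X' s' f" and g: "seq_map N X' s' X'' s'' g"
  shows "Km X s X'' s'' (\<lambda>k. g k \<bullet> f k) = Km X' s' X'' s'' g \<bullet> Km X s X' s' f"
proof (rule K_ext[OF X])
  note gf = seq_map_comp[OF f g X X' X'']
  show "Km X s X'' s'' (\<lambda>k. g k \<bullet> f k) \<in> hom N (K X s) (K X'' s'')" by (rule Km(1)[OF X X'' gf])
  show "Km X' s' X'' s'' g \<bullet> Km X s X' s' f \<in> hom N (K X s) (K X'' s'')"
    by (rule comp_hom[OF Km(1)[OF X' X'' g] Km(1)[OF X X' f]])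
  fix k
  have fg: "f 0 \<in> hom N (X 0) (X' 0)" "g 0 \<in> hom N (X' 0) (X'' 0)" using f g by (auto simp: seq_map_def)
  have "Ym X s X'' s'' (\<lambda>k. g k \<bullet> f k) k = Ym X' s' X'' s'' g k \<bullet> Ym X s X' s' f k"
    by (rule rmap_comp[OF X X' X'' f g id0[OF X] id0[OF X'] id0[OF X''] fg(1) _ fg(2)])
      (use fg in \<open>auto simp: hom_def\<close>)
  then show "Km X s X'' s'' (\<lambda>k. g k \<bullet> f k) \<bullet> kin X s k = (Km X' s' X'' s'' g \<bullet> Km X s X' s' f) \<bullet> kin X s k"
    using Km(2)[OF X X'' gf, of k] Km(1)[OF X X' f] Km(2)[OF X X' f, of k] Km(1)[OF X' X'' g]
      kin_hom[OF X, of k] kin_hom[OF X', of k] kin_hom[OF X'', of k] Ym_props(1)[OF X X' f, of k]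
      Ym_props(1)[OF X' X'' g, of k] comp_ext[OF Km(2)[OF X' X'' g, of k], of "Ym X s X' s' f k"]
    by (simp add: hom_def)
qed

lemma Km_id:
  assumes X: "is_seq N X s"
  shows "Km X s X s (\<lambda>k. idn N (X k)) = idn N (K X s)"
proof (rule K_ext[OF X])
  note i = seq_map_id[OF X]
  show "Km X s X s (\<lambda>k. idn N (X k)) \<in> hom N (K X s) (K X s)" by (rule Km(1)[OF X X i])
  show "idn N (K X s) \<in> hom N (K X s) (K X s)" by (rule id_hom[OF K_ob[OF X]])
  fix k
  show "Km X s X s (\<lambda>k. idn N (X k)) \<bullet> kin X s k = idn N (K X s) \<bullet> kin X s k"
    using Km(2)[OF X X i, of k] rmap_id[OF X id0[OF X], of k] kin_hom[OF X, of k] by (simp add: hom_def)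
qed

lemma kap:
  assumes X: "is_seq N X s" and c: "seq_cocone N X s d \<iota>"
  shows "kap X s d \<iota> \<in> hom N (K X s) d" "kap X s d \<iota> \<bullet> kin X s k = \<iota> k \<bullet> P X s k"
proof -
  have i: "\<iota> k \<in> hom N (X k) d" "\<iota> (Suc k) \<bullet> s k = \<iota> k" "s k \<in> hom N (X k) (X (Suc k))" for k
    using c X by (auto simp: seq_cocone_def is_seq_def)
  have "(\<iota> (Suc k) \<bullet> P X s (Suc k)) \<bullet> Ya X s k = \<iota> k \<bullet> P X s k" for k
  proof -
    have "P X s (Suc k) \<bullet> Ya X s k = s k \<bullet> P X s k" "Ya X s k \<in> hom N (Yo X s k) (Yo X s (Suc k))"
      using rep_props[OF X id0[OF X]] by blast+
    then show ?thesis
      using i[of k] i[of "Suc k"] P_hom[OF X, of k] P_hom[OF X, of "Suc k"] comp_ext[OF i(2)[of k], of "P X s k"]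
      by (simp add: hom_def)
  qed
  from theI'[OF K_induced[OF X comp_hom[OF i(1) P_hom[OF X]] this]]
  show "kap X s d \<iota> \<in> hom N (K X s) d" "kap X s d \<iota> \<bullet> kin X s k = \<iota> k \<bullet> P X s k"
    unfolding kap_def by blast+
qed

lemma kap_nat:
  assumes X: "is_seq N X s" and X': "is_seq N X' s'" and f: "seq_map N X s X' s' f"
    and c: "seq_cocone N X s d \<iota>" and c': "seq_cocone N X' s' d' \<iota>'"
    and h: "h \<in> hom N d d'" and e: "\<And>k. h \<bullet> \<iota> k = \<iota>' k \<bullet> f k"
  shows "h \<bullet> kap X s d \<iota> = kap X' s' d' \<iota>' \<bullet> Km X s X' s' f"
proof (rule K_ext[OF X])
  note k1 = kap[OF X c] and k2 = kap[OF X' c'] and k3 = Km[OF X X' f]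
  show "h \<bullet> kap X s d \<iota> \<in> hom N (K X s) d'" by (rule comp_hom[OF h k1(1)])
  show "kap X' s' d' \<iota>' \<bullet> Km X s X' s' f \<in> hom N (K X s) d'" by (rule comp_hom[OF k2(1) k3(1)])
  fix k
  have i: "\<iota> k \<in> hom N (X k) d" "\<iota>' k \<in> hom N (X' k) d'" "f k \<in> hom N (X k) (X' k)"
    using c c' f by (auto simp: seq_cocone_def seq_map_def)
  have p: "P X s k \<in> hom N (Yo X s k) (X k)" "P X' s' k \<in> hom N (Yo X' s' k) (X' k)"
    using P_hom X X' by auto
  note y = Ym_props[OF X X' f, of k]
  have "(h \<bullet> kap X s d \<iota>) \<bullet> kin X s k = h \<bullet> \<iota> k \<bullet> P X s k"
    using k1 kin_hom[OF X, of k] h by (simp add: hom_def)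
  also have "\<dots> = \<iota>' k \<bullet> f k \<bullet> P X s k"
    using comp_ext[OF e[of k], of "P X s k"] h i p by (simp add: hom_def)
  also have "\<dots> = (\<iota>' k \<bullet> P X' s' k) \<bullet> Ym X s X' s' f k"
    using y i p by (simp add: hom_def)
  also have "\<dots> = (kap X' s' d' \<iota>' \<bullet> Km X s X' s' f) \<bullet> kin X s k"
    using k2(1) k3(1) k3(2)[of k] kin_hom[OF X, of k] kin_hom[OF X', of k] y(1) comp_ext[OF k2(2)[of k], of "Ym X s X' s' f k"]
    by (simp add: hom_def)
  finally show "(h \<bullet> kap X s d \<iota>) \<bullet> kin X s k = (kap X' s' d' \<iota>' \<bullet> Km X s X' s' f) \<bullet> kin X s k" .
qed

text \<open>Here \<open>P\<close> is a levelwise equivalence between two sequences of cofibrations,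
  so \<open>homotopical\<close> compares their colimits.\<close>

lemma kap_eqv:
  assumes X: "cof_seq N X s" and c: "seq_colimit N X s d \<iota>"
  shows "kap X s d \<iota> \<in> Eqv N"
proof -
  have X': "is_seq N X s" "seq_cocone N X s d \<iota>" using X c by (auto simp: cof_seq_def seq_colimit_def)
  show ?thesis
    using homotopical Y_seq(1)[OF X'(1)] X P_eqv[OF X'(1)] K_colimit[OF X'(1)] c kap[OF X']
    unfolding seq_colimits_of_cofibrations_homotopical_def by blast
qed

text \<open>\<open>seq_hocolim\<close> tests against projectively cofibrant replacements, but the
  replacement behind \<open>K\<close> starts with \<open>X 0\<close>, which may fail to be
  cofibrant. It is therefore replaced once more, from a cofibrant first term. The colimit of the new
  sequence maps by equivalences to \<open>K X s\<close>, by \<open>homotopical\<close>, and to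
  \<open>d\<close>, by the hypothesis.\<close>

lemma kap_hocolim:
  assumes hc: "seq_hocolim N X s d \<iota>"
  shows "kap X s d \<iota> \<in> Eqv N"
proof -
  have X: "is_seq N X s" and co: "seq_cocone N X s d \<iota>" using hc by (auto simp: seq_hocolim_def)
  let ?Y = "Yo X s" and ?y = "Ya X s"
  note Y = Y_seq(2)[OF X]
  obtain t where t: "initial N t" using initial_ex by blast
  have "?Y 0 \<in> ob N" using Y unfolding is_seq_def by blast
  then obtain f where f: "f \<in> hom N t (?Y 0)" using initial_hom[OF t] by blast
  obtain z j p where jp: "j \<in> hom N t z" "p \<in> hom N z (?Y 0)" "j \<in> Cof N" "p \<in> Fib N" "p \<in> Eqv N" "p \<bullet> j = f"
    using factor_afib[OF f] by blast
  note Z = rep_seq[OF Y jp(2)] and E = rep_eqv[OF Y jp(2,5)]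
  have cz: "cofibrant N (rob p ?y 0)" using jp(2) cofibrant_initial[OF t jp(1)] jp(3) by (simp add: hom_def)
  obtain c \<kappa> where c: "seq_colimit N (rob p ?y) (rarr p ?y) c \<kappa>" using seq_colimit_ex[OF Z(2)] by blast
  have cc: "seq_cocone N (rob p ?y) (rarr p ?y) (K X s) (\<lambda>k. kin X s k \<bullet> rep p ?y k)"
  proof -
    have "(kin X s (Suc k) \<bullet> rep p ?y (Suc k)) \<bullet> rarr p ?y k = kin X s k \<bullet> rep p ?y k" for k
    proof -
      have a: "rarr p ?y k \<in> hom N (rob p ?y k) (rob p ?y (Suc k))" "?y k \<in> hom N (?Y k) (?Y (Suc k))"
        using Z(2) Y unfolding is_seq_def by blast+
      have b: "rep p ?y (Suc k) \<bullet> rarr p ?y k = ?y k \<bullet> rep p ?y k" using Z(3) unfolding seq_map_def by blast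
      show ?thesis using a b kin_hom[OF X, of k] kin_hom[OF X, of "Suc k"] rep_hom[OF Y jp(2), of k]
          rep_hom[OF Y jp(2), of "Suc k"] comp_ext[OF kin_step[OF X, of k], of "rep p ?y k"]
        by (simp add: hom_def)
    qed
    then show ?thesis
      unfolding seq_cocone_def using K_ob[OF X] comp_hom[OF kin_hom[OF X] rep_hom[OF Y jp(2)]] by blast
  qed
  obtain h where h: "h \<in> hom N c (K X s)" "\<And>k. h \<bullet> \<kappa> k = kin X s k \<bullet> rep p ?y k"
    using seq_colimit_univ[OF c cc] by blast
  have hE: "h \<in> Eqv N"
    using homotopical Z(1) Y_seq(1)[OF X] E c K_colimit[OF X] h
    unfolding seq_colimits_of_cofibrations_homotopical_def by blast
  note k = kap[OF X co]
  have kE: "kap X s d \<iota> \<bullet> h \<in> Eqv N"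
  proof -
    have i: "\<iota> k \<in> hom N (X k) d" "\<kappa> k \<in> hom N (rob p ?y k) c" for k
      using co c by (auto simp: seq_cocone_def seq_colimit_def)
    have 1: "P X s k \<bullet> rep p ?y k \<in> hom N (rob p ?y k) (X k)" for k
      by (rule comp_hom[OF P_hom[OF X] rep_hom[OF Y jp(2)]])
    have "seq_map N (rob p ?y) (rarr p ?y) X s (\<lambda>k. P X s k \<bullet> rep p ?y k)"
      by (rule seq_map_comp[OF Z(3) Y_seq(3)[OF X] Z(2) Y X])
    moreover have "P X s k \<bullet> rep p ?y k \<in> Eqv N" for k
      using eqv_comp[OF rep_hom[OF Y jp(2)] P_hom[OF X]] E P_eqv[OF X] by (auto simp: levelwise_eqv_def)
    ultimately have "levelwise_eqv N (rob p ?y) (rarr p ?y) X s (\<lambda>k. P X s k \<bullet> rep p ?y k)"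
      by (simp add: levelwise_eqv_def)
    moreover have "(kap X s d \<iota> \<bullet> h) \<bullet> \<kappa> j = \<iota> j \<bullet> P X s j \<bullet> rep p ?y j" for j
      using i[of j] h(1) h(2)[of j] k(1) comp_ext[OF k(2)[of j], of "rep p ?y j"] rep_hom[OF Y jp(2), of j]
        P_hom[OF X, of j] kin_hom[OF X, of j] by (simp add: hom_def)
    ultimately show ?thesis
      using hc[unfolded seq_hocolim_def, THEN conjunct2, THEN conjunct2, rule_format,
          of "rob p ?y" "rarr p ?y" "\<lambda>k. P X s k \<bullet> rep p ?y k" c \<kappa> "kap X s d \<iota> \<bullet> h"]
        cz Z(1) c comp_hom[OF k(1) h(1)] by simp
  qed
  show ?thesis by (rule eqv_cancel_right[OF h(1) k(1) hE kE])
qed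

lemma Yo_0: "is_seq N X s \<Longrightarrow> Yo X s 0 = X 0"
  by (simp add: is_seq_def)

lemma kin_0_hom: "is_seq N X s \<Longrightarrow> kin X s 0 \<in> hom N (X 0) (K X s)"
  using kin_hom[of X s 0] Yo_0 by simp

lemma Km_kin_0:
  "is_seq N X s \<Longrightarrow> is_seq N X' s' \<Longrightarrow> seq_map N X s X' s' f \<Longrightarrow>
   Km X s X' s' f \<bullet> kin X s 0 = kin X' s' 0 \<bullet> f 0"
  using Km(2)[of X s X' s' f 0] by simp

lemma kap_const: "x \<in> ob N \<Longrightarrow> kap (\<lambda>_. x) (\<lambda>_. idn N x) x (\<lambda>_. idn N x) \<in> Eqv N"
  by (rule kap_eqv) (simp_all add: cof_seq_def const_seq const_colimit id_classes)

lemma path_cof: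
  assumes "cof_seq N X s" "i \<le> j"
  shows "path X s i j \<in> Cof N"
  using assms(2)
proof (induction j rule: dec_induct)
  case base
  then show ?case using assms id_classes by (simp add: path_refl cof_seq_def is_seq_def)
next
  case (step j)
  have X: "is_seq N X s" "s j \<in> Cof N" "s j \<in> hom N (X j) (X (Suc j))"
    using assms by (auto simp: cof_seq_def is_seq_def)
  show ?case
    using cof_comp[OF path_hom[OF X(1)] X(3)] step X by (simp add: path_Suc)
qed

text \<open>For the replacement, a sequence of cofibrations, passing to the subsequence does not
  change the colimit, and both maps \<open>kap\<close> to it are equivalences. The result is carried
  to \<open>X\<close> along the levelwise equivalences \<open>P\<close>.\<close>

lemma Km_cofinal:
  assumes X: "is_seq N X s" and m: "\<And>k. \<phi> k \<le> \<phi> (Suc k)" and le: "\<And>k. k \<le> \<phi> k"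
  shows "Km X s (X \<circ> \<phi>) (subseq_maps X s \<phi>) (\<lambda>k. path X s k (\<phi> k)) \<in> Eqv N"
proof -
  let ?Y = "Yo X s" and ?y = "Ya X s"
  let ?X' = "X \<circ> \<phi>" and ?s' = "subseq_maps X s \<phi>"
  let ?Y' = "?Y \<circ> \<phi>" and ?y' = "subseq_maps ?Y ?y \<phi>"
  let ?f = "\<lambda>k. path X s k (\<phi> k)" and ?g = "\<lambda>k. path ?Y ?y k (\<phi> k)"
  let ?p = "\<lambda>k. P X s (\<phi> k)"
  note Y = Y_seq(2)[OF X] and cY = Y_seq(1)[OF X]
  note X' = subseq_seq[OF X, of \<phi>, OF m] and Y' = subseq_seq[OF Y, of \<phi>, OF m]
  note f = subseq_map[OF X, of \<phi>, OF m le] and g = subseq_map[OF Y, of \<phi>, OF m le]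
  have p: "levelwise_eqv N ?Y' ?y' ?X' ?s' ?p"
    using P_eqv[OF X] path_nat[OF Y_seq(3)[OF X] Y X m]
    by (auto simp: levelwise_eqv_def seq_map_def subseq_maps_def)
  have cY': "cof_seq N ?Y' ?y'"
    using Y' path_cof[OF cY m] by (simp add: cof_seq_def subseq_maps_def)
  have gE: "Km ?Y ?y ?Y' ?y' ?g \<in> Eqv N"
  proof -
    let ?c = "K X s" and ?i = "kin X s"
    note c = K_colimit[OF X] and c' = subseq_colimit[OF Y, of \<phi>, OF m le K_colimit[OF X]]
    have co: "seq_cocone N ?Y ?y ?c ?i" "seq_cocone N ?Y' ?y' ?c (?i \<circ> \<phi>)"
      using c c' by (auto simp: seq_colimit_def)
    \<comment> \<open>On colimits the passage to the subsequence is the identity of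
      \<open>?c\<close>, so \<open>kap_nat\<close> sandwiches \<open>Km\<close> between two
      equivalences.\<close>
    have "idn N ?c \<bullet> ?i k = (?i \<circ> \<phi>) k \<bullet> ?g k" for k
      using path_cocone[OF co(1) Y le[of k]] kin_hom[OF X, of k] by (simp add: hom_def)
    from kap_nat[OF Y Y' g co id_hom[OF K_ob[OF X]] this]
    have "kap ?Y ?y ?c ?i = kap ?Y' ?y' ?c (?i \<circ> \<phi>) \<bullet> Km ?Y ?y ?Y' ?y' ?g"
      using kap(1)[OF Y co(1)] by (simp add: hom_def comp_def)
    then show ?thesis
      using eqv_cancel_left[OF Km(1)[OF Y Y' g] kap(1)[OF Y' co(2)] kap_eqv[OF cY' c']] kap_eqv[OF cY c] by simp
  qed
  have P: "seq_map N ?Y ?y X s (P X s)" by (rule Y_seq(3)[OF X])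
  have p': "seq_map N ?Y' ?y' ?X' ?s' ?p" using p by (simp add: levelwise_eqv_def)
  have "(\<lambda>k. ?f k \<bullet> P X s k) = (\<lambda>k. ?p k \<bullet> ?g k)"
    using path_nat[OF P Y X le] by simp
  then have e: "Km X s ?X' ?s' ?f \<bullet> Km ?Y ?y X s (P X s) = Km ?Y' ?y' ?X' ?s' ?p \<bullet> Km ?Y ?y ?Y' ?y' ?g"
    using Km_comp[OF Y X X' P f] Km_comp[OF Y Y' X' g p'] by simp
  have "Km ?Y' ?y' ?X' ?s' ?p \<bullet> Km ?Y ?y ?Y' ?y' ?g \<in> Eqv N"
    by (rule eqv_comp[OF Km(1)[OF Y Y' g] Km(1)[OF Y' X' p'] gE Km_eqv[OF Y' X' p]])
  then show ?thesis
    using eqv_cancel_right[OF Km(1)[OF Y X P] Km(1)[OF X X' f] Km_eqv[OF Y X P_eqv[OF X]]] e by simp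
qed

end

section \<open>Stabilization of a pointed endofunctor\<close>

lemma comp_functor:
  assumes F: "is_functor C D F" and G: "is_functor D E G"
  shows "is_functor C E (comp_ftr G F)"
  unfolding is_functor_def
proof (intro conjI ballI impI)
  show "category C" "category E" using F G by (auto simp: is_functor_def)
  show "omap (comp_ftr G F) x \<in> ob E" if "x \<in> ob C" for x
    using functor_ob[OF G functor_ob[OF F that]] by (simp add: comp_ftr_def)
  show "amap (comp_ftr G F) f \<in> hom E (omap (comp_ftr G F) (src C f)) (omap (comp_ftr G F) (tgt C f))"
    if "f \<in> arr C" for f
    using functor_hom[OF G functor_hom[OF F, of f "src C f" "tgt C f"]] that
    by (simp add: comp_ftr_def hom_def)
  show "amap (comp_ftr G F) (idn C x) = idn E (omap (comp_ftr G F) x)" if "x \<in> ob C" for x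
    using functor_id[OF F that] functor_id[OF G functor_ob[OF F that]] by (simp add: comp_ftr_def)
  show "amap (comp_ftr G F) (g \<cdot>\<^bsub>C\<^esub> f) = amap (comp_ftr G F) g \<cdot>\<^bsub>E\<^esub> amap (comp_ftr G F) f"
    if "f \<in> arr C" "g \<in> arr C" "tgt C f = src C g" for f g
  proof -
    have fg: "f \<in> hom C (src C f) (src C g)" "g \<in> hom C (src C g) (tgt C g)" using that by (auto simp: hom_def)
    show ?thesis
      using functor_comp[OF F fg(2,1)] functor_comp[OF G functor_hom[OF F fg(2)] functor_hom[OF F fg(1)]]
      by (simp add: comp_ftr_def)
  qed
qed

text \<open>An abstract setting for the telescope, with \<open>Th\<close> in the role of \<Theta>
  and \<open>N\<close> in that of the level structure. \<open>Th_\<sigma>\<close> is an equality of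
  maps and not just a homotopy, so \<open>Th\<close> turns the telescope of \<open>x\<close> into
  its own shift; \<open>Th_fibrant\<close> and \<open>Th_afib\<close> give homotopy invariance of
  the iterates on fibrant objects through Ken Brown's lemma.\<close>

locale stab = seq_model N U m l r e + a: ffact N "Cof N \<inter> Eqv N" "Fib N" m' l' r' e'
  for N :: "('o, 'a, 'z) mcat_scheme" and U :: "'u itself" and m l r e and m' l' r' e' +
  fixes Th :: "('o, 'a, 'o, 'a) ftr" and \<sigma> :: "'o \<Rightarrow> 'a"
  assumes Th: "is_functor N N Th" and \<sigma>: "nat_trans N N id_ftr Th \<sigma>"
    and Th_\<sigma>: "x \<in> ob N \<Longrightarrow> amap Th (\<sigma> x) = \<sigma> (omap Th x)"
    and Th_fibrant: "fibrant N x \<Longrightarrow> fibrant N (omap Th x)"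
    and Th_afib: "p \<in> Fib N \<Longrightarrow> p \<in> Eqv N \<Longrightarrow> amap Th p \<in> Eqv N"
    and sends: "sends_seq_colimits_to_hocolims N Th"
begin

subsection \<open>Fibrant replacement\<close>

definition "pt = (SOME t. terminal N t)"
definition "bang x = (THE f. f \<in> hom N x pt)"
definition Rf :: "('o, 'a, 'o, 'a) ftr" where
  "Rf = \<lparr>omap = (\<lambda>x. m' (bang x)), amap = (\<lambda>f. e' (bang (src N f)) (bang (tgt N f)) f (idn N pt))\<rparr>"
definition "rr x = l' (bang x)"

lemma pt: "terminal N pt"
  using someI_ex[OF terminal_ex] by (simp add: pt_def)

lemma bang_hom: "x \<in> ob N \<Longrightarrow> bang x \<in> hom N x pt"
  using pt theI'[of "\<lambda>f. f \<in> hom N x pt"] unfolding bang_def terminal_def by blast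

lemma pt_ob: "pt \<in> ob N"
  using pt by (simp add: terminal_def)

lemma bang_square: "f \<in> hom N x y \<Longrightarrow> bang y \<bullet> f = idn N pt \<bullet> bang x"
  by (rule terminal_unique[OF pt comp_hom[OF bang_hom[OF hom_ob(2)]]
        comp_hom[OF id_hom[OF pt_ob] bang_hom[OF hom_ob(1)]]])

lemma rr:
  assumes "x \<in> ob N"
  shows "rr x \<in> hom N x (omap Rf x)" "rr x \<in> Cof N" "rr x \<in> Eqv N" "fibrant N (omap Rf x)"
proof -
  note f = a.fact_hom[OF bang_hom[OF assms]]
  show "rr x \<in> hom N x (omap Rf x)" "rr x \<in> Cof N" "rr x \<in> Eqv N"
    using f by (auto simp: rr_def Rf_def)
  have "fibrant N pt" using fibrant_terminal[OF pt id_hom[OF pt_ob]] id_classes[OF pt_ob] by simp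
  then show "fibrant N (omap Rf x)" using fib_fibrant[OF f(4,2)] by (simp add: Rf_def)
qed

lemma Rf_map:
  assumes f: "f \<in> hom N x y"
  shows "amap Rf f \<in> hom N (omap Rf x) (omap Rf y)" "amap Rf f \<bullet> rr x = rr y \<bullet> f"
proof -
  have xy: "x \<in> ob N" "y \<in> ob N" using f hom_ob by auto
  have s: "src N f = x" "tgt N f = y" using f by (auto simp: hom_def)
  show "amap Rf f \<in> hom N (omap Rf x) (omap Rf y)" "amap Rf f \<bullet> rr x = rr y \<bullet> f"
    using a.mid[OF bang_hom[OF xy(1)] bang_hom[OF xy(2)] f id_hom[OF pt_ob] bang_square[OF f]] s
    by (auto simp: Rf_def rr_def)
qed

lemma Rf: "is_functor N N Rf"
  unfolding is_functor_def
proof (intro conjI ballI impI)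
  show "category N" "category N" by (rule category)+
  show "omap Rf x \<in> ob N" if "x \<in> ob N" for x using rr(1)[OF that] hom_ob by blast
  show "amap Rf f \<in> hom N (omap Rf (src N f)) (omap Rf (tgt N f))" if "f \<in> arr N" for f
    by (rule Rf_map(1)[OF hom_self[OF that]])
  show "amap Rf (idn N x) = idn N (omap Rf x)" if "x \<in> ob N" for x
    using a.fact_hom(6)[OF bang_hom[OF that]] that by (simp add: Rf_def)
  fix f g assume "f \<in> arr N" "g \<in> arr N" "tgt N f = src N g"
  then have f: "f \<in> hom N (src N f) (src N g)" and g: "g \<in> hom N (src N g) (tgt N g)" by (auto simp: hom_def)
  have gf: "src N (g \<bullet> f) = src N f" "tgt N (g \<bullet> f) = tgt N g" using comp_hom[OF g f] by (auto simp: hom_def)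
  have o: "src N f \<in> ob N" "src N g \<in> ob N" "tgt N g \<in> ob N" using f g hom_ob by auto
  have "idn N pt \<bullet> idn N pt = idn N pt" using pt_ob by simp
  then show "amap Rf (g \<bullet> f) = amap Rf g \<bullet> amap Rf f"
    using a.mid_comp[OF bang_hom[OF o(1)] bang_hom[OF o(2)] bang_hom[OF o(3)] f id_hom[OF pt_ob] g
        id_hom[OF pt_ob] bang_square[OF f] bang_square[OF g]] f gf by (simp add: Rf_def hom_def)
qed

lemma Rf_eqv:
  assumes f: "f \<in> hom N x y" "f \<in> Eqv N"
  shows "amap Rf f \<in> Eqv N"
proof -
  have o: "x \<in> ob N" "y \<in> ob N" using f hom_ob by auto
  have "rr y \<bullet> f \<in> Eqv N" by (rule eqv_comp[OF f(1) rr(1)[OF o(2)] f(2) rr(3)[OF o(2)]])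
  then show ?thesis
    using eqv_cancel_right[OF rr(1)[OF o(1)] Rf_map(1)[OF f(1)] rr(3)[OF o(1)]] Rf_map(2)[OF f(1)] by simp
qed

subsection \<open>Iterates\<close>

abbreviation "To k \<equiv> omap Th ^^ k"
abbreviation "Ta k \<equiv> amap Th ^^ k"

lemma To_ob: "x \<in> ob N \<Longrightarrow> To k x \<in> ob N"
  by (induction k) (auto intro: functor_ob[OF Th])

lemma Ta_hom: "f \<in> hom N x y \<Longrightarrow> Ta k f \<in> hom N (To k x) (To k y)"
  by (induction k) (auto intro: functor_hom[OF Th])

lemma Ta_id: "x \<in> ob N \<Longrightarrow> Ta k (idn N x) = idn N (To k x)"
  by (induction k) (auto simp: functor_id[OF Th] To_ob)

lemma Ta_comp: "g \<in> hom N y z \<Longrightarrow> f \<in> hom N x y \<Longrightarrow> Ta k (g \<bullet> f) = Ta k g \<bullet> Ta k f"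
proof (induction k)
  case (Suc k)
  then show ?case using functor_comp[OF Th Ta_hom[OF Suc(2), of k] Ta_hom[OF Suc(3), of k]] by simp
qed simp

lemma To_fibrant: "fibrant N x \<Longrightarrow> fibrant N (To k x)"
  by (induction k) (auto intro: Th_fibrant)

lemma Th_eqv: "f \<in> hom N x y \<Longrightarrow> f \<in> Eqv N \<Longrightarrow> fibrant N x \<Longrightarrow> fibrant N y \<Longrightarrow> amap Th f \<in> Eqv N"
  using ken_brown[OF Th] model id_classes Th_afib by (simp add: model_category_def)

lemma Ta_eqv:
  assumes "f \<in> hom N x y" "f \<in> Eqv N" "fibrant N x" "fibrant N y"
  shows "Ta k f \<in> Eqv N"
  by (induction k) (use assms Th_eqv[OF Ta_hom[OF assms(1)] _ To_fibrant To_fibrant] in auto)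

lemma \<sigma>_hom: "x \<in> ob N \<Longrightarrow> \<sigma> x \<in> hom N x (omap Th x)"
  using \<sigma> by (simp add: nat_trans_def id_ftr_def)

lemma \<sigma>_nat: "f \<in> hom N x y \<Longrightarrow> \<sigma> y \<bullet> f = amap Th f \<bullet> \<sigma> x"
  using \<sigma> by (auto simp: nat_trans_def id_ftr_def hom_def)

lemma Ta_\<sigma>: "x \<in> ob N \<Longrightarrow> Ta k (\<sigma> x) = \<sigma> (To k x)"
  by (induction k) (simp_all add: Th_\<sigma> To_ob)

lemma \<sigma>_eqv_iff:
  assumes f: "f \<in> hom N x y" "f \<in> Eqv N" and "fibrant N x" "fibrant N y"
  shows "\<sigma> x \<in> Eqv N \<longleftrightarrow> \<sigma> y \<in> Eqv N"
proof -
  have o: "x \<in> ob N" "y \<in> ob N" using f hom_ob by auto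
  have T: "amap Th f \<in> hom N (omap Th x) (omap Th y)" "amap Th f \<in> Eqv N"
    using functor_hom[OF Th f(1)] Th_eqv assms by auto
  note s = \<sigma>_nat[OF f(1)] \<sigma>_hom[OF o(1)] \<sigma>_hom[OF o(2)]
  show ?thesis
  proof
    assume "\<sigma> x \<in> Eqv N"
    then have "\<sigma> y \<bullet> f \<in> Eqv N" using eqv_comp[OF s(2) T(1) _ T(2)] s(1) by simp
    then show "\<sigma> y \<in> Eqv N" by (rule eqv_cancel_right[OF f(1) s(3) f(2)])
  next
    assume "\<sigma> y \<in> Eqv N"
    then have "amap Th f \<bullet> \<sigma> x \<in> Eqv N" using eqv_comp[OF f(1) s(3) f(2)] s(1) by simp
    then show "\<sigma> x \<in> Eqv N" by (rule eqv_cancel_left[OF s(2) T(1) T(2)])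
  qed
qed

abbreviation "Ux x \<equiv> \<lambda>k. To k x"
abbreviation "Us x \<equiv> \<lambda>k. \<sigma> (To k x)"

lemma U_seq: "x \<in> ob N \<Longrightarrow> is_seq N (Ux x) (Us x)"
  using \<sigma>_hom[OF To_ob] by (simp add: is_seq_def To_ob)

lemma U_map:
  assumes f: "f \<in> hom N x y"
  shows "seq_map N (Ux x) (Us x) (Ux y) (Us y) (\<lambda>k. Ta k f)"
  using Ta_hom[OF f] \<sigma>_nat[OF Ta_hom[OF f]] by (simp add: seq_map_def)

primrec sg :: "nat \<Rightarrow> 'o \<Rightarrow> 'a" where
  "sg 0 x = idn N x"
| "sg (Suc k) x = \<sigma> (To k x) \<bullet> sg k x"

lemma sg_hom: "x \<in> ob N \<Longrightarrow> sg k x \<in> hom N x (To k x)"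
proof (induction k)
  case (Suc k)
  then show ?case using comp_hom[OF \<sigma>_hom[OF To_ob[OF Suc(2), of k]]] by simp
qed (simp add: id_hom)

lemma sg_nat: "f \<in> hom N x y \<Longrightarrow> sg k y \<bullet> f = Ta k f \<bullet> sg k x"
proof (induction k)
  case 0
  then show ?case by (simp add: hom_def)
next
  case (Suc k)
  note f = Suc(2)
  have o: "x \<in> ob N" "y \<in> ob N" using f hom_ob by auto
  note h = sg_hom[OF o(1), of k] sg_hom[OF o(2), of k] Ta_hom[OF f, of k] \<sigma>_hom[OF To_ob[OF o(1), of k]]
    \<sigma>_hom[OF To_ob[OF o(2), of k]] functor_hom[OF Th Ta_hom[OF f, of k]]
  show ?case
    using h f Suc(1)[OF f] comp_ext[OF \<sigma>_nat[OF Ta_hom[OF f, of k]], of "sg k x"] by (simp add: hom_def)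
qed

lemma sg_path: "x \<in> ob N \<Longrightarrow> sg k (To j x) = path (Ux x) (Us x) j (j + k)"
proof (induction k)
  case (Suc k)
  have "To k (To j x) = To (j + k) x" by (simp add: funpow_add add.commute[of j k])
  then show ?case using Suc path_Suc[OF U_seq[OF Suc(2)], of j "j + k"] by simp
qed (simp add: path_refl)

text \<open>\<open>Th_\<sigma>\<close> lets the loops of a structure map be read as a structure map
  of the loops, so the looped segment is again a segment of the telescope, the same one as in
  \<open>sg_path\<close>.\<close>

lemma Ta_sg: "x \<in> ob N \<Longrightarrow> Ta j (sg k x) = path (Ux x) (Us x) j (j + k)"
proof (induction k)
  case 0
  then show ?case by (simp add: Ta_id path_refl)
next
  case (Suc k)
  have "To j (To k x) = To (j + k) x" by (simp add: funpow_add)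
  then show ?case
    using Suc path_Suc[OF U_seq[OF Suc(2)], of j "j + k"] Ta_\<sigma>[OF To_ob[OF Suc(2), of k], of j]
      Ta_comp[OF \<sigma>_hom[OF To_ob[OF Suc(2), of k]] sg_hom[OF Suc(2)]] by simp
qed

text \<open>For prespectra these are the level-fibrant \<Omega>-spectra.\<close>

definition local :: "'o \<Rightarrow> bool" where
  "local x \<longleftrightarrow> fibrant N x \<and> \<sigma> x \<in> Eqv N"

lemma local_eqv: "f \<in> hom N x y \<Longrightarrow> f \<in> Eqv N \<Longrightarrow> local x \<Longrightarrow> fibrant N y \<Longrightarrow> local y"
  and local_eqv': "f \<in> hom N x y \<Longrightarrow> f \<in> Eqv N \<Longrightarrow> local y \<Longrightarrow> fibrant N x \<Longrightarrow> local x"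
  using \<sigma>_eqv_iff unfolding local_def by blast+

lemma sg_eqv: "local x \<Longrightarrow> sg k x \<in> Eqv N"
proof (induction k)
  case 0
  then show ?case by (auto simp: local_def fibrant_ob id_classes)
next
  case (Suc k)
  have x: "fibrant N x" "x \<in> ob N" "\<sigma> x \<in> Eqv N" using Suc(2) fibrant_ob by (auto simp: local_def)
  have "\<sigma> (To k x) \<in> Eqv N"
    using Ta_eqv[OF \<sigma>_hom[OF x(2)] x(3,1) Th_fibrant[OF x(1)]] Ta_\<sigma>[OF x(2)] by metis
  then show ?case using eqv_comp[OF sg_hom[OF x(2), of k] \<sigma>_hom[OF To_ob[OF x(2), of k]]] Suc by simp
qed

lemma sg_const_map: "x \<in> ob N \<Longrightarrow> seq_map N (\<lambda>_. x) (\<lambda>_. idn N x) (Ux x) (Us x) (\<lambda>k. sg k x)"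
  using sg_hom[of x] \<sigma>_hom[OF To_ob[of x]] unfolding seq_map_def by (auto simp: hom_def)

lemma sg_const_eqv:
  "local x \<Longrightarrow> levelwise_eqv N (\<lambda>_. x) (\<lambda>_. idn N x) (Ux x) (Us x) (\<lambda>k. sg k x)"
  using sg_const_map sg_eqv fibrant_ob by (simp add: levelwise_eqv_def local_def)

subsection \<open>The localization functor\<close>

text \<open>The homotopy colimit of the telescope of \<open>x\<close>. Since \<open>Th\<close>
  respects equivalences only between fibrant objects, \<open>Gf\<close> is homotopy invariant only
  on these (\<open>Gf_eqv\<close>).\<close>

definition Gf :: "('o, 'a, 'o, 'a) ftr" where
  "Gf = \<lparr>omap = (\<lambda>x. K (Ux x) (Us x)),
    amap = (\<lambda>f. Km (Ux (src N f)) (Us (src N f)) (Ux (tgt N f)) (Us (tgt N f)) (\<lambda>k. Ta k f))\<rparr>"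

definition "gi x = kin (Ux x) (Us x) 0"

lemma Gf_map:
  assumes f: "f \<in> hom N x y"
  shows "amap Gf f = Km (Ux x) (Us x) (Ux y) (Us y) (\<lambda>k. Ta k f)"
    "amap Gf f \<in> hom N (omap Gf x) (omap Gf y)" "amap Gf f \<bullet> gi x = gi y \<bullet> f"
proof -
  have o: "x \<in> ob N" "y \<in> ob N" using f hom_ob by auto
  show e: "amap Gf f = Km (Ux x) (Us x) (Ux y) (Us y) (\<lambda>k. Ta k f)" using f by (simp add: Gf_def hom_def)
  show "amap Gf f \<in> hom N (omap Gf x) (omap Gf y)"
    using Km(1)[OF U_seq[OF o(1)] U_seq[OF o(2)] U_map[OF f]] e by (simp add: Gf_def)
  show "amap Gf f \<bullet> gi x = gi y \<bullet> f"
    using Km_kin_0[OF U_seq[OF o(1)] U_seq[OF o(2)] U_map[OF f]] e by (simp add: gi_def)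
qed

lemma gi_hom: "x \<in> ob N \<Longrightarrow> gi x \<in> hom N x (omap Gf x)"
  using kin_0_hom[OF U_seq, of x] by (simp add: gi_def Gf_def)

lemma Gf: "is_functor N N Gf"
  unfolding is_functor_def
proof (intro conjI ballI impI)
  show "category N" "category N" by (rule category)+
  show "omap Gf x \<in> ob N" if "x \<in> ob N" for x using gi_hom[OF that] hom_ob by blast
  show "amap Gf f \<in> hom N (omap Gf (src N f)) (omap Gf (tgt N f))" if "f \<in> arr N" for f
    by (rule Gf_map(2)[OF hom_self[OF that]])
  show "amap Gf (idn N x) = idn N (omap Gf x)" if "x \<in> ob N" for x
    using Gf_map(1)[OF id_hom[OF that]] Km_id[OF U_seq[OF that]] Ta_id[OF that] by (simp add: Gf_def)
  fix f g assume "f \<in> arr N" "g \<in> arr N" "tgt N f = src N g"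
  then have f: "f \<in> hom N (src N f) (src N g)" and g: "g \<in> hom N (src N g) (tgt N g)" by (auto simp: hom_def)
  have o: "src N f \<in> ob N" "src N g \<in> ob N" "tgt N g \<in> ob N" using f g hom_ob by auto
  show "amap Gf (g \<bullet> f) = amap Gf g \<bullet> amap Gf f"
    using Km_comp[OF U_seq[OF o(1)] U_seq[OF o(2)] U_seq[OF o(3)] U_map[OF f] U_map[OF g]]
      Ta_comp[OF g f] Gf_map(1)[OF f] Gf_map(1)[OF g] Gf_map(1)[OF comp_hom[OF g f]] by simp
qed

lemma Gf_eqv:
  assumes f: "f \<in> hom N x y" "f \<in> Eqv N" "fibrant N x" "fibrant N y"
  shows "amap Gf f \<in> Eqv N"
  using Km_eqv[OF U_seq U_seq, of x y "\<lambda>k. Ta k f"] U_map[OF f(1)] Ta_eqv[OF f] Gf_map(1)[OF f(1)]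
    fibrant_ob f by (simp add: levelwise_eqv_def)

text \<open>For local \<open>x\<close> the maps \<open>sg k x\<close> form a levelwise equivalence
  from the constant sequence to the telescope. On the constant sequence the inclusion of the first
  term is a section of the equivalence \<open>?c\<close>, hence an equivalence itself.\<close>

lemma gi_local:
  assumes x: "local x"
  shows "gi x \<in> Eqv N"
proof -
  have o: "x \<in> ob N" using x fibrant_ob by (auto simp: local_def)
  let ?k = "kin (\<lambda>_. x) (\<lambda>_. idn N x) 0" and ?c = "kap (\<lambda>_. x) (\<lambda>_. idn N x) x (\<lambda>_. idn N x)"
  let ?m = "Km (\<lambda>_. x) (\<lambda>_. idn N x) (Ux x) (Us x) (\<lambda>k. sg k x)"
  note s = const_seq[OF o] and u = U_seq[OF o] and c = const_colimit[OF o]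
  have cc: "seq_cocone N (\<lambda>_. x) (\<lambda>_. idn N x) x (\<lambda>_. idn N x)" using c by (simp add: seq_colimit_def)
  have k: "?k \<in> hom N x (K (\<lambda>_. x) (\<lambda>_. idn N x))" using kin_0_hom[OF s] by simp
  have "?c \<bullet> ?k = idn N x" using kap(2)[OF s cc, of 0] o by simp
  then have kE: "?k \<in> Eqv N"
    using eqv_cancel_left[OF k kap(1)[OF s cc] kap_const[OF o]] id_classes[OF o] by simp
  have "?m \<bullet> ?k = gi x \<bullet> idn N x" using Km_kin_0[OF s u sg_const_map[OF o]] by (simp add: gi_def)
  moreover have "?m \<bullet> ?k \<in> Eqv N"
    by (rule eqv_comp[OF k Km(1)[OF s u sg_const_map[OF o]] kE Km_eqv[OF s u sg_const_eqv[OF x]]])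
  ultimately show ?thesis using gi_hom[OF o] by (simp add: hom_def)
qed

section \<open>The stabilization of a fibrant object is local\<close>

context
  fixes x assumes x: "fibrant N x"
begin

abbreviation "Cx \<equiv> Yo (Ux x) (Us x)"
abbreviation "Cs \<equiv> Ya (Ux x) (Us x)"
abbreviation "dx \<equiv> P (Ux x) (Us x)"
abbreviation "Gx \<equiv> omap Gf x"
abbreviation "Zx \<equiv> omap Rf Gx"

definition "cx k = rr Gx \<bullet> kin (Ux x) (Us x) k"

lemma xo: "x \<in> ob N" by (rule fibrant_ob[OF x])

lemma Gx: "Gx = K (Ux x) (Us x)" "Gx \<in> ob N" "Zx \<in> ob N"
  using K_ob[OF U_seq[OF xo]] rr(1) hom_ob(2) by (auto simp: Gf_def)

lemma C_seq: "is_seq N Cx Cs" "cof_seq N Cx Cs"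
  using Y_seq[OF U_seq[OF xo]] by auto

lemma d_map: "seq_map N Cx Cs (Ux x) (Us x) dx" "levelwise_eqv N Cx Cs (Ux x) (Us x) dx"
  using Y_seq(3)[OF U_seq[OF xo]] P_eqv[OF U_seq[OF xo]] by auto

lemma C_colimit: "seq_colimit N Cx Cs Gx (kin (Ux x) (Us x))"
  using K_colimit[OF U_seq[OF xo]] Gx(1) by simp

lemma d_hom: "dx k \<in> hom N (Cx k) (To k x)"
  using d_map by (simp only: seq_map_def)

lemma Cs_hom: "Cs k \<in> hom N (Cx k) (Cx (Suc k))"
  using C_seq(1) by (simp only: is_seq_def)

text \<open>Stage 0 is \<open>x\<close> itself, and every later stage maps by a fibration to an
  iterate of \<open>Th\<close> on \<open>x\<close>.\<close>

lemma C_fibrant: "fibrant N (Cx k)"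
proof (cases k)
  case 0
  then show ?thesis using x by (simp add: xo)
next
  case (Suc j)
  have "rep (idn N (To 0 x)) (Us x) (Suc j) \<in> Fib N"
    using rep_props(3)[OF U_seq[OF xo] id0[OF U_seq[OF xo]]] by blast
  then show ?thesis using fib_fibrant[OF d_hom[of k] _ To_fibrant[OF x]] Suc by blast
qed

lemma c_hom: "cx k \<in> hom N (Cx k) Zx"
  unfolding cx_def using comp_hom[OF rr(1)[OF Gx(2)] kin_hom[OF U_seq[OF xo], of k, folded Gx(1)]] .

lemma c_step: "cx (Suc k) \<bullet> Cs k = cx k"
proof -
  note h = kin_hom[OF U_seq[OF xo], of "Suc k"] kin_step[OF U_seq[OF xo], of k] rr(1)[OF Gx(2)] Cs_hom[of k]
  show ?thesis unfolding cx_def using h Gx(1) by (simp add: hom_def)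
qed

lemma c_cocone: "seq_cocone N Cx Cs Zx cx"
  unfolding seq_cocone_def using Gx(3) c_hom c_step by blast

lemma kap_c: "kap Cx Cs Zx cx \<in> Eqv N" "kap Cx Cs Zx cx \<in> hom N (K Cx Cs) Zx"
proof -
  have co: "seq_cocone N Cx Cs Gx (kin (Ux x) (Us x))" using C_colimit by (simp add: seq_colimit_def)
  note k = kap(1)[OF C_seq(1) co]
  have "cx k = cx k \<bullet> idn N (Cx k)" for k using c_hom[of k] by (simp add: hom_def)
  then have "rr Gx \<bullet> kap Cx Cs Gx (kin (Ux x) (Us x)) = kap Cx Cs Zx cx \<bullet> Km Cx Cs Cx Cs (\<lambda>k. idn N (Cx k))"
    by (intro kap_nat[OF C_seq(1) C_seq(1) seq_map_id[OF C_seq(1)] co c_cocone rr(1)[OF Gx(2)]])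
      (simp add: cx_def)
  also have "\<dots> = kap Cx Cs Zx cx"
    using Km_id[OF C_seq(1)] kap(1)[OF C_seq(1) c_cocone] by (simp add: hom_def)
  finally show "kap Cx Cs Zx cx \<in> Eqv N"
    using eqv_comp[OF k rr(1)[OF Gx(2)] kap_eqv[OF C_seq(2) C_colimit] rr(3)[OF Gx(2)]] by simp
  show "kap Cx Cs Zx cx \<in> hom N (K Cx Cs) Zx" by (rule kap(1)[OF C_seq(1) c_cocone])
qed

text \<open>\<open>sends\<close> is applied with the sequence as its own fibrant replacement, by
  \<open>C_fibrant\<close>, and with \<open>rr\<close> as the replacement of its colimit.\<close>

lemma Th_C: "seq_hocolim N (\<lambda>i. omap Th (Cx i)) (\<lambda>i. amap Th (Cs i)) (omap Th Zx) (\<lambda>i. amap Th (cx i))"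
proof -
  have "levelwise_eqv N Cx Cs Cx Cs (\<lambda>k. idn N (Cx k))"
    using seq_map_id[OF C_seq(1)] id_classes hom_ob(1)[OF d_hom] by (simp only: levelwise_eqv_def) blast
  moreover have "rr Gx \<bullet> kin (Ux x) (Us x) i = cx i \<bullet> idn N (Cx i)" for i
    using c_hom[of i] by (simp add: hom_def flip: cx_def)
  ultimately show ?thesis
    using sends C_seq C_colimit C_fibrant rr[OF Gx(2)] c_cocone
    unfolding sends_seq_colimits_to_hocolims_def by blast
qed

lemma \<sigma>C_map: "seq_map N Cx Cs (\<lambda>i. omap Th (Cx i)) (\<lambda>i. amap Th (Cs i)) (\<lambda>k. \<sigma> (Cx k))"
  unfolding seq_map_def using \<sigma>_hom[OF hom_ob(1)[OF d_hom]] \<sigma>_nat[OF Cs_hom] by blast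

text \<open>Along the equivalences \<open>dx\<close> and their loops, \<sigma> on the stages becomes
  the shift of the telescope of \<open>x\<close> by one. The shift is the inclusion of a cofinal
  subsequence, which \<open>Km\<close> inverts.\<close>

lemma \<sigma>C_eqv: "Km Cx Cs (\<lambda>i. omap Th (Cx i)) (\<lambda>i. amap Th (Cs i)) (\<lambda>k. \<sigma> (Cx k)) \<in> Eqv N"
proof -
  let ?TC = "\<lambda>i. omap Th (Cx i)" and ?Ts = "\<lambda>i. amap Th (Cs i)"
  let ?U = "Ux x \<circ> Suc" and ?u = "subseq_maps (Ux x) (Us x) Suc"
  note U = U_seq[OF xo] and C = C_seq(1)
  have TC: "is_seq N ?TC ?Ts" using Th_C by (simp add: seq_hocolim_def)
  have u: "?u = (\<lambda>k. \<sigma> (To (Suc k) x))" using path_step[OF U] by (intro ext) (simp add: subseq_maps_def)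
  have U': "is_seq N ?U ?u" by (rule subseq_seq[OF U]) simp
  let ?p = "\<lambda>k. path (Ux x) (Us x) k (Suc k)"
  have p: "seq_map N (Ux x) (Us x) ?U ?u ?p" by (rule subseq_map[OF U]) auto
  have pE: "Km (Ux x) (Us x) ?U ?u ?p \<in> Eqv N" by (rule Km_cofinal[OF U]) auto
  have pk: "?p k = \<sigma> (To k x)" for k using path_step[OF U] by simp
  let ?d = "\<lambda>k. amap Th (dx k)"
  have d: "levelwise_eqv N ?TC ?Ts ?U ?u ?d"
  proof -
    have "amap Th (dx (Suc k)) \<bullet> amap Th (Cs k) = \<sigma> (To (Suc k) x) \<bullet> amap Th (dx k)" for k
    proof -
      have "dx (Suc k) \<bullet> Cs k = \<sigma> (To k x) \<bullet> dx k" using d_map(1) unfolding seq_map_def by blast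
      then show ?thesis
        using functor_comp[OF Th d_hom[of "Suc k"] Cs_hom[of k]]
          functor_comp[OF Th \<sigma>_hom[OF To_ob[OF xo, of k]] d_hom[of k]] Th_\<sigma>[OF To_ob[OF xo, of k]] by simp
    qed
    moreover have "amap Th (dx k) \<in> Eqv N" for k
      using Th_eqv[OF d_hom _ C_fibrant To_fibrant[OF x]] d_map(2) unfolding levelwise_eqv_def by blast
    moreover have "amap Th (dx k) \<in> hom N (?TC k) (?U k)" for k using functor_hom[OF Th d_hom[of k]] by simp
    ultimately show ?thesis unfolding levelwise_eqv_def seq_map_def u by blast
  qed
  have d': "seq_map N ?TC ?Ts ?U ?u ?d" using d by (simp add: levelwise_eqv_def)
  have "(\<lambda>k. ?p k \<bullet> dx k) = (\<lambda>k. ?d k \<bullet> \<sigma> (Cx k))"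
    using \<sigma>_nat[OF d_hom] pk by simp
  then have e: "Km (Ux x) (Us x) ?U ?u ?p \<bullet> Km Cx Cs (Ux x) (Us x) dx =
      Km ?TC ?Ts ?U ?u ?d \<bullet> Km Cx Cs ?TC ?Ts (\<lambda>k. \<sigma> (Cx k))"
    using Km_comp[OF C U U' d_map(1) p] Km_comp[OF C TC U' \<sigma>C_map d'] by simp
  have "Km (Ux x) (Us x) ?U ?u ?p \<bullet> Km Cx Cs (Ux x) (Us x) dx \<in> Eqv N"
    by (rule eqv_comp[OF Km(1)[OF C U d_map(1)] Km(1)[OF U U' p] Km_eqv[OF C U d_map(2)] pE])
  then show ?thesis
    using eqv_cancel_left[OF Km(1)[OF C TC \<sigma>C_map] Km(1)[OF TC U' d'] Km_eqv[OF TC U' d]] e by simp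
qed

text \<open>Naturality of \<open>kap\<close> compares \<open>\<sigma> Zx\<close> with the map
  induced by \<sigma> on the stages. One \<open>kap\<close> is an equivalence because
  \<open>Zx\<close> replaces the colimit of the stages, the other because \<open>Th\<close> sends
  that colimit to a homotopy colimit.\<close>

lemma Z_local: "local Zx"
proof -
  let ?TC = "\<lambda>i. omap Th (Cx i)" and ?Ts = "\<lambda>i. amap Th (Cs i)"
  note h = Th_C
  have TC: "is_seq N ?TC ?Ts" and co: "seq_cocone N ?TC ?Ts (omap Th Zx) (\<lambda>i. amap Th (cx i))"
    using h by (auto simp: seq_hocolim_def)
  have "\<sigma> Zx \<bullet> kap Cx Cs Zx cx = kap ?TC ?Ts (omap Th Zx) (\<lambda>i. amap Th (cx i)) \<bullet>
      Km Cx Cs ?TC ?Ts (\<lambda>k. \<sigma> (Cx k))"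
    by (rule kap_nat[OF C_seq(1) TC \<sigma>C_map c_cocone co \<sigma>_hom[OF Gx(3)] \<sigma>_nat[OF c_hom]])
  moreover have "kap ?TC ?Ts (omap Th Zx) (\<lambda>i. amap Th (cx i)) \<bullet> Km Cx Cs ?TC ?Ts (\<lambda>k. \<sigma> (Cx k)) \<in> Eqv N"
    by (rule eqv_comp[OF Km(1)[OF C_seq(1) TC \<sigma>C_map] kap(1)[OF TC co] \<sigma>C_eqv kap_hocolim[OF h]])
  ultimately have "\<sigma> Zx \<in> Eqv N"
    using eqv_cancel_right[OF kap_c(2) \<sigma>_hom[OF Gx(3)] kap_c(1)] by simp
  then show ?thesis using rr(4)[OF Gx(2)] by (simp add: local_def)
qed

end

end

section \<open>The stabilization inverts its unit\<close>

context stab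
begin

text \<open>\<open>Gf\<close> inverts the unit \<open>c : x \<rightarrow> Zx x\<close>. Write \<open>C\<close> for the replacement of the sequence of the
  \<open>\<Theta>\<^sup>k x\<close>. The two natural maps \<open>\<alpha>, \<beta> : C k \<rightarrow> \<Theta>\<^sup>k (C k)\<close> agree after composition with the
  equivalences \<open>h : \<Theta>\<^sup>k (C k) \<rightarrow> \<Theta>\<^sup>2\<^sup>k x\<close>, hence one is inverted by \<open>Km\<close> if the other is. Composed
  with \<open>\<Theta>\<^sup>k (C k) \<rightarrow> \<Theta>\<^sup>k (Zx x)\<close>, the former is \<open>\<Theta>\<^sup>k c\<close>, and the latter is inverted because
  \<open>Zx x\<close> is local.\<close>

lemma Gf_unit:
  assumes x: "fibrant N x"
  shows "amap Gf (rr (omap Gf x) \<bullet> gi x) \<in> Eqv N"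
proof -
  let ?C = "Cx x" and ?s = "Cs x" and ?d = "dx x" and ?Z = "Zx x" and ?c = "cx x"
  let ?U = "Ux x" and ?u = "Us x" and ?W = "Ux ?Z" and ?w = "Us ?Z"
  define D where "D k = To k (?C k)" for k
  define Ds where "Ds k = \<sigma> (To k (?C (Suc k))) \<bullet> Ta k (?s k)" for k
  define \<beta> where "\<beta> k = sg k (?C k)" for k
  define \<alpha> where "\<alpha> k = Ta k (path ?C ?s 0 k) \<bullet> ?d k" for k
  define h where "h k = Ta k (?d k)" for k
  define g where "g k = Ta k (?c k)" for k
  \<comment> \<open>Stage \<open>k\<close> lies over \<open>To k x\<close>, so its
    \<open>k\<close>-fold loops lie over \<open>To (k + k) x\<close>: the comparison
    \<open>h\<close> ends in the subsequence of even indices, and \<open>\<gamma>\<close> is the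
    inclusion into it.\<close>
  define \<phi> :: "nat \<Rightarrow> nat" where "\<phi> k = k + k" for k
  define \<gamma> where "\<gamma> k = path ?U ?u k (\<phi> k)" for k
  let ?V = "?U \<circ> \<phi>" and ?v = "subseq_maps ?U ?u \<phi>"
  note xo = xo[OF x]
  have Zo: "?Z \<in> ob N" using Gx(3)[OF x] .
  note U = U_seq[OF xo] and C = C_seq(1)[OF x] and W = U_seq[OF Zo]
  have C0: "?C 0 = x" "?d 0 = idn N x" using xo by auto
  note dh = d_hom[OF x] and sh = Cs_hom[OF x] and ch = c_hom[OF x]
  have Co: "?C k \<in> ob N" for k using hom_ob(1)[OF dh] .
  have ph: "path ?C ?s 0 k \<in> hom N x (?C k)" for k using path_hom[OF C, of 0 k] C0 by simp
  have Tdh: "Ta k (?d k) \<in> hom N (D k) (To (\<phi> k) x)" for k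
    using Ta_hom[OF dh[of k], of k] by (simp add: D_def \<phi>_def funpow_add)
  have dk: "?d (Suc k) \<bullet> ?s k = \<sigma> (To k x) \<bullet> ?d k" for k
    using d_map(1)[OF x] unfolding seq_map_def by blast
  have Tph: "Ta k (path ?C ?s 0 k) \<in> hom N (To k x) (D k)" for k
    using Ta_hom[OF ph[of k], of k] by (simp add: D_def)
  have Tsh: "Ta k (?s k) \<in> hom N (D k) (To k (?C (Suc k)))" for k
    using Ta_hom[OF sh[of k], of k] by (simp add: D_def)
  have \<sigma>h: "\<sigma> (To k (?C (Suc k))) \<in> hom N (To k (?C (Suc k))) (D (Suc k))" for k
    using \<sigma>_hom[OF To_ob[OF Co, of k "Suc k"]] by (simp add: D_def)
  have Dsh: "Ds k \<in> hom N (D k) (D (Suc k))" for k unfolding Ds_def by (rule comp_hom[OF \<sigma>h Tsh])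
  have D: "is_seq N D Ds" using Dsh hom_ob(1)[OF Dsh] by (simp add: is_seq_def)
  have V: "is_seq N ?V ?v" by (rule subseq_seq[OF U]) (simp add: \<phi>_def)
  have \<beta>h: "\<beta> k \<in> hom N (?C k) (D k)" for k unfolding \<beta>_def D_def by (rule sg_hom[OF Co])
  have \<alpha>h: "\<alpha> k \<in> hom N (?C k) (D k)" for k unfolding \<alpha>_def by (rule comp_hom[OF Tph dh])
  have \<beta>: "seq_map N ?C ?s D Ds \<beta>"
  proof -
    have "\<beta> (Suc k) \<bullet> ?s k = Ds k \<bullet> \<beta> k" for k
      using sg_nat[OF sh[of k], of k] sg_hom[OF Co, of k k] sg_hom[OF Co, of k "Suc k"] \<sigma>h[of k] Tsh[of k] sh[of k]
      by (simp add: \<beta>_def Ds_def hom_def D_def)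
    then show ?thesis using \<beta>h by (simp only: seq_map_def) blast
  qed
  have \<alpha>: "seq_map N ?C ?s D Ds \<alpha>"
  proof -
    have "\<alpha> (Suc k) \<bullet> ?s k = Ds k \<bullet> \<alpha> k" for k
    proof -
      have f: "?s k \<bullet> path ?C ?s 0 k \<in> hom N x (?C (Suc k))" by (rule comp_hom[OF sh ph])
      have "\<alpha> (Suc k) \<bullet> ?s k = amap Th (Ta k (?s k \<bullet> path ?C ?s 0 k)) \<bullet> ?d (Suc k) \<bullet> ?s k"
        using path_Suc[OF C, of 0 k] Tph[of "Suc k"] dh[of "Suc k"] sh[of k] by (simp add: \<alpha>_def hom_def)
      also have "\<dots> = amap Th (Ta k (?s k \<bullet> path ?C ?s 0 k)) \<bullet> \<sigma> (To k x) \<bullet> ?d k" using dk by simp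
      also have "\<dots> = \<sigma> (To k (?C (Suc k))) \<bullet> Ta k (?s k \<bullet> path ?C ?s 0 k) \<bullet> ?d k"
        using comp_ext[OF \<sigma>_nat[OF Ta_hom[OF f, of k], symmetric], of "?d k"] dh[of k]
          \<sigma>_hom[OF To_ob[OF xo, of k]] functor_hom[OF Th Ta_hom[OF f, of k]] Ta_hom[OF f, of k] \<sigma>h[of k]
        by (simp add: hom_def D_def)
      also have "\<dots> = Ds k \<bullet> \<alpha> k"
        using Ta_comp[OF sh[of k] ph[of k], of k] \<sigma>h[of k] Tsh[of k] Tph[of k] dh[of k]
        by (simp add: Ds_def \<alpha>_def hom_def)
      finally show ?thesis .
    qed
    then show ?thesis using \<alpha>h by (simp only: seq_map_def) blast
  qed
  have h: "levelwise_eqv N D Ds ?V ?v h"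
  proof -
    have "h (Suc k) \<bullet> Ds k = ?v k \<bullet> h k" for k
    proof -
      have v: "?v k = \<sigma> (To (Suc (k + k)) x) \<bullet> \<sigma> (To (k + k) x)"
      proof -
        have "?v k = path ?U ?u (k + k) (Suc (Suc (k + k)))" by (simp add: subseq_maps_def \<phi>_def)
        also have "\<dots> = \<sigma> (To (Suc (k + k)) x) \<bullet> path ?U ?u (k + k) (Suc (k + k))"
          using path_Suc[OF U, of "k + k" "Suc (k + k)"] by simp
        finally show ?thesis using path_step[OF U, of "k + k"] by simp
      qed
      have T1: "To k (To (Suc k) x) = To (Suc (k + k)) x" "To k (To k x) = To (k + k) x"
        by (simp_all add: funpow_add funpow_swap1)
      have dS: "Ta k (?d (Suc k)) \<in> hom N (To k (?C (Suc k))) (To (Suc (k + k)) x)"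
        using Ta_hom[OF dh[of "Suc k"], of k] T1 by simp
      have ThdS: "amap Th (Ta k (?d (Suc k))) \<in> hom N (D (Suc k)) (To (Suc (Suc (k + k))) x)"
        using functor_hom[OF Th dS] by (simp add: D_def)
      have sU: "\<sigma> (To (k + k) x) \<in> hom N (To (k + k) x) (To (Suc (k + k)) x)"
        "\<sigma> (To (Suc (k + k)) x) \<in> hom N (To (Suc (k + k)) x) (To (Suc (Suc (k + k))) x)"
        using \<sigma>_hom[OF To_ob[OF xo, of "k + k"]] \<sigma>_hom[OF To_ob[OF xo, of "Suc (k + k)"]] by auto
      have 1: "Ta k (?d (Suc k)) \<bullet> Ta k (?s k) = \<sigma> (To (k + k) x) \<bullet> h k"
        using Ta_comp[OF dh[of "Suc k"] sh[of k], of k] dk[of k] Ta_\<sigma>[OF To_ob[OF xo, of k], of k]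
          Ta_comp[OF \<sigma>_hom[OF To_ob[OF xo, of k]] dh[of k], of k] T1 by (simp add: h_def)
      have 2: "amap Th (Ta k (?d (Suc k))) \<bullet> \<sigma> (To k (?C (Suc k))) =
          \<sigma> (To (Suc (k + k)) x) \<bullet> Ta k (?d (Suc k))"
        using \<sigma>_nat[OF dS] by simp
      have "h (Suc k) \<bullet> Ds k = \<sigma> (To (Suc (k + k)) x) \<bullet> Ta k (?d (Suc k)) \<bullet> Ta k (?s k)"
        using comp_ext[OF 2, of "Ta k (?s k)"] ThdS dS sU \<sigma>h[of k] Tsh[of k]
        by (simp add: h_def Ds_def hom_def)
      also have "\<dots> = ?v k \<bullet> h k" using 1 v sU Tdh[of k] by (simp add: h_def hom_def \<phi>_def)
      finally show ?thesis .
    qed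
    moreover have "h k \<in> hom N (D k) (?V k)" for k using Tdh[of k] by (simp add: h_def)
    moreover have "h k \<in> Eqv N" for k
      using Ta_eqv[OF dh[of k] _ C_fibrant[OF x] To_fibrant[OF x]] d_map(2)[OF x]
      unfolding h_def levelwise_eqv_def by blast
    ultimately show ?thesis unfolding levelwise_eqv_def seq_map_def by blast
  qed
  have h': "seq_map N D Ds ?V ?v h" using h by (simp add: levelwise_eqv_def)
  have \<gamma>: "seq_map N ?U ?u ?V ?v \<gamma>" unfolding \<gamma>_def by (rule subseq_map[OF U]) (auto simp: \<phi>_def)
  have \<gamma>E: "Km ?U ?u ?V ?v \<gamma> \<in> Eqv N" unfolding \<gamma>_def by (rule Km_cofinal[OF U]) (auto simp: \<phi>_def)
  have h\<beta>: "h k \<bullet> \<beta> k = \<gamma> k \<bullet> ?d k" for k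
    using sg_nat[OF dh[of k], of k] sg_path[OF xo, of k k] by (simp add: h_def \<beta>_def \<gamma>_def \<phi>_def)
  \<comment> \<open>The segment from \<open>k\<close> to \<open>k + k\<close> arises here as
    \<open>Ta k (sg k x)\<close>, whereas in \<open>h\<beta>\<close> it arises as
    \<open>sg k (To k x)\<close>. \<open>Ta_sg\<close> and \<open>sg_path\<close> identify both with
    \<open>\<gamma> k\<close>; the relation between the two maps rests on this coincidence.\<close>
  have h\<alpha>: "h k \<bullet> \<alpha> k = \<gamma> k \<bullet> ?d k" for k
  proof -
    have "?d k \<bullet> path ?C ?s 0 k = sg k x"
      using path_nat[OF d_map(1)[OF x] C U, of 0 k] sg_path[OF xo, of k 0] C0(2) path_hom[OF U, of 0 k]
      by (simp add: hom_def)
    then have "Ta k (?d k) \<bullet> Ta k (path ?C ?s 0 k) = \<gamma> k"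
      using Ta_comp[OF dh[of k] ph[of k], of k] Ta_sg[OF xo, of k k] by (simp add: \<gamma>_def \<phi>_def)
    then show ?thesis
      using comp_ext[of "Ta k (?d k)" "Ta k (path ?C ?s 0 k)" "\<gamma> k" "?d k"] Tdh[of k] Tph[of k] dh[of k]
      by (simp add: h_def \<alpha>_def hom_def)
  qed
  have \<gamma>d: "Km ?U ?u ?V ?v \<gamma> \<bullet> Km ?C ?s ?U ?u ?d \<in> Eqv N"
    by (rule eqv_comp[OF Km(1)[OF C U d_map(1)[OF x]] Km(1)[OF U V \<gamma>] Km_eqv[OF C U d_map(2)[OF x]] \<gamma>E])
  have e: "Km ?U ?u ?V ?v \<gamma> \<bullet> Km ?C ?s ?U ?u ?d = Km D Ds ?V ?v h \<bullet> Km ?C ?s D Ds \<beta>"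
    "Km ?U ?u ?V ?v \<gamma> \<bullet> Km ?C ?s ?U ?u ?d = Km D Ds ?V ?v h \<bullet> Km ?C ?s D Ds \<alpha>"
    using Km_comp[OF C U V d_map(1)[OF x] \<gamma>] Km_comp[OF C D V \<beta> h'] Km_comp[OF C D V \<alpha> h'] h\<alpha> h\<beta> by auto
  have \<beta>E: "Km ?C ?s D Ds \<beta> \<in> Eqv N"
    using eqv_cancel_left[OF Km(1)[OF C D \<beta>] Km(1)[OF D V h'] Km_eqv[OF D V h]] \<gamma>d e(1) by simp
  have \<alpha>E: "Km ?C ?s D Ds \<alpha> \<in> Eqv N"
    using eqv_cancel_left[OF Km(1)[OF C D \<alpha>] Km(1)[OF D V h'] Km_eqv[OF D V h]] \<gamma>d e(2) by simp
  have g: "seq_map N D Ds ?W ?w g"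
  proof -
    have "g (Suc k) \<bullet> Ds k = \<sigma> (To k ?Z) \<bullet> g k" for k
    proof -
      have 1: "amap Th (Ta k (?c (Suc k))) \<bullet> \<sigma> (To k (?C (Suc k))) = \<sigma> (To k ?Z) \<bullet> Ta k (?c (Suc k))"
        using \<sigma>_nat[OF Ta_hom[OF ch[of "Suc k"], of k]] by simp
      have 2: "Ta k (?c (Suc k)) \<bullet> Ta k (?s k) = Ta k (?c k)"
        using Ta_comp[OF ch[of "Suc k"] sh[of k], of k] c_step[OF x, of k] by simp
      show ?thesis
        using comp_ext[OF 1, of "Ta k (?s k)"] 2 Tsh[of k] \<sigma>h[of k] Ta_hom[OF ch[of "Suc k"], of k]
          functor_hom[OF Th Ta_hom[OF ch[of "Suc k"], of k]] \<sigma>_hom[OF To_ob[OF Zo, of k]]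
        by (simp add: g_def Ds_def hom_def D_def)
    qed
    moreover have "g k \<in> hom N (D k) (?W k)" for k using Ta_hom[OF ch[of k], of k] by (simp add: g_def D_def)
    ultimately show ?thesis unfolding seq_map_def by blast
  qed
  let ?K = "\<lambda>_ :: nat. ?Z" and ?k = "\<lambda>_ :: nat. idn N ?Z"
  note L = Z_local[OF x]
  note K = const_seq[OF Zo] and sm = sg_const_map[OF Zo]
  have c: "seq_map N ?C ?s ?K ?k ?c"
    using ch c_step[OF x] unfolding seq_map_def by (auto simp: hom_def)
  have cK: "seq_cocone N ?K ?k ?Z ?k" using const_colimit[OF Zo] by (simp add: seq_colimit_def)
  have cE: "Km ?C ?s ?K ?k ?c \<in> Eqv N"
  proof -
    have "idn N ?Z \<bullet> kap ?C ?s ?Z ?c = kap ?K ?k ?Z ?k \<bullet> Km ?C ?s ?K ?k ?c"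
      by (rule kap_nat[OF C K c c_cocone[OF x] cK id_hom[OF Zo]]) simp
    then have "kap ?C ?s ?Z ?c = kap ?K ?k ?Z ?k \<bullet> Km ?C ?s ?K ?k ?c"
      using kap_c(2)[OF x] by (simp add: hom_def)
    then show ?thesis
      using eqv_cancel_left[OF Km(1)[OF C K c] kap(1)[OF K cK] kap_const[OF Zo]] kap_c(1)[OF x] by simp
  qed
  have "(\<lambda>k. g k \<bullet> \<beta> k) = (\<lambda>k. sg k ?Z \<bullet> ?c k)"
    using sg_nat[OF ch] by (simp add: g_def \<beta>_def)
  then have "Km D Ds ?W ?w g \<bullet> Km ?C ?s D Ds \<beta> = Km ?K ?k ?W ?w (\<lambda>k. sg k ?Z) \<bullet> Km ?C ?s ?K ?k ?c"
    using Km_comp[OF C D W \<beta> g] Km_comp[OF C K W c sm] by simp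
  moreover have "Km ?K ?k ?W ?w (\<lambda>k. sg k ?Z) \<bullet> Km ?C ?s ?K ?k ?c \<in> Eqv N"
    by (rule eqv_comp[OF Km(1)[OF C K c] Km(1)[OF K W sm] cE Km_eqv[OF K W sg_const_eqv[OF L]]])
  ultimately have gE: "Km D Ds ?W ?w g \<in> Eqv N"
    using eqv_cancel_right[OF Km(1)[OF C D \<beta>] Km(1)[OF D W g] \<beta>E] by simp
  have c0: "?c 0 \<in> hom N x ?Z" using ch[of 0] C0 by simp
  have "g k \<bullet> \<alpha> k = Ta k (?c 0) \<bullet> ?d k" for k
  proof -
    have "Ta k (?c k) \<bullet> Ta k (path ?C ?s 0 k) = Ta k (?c 0)"
      using Ta_comp[OF ch[of k] ph[of k], of k] path_cocone[OF c_cocone[OF x] C, of 0 k] by simp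
    then show ?thesis
      using comp_ext[of "Ta k (?c k)" "Ta k (path ?C ?s 0 k)" "Ta k (?c 0)" "?d k"]
        Ta_hom[OF ch[of k], of k] Tph[of k] dh[of k]
      by (simp add: g_def \<alpha>_def hom_def D_def)
  qed
  then have "Km ?U ?u ?W ?w (\<lambda>k. Ta k (?c 0)) \<bullet> Km ?C ?s ?U ?u ?d = Km D Ds ?W ?w g \<bullet> Km ?C ?s D Ds \<alpha>"
    using Km_comp[OF C D W \<alpha> g] Km_comp[OF C U W d_map(1)[OF x] U_map[OF c0]] by simp
  moreover have "Km D Ds ?W ?w g \<bullet> Km ?C ?s D Ds \<alpha> \<in> Eqv N"
    by (rule eqv_comp[OF Km(1)[OF C D \<alpha>] Km(1)[OF D W g] \<alpha>E gE])
  ultimately have "Km ?U ?u ?W ?w (\<lambda>k. Ta k (?c 0)) \<in> Eqv N"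
    using eqv_cancel_right[OF Km(1)[OF C U d_map(1)[OF x]] Km(1)[OF U W U_map[OF c0]]
        Km_eqv[OF C U d_map(2)[OF x]]] by simp
  then show ?thesis using Gf_map(1)[OF c0] by (simp add: cx_def[OF x] gi_def)
qed

text \<open>The inner \<open>Rf\<close> provides the fibrancy under which \<open>Gf\<close> is
  homotopy invariant; the outer one makes the value fibrant.\<close>

definition "Qf = comp_ftr Rf (comp_ftr Gf Rf)"
definition "qq x = rr (omap Gf (omap Rf x)) \<bullet> gi (omap Rf x) \<bullet> rr x"

lemma Qf: "is_functor N N Qf"
  unfolding Qf_def by (intro comp_functor[of N N _ N] Rf Gf)

lemma Qf_simps: "omap Qf x = omap Rf (omap Gf (omap Rf x))" "amap Qf f = amap Rf (amap Gf (amap Rf f))"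
  by (simp_all add: Qf_def comp_ftr_def)

lemma Q_local: "x \<in> ob N \<Longrightarrow> local (omap Qf x)"
  using Z_local[OF rr(4)] by (simp add: Qf_simps)

lemma unit_hom: "x \<in> ob N \<Longrightarrow> rr (omap Gf x) \<bullet> gi x \<in> hom N x (omap Rf (omap Gf x))"
  using comp_hom[OF rr(1) gi_hom, of x] gi_hom[of x] hom_ob by blast

lemma qq_hom: "x \<in> ob N \<Longrightarrow> qq x \<in> hom N x (omap Qf x)"
  unfolding qq_def Qf_simps
  using comp_hom[OF comp_hom[OF rr(1)[OF functor_ob[OF Gf]] gi_hom] rr(1)] rr(1)[of x] hom_ob(2)[of "rr x"]
    rr(1)[OF functor_ob[OF Gf]] gi_hom by (auto simp: hom_def functor_ob[OF Rf])

lemma qq_nat: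
  assumes f: "f \<in> hom N x y"
  shows "qq y \<bullet> f = amap Qf f \<bullet> qq x"
proof -
  have o: "x \<in> ob N" "y \<in> ob N" using f hom_ob by auto
  have o': "omap Rf x \<in> ob N" "omap Rf y \<in> ob N" using functor_ob[OF Rf] o by auto
  have o'': "omap Gf (omap Rf x) \<in> ob N" "omap Gf (omap Rf y) \<in> ob N" using functor_ob[OF Gf] o' by auto
  note R = Rf_map[OF f] and G = Gf_map(2,3)[OF Rf_map(1)[OF f]]
  note R' = Rf_map[OF G(1)]
  note h = rr(1)[OF o(1)] rr(1)[OF o(2)] gi_hom[OF o'(1)] gi_hom[OF o'(2)] rr(1)[OF o''(1)] rr(1)[OF o''(2)]
  have "qq y \<bullet> f = rr (omap Gf (omap Rf y)) \<bullet> gi (omap Rf y) \<bullet> amap Rf f \<bullet> rr x"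
    using h f R by (simp add: qq_def hom_def)
  also have "\<dots> = rr (omap Gf (omap Rf y)) \<bullet> amap Gf (amap Rf f) \<bullet> gi (omap Rf x) \<bullet> rr x"
    using comp_ext[OF G(2)[symmetric], of "rr x"] h R(1) G(1) by (simp add: hom_def)
  also have "\<dots> = amap Qf f \<bullet> qq x"
    using comp_ext[OF R'(2)[symmetric], of "gi (omap Rf x) \<bullet> rr x"] h G(1) R'(1)
    by (simp add: hom_def qq_def Qf_simps)
  finally show ?thesis .
qed

lemma qq: "nat_trans N N id_ftr Qf qq"
  unfolding nat_trans_def using qq_hom qq_nat[OF hom_self] by (simp add: id_ftr_def)

sublocale Q: pointed_functor N Qf qq
  by unfold_locales (rule Qf, rule qq)

lemma Qf_eqv:
  assumes f: "f \<in> hom N x y" "f \<in> Eqv N"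
  shows "amap Qf f \<in> Eqv N"
proof -
  have o: "x \<in> ob N" "y \<in> ob N" using f hom_ob by auto
  have "amap Gf (amap Rf f) \<in> Eqv N" using Gf_eqv[OF Rf_map(1)[OF f(1)] Rf_eqv[OF f] rr(4)[OF o(1)] rr(4)[OF o(2)]] .
  then show ?thesis using Rf_eqv[OF Gf_map(2)[OF Rf_map(1)[OF f(1)]]] by (simp add: Qf_simps)
qed

lemma qq_local:
  assumes x: "local x"
  shows "qq x \<in> Eqv N"
proof -
  have o: "x \<in> ob N" using x fibrant_ob by (simp add: local_def)
  have Rx: "local (omap Rf x)" using local_eqv[OF rr(1)[OF o] rr(3)[OF o] x rr(4)[OF o]] .
  have o': "omap Rf x \<in> ob N" "omap Gf (omap Rf x) \<in> ob N" using functor_ob[OF Rf o] functor_ob[OF Gf] by auto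
  have "gi (omap Rf x) \<bullet> rr x \<in> Eqv N"
    by (rule eqv_comp[OF rr(1)[OF o] gi_hom[OF o'(1)] rr(3)[OF o] gi_local[OF Rx]])
  then show ?thesis
    unfolding qq_def by (intro eqv_comp[OF comp_hom[OF gi_hom[OF o'(1)] rr(1)[OF o]] rr(1)[OF o'(2)] _ rr(3)[OF o'(2)]])
qed

text \<open>\<open>Gf_unit\<close> treats \<open>amap Gf ?c\<close>, but \<open>Qf\<close> applies
  \<open>Gf\<close> to \<open>amap Rf ?c\<close>. Naturality of \<open>rr\<close> exchanges the two
  up to equivalences between fibrant objects, and the remaining factor \<open>rr x\<close> of
  \<open>qq x\<close> is itself an equivalence.\<close>

lemma Q_qq:
  assumes o: "x \<in> ob N"
  shows "amap Qf (qq x) \<in> Eqv N"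
proof -
  let ?y = "omap Rf x"
  let ?z = "omap Rf (omap Gf ?y)"
  let ?c = "rr (omap Gf ?y) \<bullet> gi ?y"
  have o': "?y \<in> ob N" "omap Gf ?y \<in> ob N" using functor_ob[OF Rf o] functor_ob[OF Gf] by auto
  have F: "fibrant N ?y" "fibrant N ?z" using rr(4) o o' by auto
  have zo: "?z \<in> ob N" using fibrant_ob F by blast
  have c: "?c \<in> hom N ?y ?z" by (rule unit_hom[OF o'(1)])
  have Gc: "amap Gf ?c \<in> Eqv N" by (rule Gf_unit[OF F(1)])
  note Rc = Rf_map[OF c]
  have rE: "amap Gf (rr ?y) \<in> Eqv N" "amap Gf (rr ?z) \<in> Eqv N"
    using Gf_eqv[OF rr(1) rr(3) _ rr(4)] o'(1) zo F by auto
  have "amap Gf (amap Rf ?c) \<bullet> amap Gf (rr ?y) = amap Gf (rr ?z) \<bullet> amap Gf ?c"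
    using functor_comp[OF Gf Rc(1) rr(1)[OF o'(1)]] functor_comp[OF Gf rr(1)[OF zo] c] Rc(2) by simp
  moreover have "amap Gf (rr ?z) \<bullet> amap Gf ?c \<in> Eqv N"
    by (rule eqv_comp[OF Gf_map(2)[OF c] Gf_map(2)[OF rr(1)[OF zo]] Gc rE(2)])
  ultimately have 1: "amap Gf (amap Rf ?c) \<in> Eqv N"
    using eqv_cancel_right[OF Gf_map(2)[OF rr(1)[OF o'(1)]] Gf_map(2)[OF Rc(1)] rE(1)] by simp
  have "qq x = ?c \<bullet> rr x" using rr(1)[OF o] rr(1)[OF o'(2)] gi_hom[OF o'(1)] by (simp add: qq_def hom_def)
  then have "amap Qf (qq x) = amap Qf ?c \<bullet> amap Qf (rr x)"
    using functor_comp[OF Qf c rr(1)[OF o]] by simp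
  moreover have "amap Qf ?c \<in> Eqv N" using Rf_eqv[OF Gf_map(2)[OF Rc(1)] 1] by (simp add: Qf_simps)
  moreover have "amap Qf (rr x) \<in> Eqv N" by (rule Qf_eqv[OF rr(1,3)[OF o]])
  ultimately show ?thesis
    using eqv_comp[OF functor_hom[OF Qf rr(1)[OF o]] functor_hom[OF Qf c]] by simp
qed

end

section \<open>The localized semimodel structure\<close>

lemma functor_retract:
  assumes F: "is_functor C D F" and r: "retract_of C f g"
  shows "retract_of D (amap F f) (amap F g)"
proof -
  obtain i p j s where fg: "f \<in> arr C" "g \<in> arr C"
    and h: "i \<in> hom C (src C f) (src C g)" "p \<in> hom C (src C g) (src C f)"
    "j \<in> hom C (tgt C f) (tgt C g)" "s \<in> hom C (tgt C g) (tgt C f)"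
    and e: "p \<cdot>\<^bsub>C\<^esub> i = idn C (src C f)" "s \<cdot>\<^bsub>C\<^esub> j = idn C (tgt C f)" "g \<cdot>\<^bsub>C\<^esub> i = j \<cdot>\<^bsub>C\<^esub> f" "f \<cdot>\<^bsub>C\<^esub> p = s \<cdot>\<^bsub>C\<^esub> g"
    using r unfolding retract_of_def by blast
  interpret categ C using F by unfold_locales (simp add: is_functor_def)
  note f = hom_self[OF fg(1)] and g = hom_self[OF fg(2)]
  show ?thesis
    by (rule retract_ofI[OF functor_hom[OF F f] functor_hom[OF F g] functor_hom[OF F h(1)]
          functor_hom[OF F h(2)] functor_hom[OF F h(3)] functor_hom[OF F h(4)]])
      (simp_all add: e functor_id[OF F] fg
        functor_comp[OF F h(2,1), symmetric] functor_comp[OF F h(4,3), symmetric]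
        functor_comp[OF F g h(1), symmetric] functor_comp[OF F h(3) f, symmetric]
        functor_comp[OF F f h(2), symmetric] functor_comp[OF F h(4) g, symmetric])
qed

lemma factors_asI:
  assumes "i \<in> hom C x z" "p \<in> hom C z y" "i \<in> A" "p \<in> B" "p \<cdot>\<^bsub>C\<^esub> i = f" "f \<in> hom C x y"
  shows "factors_as C A B f"
  unfolding factors_as_def
  by (rule bexI[OF _ assms(3)], rule bexI[OF _ assms(4)]) (use assms in \<open>simp add: hom_def\<close>)

section \<open>Localized equivalences, and fibrations between local objects\<close>

context stab
begin

definition "EqL = {f \<in> arr N. amap Qf f \<in> Eqv N}"

text \<open>Fibrations are defined by lifting, so that closure under retracts and base change and
  the first lifting axiom come for free; what has to be proved is that there are enough of them for
  the factorizations.\<close>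

definition "FibL = {p \<in> arr N. \<forall>i\<in>Cof N \<inter> EqL. lifts_against N i p}"

lemma EqL_I: "f \<in> hom N x y \<Longrightarrow> amap Qf f \<in> Eqv N \<Longrightarrow> f \<in> EqL"
  by (auto simp: EqL_def hom_def)

lemma Eqv_EqL: "Eqv N \<subseteq> EqL"
  using Qf_eqv[OF hom_self] class_arr(2) by (auto simp: EqL_def)

lemma qq_EqL: "x \<in> ob N \<Longrightarrow> qq x \<in> EqL"
  using EqL_I[OF qq_hom Q_qq] .

lemma EqL_two_out_of_three: "two_out_of_three N EqL"
  unfolding two_out_of_three_def
proof (intro ballI impI)
  fix f g assume fg: "f \<in> arr N" "g \<in> arr N" "tgt N f = src N g"
  have f: "f \<in> hom N (src N f) (src N g)" and g: "g \<in> hom N (src N g) (tgt N g)"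
    using fg by (auto simp: hom_def)
  have "two_out_of_three N (Eqv N)" using model by (simp add: model_category_def)
  from two_out_of_threeD[OF this functor_hom[OF Qf f] functor_hom[OF Qf g]]
  show "(f \<in> EqL \<and> g \<in> EqL \<longrightarrow> g \<bullet> f \<in> EqL) \<and> (f \<in> EqL \<and> g \<bullet> f \<in> EqL \<longrightarrow> g \<in> EqL) \<and>
        (g \<in> EqL \<and> g \<bullet> f \<in> EqL \<longrightarrow> f \<in> EqL)"
    using functor_comp[OF Qf g f] fg by (simp add: EqL_def)
qed

lemma EqL_retract:
  assumes r: "retract_of N f g" and g: "g \<in> EqL"
  shows "f \<in> EqL"
proof -
  have "f \<in> arr N" using r by (simp add: retract_of_def)
  then show ?thesis using retract_classes(2)[OF functor_retract[OF Qf r]] g by (simp add: EqL_def)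
qed

lemmas EqL_comp = two_out_of_threeD(1)[OF EqL_two_out_of_three]
  and EqL_cancel_right = two_out_of_threeD(2)[OF EqL_two_out_of_three]
  and EqL_cancel_left = two_out_of_threeD(3)[OF EqL_two_out_of_three]

text \<open>By naturality of \<sigma>, \<open>\<sigma> x\<close> is a retract of
  \<open>\<sigma> y\<close>.\<close>

lemma local_retract:
  assumes i: "i \<in> hom N x y" and p: "p \<in> hom N y x" and e: "p \<bullet> i = idn N x" and y: "local y"
  shows "local x"
proof -
  have o: "x \<in> ob N" "y \<in> ob N" using i hom_ob by auto
  have "amap Th p \<bullet> amap Th i = idn N (omap Th x)"
    using functor_comp[OF Th p i] functor_id[OF Th o(1)] e by simp
  then have "retract_of N (\<sigma> x) (\<sigma> y)"
    by (intro retract_ofI[OF \<sigma>_hom[OF o(1)] \<sigma>_hom[OF o(2)] i p functor_hom[OF Th i] functor_hom[OF Th p] e]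
        \<sigma>_nat[OF i] \<sigma>_nat[OF p])
  then show ?thesis using y retract_classes(2) fibrant_retract[OF i p e] by (auto simp: local_def)
qed

lemma local_section:
  assumes j: "j \<in> hom N y z" "j \<in> Cof N" "j \<in> Eqv N" and y: "fibrant N y"
  obtains \<rho> where "\<rho> \<in> hom N z y" "\<rho> \<bullet> j = idn N y"
  using fibrant_extend[OF y j id_hom[OF fibrant_ob[OF y]]] by blast

text \<open>The fibrations between local objects lift against the local acyclic cofibrations
  \<open>i : A \<rightarrow> B\<close>: since \<open>Q i\<close> is an equivalence, the square obtained by applying \<open>Q\<close> to the given one
  has a filler up to replacement; it is transported back to \<open>p\<close> along \<open>p \<rightarrow> Q p\<close>, where pulling back
  along \<open>y \<rightarrow> Q y\<close> is avoided by retracting an acyclic cofibration out of the fibrant \<open>y\<close>, so that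
  no right properness is needed.\<close>

lemma local_fib_lift:
  assumes p: "p \<in> hom N x y" "p \<in> Fib N" and x: "local x" and y: "local y"
    and i: "i \<in> hom N A B" "i \<in> Cof N" "i \<in> EqL"
  shows "lifts_against N i p"
proof (rule liftsI[OF i(1) p(1)])
  fix u v assume u: "u \<in> hom N A x" and v: "v \<in> hom N B y" and s: "p \<bullet> u = v \<bullet> i"
  have o: "A \<in> ob N" "B \<in> ob N" "x \<in> ob N" "y \<in> ob N" using i p hom_ob by auto
  note q = qq_hom[OF o(1)] qq_hom[OF o(2)] qq_hom[OF o(3)] qq_hom[OF o(4)]
  note Qp = functor_hom[OF Qf p(1)] and Qi = functor_hom[OF Qf i(1)]
    and Qu = functor_hom[OF Qf u] and Qv = functor_hom[OF Qf v]
  have QiE: "amap Qf i \<in> Eqv N" using i(3) by (simp add: EqL_def)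
  have qE: "qq x \<in> Eqv N" "qq y \<in> Eqv N" using qq_local x y by auto
  have Qs: "amap Qf p \<bullet> amap Qf u = amap Qf v \<bullet> amap Qf i"
    using functor_comp[OF Qf p(1) u] functor_comp[OF Qf v i(1)] s by simp
  obtain G j0 p' where G: "j0 \<in> hom N (omap Qf x) G" "p' \<in> hom N G (omap Qf y)" "j0 \<in> Cof N"
    "j0 \<in> Eqv N" "p' \<in> Fib N" "p' \<bullet> j0 = amap Qf p" using factor_acof[OF Qp] by blast
  \<comment> \<open>\<open>Q i\<close> is an equivalence but has no lifting property. Splitting it
    into an acyclic cofibration \<open>k\<close> and an acyclic fibration \<open>\<pi>\<close> gives
    the filler in two pieces: \<open>i\<close> lifts against \<open>\<pi>\<close>, and
    \<open>k\<close> lifts against the fibration \<open>p'\<close> replacing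
    \<open>Q p\<close>.\<close>
  obtain D k \<pi> where D: "k \<in> hom N (omap Qf A) D" "\<pi> \<in> hom N D (omap Qf B)" "k \<in> Cof N"
    "k \<in> Eqv N" "\<pi> \<in> Fib N" "\<pi> \<bullet> k = amap Qf i" using factor_acof[OF Qi] by blast
  have \<pi>E: "\<pi> \<in> Eqv N" using eqv_cancel_right[OF D(1,2,4)] D(6) QiE by simp
  have "\<pi> \<bullet> k \<bullet> qq A = qq B \<bullet> i"
    using comp_ext[OF D(6), of "qq A"] D(1,2) q(1) qq_nat[OF i(1)] by (simp add: hom_def)
  then obtain w1 where w1: "w1 \<in> hom N B D" "w1 \<bullet> i = k \<bullet> qq A" "\<pi> \<bullet> w1 = qq B"
    by (rule liftsE[OF lift_afib[OF i(2) D(5) \<pi>E] i(1) D(2) comp_hom[OF D(1) q(1)] q(2)])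
  have "p' \<bullet> j0 \<bullet> amap Qf u = (amap Qf v \<bullet> \<pi>) \<bullet> k"
    using comp_ext[OF G(6), of "amap Qf u"] G(1,2) D(1,2) D(6) Qu Qv Qs by (simp add: hom_def)
  then obtain w2 where w2: "w2 \<in> hom N D G" "w2 \<bullet> k = j0 \<bullet> amap Qf u" "p' \<bullet> w2 = amap Qf v \<bullet> \<pi>"
    by (rule liftsE[OF lift_acof[OF D(3,4) G(5)] D(1) G(2) comp_hom[OF G(1) Qu] comp_hom[OF Qv D(2)]])
  have w: "w2 \<bullet> w1 \<in> hom N B G" by (rule comp_hom[OF w2(1) w1(1)])
  have pw: "p' \<bullet> w2 \<bullet> w1 = qq y \<bullet> v"
    using comp_ext[OF w2(3), of w1] w1(1,3) w2(1) G(2) D(2) Qv qq_nat[OF v] by (simp add: hom_def)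
  have wi: "(w2 \<bullet> w1) \<bullet> i = j0 \<bullet> qq x \<bullet> u"
    using comp_ext[OF w2(2), of "qq A"] w1(1,2) w2(1) i(1) D(1) G(1) Qu q qq_nat[OF u] by (simp add: hom_def)
  \<comment> \<open>As \<open>y\<close> is local, \<open>qq y\<close> is an equivalence, so
    \<open>a\<close> is an acyclic fibration and remains one after base change along
    \<open>p'\<close>.\<close>
  obtain Y1 j a where Y1: "j \<in> hom N y Y1" "a \<in> hom N Y1 (omap Qf y)" "j \<in> Cof N"
    "j \<in> Eqv N" "a \<in> Fib N" "a \<bullet> j = qq y" using factor_acof[OF q(4)] by blast
  have aE: "a \<in> Eqv N" using eqv_cancel_right[OF Y1(1,2,4)] Y1(6) qE by simp
  obtain a' b where sq: "pullback_square N a p' a' b" using pullback_ex[OF Y1(2) G(2)] by blast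
  let ?G1 = "src N a'"
  note pb = pullback_hom[OF sq Y1(2) G(2)]
  have a': "a' \<in> Eqv N" "a' \<in> Fib N" using afib_pullback[OF sq] fib_pullback[OF sq] Y1(5) aE by auto
  have "a \<bullet> j \<bullet> p = p' \<bullet> j0 \<bullet> qq x"
    using comp_ext[OF Y1(6), of p] comp_ext[OF G(6), of "qq x"] Y1(1,2) G(1,2) p(1) q qq_nat[OF p(1)]
    by (simp add: hom_def)
  then obtain n where n: "n \<in> hom N x ?G1" "b \<bullet> n = j \<bullet> p" "a' \<bullet> n = j0 \<bullet> qq x"
    using pullback_univ[OF sq Y1(2) G(2) comp_hom[OF Y1(1) p(1)] comp_hom[OF G(1) q(3)]] by blast
  have nE: "n \<in> Eqv N"
    using eqv_cancel_left[OF n(1) pb(1) a'(1)] n(3) eqv_comp[OF q(3) G(1) qE(1) G(4)] by simp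
  have "a \<bullet> j \<bullet> v = p' \<bullet> w2 \<bullet> w1"
    using comp_ext[OF Y1(6), of v] Y1(1,2) v pw by (simp add: hom_def)
  then obtain w' where w': "w' \<in> hom N B ?G1" "b \<bullet> w' = j \<bullet> v" "a' \<bullet> w' = w2 \<bullet> w1"
    using pullback_univ[OF sq Y1(2) G(2) comp_hom[OF Y1(1) v] w] by blast
  have w'i: "w' \<bullet> i = n \<bullet> u"
  proof (rule pullback_unique[OF sq Y1(2) G(2) comp_hom[OF w'(1) i(1)] comp_hom[OF n(1) u]])
    show "b \<bullet> w' \<bullet> i = b \<bullet> n \<bullet> u"
      using comp_ext[OF w'(2), of i] comp_ext[OF n(2), of u] w'(1) n(1) pb i(1) u v p(1) Y1(1) s
      by (simp add: hom_def)
    show "a' \<bullet> w' \<bullet> i = a' \<bullet> n \<bullet> u"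
      using comp_ext[OF w'(3), of i] comp_ext[OF n(3), of u] w'(1) n(1) pb i(1) u w1(1) w2(1) wi G(1) q
      by (simp add: hom_def)
  qed
  \<comment> \<open>The equivalence \<open>n\<close> need not be a fibration, so \<open>i\<close>
    cannot be lifted against it directly; it is lifted against the acyclic fibration
    \<open>\<pi>1\<close>, and the acyclic cofibration \<open>k1\<close> is undone later.\<close>
  obtain E1 k1 \<pi>1 where E1: "k1 \<in> hom N x E1" "\<pi>1 \<in> hom N E1 ?G1" "k1 \<in> Cof N"
    "k1 \<in> Eqv N" "\<pi>1 \<in> Fib N" "\<pi>1 \<bullet> k1 = n" using factor_acof[OF n(1)] by blast
  have \<pi>1E: "\<pi>1 \<in> Eqv N" using eqv_cancel_right[OF E1(1,2,4)] E1(6) nE by simp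
  have "\<pi>1 \<bullet> k1 \<bullet> u = w' \<bullet> i"
    using comp_ext[OF E1(6), of u] E1(1,2) u w'i by (simp add: hom_def)
  then obtain z where z: "z \<in> hom N B E1" "z \<bullet> i = k1 \<bullet> u" "\<pi>1 \<bullet> z = w'"
    by (rule liftsE[OF lift_afib[OF i(2) E1(5) \<pi>1E] i(1) E1(2) comp_hom[OF E1(1) u] w'(1)])
  have fy: "fibrant N y" using y by (simp add: local_def)
  obtain \<rho> where \<rho>: "\<rho> \<in> hom N Y1 y" "\<rho> \<bullet> j = idn N y" using local_section[OF Y1(1,3,4) fy] by blast
  \<comment> \<open>This square retracts the detour: \<open>\<rho>\<close> returns from
    \<open>Y1\<close> to \<open>y\<close>, and its lift \<open>g\<close> against the fibration
    \<open>p\<close> returns from \<open>E1\<close> to \<open>x\<close>.\<close>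
  have "p \<bullet> idn N x = (\<rho> \<bullet> b \<bullet> \<pi>1) \<bullet> k1"
  proof -
    have "(\<rho> \<bullet> b \<bullet> \<pi>1) \<bullet> k1 = \<rho> \<bullet> b \<bullet> n" using E1(1,2,6) \<rho>(1) pb(2) by (simp add: hom_def)
    also have "\<dots> = \<rho> \<bullet> j \<bullet> p" using n(2) by simp
    also have "\<dots> = p" using comp_ext[OF \<rho>(2), of p] \<rho>(1) Y1(1) p(1) by (simp add: hom_def)
    finally show ?thesis using p(1) by (simp add: hom_def)
  qed
  then obtain g where g: "g \<in> hom N E1 x" "g \<bullet> k1 = idn N x" "p \<bullet> g = \<rho> \<bullet> b \<bullet> \<pi>1"
    by (rule liftsE[OF lift_acof[OF E1(3,4) p(2)] E1(1) p(1) id_hom[OF o(3)]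
          comp_hom[OF \<rho>(1) comp_hom[OF pb(2) E1(2)]]])
  have "(g \<bullet> z) \<bullet> i = u"
    using comp_ext[OF g(2), of u] g(1) z(1,2) i(1) E1(1) u by (simp add: hom_def)
  moreover have "p \<bullet> g \<bullet> z = v"
  proof -
    have "p \<bullet> g \<bullet> z = \<rho> \<bullet> b \<bullet> w'"
      using comp_ext[OF g(3), of z] g(1) z(1,3) p(1) \<rho>(1) pb(2) E1(2) by (simp add: hom_def)
    also have "\<dots> = \<rho> \<bullet> j \<bullet> v" using w'(2) by simp
    also have "\<dots> = v" using comp_ext[OF \<rho>(2), of v] \<rho>(1) Y1(1) v by (simp add: hom_def)
    finally show ?thesis .
  qed
  ultimately show "\<exists>h. h \<in> hom N B x \<and> h \<bullet> i = u \<and> p \<bullet> h = v"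
    using comp_hom[OF g(1) z(1)] by blast
qed

text \<open>\<open>z\<close> is obtained by factoring \<open>qq x\<close> and is acyclically fibred
  over the local \<open>omap Qf x\<close>. For \<open>f\<close> into a local \<open>y\<close>, the
  map \<open>amap Qf f \<bullet> \<pi>\<close> already extends \<open>f\<close> after composition
  with \<open>qq y\<close>. Of the two factors of \<open>qq y\<close>, the acyclic fibration
  \<open>a\<close> admits a lift and the acyclic cofibration \<open>j\<close> has a retraction
  because \<open>y\<close> is fibrant.\<close>

lemma local_replacement:
  assumes o: "x \<in> ob N"
  obtains z i where "i \<in> hom N x z" "i \<in> Cof N" "i \<in> EqL" "local z"
    "\<And>f y. f \<in> hom N x y \<Longrightarrow> local y \<Longrightarrow> \<exists>g. g \<in> hom N z y \<and> g \<bullet> i = f"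
proof -
  obtain z i \<pi> where z: "i \<in> hom N x z" "\<pi> \<in> hom N z (omap Qf x)" "i \<in> Cof N" "\<pi> \<in> Fib N"
    "\<pi> \<in> Eqv N" "\<pi> \<bullet> i = qq x" using factor_afib[OF qq_hom[OF o]] by blast
  have iL: "i \<in> EqL" using EqL_cancel_left[OF z(1,2)] z(5,6) Eqv_EqL qq_EqL[OF o] by auto
  have Ql: "local (omap Qf x)" by (rule Q_local[OF o])
  then have "fibrant N z" using fib_fibrant[OF z(2,4)] by (simp add: local_def)
  then have zl: "local z" using local_eqv'[OF z(2,5) Ql] by blast
  have "\<exists>g. g \<in> hom N z y \<and> g \<bullet> i = f" if f: "f \<in> hom N x y" and y: "local y" for f y
  proof -
    have fy: "fibrant N y" "y \<in> ob N" using y fibrant_ob by (auto simp: local_def)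
    obtain Y1 j a where Y1: "j \<in> hom N y Y1" "a \<in> hom N Y1 (omap Qf y)" "j \<in> Cof N"
      "j \<in> Eqv N" "a \<in> Fib N" "a \<bullet> j = qq y" using factor_acof[OF qq_hom[OF fy(2)]] by blast
    have aE: "a \<in> Eqv N" using eqv_cancel_right[OF Y1(1,2,4)] Y1(6) qq_local[OF y] by simp
    note Qf' = functor_hom[OF Qf f]
    have "a \<bullet> j \<bullet> f = (amap Qf f \<bullet> \<pi>) \<bullet> i"
      using comp_ext[OF Y1(6), of f] Y1(1,2) f z(1,2,6) Qf' qq_nat[OF f] by (simp add: hom_def)
    then obtain h where h: "h \<in> hom N z Y1" "h \<bullet> i = j \<bullet> f"
      by (rule liftsE[OF lift_afib[OF z(3) Y1(5) aE] z(1) Y1(2) comp_hom[OF Y1(1) f] comp_hom[OF Qf' z(2)]])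
    obtain \<rho> where \<rho>: "\<rho> \<in> hom N Y1 y" "\<rho> \<bullet> j = idn N y" using local_section[OF Y1(1,3,4) fy(1)] by blast
    have "(\<rho> \<bullet> h) \<bullet> i = f"
      using comp_ext[OF \<rho>(2), of f] \<rho>(1) h z(1) Y1(1) f by (simp add: hom_def)
    then show ?thesis using comp_hom[OF \<rho>(1) h(1)] by blast
  qed
  with z(1,3) iL zl show ?thesis by (rule that)
qed

lemma FibL_I: "p \<in> hom N x y \<Longrightarrow> p \<in> Fib N \<Longrightarrow> local x \<Longrightarrow> local y \<Longrightarrow> p \<in> FibL"
  using local_fib_lift[OF _ _ _ _ hom_self] class_arr by (auto simp: FibL_def)

text \<open>Extending \<open>f\<close> over a local \<open>z\<close> before factoring is what makes
  the middle object local: it is equivalent to \<open>z\<close> and fibred over the fibrant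
  \<open>y\<close>.\<close>

lemma local_factor:
  assumes f: "f \<in> hom N x y" and y: "local y"
  obtains z i p where "i \<in> hom N x z" "p \<in> hom N z y" "i \<in> Cof N" "i \<in> EqL" "local z" "p \<in> Fib N" "p \<bullet> i = f"
proof -
  have o: "x \<in> ob N" using f hom_ob by blast
  obtain z i where z: "i \<in> hom N x z" "i \<in> Cof N" "i \<in> EqL" "local z"
    and ex: "\<And>f y. f \<in> hom N x y \<Longrightarrow> local y \<Longrightarrow> \<exists>g. g \<in> hom N z y \<and> g \<bullet> i = f"
    using local_replacement[OF o] by metis
  obtain g where g: "g \<in> hom N z y" "g \<bullet> i = f" using ex[OF f y] by blast
  obtain e k p where e: "k \<in> hom N z e" "p \<in> hom N e y" "k \<in> Cof N" "k \<in> Eqv N" "p \<in> Fib N" "p \<bullet> k = g"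
    using factor_acof[OF g(1)] by blast
  have "fibrant N e" using fib_fibrant[OF e(2,5)] y by (simp add: local_def)
  then have el: "local e" using local_eqv[OF e(1,4) z(4)] by blast
  have "k \<bullet> i \<in> EqL" using EqL_comp[OF z(1) e(1) z(3)] e(4) Eqv_EqL by blast
  moreover have "p \<bullet> k \<bullet> i = f"
    using comp_ext[OF e(6), of i] e(1,2) z(1) g by (simp add: hom_def)
  ultimately show ?thesis
    using that[OF comp_hom[OF e(1) z(1)] e(2) cof_comp[OF z(1) e(1) z(2) e(3)] _ el e(5)] by blast
qed

text \<open>A localized fibration to \<open>t\<close> lifts against the first factor of its own
  \<open>local_factor\<close> factorization, so its source is a retract of a local object.\<close>

lemma FibL_iff_terminal:
  assumes t: "terminal N t" and f: "f \<in> hom N x t"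
  shows "f \<in> FibL \<longleftrightarrow> local x"
proof -
  \<comment> \<open>\<open>t\<close> is a retract of its local replacement, since every endomorphism
    of a terminal object is the identity.\<close>
  have tl: "local t"
  proof -
    have to: "t \<in> ob N" using t by (simp add: terminal_def)
    obtain z i where z: "i \<in> hom N t z" "local z" using local_replacement[OF to] by metis
    obtain g where g: "g \<in> hom N z t" using terminal_hom[OF t] z(1) hom_ob(2) by blast
    have "g \<bullet> i = idn N t" by (rule terminal_unique[OF t comp_hom[OF g z(1)] id_hom[OF to]])
    then show ?thesis by (rule local_retract[OF z(1) g _ z(2)])
  qed
  show ?thesis
  proof
    assume fF: "f \<in> FibL"
    obtain z i p where z: "i \<in> hom N x z" "p \<in> hom N z t" "i \<in> Cof N" "i \<in> EqL" "local z" "p \<bullet> i = f"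
      using local_factor[OF f tl] by metis
    have "lifts_against N i f" using fF z by (simp add: FibL_def)
    moreover have "f \<bullet> idn N x = p \<bullet> i" using f z by (simp add: hom_def)
    ultimately obtain h where "h \<in> hom N z x" "h \<bullet> i = idn N x"
      using liftsE[OF _ z(1) f id_hom[OF hom_ob(1)[OF f]] z(2)] by metis
    then show "local x" using local_retract[OF z(1) _ _ z(5)] by blast
  next
    assume x: "local x"
    then have "f \<in> Fib N" using fibrant_terminal[OF t f] by (simp add: local_def)
    then show "f \<in> FibL" by (rule FibL_I[OF f _ x tl])
  qed
qed

text \<open>The first factor of a localized acyclic fibration is a cofibration in
  \<open>EqL\<close>, so the retract argument applies. Hence localization leaves the weak
  factorization system of cofibrations and acyclic fibrations unchanged, which gives the coSpitzweck
  condition.\<close>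

lemma afib_L: "FibL \<inter> EqL = Fib N \<inter> Eqv N"
proof (intro set_eqI iffI)
  fix p assume p: "p \<in> Fib N \<inter> Eqv N"
  then show "p \<in> FibL \<inter> EqL" using lift_afib Eqv_EqL class_arr by (auto simp: FibL_def)
next
  fix p assume p: "p \<in> FibL \<inter> EqL"
  then have pa: "p \<in> arr N" by (simp add: FibL_def)
  obtain z j q where z: "j \<in> hom N (src N p) z" "q \<in> hom N z (tgt N p)" "j \<in> Cof N" "q \<in> Fib N"
    "q \<in> Eqv N" "q \<bullet> j = p" using factor_afib[OF hom_self[OF pa]] by metis
  have "j \<in> EqL" using EqL_cancel_left[OF z(1,2)] z(5,6) Eqv_EqL p by auto
  then have "lifts_against N j (q \<bullet> j)" using p z by (simp add: FibL_def)
  then have "retract_of N (q \<bullet> j) q" by (rule retract_right[OF z(1,2)])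
  then show "p \<in> Fib N \<inter> Eqv N" using retract_classes z by auto
qed

section \<open>The localized structure, its axioms and its universal property\<close>

definition "Loc = N\<lparr>Eqv := EqL, Fib := FibL\<rparr>"

lemma Loc_simps [simp]:
  "ob Loc = ob N" "arr Loc = arr N" "src Loc = src N" "tgt Loc = tgt N" "idn Loc = idn N" "cmp Loc = cmp N"
  "Cof Loc = Cof N" "Eqv Loc = EqL" "Fib Loc = FibL"
  by (simp_all add: Loc_def)

text \<open>Notions that read only the category fields cannot distinguish \<open>Loc\<close> from
  \<open>N\<close>; the transfer is made once here.\<close>

lemma Loc_defs [simp]:
  "hom Loc = hom N" "category Loc = category N" "is_functor J Loc D = is_functor J N D"
  "is_functor Loc E F = is_functor N E F"
  "limit_cone J Loc D c \<pi> = limit_cone J N D c \<pi>" "colimit_cocone J Loc D c \<iota> = colimit_cocone J N D c \<iota>"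
  "lifts_against Loc = lifts_against N" "retract_of Loc = retract_of N" "terminal Loc = terminal N"
  "pushout_square Loc = pushout_square N" "pullback_square Loc = pullback_square N"
  "factors_as Loc = factors_as N"
proof -
  show h: "hom Loc = hom N" by (intro ext) (simp add: hom_def)
  show c: "category Loc = category N" by (simp add: category_def h)
  show "is_functor J Loc D = is_functor J N D" for J :: "('j, 'k, 'y) cat_scheme" and D
    by (simp add: is_functor_def h c)
  show "is_functor Loc E F = is_functor N E F" by (simp add: is_functor_def h c)
  show "limit_cone J Loc D c \<pi> = limit_cone J N D c \<pi>" "colimit_cocone J Loc D c \<iota> = colimit_cocone J N D c \<iota>"
    by (simp_all add: limit_cone_def colimit_cocone_def cone_def cocone_def h)
  show "lifts_against Loc = lifts_against N" "retract_of Loc = retract_of N" "terminal Loc = terminal N"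
    "pushout_square Loc = pushout_square N" "pullback_square Loc = pullback_square N"
    "factors_as Loc = factors_as N"
    by (intro ext; simp add: lifts_against_def retract_of_def terminal_def pushout_square_def
        pullback_square_def factors_as_def h)+
qed

lemma bicomplete_Loc: "bicomplete U Loc"
  using bicomplete by (simp add: bicomplete_def)

lemma fibrant_Loc: "fibrant Loc x \<longleftrightarrow> local x"
proof
  assume "fibrant Loc x"
  then obtain t f where "terminal N t" "f \<in> hom N x t" "f \<in> FibL" by (auto simp: fibrant_def)
  then show "local x" using FibL_iff_terminal by blast
next
  assume x: "local x"
  then have o: "x \<in> ob N" using fibrant_ob by (simp add: local_def)
  have "bang x \<in> FibL" using FibL_iff_terminal[OF pt bang_hom[OF o]] x by blast
  then show "fibrant Loc x" using o pt bang_hom[OF o] by (auto simp: fibrant_def)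
qed

lemma Loc_semimodel: "right_semimodel_category U Loc"
  unfolding right_semimodel_category_def
proof (intro conjI)
  show "bicomplete U Loc" by (rule bicomplete_Loc)
  show "Cof Loc \<subseteq> arr Loc" "Eqv Loc \<subseteq> arr Loc" "Fib Loc \<subseteq> arr Loc"
    using class_arr by (auto simp: EqL_def FibL_def)
  show "closed_under_retracts Loc (Eqv Loc)" using EqL_retract unfolding closed_under_retracts_def Loc_simps Loc_defs by blast
  show "two_out_of_three Loc (Eqv Loc)" using EqL_two_out_of_three unfolding two_out_of_three_def Loc_simps .
  show "closed_under_retracts Loc (Cof Loc)" using closed_retracts(1) unfolding closed_under_retracts_def Loc_simps Loc_defs .
  show "closed_under_pushouts Loc (Cof Loc)" using cof_pushout unfolding closed_under_pushouts_def Loc_simps Loc_defs by blast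
  show "closed_under_retracts Loc (Fib Loc)"
  proof -
    have "f \<in> FibL" if g: "g \<in> FibL" and r: "retract_of N f g" for f g
    proof -
      have "f \<in> arr N" using r by (simp add: retract_of_def)
      then show ?thesis using g lifts_retract_right[OF r class_arr(1)] by (simp add: FibL_def)
    qed
    then show ?thesis unfolding closed_under_retracts_def Loc_simps Loc_defs by blast
  qed
  show "closed_under_pullbacks Loc (Fib Loc)"
  proof -
    have "f' \<in> FibL" if f: "f \<in> FibL" and r: "pullback_square N f g f' g'" for f g f' g'
    proof -
      have "f' \<in> arr N" using r by (simp add: pullback_square_def)
      then show ?thesis using f lifts_pullback[OF r class_arr(1)] by (simp add: FibL_def)
    qed
    then show ?thesis unfolding closed_under_pullbacks_def Loc_simps Loc_defs by blast
  qed
  show "\<forall>i\<in>Cof Loc \<inter> Eqv Loc. \<forall>p\<in>Fib Loc. fibrant Loc (tgt Loc p) \<longrightarrow> lifts_against Loc i p"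
    by (auto simp: FibL_def)
  show "\<forall>i\<in>Cof Loc. \<forall>p\<in>Fib Loc \<inter> Eqv Loc. fibrant Loc (tgt Loc p) \<longrightarrow> lifts_against Loc i p"
    using lift_afib by (auto simp: afib_L)
  show "\<forall>t. terminal Loc t \<longrightarrow> fibrant Loc t"
  proof (intro allI impI)
    fix t assume "terminal Loc t"
    then have t: "terminal N t" "t \<in> ob N" by (auto simp: terminal_def)
    have "idn N t \<in> FibL" using lifts_id_right[OF t(2)] class_arr t(2) by (auto simp: FibL_def)
    then show "fibrant Loc t" using FibL_iff_terminal[OF t(1) id_hom[OF t(2)]] fibrant_Loc by blast
  qed
  show "\<forall>f\<in>arr Loc. fibrant Loc (tgt Loc f) \<longrightarrow>
      factors_as Loc (Cof Loc \<inter> Eqv Loc) (Fib Loc) f \<and> factors_as Loc (Cof Loc) (Fib Loc \<inter> Eqv Loc) f"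
  proof (intro ballI impI)
    fix f assume "f \<in> arr Loc" and "fibrant Loc (tgt Loc f)"
    then have f: "f \<in> hom N (src N f) (tgt N f)" and y: "local (tgt N f)" by (auto simp: fibrant_Loc hom_def)
    obtain z i p where z: "i \<in> hom N (src N f) z" "p \<in> hom N z (tgt N f)" "i \<in> Cof N" "i \<in> EqL"
      "local z" "p \<in> Fib N" "p \<bullet> i = f" using local_factor[OF f y] by metis
    have "p \<in> FibL" by (rule FibL_I[OF z(2,6,5) y])
    then have 1: "factors_as Loc (Cof Loc \<inter> Eqv Loc) (Fib Loc) f"
      using factors_asI[OF z(1,2), of "Cof N \<inter> EqL" FibL] z(3,4,7) f by (simp add: factors_as_def)
    obtain e k q where e: "k \<in> hom N (src N f) e" "q \<in> hom N e (tgt N f)" "k \<in> Cof N" "q \<in> Fib N" "q \<in> Eqv N"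
      "q \<bullet> k = f" using factor_afib[OF f] by metis
    have "factors_as Loc (Cof Loc) (Fib Loc \<inter> Eqv Loc) f"
      using factors_asI[OF e(1,2), of "Cof N" "Fib N \<inter> Eqv N"] e(3-6) f
      by (simp add: factors_as_def afib_L)
    with 1 show "factors_as Loc (Cof Loc \<inter> Eqv Loc) (Fib Loc) f \<and>
      factors_as Loc (Cof Loc) (Fib Loc \<inter> Eqv Loc) f" by blast
  qed
qed

lemma coSpitzweck_Loc: "coSpitzweck U Loc"
proof -
  have "Cof N = {i \<in> arr N. \<forall>p\<in>Fib N \<inter> Eqv N. lifts_against N i p}" using cof_iff by auto
  moreover have "Fib N \<inter> Eqv N = {p \<in> arr N. \<forall>i\<in>Cof N. lifts_against N i p}" using afib_iff by auto
  moreover have "\<forall>f\<in>arr N. factors_as N (Cof N) (Fib N \<inter> Eqv N) f"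
    using model by (simp add: model_category_def)
  ultimately have "weak_factorization_system N (Cof N) (Fib N \<inter> Eqv N)"
    unfolding weak_factorization_system_def by blast
  moreover have "weak_factorization_system Loc A B = weak_factorization_system N A B" for A B
    by (simp only: weak_factorization_system_def Loc_simps Loc_defs)
  ultimately show ?thesis using Loc_semimodel by (simp add: coSpitzweck_def afib_L)
qed

lemma Loc_left_Quillen: "left_Quillen U N Loc id_ftr"
proof -
  have "is_functor N N id_ftr" using category by (auto simp: is_functor_def id_ftr_def hom_def)
  moreover have "nat_trans N N id_ftr (comp_ftr id_ftr id_ftr) (idn N)"
    "nat_trans Loc Loc (comp_ftr id_ftr id_ftr) id_ftr (idn N)"
    using id_hom by (auto simp: nat_trans_def id_ftr_def comp_ftr_def)
  ultimately have "adjunction N Loc id_ftr id_ftr (idn N) (idn N)"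
    by (simp add: adjunction_def id_ftr_def)
  moreover have "preserves_cofibrations N Loc id_ftr"
    using Eqv_EqL by (auto simp: preserves_cofibrations_def id_ftr_def)
  ultimately show ?thesis
    unfolding left_Quillen_def using right_semimodel Loc_semimodel by blast
qed

text \<open>The category and the cofibrations are those of \<open>N\<close>, so the adjunction of
  \<open>F\<close> serves unchanged; only the new acyclic cofibrations are at stake, and they lie in
  \<open>EqL\<close>.\<close>

lemma Loc_Quillen_factor:
  assumes F: "left_Quillen U N E F" and FE: "amap F ` EqL \<subseteq> Eqv E"
  shows "left_Quillen U Loc E F"
proof -
  obtain G \<eta> \<epsilon> where "adjunction N E F G \<eta> \<epsilon>" using F by (auto simp: left_Quillen_def)
  then have "adjunction Loc E F G \<eta> \<epsilon>" by (simp add: adjunction_def nat_trans_def)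
  moreover have "preserves_cofibrations Loc E F"
    using F FE by (auto simp: left_Quillen_def preserves_cofibrations_def)
  ultimately show ?thesis using F Loc_semimodel by (auto simp: left_Quillen_def)
qed

lemma Loc_Ho:
  "equivalence_of_categories (full_subcategory (Ho N) {x. local x}) (Ho Loc) (Ho_comparison Loc)"
proof (rule Q.Ho_comparison_equivalence)
  show "Eqv N \<subseteq> Eqv Loc" using Eqv_EqL by simp
  show "amap Qf ` Eqv Loc \<subseteq> Eqv N" by (auto simp: EqL_def)
  show "{x. local x} \<subseteq> ob N" using fibrant_ob by (auto simp: local_def)
qed (auto simp: qq_EqL qq_local Q_local)

end

section \<open>Prespectra: limits and colimits\<close>

lemma limit_ext:
  assumes l: "limit_cone J C D c \<pi>" and D: "is_functor J C D"
    and h: "h \<in> hom C d c" "h' \<in> hom C d c" and e: "\<And>j. j \<in> ob J \<Longrightarrow> \<pi> j \<cdot>\<^bsub>C\<^esub> h = \<pi> j \<cdot>\<^bsub>C\<^esub> h'"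
  shows "h = h'"
proof -
  interpret C: categ C using D by unfold_locales (simp add: is_functor_def)
  interpret J: categ J using D by unfold_locales (simp add: is_functor_def)
  have c: "\<pi> j \<in> hom C c (omap D j)" if "j \<in> ob J" for j using l that by (simp add: limit_cone_def cone_def)
  have "cone J C D d (\<lambda>j. \<pi> j \<cdot>\<^bsub>C\<^esub> h')"
    unfolding cone_def
  proof (intro conjI ballI)
    show "d \<in> ob C" using h C.hom_ob by blast
    show "\<pi> j \<cdot>\<^bsub>C\<^esub> h' \<in> hom C d (omap D j)" if "j \<in> ob J" for j by (rule C.comp_hom[OF c[OF that] h(2)])
    fix k assume k: "k \<in> arr J"
    have "amap D k \<cdot>\<^bsub>C\<^esub> \<pi> (src J k) = \<pi> (tgt J k)" using l k by (simp add: limit_cone_def cone_def)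
    then show "amap D k \<cdot>\<^bsub>C\<^esub> \<pi> (src J k) \<cdot>\<^bsub>C\<^esub> h' = \<pi> (tgt J k) \<cdot>\<^bsub>C\<^esub> h'"
      using C.comp_ext[of "amap D k" "\<pi> (src J k)" _ h'] functor_hom[OF D J.hom_self[OF k]]
        c[of "src J k"] h(2) k by (simp add: hom_def)
  qed
  then have "\<exists>!g. g \<in> hom C d c \<and> (\<forall>j\<in>ob J. \<pi> j \<cdot>\<^bsub>C\<^esub> g = \<pi> j \<cdot>\<^bsub>C\<^esub> h')"
    using l unfolding limit_cone_def by blast
  then show ?thesis using h e by blast
qed

lemma colimit_ext:
  assumes l: "colimit_cocone J C D c \<iota>" and D: "is_functor J C D"
    and h: "h \<in> hom C c d" "h' \<in> hom C c d" and e: "\<And>j. j \<in> ob J \<Longrightarrow> h \<cdot>\<^bsub>C\<^esub> \<iota> j = h' \<cdot>\<^bsub>C\<^esub> \<iota> j"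
  shows "h = h'"
proof -
  interpret C: categ C using D by unfold_locales (simp add: is_functor_def)
  interpret J: categ J using D by unfold_locales (simp add: is_functor_def)
  have c: "\<iota> j \<in> hom C (omap D j) c" if "j \<in> ob J" for j
    using l that by (simp add: colimit_cocone_def cocone_def)
  have "cocone J C D d (\<lambda>j. h' \<cdot>\<^bsub>C\<^esub> \<iota> j)"
    unfolding cocone_def
  proof (intro conjI ballI)
    show "d \<in> ob C" using h C.hom_ob by blast
    show "h' \<cdot>\<^bsub>C\<^esub> \<iota> j \<in> hom C (omap D j) d" if "j \<in> ob J" for j by (rule C.comp_hom[OF h(2) c[OF that]])
    fix k assume k: "k \<in> arr J"
    have "\<iota> (tgt J k) \<cdot>\<^bsub>C\<^esub> amap D k = \<iota> (src J k)" using l k by (simp add: colimit_cocone_def cocone_def)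
    then show "(h' \<cdot>\<^bsub>C\<^esub> \<iota> (tgt J k)) \<cdot>\<^bsub>C\<^esub> amap D k = h' \<cdot>\<^bsub>C\<^esub> \<iota> (src J k)"
      using functor_hom[OF D J.hom_self[OF k]] c[of "tgt J k"] h(2) k by (simp add: hom_def)
  qed
  then have "\<exists>!g. g \<in> hom C c d \<and> (\<forall>j\<in>ob J. g \<cdot>\<^bsub>C\<^esub> \<iota> j = h' \<cdot>\<^bsub>C\<^esub> \<iota> j)"
    using l unfolding colimit_cocone_def by blast
  then show ?thesis using h e by blast
qed

lemma (in categ) seq_colimit_iso:
  assumes c: "seq_colimit C X s c \<iota>" and s: "is_seq C X s"
    and h: "h \<in> hom C c d" and k: "k \<in> hom C d c"
    and e: "k \<bullet> h = idn C c" "h \<bullet> k = idn C d" and \<kappa>: "\<And>i. h \<bullet> \<iota> i = \<kappa> i"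
  shows "seq_colimit C X s d \<kappa>"
proof -
  have co: "\<iota> i \<in> hom C (X i) c" "\<iota> (Suc i) \<bullet> s i = \<iota> i" "s i \<in> hom C (X i) (X (Suc i))" for i
    using c s by (auto simp: seq_colimit_def seq_cocone_def is_seq_def)
  have \<kappa>h: "\<kappa> i \<in> hom C (X i) d" for i using comp_hom[OF h co(1)] \<kappa> by metis
  have \<kappa>s: "\<kappa> (Suc i) \<bullet> s i = \<kappa> i" for i
    using co[of i] co(1)[of "Suc i"] h by (simp add: hom_def flip: \<kappa>)
  have k\<kappa>: "k \<bullet> \<kappa> i = \<iota> i" for i
    using comp_ext[OF e(1), of "\<iota> i"] h k co(1)[of i] by (simp add: hom_def flip: \<kappa>)
  have "\<exists>!g. g \<in> hom C d x \<and> (\<forall>i. g \<bullet> \<kappa> i = \<mu> i)" if x: "seq_cocone C X s x \<mu>" for x \<mu>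
  proof -
    obtain g where g: "g \<in> hom C c x" "\<And>i. g \<bullet> \<iota> i = \<mu> i" using seq_colimit_univ[OF c x] by blast
    have "(g \<bullet> k) \<bullet> \<kappa> i = \<mu> i" for i using g k k\<kappa>[of i] \<kappa>h[of i] by (simp add: hom_def)
    moreover have "g' = g \<bullet> k" if g': "g' \<in> hom C d x" "\<forall>i. g' \<bullet> \<kappa> i = \<mu> i" for g'
    proof -
      have "g' \<bullet> h = g"
      proof (rule seq_colimit_unique[OF c comp_hom[OF g'(1) h] g(1) _ s])
        fix i show "(g' \<bullet> h) \<bullet> \<iota> i = g \<bullet> \<iota> i" using g g' h co(1)[of i] \<kappa> by (simp add: hom_def)
      qed
      moreover have "(g' \<bullet> h) \<bullet> k = g'" using g'(1) h k e(2) by (simp add: hom_def)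
      ultimately show ?thesis by simp
    qed
    ultimately show ?thesis using comp_hom[OF g(1) k] by blast
  qed
  then show ?thesis
    unfolding seq_colimit_def seq_cocone_def using hom_ob(2)[OF h] \<kappa>h \<kappa>s by auto
qed

section \<open>Transposition along the adjunction of \<open>T\<close> and \<Omega>\<close>

locale spt = model_cat M U for M :: "('o, 'a, 'z) mcat_scheme" and U :: "'u itself" +
  fixes T \<Omega> :: "('o, 'a, 'o, 'a) ftr" and \<eta> \<epsilon> :: "'o \<Rightarrow> 'a"
  assumes adj: "adjunction M M T \<Omega> \<eta> \<epsilon>" and T_cof: "preserves_cofibrations M M T"
begin

notation comp (infixr "\<bullet>" 65)

lemma T: "is_functor M M T" and Om: "is_functor M M \<Omega>"
  using adj by (auto simp: adjunction_def)

lemmas T_hom = functor_hom[OF T] and T_comp = functor_comp[OF T] and T_id = functor_id[OF T]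
  and T_ob = functor_ob[OF T]
lemmas Om_hom = functor_hom[OF Om] and Om_comp = functor_comp[OF Om] and Om_id = functor_id[OF Om]
  and Om_ob = functor_ob[OF Om]

lemma \<eta>_hom: "x \<in> ob M \<Longrightarrow> \<eta> x \<in> hom M x (omap \<Omega> (omap T x))"
  and \<epsilon>_hom: "x \<in> ob M \<Longrightarrow> \<epsilon> x \<in> hom M (omap T (omap \<Omega> x)) x"
  and triangle1: "x \<in> ob M \<Longrightarrow> \<epsilon> (omap T x) \<bullet> amap T (\<eta> x) = idn M (omap T x)"
  and triangle2: "x \<in> ob M \<Longrightarrow> amap \<Omega> (\<epsilon> x) \<bullet> \<eta> (omap \<Omega> x) = idn M (omap \<Omega> x)"
  using adj by (auto simp: adjunction_def nat_trans_def id_ftr_def comp_ftr_def)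

lemma \<eta>_nat: "f \<in> hom M x y \<Longrightarrow> \<eta> y \<bullet> f = amap \<Omega> (amap T f) \<bullet> \<eta> x"
  and \<epsilon>_nat: "f \<in> hom M x y \<Longrightarrow> \<epsilon> y \<bullet> amap T (amap \<Omega> f) = f \<bullet> \<epsilon> x"
  using adj by (auto simp: adjunction_def nat_trans_def id_ftr_def comp_ftr_def hom_def)

definition "adjoint x f = amap \<Omega> f \<bullet> \<eta> x"

lemma adjoint_hom: "x \<in> ob M \<Longrightarrow> f \<in> hom M (omap T x) y \<Longrightarrow> adjoint x f \<in> hom M x (omap \<Omega> y)"
  unfolding adjoint_def by (rule comp_hom[OF Om_hom \<eta>_hom])

lemma adjoint_inverse:
  assumes x: "x \<in> ob M" and f: "f \<in> hom M (omap T x) y"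
  shows "\<epsilon> y \<bullet> amap T (adjoint x f) = f"
proof -
  have y: "y \<in> ob M" using f hom_ob by blast
  note h = T_hom[OF \<eta>_hom[OF x]] T_hom[OF Om_hom[OF f]] \<epsilon>_hom[OF y] \<epsilon>_hom[OF T_ob[OF x]]
  have "\<epsilon> y \<bullet> amap T (adjoint x f) = \<epsilon> y \<bullet> amap T (amap \<Omega> f) \<bullet> amap T (\<eta> x)"
    using T_comp[OF Om_hom[OF f] \<eta>_hom[OF x]] by (simp add: adjoint_def)
  also have "\<dots> = f \<bullet> \<epsilon> (omap T x) \<bullet> amap T (\<eta> x)"
    using comp_ext[OF \<epsilon>_nat[OF f], of "amap T (\<eta> x)"] h f by (simp add: hom_def)
  also have "\<dots> = f" using triangle1[OF x] f by (simp add: hom_def)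
  finally show ?thesis .
qed

lemma adjoint_inj:
  "x \<in> ob M \<Longrightarrow> f \<in> hom M (omap T x) y \<Longrightarrow> g \<in> hom M (omap T x) y \<Longrightarrow>
   adjoint x f = adjoint x g \<Longrightarrow> f = g"
  using adjoint_inverse by metis

lemma adjoint_surj:
  assumes x: "x \<in> ob M" and y: "y \<in> ob M" and g: "g \<in> hom M x (omap \<Omega> y)"
  shows "adjoint x (\<epsilon> y \<bullet> amap T g) = g"
proof -
  note h = \<eta>_hom[OF x] Om_hom[OF T_hom[OF g]] Om_hom[OF \<epsilon>_hom[OF y]] \<eta>_hom[OF Om_ob[OF y]]
  have "adjoint x (\<epsilon> y \<bullet> amap T g) = amap \<Omega> (\<epsilon> y) \<bullet> amap \<Omega> (amap T g) \<bullet> \<eta> x"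
    using Om_comp[OF \<epsilon>_hom[OF y] T_hom[OF g]] h by (simp add: adjoint_def hom_def)
  also have "\<dots> = amap \<Omega> (\<epsilon> y) \<bullet> \<eta> (omap \<Omega> y) \<bullet> g" using \<eta>_nat[OF g] by simp
  also have "\<dots> = g" using comp_ext[OF triangle2[OF y], of g] h g by (simp add: hom_def)
  finally show ?thesis .
qed

lemma adjoint_natural:
  assumes x: "x' \<in> ob M" and f: "f \<in> hom M (omap T x') y" and g: "g \<in> hom M x x'"
  shows "adjoint x (f \<bullet> amap T g) = adjoint x' f \<bullet> g"
proof -
  have xo: "x \<in> ob M" using g hom_ob by blast
  show ?thesis
    unfolding adjoint_def
    using Om_comp[OF f T_hom[OF g]] \<eta>_nat[OF g] Om_hom[OF f] Om_hom[OF T_hom[OF g]] \<eta>_hom[OF x]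
      \<eta>_hom[OF xo] g by (simp add: hom_def)
qed

text \<open>Left adjoints preserve colimits: a cocone on the \<open>T\<close>-image transposes to a
  cocone on the diagram. The structure maps of a levelwise colimit of prespectra start at
  \<open>T\<close> of a colimit.\<close>

lemma T_colimit:
  assumes D: "is_functor J M D" and c: "colimit_cocone J M D c \<iota>"
  shows "colimit_cocone J M (comp_ftr T D) (omap T c) (\<lambda>j. amap T (\<iota> j))"
proof -
  interpret J: categ J using D by unfold_locales (simp add: is_functor_def)
  have co: "c \<in> ob M" and i: "\<And>j. j \<in> ob J \<Longrightarrow> \<iota> j \<in> hom M (omap D j) c"
    and ik: "\<And>k. k \<in> arr J \<Longrightarrow> \<iota> (tgt J k) \<bullet> amap D k = \<iota> (src J k)"
    using c by (auto simp: colimit_cocone_def cocone_def)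
  note Dk = functor_hom[OF D J.hom_self] and Do = functor_ob[OF D]
  have cc: "cocone J M (comp_ftr T D) (omap T c) (\<lambda>j. amap T (\<iota> j))"
    unfolding cocone_def comp_ftr_def using T_ob[OF co] T_hom[OF i] T_comp[OF i Dk] ik by simp
  have "\<exists>!h. h \<in> hom M (omap T c) d \<and> (\<forall>j\<in>ob J. h \<bullet> amap T (\<iota> j) = \<kappa> j)"
    if k: "cocone J M (comp_ftr T D) d \<kappa>" for d \<kappa>
  proof -
    have d: "d \<in> ob M" and kh: "\<And>j. j \<in> ob J \<Longrightarrow> \<kappa> j \<in> hom M (omap T (omap D j)) d"
      and kk: "\<And>k. k \<in> arr J \<Longrightarrow> \<kappa> (tgt J k) \<bullet> amap T (amap D k) = \<kappa> (src J k)"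
      using k by (auto simp: cocone_def comp_ftr_def)
    have "cocone J M D (omap \<Omega> d) (\<lambda>j. adjoint (omap D j) (\<kappa> j))"
      unfolding cocone_def
      using Om_ob[OF d] adjoint_hom[OF Do kh] adjoint_natural[OF Do kh Dk] kk by simp
    then have "\<exists>!h. h \<in> hom M c (omap \<Omega> d) \<and> (\<forall>j\<in>ob J. h \<bullet> \<iota> j = adjoint (omap D j) (\<kappa> j))"
      using c unfolding colimit_cocone_def by blast
    then obtain h where h: "h \<in> hom M c (omap \<Omega> d)"
      "\<And>j. j \<in> ob J \<Longrightarrow> h \<bullet> \<iota> j = adjoint (omap D j) (\<kappa> j)" by blast
    let ?g = "\<epsilon> d \<bullet> amap T h"
    have g: "?g \<in> hom M (omap T c) d" by (rule comp_hom[OF \<epsilon>_hom[OF d] T_hom[OF h(1)]])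
    have "?g \<bullet> amap T (\<iota> j) = \<kappa> j" if j: "j \<in> ob J" for j
    proof -
      have "?g \<bullet> amap T (\<iota> j) = \<epsilon> d \<bullet> amap T (h \<bullet> \<iota> j)"
        using T_comp[OF h(1) i[OF j]] T_hom[OF h(1)] T_hom[OF i[OF j]] \<epsilon>_hom[OF d] by (simp add: hom_def)
      then show ?thesis using h(2)[OF j] adjoint_inverse[OF Do[OF j] kh[OF j]] by simp
    qed
    moreover have "g' = ?g" if g': "g' \<in> hom M (omap T c) d" "\<forall>j\<in>ob J. g' \<bullet> amap T (\<iota> j) = \<kappa> j" for g'
    proof (rule adjoint_inj[OF co g'(1) g])
      have "adjoint c g' = h"
      proof (rule colimit_ext[OF c D adjoint_hom[OF co g'(1)] h(1)])
        fix j assume j: "j \<in> ob J"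
        show "adjoint c g' \<bullet> \<iota> j = h \<bullet> \<iota> j"
          using adjoint_natural[OF co g'(1) i[OF j]] g'(2) h(2) j by simp
      qed
      then show "adjoint c g' = adjoint c ?g" using adjoint_surj[OF co d h(1)] by simp
    qed
    ultimately show ?thesis using g by blast
  qed
  then show ?thesis unfolding colimit_cocone_def using cc by simp
qed

section \<open>The category of prespectra and its levelwise limits and colimits\<close>

abbreviation "S \<equiv> level_structure M T"
abbreviation scomp (infixr "\<star>" 65) where "g \<star> f \<equiv> cmp S g f"

definition lv :: "('o, 'a) spt_map \<Rightarrow> nat \<Rightarrow> 'a" where "lv \<phi> = fst (snd \<phi>)"

lemma S_simps:
  "ob S = {X. is_prespectrum M T X}" "arr S = {\<phi>. is_spt_map M T \<phi>}"
  "src S \<phi> = fst \<phi>" "tgt S \<phi> = snd (snd \<phi>)" "idn S X = (X, \<lambda>n. idn M (lev X n), X)"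
  "\<psi> \<star> \<phi> = (fst \<phi>, \<lambda>n. lv \<psi> n \<bullet> lv \<phi> n, snd (snd \<psi>))"
  by (auto simp: level_structure_def cat.extend_def Spt_def lv_def split: prod.split)

lemma lv_simps [simp]:
  "lv (X, f, Y) = f" "lv (\<psi> \<star> \<phi>) n = lv \<psi> n \<bullet> lv \<phi> n" "lv (idn S X) n = idn M (lev X n)"
  by (simp_all add: lv_def S_simps)

lemma S_hom:
  "\<phi> \<in> hom S X Y \<longleftrightarrow> \<phi> = (X, lv \<phi>, Y) \<and> is_prespectrum M T X \<and> is_prespectrum M T Y \<and>
    (\<forall>n. lv \<phi> n \<in> hom M (lev X n) (lev Y n) \<and>
       lv \<phi> (Suc n) \<bullet> bond X n = bond Y n \<bullet> amap T (lv \<phi> n))"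
  by (cases \<phi>) (auto simp: hom_def[of S] S_simps is_spt_map_def)

lemma S_homI:
  "is_prespectrum M T X \<Longrightarrow> is_prespectrum M T Y \<Longrightarrow> (\<And>n. f n \<in> hom M (lev X n) (lev Y n)) \<Longrightarrow>
   (\<And>n. f (Suc n) \<bullet> bond X n = bond Y n \<bullet> amap T (f n)) \<Longrightarrow> (X, f, Y) \<in> hom S X Y"
  by (simp add: S_hom)

lemma S_homD:
  assumes "\<phi> \<in> hom S X Y"
  shows "\<phi> = (X, lv \<phi>, Y)" "is_prespectrum M T X" "is_prespectrum M T Y"
    "lv \<phi> n \<in> hom M (lev X n) (lev Y n)" "lv \<phi> (Suc n) \<bullet> bond X n = bond Y n \<bullet> amap T (lv \<phi> n)"
  using assms unfolding S_hom by blast+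

lemma S_eqI: "\<phi> \<in> hom S X Y \<Longrightarrow> \<psi> \<in> hom S X Y \<Longrightarrow> (\<And>n. lv \<phi> n = lv \<psi> n) \<Longrightarrow> \<phi> = \<psi>"
  by (metis S_homD(1) ext)

lemma spectrum_hom:
  "is_prespectrum M T X \<Longrightarrow> lev X n \<in> ob M"
  "is_prespectrum M T X \<Longrightarrow> bond X n \<in> hom M (omap T (lev X n)) (lev X (Suc n))"
  by (auto simp: is_prespectrum_def)

lemma S_id: "is_prespectrum M T X \<Longrightarrow> idn S X \<in> hom S X X"
proof -
  assume X: "is_prespectrum M T X"
  note h = spectrum_hom[OF X]
  show ?thesis
    unfolding S_simps by (rule S_homI[OF X X]) (use h id_hom T_id in \<open>auto simp: hom_def\<close>)
qed

lemma S_comp: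
  assumes f: "\<phi> \<in> hom S X Y" and g: "\<psi> \<in> hom S Y Z"
  shows "\<psi> \<star> \<phi> \<in> hom S X Z"
proof -
  note f' = S_homD[OF f] and g' = S_homD[OF g]
  have "(X, \<lambda>n. lv \<psi> n \<bullet> lv \<phi> n, Z) \<in> hom S X Z"
  proof (rule S_homI[OF f'(2) g'(3)])
    fix n
    show "lv \<psi> n \<bullet> lv \<phi> n \<in> hom M (lev X n) (lev Z n)" by (rule comp_hom[OF g'(4) f'(4)])
    note b = spectrum_hom(2)[OF f'(2), of n] spectrum_hom(2)[OF g'(2), of n] spectrum_hom(2)[OF g'(3), of n]
    show "(lv \<psi> (Suc n) \<bullet> lv \<phi> (Suc n)) \<bullet> bond X n = bond Z n \<bullet> amap T (lv \<psi> n \<bullet> lv \<phi> n)"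
      using f'(4)[of "Suc n"] g'(4)[of "Suc n"] f'(5)[of n] b T_comp[OF g'(4)[of n] f'(4)[of n]]
        T_hom[OF f'(4)[of n]] T_hom[OF g'(4)[of n]] comp_ext[OF g'(5)[of n], of "amap T (lv \<phi> n)"]
      by (simp add: hom_def)
  qed
  moreover have "fst \<phi> = X" "snd (snd \<psi>) = Z"
    using f g by (simp_all add: hom_def[of S] S_simps(3,4))
  then have "\<psi> \<star> \<phi> = (X, \<lambda>n. lv \<psi> n \<bullet> lv \<phi> n, Z)" by (simp add: S_simps(6))
  ultimately show ?thesis by simp
qed

lemma S_category: "category S"
  unfolding category_def
proof (intro conjI ballI impI)
  fix \<phi> assume "\<phi> \<in> arr S"
  then have f: "\<phi> \<in> hom S (src S \<phi>) (tgt S \<phi>)" by (simp add: hom_def)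
  note f' = S_homD[OF f]
  show "src S \<phi> \<in> ob S" "tgt S \<phi> \<in> ob S" using f' by (auto simp: S_simps(1))
  show "\<phi> \<star> idn S (src S \<phi>) = \<phi>"
    by (rule S_eqI[OF S_comp[OF S_id[OF f'(2)] f] f]) (use f'(4) in \<open>simp add: hom_def\<close>)
  show "idn S (tgt S \<phi>) \<star> \<phi> = \<phi>"
    by (rule S_eqI[OF S_comp[OF f S_id[OF f'(3)]] f]) (use f'(4) in \<open>simp add: hom_def\<close>)
  fix \<psi> assume "\<psi> \<in> arr S" "tgt S \<phi> = src S \<psi>"
  then have g: "\<psi> \<in> hom S (tgt S \<phi>) (tgt S \<psi>)" by (simp add: hom_def)
  show "\<psi> \<star> \<phi> \<in> hom S (src S \<phi>) (tgt S \<psi>)" by (rule S_comp[OF f g])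
  fix \<chi> assume "\<chi> \<in> arr S" "tgt S \<psi> = src S \<chi>"
  then have h: "\<chi> \<in> hom S (tgt S \<psi>) (tgt S \<chi>)" by (simp add: hom_def)
  note g' = S_homD[OF g] and h' = S_homD[OF h]
  show "\<chi> \<star> \<psi> \<star> \<phi> = (\<chi> \<star> \<psi>) \<star> \<phi>"
    by (rule S_eqI[OF S_comp[OF S_comp[OF f g] h] S_comp[OF f S_comp[OF g h]]])
      (use f'(4) g'(4) h'(4) in \<open>simp add: hom_def\<close>)
next
  fix X assume "X \<in> ob S"
  then show "idn S X \<in> hom S X X" using S_id by (simp add: S_simps(1))
qed

sublocale S: categ S by unfold_locales (rule S_category)

definition ev :: "nat \<Rightarrow> (('o, 'a) prespectrum, ('o, 'a) spt_map, 'o, 'a) ftr" where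
  "ev n = \<lparr>omap = (\<lambda>X. lev X n), amap = (\<lambda>\<phi>. lv \<phi> n)\<rparr>"

lemma ev: "is_functor S M (ev n)"
  unfolding is_functor_def
  using S_category category S_homD(4)[OF S.hom_self] spectrum_hom(1)
  by (auto simp: ev_def S_simps(1))

text \<open>The structure map into \<open>c (Suc n)\<close> is induced by the cone
  \<open>\<beta> n\<close> of \<open>T\<close> of the projections followed by the structure maps of
  the diagram; uniqueness at level \<open>Suc n\<close> makes the induced levelwise maps compatible
  with it.\<close>

lemma limit_levelwise:
  assumes D: "is_functor J S D" and l: "\<And>n. limit_cone J M (comp_ftr (ev n) D) (c n) (\<pi> n)"
  shows "\<exists>X. lev X = c \<and> limit_cone J S D X (\<lambda>j. (X, \<lambda>n. \<pi> n j, omap D j))"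
proof -
  interpret J: categ J using D by unfold_locales (simp add: is_functor_def)
  have DJ: "is_functor J M (comp_ftr (ev n) D)" for n by (rule comp_functor[OF D ev])
  have co: "c n \<in> ob M" and p: "j \<in> ob J \<Longrightarrow> \<pi> n j \<in> hom M (c n) (lev (omap D j) n)"
    and pk: "k \<in> arr J \<Longrightarrow> lv (amap D k) n \<bullet> \<pi> n (src J k) = \<pi> n (tgt J k)" for n j k
    using l[of n] by (auto simp: limit_cone_def cone_def comp_ftr_def ev_def)
  note Dk = functor_hom[OF D J.hom_self]
  have Do: "is_prespectrum M T (omap D j)" if "j \<in> ob J" for j using functor_ob[OF D that] by (simp add: S_simps(1))
  define \<beta> where "\<beta> n j = bond (omap D j) n \<bullet> amap T (\<pi> n j)" for n j
  have \<beta>h: "\<beta> n j \<in> hom M (omap T (c n)) (lev (omap D j) (Suc n))" if "j \<in> ob J" for n j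
    unfolding \<beta>_def by (rule comp_hom[OF spectrum_hom(2)[OF Do[OF that]] T_hom[OF p[OF that]]])
  have "\<exists>b. b \<in> hom M (omap T (c n)) (c (Suc n)) \<and> (\<forall>j\<in>ob J. \<pi> (Suc n) j \<bullet> b = \<beta> n j)" for n
  proof -
    have "cone J M (comp_ftr (ev (Suc n)) D) (omap T (c n)) (\<beta> n)"
      unfolding cone_def
    proof (intro conjI ballI)
      show "omap T (c n) \<in> ob M" by (rule T_ob[OF co])
      show "\<beta> n j \<in> hom M (omap T (c n)) (omap (comp_ftr (ev (Suc n)) D) j)" if "j \<in> ob J" for j
        using \<beta>h[OF that] by (simp add: comp_ftr_def ev_def)
      fix k assume k: "k \<in> arr J"
      then have st: "src J k \<in> ob J" "tgt J k \<in> ob J" by auto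
      note f = S_homD[OF Dk[OF k]]
      have "lv (amap D k) (Suc n) \<bullet> \<beta> n (src J k) = \<beta> n (tgt J k)"
        unfolding \<beta>_def
        using comp_ext[OF f(5)[of n], of "amap T (\<pi> n (src J k))"] f(4)[of "Suc n"]
          spectrum_hom(2)[OF f(2), of n] spectrum_hom(2)[OF f(3), of n] T_hom[OF p[OF st(1), of n]]
          T_hom[OF f(4)[of n]] T_comp[OF f(4)[of n] p[OF st(1), of n]] pk[OF k, of n]
        by (simp add: hom_def)
      then show "amap (comp_ftr (ev (Suc n)) D) k \<bullet> \<beta> n (src J k) = \<beta> n (tgt J k)"
        by (simp add: comp_ftr_def ev_def)
    qed
    then show ?thesis using l[of "Suc n"] unfolding limit_cone_def by blast
  qed
  then obtain b where b: "\<And>n. b n \<in> hom M (omap T (c n)) (c (Suc n))"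
    "\<And>n j. j \<in> ob J \<Longrightarrow> \<pi> (Suc n) j \<bullet> b n = \<beta> n j" by metis
  define X where "X = \<lparr>lev = c, bond = b\<rparr>"
  have X: "is_prespectrum M T X" using co b by (simp add: is_prespectrum_def X_def)
  have pr: "(X, \<lambda>n. \<pi> n j, omap D j) \<in> hom S X (omap D j)" if "j \<in> ob J" for j
    by (rule S_homI[OF X Do[OF that]]) (use p[OF that] b(2)[OF that] in \<open>auto simp: X_def \<beta>_def\<close>)
  have cone: "cone J S D X (\<lambda>j. (X, \<lambda>n. \<pi> n j, omap D j))"
    unfolding cone_def
  proof (intro conjI ballI)
    show "X \<in> ob S" using X by (simp add: S_simps(1))
    fix k assume k: "k \<in> arr J"
    then have st: "src J k \<in> ob J" "tgt J k \<in> ob J" by auto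
    show "amap D k \<star> (X, \<lambda>n. \<pi> n (src J k), omap D (src J k)) = (X, \<lambda>n. \<pi> n (tgt J k), omap D (tgt J k))"
      by (rule S_eqI[OF S_comp[OF pr[OF st(1)] Dk[OF k]] pr[OF st(2)]]) (use pk[OF k] in simp)
  qed (rule pr)
  have "\<exists>!h. h \<in> hom S Y X \<and> (\<forall>j\<in>ob J. (X, \<lambda>n. \<pi> n j, omap D j) \<star> h = \<kappa> j)"
    if k: "cone J S D Y \<kappa>" for Y \<kappa>
  proof -
    have kh: "\<kappa> j \<in> hom S Y (omap D j)" if "j \<in> ob J" for j using k that by (simp add: cone_def)
    have kk: "amap D k \<star> \<kappa> (src J k) = \<kappa> (tgt J k)" if "k \<in> arr J" for k using k that by (simp add: cone_def)
    have Y: "is_prespectrum M T Y" using k by (simp add: cone_def S_simps(1))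
    have "\<exists>h. h \<in> hom M (lev Y n) (c n) \<and> (\<forall>j\<in>ob J. \<pi> n j \<bullet> h = lv (\<kappa> j) n)" for n
    proof -
      have "cone J M (comp_ftr (ev n) D) (lev Y n) (\<lambda>j. lv (\<kappa> j) n)"
        unfolding cone_def comp_ftr_def ev_def
        using spectrum_hom(1)[OF Y] S_homD(4)[OF kh] arg_cong[OF kk, where f = "\<lambda>\<phi>. lv \<phi> n"] by simp
      then show ?thesis using l[of n] unfolding limit_cone_def by blast
    qed
    then obtain h where h: "\<And>n. h n \<in> hom M (lev Y n) (c n)"
      "\<And>n j. j \<in> ob J \<Longrightarrow> \<pi> n j \<bullet> h n = lv (\<kappa> j) n" by metis
    have hS: "(Y, h, X) \<in> hom S Y X"
    proof (rule S_homI[OF Y X])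
      show "h n \<in> hom M (lev Y n) (lev X n)" for n using h by (simp add: X_def)
      fix n
      show "h (Suc n) \<bullet> bond Y n = bond X n \<bullet> amap T (h n)"
      proof (rule limit_ext[OF l DJ])
        note bY = spectrum_hom(2)[OF Y, of n]
        show "h (Suc n) \<bullet> bond Y n \<in> hom M (omap T (lev Y n)) (c (Suc n))"
          by (rule comp_hom[OF h(1) bY])
        show "bond X n \<bullet> amap T (h n) \<in> hom M (omap T (lev Y n)) (c (Suc n))"
          using comp_hom[OF b(1) T_hom[OF h(1)]] by (simp add: X_def)
        fix j assume j: "j \<in> ob J"
        note kj = S_homD[OF kh[OF j]]
        have "\<pi> (Suc n) j \<bullet> h (Suc n) \<bullet> bond Y n = lv (\<kappa> j) (Suc n) \<bullet> bond Y n"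
          using comp_ext[OF h(2)[OF j, of "Suc n"], of "bond Y n"] p[OF j, of "Suc n"] h(1)[of "Suc n"] bY
          by (simp add: hom_def)
        also have "\<dots> = bond (omap D j) n \<bullet> amap T (\<pi> n j \<bullet> h n)" using kj(5) h(2)[OF j] by simp
        also have "\<dots> = \<beta> n j \<bullet> amap T (h n)"
          using T_comp[OF p[OF j, of n] h(1)[of n]] T_hom[OF p[OF j, of n]] T_hom[OF h(1)[of n]]
            spectrum_hom(2)[OF Do[OF j], of n] by (simp add: \<beta>_def hom_def)
        also have "\<dots> = \<pi> (Suc n) j \<bullet> bond X n \<bullet> amap T (h n)"
          using comp_ext[OF b(2)[OF j, of n], of "amap T (h n)"] p[OF j, of "Suc n"] b(1)[of n] T_hom[OF h(1)[of n]]
          by (simp add: X_def hom_def)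
        finally show "\<pi> (Suc n) j \<bullet> h (Suc n) \<bullet> bond Y n = \<pi> (Suc n) j \<bullet> bond X n \<bullet> amap T (h n)" .
      qed
    qed
    have 1: "(X, \<lambda>n. \<pi> n j, omap D j) \<star> (Y, h, X) = \<kappa> j" if j: "j \<in> ob J" for j
      by (rule S_eqI[OF S_comp[OF hS pr[OF j]] kh[OF j]]) (use h(2)[OF j] in simp)
    have 2: "h' = (Y, h, X)" if h': "h' \<in> hom S Y X" "\<forall>j\<in>ob J. (X, \<lambda>n. \<pi> n j, omap D j) \<star> h' = \<kappa> j" for h'
    proof (rule S_eqI[OF h'(1) hS])
      fix n
      have "lv h' n = h n"
      proof (rule limit_ext[OF l DJ _ h(1)])
        show "lv h' n \<in> hom M (lev Y n) (c n)" using S_homD(4)[OF h'(1)] by (simp add: X_def)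
        fix j assume j: "j \<in> ob J"
        have "lv ((X, \<lambda>n. \<pi> n j, omap D j) \<star> h') n = lv (\<kappa> j) n" using h'(2) j by simp
        then show "\<pi> n j \<bullet> lv h' n = \<pi> n j \<bullet> h n" using h(2)[OF j] by simp
      qed
      then show "lv h' n = lv (Y, h, X) n" by simp
    qed
    show ?thesis using hS 1 2 by blast
  qed
  then have "limit_cone J S D X (\<lambda>j. (X, \<lambda>n. \<pi> n j, omap D j))" unfolding limit_cone_def using cone by blast
  then show ?thesis by (intro exI[of _ X]) (simp add: X_def)
qed

text \<open>The structure map leaves \<open>T\<close> of \<open>c n\<close>, which by
  \<open>T_colimit\<close> is again a colimit. That universal property defines the structure map and
  also forces the induced levelwise maps to commute with it.\<close>

lemma colimit_levelwise:
  assumes D: "is_functor J S D" and l: "\<And>n. colimit_cocone J M (comp_ftr (ev n) D) (c n) (\<iota> n)"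
  shows "\<exists>X. lev X = c \<and> colimit_cocone J S D X (\<lambda>j. (omap D j, \<lambda>n. \<iota> n j, X))"
proof -
  interpret J: categ J using D by unfold_locales (simp add: is_functor_def)
  have DJ: "is_functor J M (comp_ftr (ev n) D)" for n by (rule comp_functor[OF D ev])
  have TD: "is_functor J M (comp_ftr T (comp_ftr (ev n) D))" for n by (rule comp_functor[OF DJ T])
  note Tl = T_colimit[OF DJ l]
  have co: "c n \<in> ob M" and p: "j \<in> ob J \<Longrightarrow> \<iota> n j \<in> hom M (lev (omap D j) n) (c n)"
    and pk: "k \<in> arr J \<Longrightarrow> \<iota> n (tgt J k) \<bullet> lv (amap D k) n = \<iota> n (src J k)" for n j k
    using l[of n] by (auto simp: colimit_cocone_def cocone_def comp_ftr_def ev_def)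
  note Dk = functor_hom[OF D J.hom_self]
  have Do: "is_prespectrum M T (omap D j)" if "j \<in> ob J" for j using functor_ob[OF D that] by (simp add: S_simps(1))
  define \<beta> where "\<beta> n j = \<iota> (Suc n) j \<bullet> bond (omap D j) n" for n j
  have \<beta>h: "\<beta> n j \<in> hom M (omap T (lev (omap D j) n)) (c (Suc n))" if "j \<in> ob J" for n j
    unfolding \<beta>_def by (rule comp_hom[OF p[OF that] spectrum_hom(2)[OF Do[OF that]]])
  have "\<exists>b. b \<in> hom M (omap T (c n)) (c (Suc n)) \<and> (\<forall>j\<in>ob J. b \<bullet> amap T (\<iota> n j) = \<beta> n j)" for n
  proof -
    have "cocone J M (comp_ftr T (comp_ftr (ev n) D)) (c (Suc n)) (\<beta> n)"
      unfolding cocone_def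
    proof (intro conjI ballI)
      show "c (Suc n) \<in> ob M" by (rule co)
      show "\<beta> n j \<in> hom M (omap (comp_ftr T (comp_ftr (ev n) D)) j) (c (Suc n))" if "j \<in> ob J" for j
        using \<beta>h[OF that] by (simp add: comp_ftr_def ev_def)
      fix k assume k: "k \<in> arr J"
      then have st: "src J k \<in> ob J" "tgt J k \<in> ob J" by auto
      note f = S_homD[OF Dk[OF k]]
      have "\<beta> n (tgt J k) \<bullet> amap T (lv (amap D k) n) = \<iota> (Suc n) (tgt J k) \<bullet> lv (amap D k) (Suc n) \<bullet> bond (omap D (src J k)) n"
        unfolding \<beta>_def
        using f(5)[of n] p[OF st(2), of "Suc n"] spectrum_hom(2)[OF f(3), of n] T_hom[OF f(4)[of n]]
        by (simp add: hom_def)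
      also have "\<dots> = \<beta> n (src J k)"
        unfolding \<beta>_def
        using comp_ext[OF pk[OF k, of "Suc n"], of "bond (omap D (src J k)) n"] f(4)[of "Suc n"]
          p[OF st(2), of "Suc n"] spectrum_hom(2)[OF f(2), of n] by (simp add: hom_def)
      finally show "\<beta> n (tgt J k) \<bullet> amap (comp_ftr T (comp_ftr (ev n) D)) k = \<beta> n (src J k)"
        by (simp add: comp_ftr_def ev_def)
    qed
    then show ?thesis using Tl[of n] unfolding colimit_cocone_def by blast
  qed
  then obtain b where b: "\<And>n. b n \<in> hom M (omap T (c n)) (c (Suc n))"
    "\<And>n j. j \<in> ob J \<Longrightarrow> b n \<bullet> amap T (\<iota> n j) = \<beta> n j" by metis
  define X where "X = \<lparr>lev = c, bond = b\<rparr>"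
  have X: "is_prespectrum M T X" using co b by (simp add: is_prespectrum_def X_def)
  have pr: "(omap D j, \<lambda>n. \<iota> n j, X) \<in> hom S (omap D j) X" if "j \<in> ob J" for j
    by (rule S_homI[OF Do[OF that] X]) (use p[OF that] b(2)[OF that] in \<open>auto simp: X_def \<beta>_def\<close>)
  have cone: "cocone J S D X (\<lambda>j. (omap D j, \<lambda>n. \<iota> n j, X))"
    unfolding cocone_def
  proof (intro conjI ballI)
    show "X \<in> ob S" using X by (simp add: S_simps(1))
    fix k assume k: "k \<in> arr J"
    then have st: "src J k \<in> ob J" "tgt J k \<in> ob J" by auto
    show "(omap D (tgt J k), \<lambda>n. \<iota> n (tgt J k), X) \<star> amap D k = (omap D (src J k), \<lambda>n. \<iota> n (src J k), X)"
      by (rule S_eqI[OF S_comp[OF Dk[OF k] pr[OF st(2)]] pr[OF st(1)]]) (use pk[OF k] in simp)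
  qed (rule pr)
  have "\<exists>!h. h \<in> hom S X Y \<and> (\<forall>j\<in>ob J. h \<star> (omap D j, \<lambda>n. \<iota> n j, X) = \<kappa> j)"
    if k: "cocone J S D Y \<kappa>" for Y \<kappa>
  proof -
    have kh: "\<kappa> j \<in> hom S (omap D j) Y" if "j \<in> ob J" for j using k that by (simp add: cocone_def)
    have kk: "\<kappa> (tgt J k) \<star> amap D k = \<kappa> (src J k)" if "k \<in> arr J" for k using k that by (simp add: cocone_def)
    have Y: "is_prespectrum M T Y" using k by (simp add: cocone_def S_simps(1))
    have "\<exists>h. h \<in> hom M (c n) (lev Y n) \<and> (\<forall>j\<in>ob J. h \<bullet> \<iota> n j = lv (\<kappa> j) n)" for n
    proof -
      have "cocone J M (comp_ftr (ev n) D) (lev Y n) (\<lambda>j. lv (\<kappa> j) n)"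
        unfolding cocone_def comp_ftr_def ev_def
        using spectrum_hom(1)[OF Y] S_homD(4)[OF kh] arg_cong[OF kk, where f = "\<lambda>\<phi>. lv \<phi> n"] by simp
      then show ?thesis using l[of n] unfolding colimit_cocone_def by blast
    qed
    then obtain h where h: "\<And>n. h n \<in> hom M (c n) (lev Y n)"
      "\<And>n j. j \<in> ob J \<Longrightarrow> h n \<bullet> \<iota> n j = lv (\<kappa> j) n" by metis
    have hS: "(X, h, Y) \<in> hom S X Y"
    proof (rule S_homI[OF X Y])
      show "h n \<in> hom M (lev X n) (lev Y n)" for n using h by (simp add: X_def)
      fix n
      show "h (Suc n) \<bullet> bond X n = bond Y n \<bullet> amap T (h n)"
      proof (rule colimit_ext[OF Tl TD])
        note bY = spectrum_hom(2)[OF Y, of n]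
        show "h (Suc n) \<bullet> bond X n \<in> hom M (omap T (c n)) (lev Y (Suc n))"
          using comp_hom[OF h(1) b(1)] by (simp add: X_def)
        show "bond Y n \<bullet> amap T (h n) \<in> hom M (omap T (c n)) (lev Y (Suc n))"
          by (rule comp_hom[OF bY T_hom[OF h(1)]])
        fix j assume j: "j \<in> ob J"
        note kj = S_homD[OF kh[OF j]]
        have "(h (Suc n) \<bullet> bond X n) \<bullet> amap T (\<iota> n j) = h (Suc n) \<bullet> \<beta> n j"
          using b(2)[OF j, of n] h(1)[of "Suc n"] b(1)[of n] T_hom[OF p[OF j, of n]] by (simp add: hom_def X_def)
        also have "\<dots> = lv (\<kappa> j) (Suc n) \<bullet> bond (omap D j) n"
          using comp_ext[OF h(2)[OF j, of "Suc n"], of "bond (omap D j) n"] p[OF j, of "Suc n"]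
            h(1)[of "Suc n"] spectrum_hom(2)[OF Do[OF j], of n] by (simp add: hom_def \<beta>_def)
        also have "\<dots> = bond Y n \<bullet> amap T (h n \<bullet> \<iota> n j)" using kj(5) h(2)[OF j] by simp
        also have "\<dots> = (bond Y n \<bullet> amap T (h n)) \<bullet> amap T (\<iota> n j)"
          using T_comp[OF h(1)[of n] p[OF j, of n]] T_hom[OF p[OF j, of n]] T_hom[OF h(1)[of n]] bY
          by (simp add: hom_def)
        finally show "(h (Suc n) \<bullet> bond X n) \<bullet> amap T (\<iota> n j) = (bond Y n \<bullet> amap T (h n)) \<bullet> amap T (\<iota> n j)" .
      qed
    qed
    have 1: "(X, h, Y) \<star> (omap D j, \<lambda>n. \<iota> n j, X) = \<kappa> j" if j: "j \<in> ob J" for j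
      by (rule S_eqI[OF S_comp[OF pr[OF j] hS] kh[OF j]]) (use h(2)[OF j] in simp)
    have 2: "h' = (X, h, Y)" if h': "h' \<in> hom S X Y" "\<forall>j\<in>ob J. h' \<star> (omap D j, \<lambda>n. \<iota> n j, X) = \<kappa> j" for h'
    proof (rule S_eqI[OF h'(1) hS])
      fix n
      have "lv h' n = h n"
      proof (rule colimit_ext[OF l DJ _ h(1)])
        show "lv h' n \<in> hom M (c n) (lev Y n)" using S_homD(4)[OF h'(1), of n] by (simp add: X_def)
        fix j assume j: "j \<in> ob J"
        have "lv (h' \<star> (omap D j, \<lambda>n. \<iota> n j, X)) n = lv (\<kappa> j) n" using h'(2) j by simp
        then show "lv h' n \<bullet> \<iota> n j = h n \<bullet> \<iota> n j" using h(2)[OF j] by simp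
      qed
      then show "lv h' n = lv (X, h, Y) n" by simp
    qed
    show ?thesis using hS 1 2 by blast
  qed
  then have "colimit_cocone J S D X (\<lambda>j. (omap D j, \<lambda>n. \<iota> n j, X))" unfolding colimit_cocone_def using cone by blast
  then show ?thesis by (intro exI[of _ X]) (simp add: X_def)
qed

lemma S_bicomplete: "bicomplete U S"
  unfolding bicomplete_def
proof (intro conjI allI impI)
  show "category S" by (rule S_category)
  fix J :: "('u, 'u) cat" and D
  assume D: "is_functor J S D \<and> arr J \<prec> (UNIV :: 'u set)"
  have "is_functor J M (comp_ftr (ev n) D)" for n using comp_functor D ev by blast
  then have e: "(\<exists>c \<pi>. limit_cone J M (comp_ftr (ev n) D) c \<pi>) \<and> (\<exists>c \<iota>. colimit_cocone J M (comp_ftr (ev n) D) c \<iota>)" for n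
    using bicomplete D unfolding bicomplete_def by blast
  obtain c \<pi> where "\<And>n. limit_cone J M (comp_ftr (ev n) D) (c n) (\<pi> n)" using e by metis
  then show "\<exists>c \<pi>. limit_cone J S D c \<pi>" using limit_levelwise D by blast
  obtain d \<iota> where "\<And>n. colimit_cocone J M (comp_ftr (ev n) D) (d n) (\<iota> n)" using e by metis
  then show "\<exists>c \<iota>. colimit_cocone J S D c \<iota>" using colimit_levelwise D by blast
qed

sublocale S: bicomplete_categ S U
  by unfold_locales (rule S_bicomplete, rule uncountable)

lemma seq_level: "is_seq S X s \<Longrightarrow> is_seq M (\<lambda>i. lev (X i) n) (\<lambda>i. lv (s i) n)"
  using S_homD(4) spectrum_hom(1) by (simp add: is_seq_def S_simps(1))

lemma seq_map_level:
  assumes "seq_map S X s Y t f"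
  shows "seq_map M (\<lambda>i. lev (X i) n) (\<lambda>i. lv (s i) n) (\<lambda>i. lev (Y i) n) (\<lambda>i. lv (t i) n) (\<lambda>i. lv (f i) n)"
  unfolding seq_map_def
proof (intro allI conjI)
  fix i
  have f: "f i \<in> hom S (X i) (Y i)" "f (Suc i) \<star> s i = t i \<star> f i" using assms by (auto simp: seq_map_def)
  show "lv (f i) n \<in> hom M (lev (X i) n) (lev (Y i) n)" by (rule S_homD(4)[OF f(1)])
  show "lv (f (Suc i)) n \<bullet> lv (s i) n = lv (t i) n \<bullet> lv (f i) n"
    using arg_cong[OF f(2), of "\<lambda>\<phi>. lv \<phi> n"] by simp
qed

lemma seq_cocone_level:
  assumes "seq_cocone S X s c \<iota>"
  shows "seq_cocone M (\<lambda>i. lev (X i) n) (\<lambda>i. lv (s i) n) (lev c n) (\<lambda>i. lv (\<iota> i) n)"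
  unfolding seq_cocone_def
proof (intro allI conjI)
  show "lev c n \<in> ob M" using assms spectrum_hom(1) by (simp add: seq_cocone_def S_simps(1))
  fix i
  have f: "\<iota> i \<in> hom S (X i) c" "\<iota> (Suc i) \<star> s i = \<iota> i" using assms by (auto simp: seq_cocone_def)
  show "lv (\<iota> i) n \<in> hom M (lev (X i) n) (lev c n)" by (rule S_homD(4)[OF f(1)])
  show "lv (\<iota> (Suc i)) n \<bullet> lv (s i) n = lv (\<iota> i) n" using arg_cong[OF f(2), of "\<lambda>\<phi>. lv \<phi> n"] by simp
qed

text \<open>A given colimit is isomorphic to the one built by \<open>colimit_levelwise\<close>, and
  the isomorphism carries the universal property over at each level. This is how hypotheses on
  \<open>M\<close> are applied to sequences of prespectra.\<close>

lemma seq_colimit_level: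
  assumes X: "is_seq S X s" and c: "seq_colimit S X s c \<iota>"
  shows "seq_colimit M (\<lambda>i. lev (X i) n) (\<lambda>i. lv (s i) n) (lev c n) (\<lambda>i. lv (\<iota> i) n)"
proof -
  let ?J = "poset_cat UNIV (\<le>)" and ?D = "S.seq_ftr X s"
  have D: "is_functor ?J S ?D" by (rule S.seq_ftr_functor[OF X])
  have ch: "lv (S.chain X s i k) n = chain (\<lambda>i. lev (X i) n) (\<lambda>i. lv (s i) n) i k" for i k n
    by (induction k) simp_all
  have e: "comp_ftr (ev n) ?D = seq_ftr (\<lambda>i. lev (X i) n) (\<lambda>i. lv (s i) n)" for n
    by (auto simp: comp_ftr_def ev_def seq_ftr_def S.seq_ftr_def ch fun_eq_iff)
  have "\<exists>d \<kappa>. colimit_cocone ?J M (comp_ftr (ev n) ?D) d \<kappa>" for n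
    using seq_colimit_ex[OF seq_level[OF X, of n]] seq_colimit_iff[OF seq_level[OF X, of n]] e by metis
  then obtain d \<kappa> where l: "\<And>n. colimit_cocone ?J M (comp_ftr (ev n) ?D) (d n) (\<kappa> n)" by metis
  obtain Z where Z: "lev Z = d" "colimit_cocone ?J S ?D Z (\<lambda>j. (omap ?D j, \<lambda>n. \<kappa> n j, Z))"
    using colimit_levelwise[OF D l] by blast
  let ?i = "\<lambda>j. (X j, \<lambda>n. \<kappa> n j, Z)"
  have "seq_colimit S X s Z ?i"
    using Z(2) S.seq_colimit_iff[OF X] by (simp add: S.seq_ftr_def)
  note cZ = this
  have coc: "seq_cocone S X s c \<iota>" "seq_cocone S X s Z ?i" using c cZ by (auto simp: seq_colimit_def)
  obtain h where h: "h \<in> hom S Z c" "\<And>i. h \<star> ?i i = \<iota> i" using S.seq_colimit_univ[OF cZ coc(1)] by blast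
  obtain k where k: "k \<in> hom S c Z" "\<And>i. k \<star> \<iota> i = ?i i" using S.seq_colimit_univ[OF c coc(2)] by blast
  have ih: "?i j \<in> hom S (X j) Z" "\<iota> j \<in> hom S (X j) c" for j using coc by (auto simp: seq_cocone_def)
  have "k \<star> h = idn S Z"
  proof (rule S.seq_colimit_unique[OF cZ S.comp_hom[OF k(1) h(1)] S.id_hom[OF S.hom_ob(1)[OF h(1)]] _ X])
    fix i show "(k \<star> h) \<star> ?i i = idn S Z \<star> ?i i"
      using h(1) h(2)[of i] k(1) k(2)[of i] ih(1)[of i] by (simp add: hom_def[of S])
  qed
  moreover have "h \<star> k = idn S c"
  proof (rule S.seq_colimit_unique[OF c S.comp_hom[OF h(1) k(1)] S.id_hom[OF S.hom_ob(1)[OF k(1)]] _ X])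
    fix i show "(h \<star> k) \<star> \<iota> i = idn S c \<star> \<iota> i"
      using h(1) h(2)[of i] k(1) k(2)[of i] ih(2)[of i] by (simp add: hom_def[of S])
  qed
  ultimately have hk: "lv k n \<bullet> lv h n = idn M (lev Z n)" "lv h n \<bullet> lv k n = idn M (lev c n)"
    using arg_cong[of _ _ "\<lambda>\<phi>. lv \<phi> n"] by (metis lv_simps(2,3))+
  have "seq_colimit M (\<lambda>i. lev (X i) n) (\<lambda>i. lv (s i) n) (lev Z n) (\<kappa> n)"
    using l[of n] seq_colimit_iff[OF seq_level[OF X, of n]] e Z(1) by simp
  moreover have "lv h n \<bullet> \<kappa> n i = lv (\<iota> i) n" for i
    using arg_cong[OF h(2)[of i], of "\<lambda>\<phi>. lv \<phi> n"] by simp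
  ultimately show ?thesis
    by (rule seq_colimit_iso[OF _ seq_level[OF X] S_homD(4)[OF h(1)] S_homD(4)[OF k(1)] hk])
qed

end

section \<open>The level model structure\<close>

text \<open>The classes \<open>A\<close> and \<open>B\<close> stay arbitrary, so that one
  construction produces both factorizations of the level structure.\<close>

locale spt_ffact = spt M U T \<Omega> \<eta> \<epsilon> + F: ffact M A B m l r e
  for M :: "('o, 'a, 'z) mcat_scheme" and U :: "'u itself" and T \<Omega> :: "('o, 'a, 'o, 'a) ftr"
    and \<eta> \<epsilon> :: "'o \<Rightarrow> 'a" and A B m l r e
begin

notation comp (infixr "\<bullet>" 65)
notation scomp (infixr "\<star>" 65)

definition "PO f g = (SOME q. pushout_square M f g (fst q) (snd q))"

lemma PO: "f \<in> hom M z x \<Longrightarrow> g \<in> hom M z y \<Longrightarrow> pushout_square M f g (fst (PO f g)) (snd (PO f g))"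
  unfolding PO_def by (rule someI_ex) (use pushout_ex in \<open>auto\<close>)

text \<open>A map of prespectra is factored level by level: at level \<open>n + 1\<close> the induced map \<open>w\<close> out of
  the pushout of \<open>X (n + 1) \<leftarrow> T (X n) \<rightarrow> T (Z n)\<close> is factored, where \<open>Z n\<close> is the middle object
  constructed so far. The state \<open>st \<phi> n\<close> consists of the maps \<open>X n \<rightarrow> Z n \<rightarrow> Y n\<close>.\<close>

definition "pa \<phi> n q = fst (PO (amap T (fst q)) (bond (fst \<phi>) n))"
definition "pb \<phi> n q = snd (PO (amap T (fst q)) (bond (fst \<phi>) n))"
definition "pw \<phi> n q = (THE w. w \<in> hom M (tgt M (pa \<phi> n q)) (lev (snd (snd \<phi>)) (Suc n)) \<and>
  w \<bullet> pb \<phi> n q = bond (snd (snd \<phi>)) n \<bullet> amap T (snd q) \<and> w \<bullet> pa \<phi> n q = lv \<phi> (Suc n))"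

primrec st :: "('o, 'a) spt_map \<Rightarrow> nat \<Rightarrow> 'a \<times> 'a" where
  "st \<phi> 0 = (l (lv \<phi> 0), r (lv \<phi> 0))"
| "st \<phi> (Suc n) = (l (pw \<phi> n (st \<phi> n)) \<bullet> pa \<phi> n (st \<phi> n), r (pw \<phi> n (st \<phi> n)))"

definition "jn \<phi> n = fst (st \<phi> n)"
definition "pn \<phi> n = snd (st \<phi> n)"
definition "Zn \<phi> n = src M (pn \<phi> n)"
definition "an \<phi> n = pa \<phi> n (st \<phi> n)"
definition "bn \<phi> n = pb \<phi> n (st \<phi> n)"
definition "wn \<phi> n = pw \<phi> n (st \<phi> n)"
definition "Pn \<phi> n = tgt M (an \<phi> n)"

lemma st_0: "jn \<phi> 0 = l (lv \<phi> 0)" "pn \<phi> 0 = r (lv \<phi> 0)"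
  and st_Suc: "jn \<phi> (Suc n) = l (wn \<phi> n) \<bullet> an \<phi> n" "pn \<phi> (Suc n) = r (wn \<phi> n)"
  by (simp_all add: jn_def pn_def wn_def an_def)

text \<open>\<open>Pn \<phi> n\<close> plays the part of a latching object: a map out of it combines
  a structure map from \<open>T\<close> of level \<open>n\<close> of the middle prespectrum with a
  compatible map from \<open>lev X (Suc n)\<close>.\<close>

lemma latch:
  assumes f: "\<phi> \<in> hom S X Y" and j: "jn \<phi> n \<in> hom M (lev X n) (Zn \<phi> n)"
    and p: "pn \<phi> n \<in> hom M (Zn \<phi> n) (lev Y n)" and e: "pn \<phi> n \<bullet> jn \<phi> n = lv \<phi> n"
  shows "pushout_square M (amap T (jn \<phi> n)) (bond X n) (an \<phi> n) (bn \<phi> n)"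
    "an \<phi> n \<in> hom M (lev X (Suc n)) (Pn \<phi> n)" "bn \<phi> n \<in> hom M (omap T (Zn \<phi> n)) (Pn \<phi> n)"
    "bn \<phi> n \<bullet> amap T (jn \<phi> n) = an \<phi> n \<bullet> bond X n"
    "wn \<phi> n \<in> hom M (Pn \<phi> n) (lev Y (Suc n))"
    "wn \<phi> n \<bullet> bn \<phi> n = bond Y n \<bullet> amap T (pn \<phi> n)" "wn \<phi> n \<bullet> an \<phi> n = lv \<phi> (Suc n)"
proof -
  have XY: "fst \<phi> = X" "snd (snd \<phi>) = Y" using f by (simp_all add: hom_def[of S] S_simps(3,4))
  note f' = S_homD[OF f]
  note bX = spectrum_hom(2)[OF f'(2), of n] and bY = spectrum_hom(2)[OF f'(3), of n]
  show sq: "pushout_square M (amap T (jn \<phi> n)) (bond X n) (an \<phi> n) (bn \<phi> n)"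
    using PO[OF T_hom[OF j] bX] by (simp add: an_def bn_def pa_def pb_def jn_def XY)
  note h = pushout_hom[OF sq T_hom[OF j] bX]
  show a: "an \<phi> n \<in> hom M (lev X (Suc n)) (Pn \<phi> n)" and b: "bn \<phi> n \<in> hom M (omap T (Zn \<phi> n)) (Pn \<phi> n)"
    and "bn \<phi> n \<bullet> amap T (jn \<phi> n) = an \<phi> n \<bullet> bond X n"
    using h by (auto simp: Pn_def)
  have "(bond Y n \<bullet> amap T (pn \<phi> n)) \<bullet> amap T (jn \<phi> n) = lv \<phi> (Suc n) \<bullet> bond X n"
    using T_comp[OF p j] e f'(5)[of n] T_hom[OF p] T_hom[OF j] bY by (simp add: hom_def)
  from theI'[OF pushout_univ[OF sq T_hom[OF j] bX comp_hom[OF bY T_hom[OF p]] f'(4) this]]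
  show "wn \<phi> n \<in> hom M (Pn \<phi> n) (lev Y (Suc n))"
    "wn \<phi> n \<bullet> bn \<phi> n = bond Y n \<bullet> amap T (pn \<phi> n)" "wn \<phi> n \<bullet> an \<phi> n = lv \<phi> (Suc n)"
    by (simp_all add: wn_def pw_def an_def bn_def pn_def XY Pn_def)
qed

lemma fact_step:
  assumes f: "\<phi> \<in> hom S X Y"
  shows "jn \<phi> n \<in> hom M (lev X n) (Zn \<phi> n) \<and> pn \<phi> n \<in> hom M (Zn \<phi> n) (lev Y n) \<and>
    pn \<phi> n \<bullet> jn \<phi> n = lv \<phi> n"
proof (induction n)
  case 0
  note h = F.fact_hom[OF S_homD(4)[OF f, of 0]]
  then show ?case by (simp add: st_0 Zn_def hom_def)
next
  case (Suc n)
  then have i: "jn \<phi> n \<in> hom M (lev X n) (Zn \<phi> n)" "pn \<phi> n \<in> hom M (Zn \<phi> n) (lev Y n)"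
    "pn \<phi> n \<bullet> jn \<phi> n = lv \<phi> n" by auto
  note h = latch[OF f i] and w = F.fact_hom[OF latch(5)[OF f i]]
  show ?case
    using h(2,7) w(3,4) comp_ext[OF w(5), of "an \<phi> n"] by (simp add: st_Suc Zn_def hom_def)
qed

lemma fact_maps:
  assumes f: "\<phi> \<in> hom S X Y"
  shows "jn \<phi> n \<in> hom M (lev X n) (Zn \<phi> n)" "pn \<phi> n \<in> hom M (Zn \<phi> n) (lev Y n)"
    "pn \<phi> n \<bullet> jn \<phi> n = lv \<phi> n"
  using fact_step[OF f] by auto

lemmas fact_latch = latch[OF _ fact_maps]

lemma wn_fact:
  assumes f: "\<phi> \<in> hom S X Y"
  shows "l (wn \<phi> n) \<in> hom M (Pn \<phi> n) (Zn \<phi> (Suc n))" "r (wn \<phi> n) \<in> hom M (Zn \<phi> (Suc n)) (lev Y (Suc n))"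
    "l (wn \<phi> n) \<in> A" "r (wn \<phi> n) \<in> B" "r (wn \<phi> n) \<bullet> l (wn \<phi> n) = wn \<phi> n" "m (wn \<phi> n) = Zn \<phi> (Suc n)"
proof -
  note w = F.fact_hom[OF fact_latch(5)[OF f f f f, of n]]
  show "l (wn \<phi> n) \<in> hom M (Pn \<phi> n) (Zn \<phi> (Suc n))" "r (wn \<phi> n) \<in> hom M (Zn \<phi> (Suc n)) (lev Y (Suc n))"
    "l (wn \<phi> n) \<in> A" "r (wn \<phi> n) \<in> B" "r (wn \<phi> n) \<bullet> l (wn \<phi> n) = wn \<phi> n" "m (wn \<phi> n) = Zn \<phi> (Suc n)"
    using w by (auto simp: Zn_def st_Suc hom_def)
qed

definition Zs :: "('o, 'a) spt_map \<Rightarrow> ('o, 'a) prespectrum" where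
  "Zs \<phi> = \<lparr>lev = Zn \<phi>, bond = (\<lambda>n. l (wn \<phi> n) \<bullet> bn \<phi> n)\<rparr>"
definition "js \<phi> = (fst \<phi>, jn \<phi>, Zs \<phi>)"
definition "ps \<phi> = (Zs \<phi>, pn \<phi>, snd (snd \<phi>))"

lemma Zs_bond: "\<phi> \<in> hom S X Y \<Longrightarrow> l (wn \<phi> n) \<bullet> bn \<phi> n \<in> hom M (omap T (Zn \<phi> n)) (Zn \<phi> (Suc n))"
  using comp_hom[OF wn_fact(1) fact_latch(3)] .

lemma Zs: "\<phi> \<in> hom S X Y \<Longrightarrow> is_prespectrum M T (Zs \<phi>)"
  unfolding is_prespectrum_def Zs_def using Zs_bond hom_ob(1)[OF fact_maps(2)] by simp

lemma js:
  assumes f: "\<phi> \<in> hom S X Y"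
  shows "js \<phi> \<in> hom S X (Zs \<phi>)"
proof -
  have X: "fst \<phi> = X" using f by (simp add: hom_def[of S] S_simps)
  note b = spectrum_hom(2)[OF S_homD(2)[OF f]]
  have "jn \<phi> (Suc n) \<bullet> bond X n = bond (Zs \<phi>) n \<bullet> amap T (jn \<phi> n)" for n
    using wn_fact(1)[OF f, of n] fact_latch(2,3,4)[OF f f f f, of n] b[of n] T_hom[OF fact_maps(1)[OF f, of n]]
    by (simp add: st_Suc Zs_def hom_def)
  then show ?thesis
    unfolding js_def X using fact_maps(1)[OF f]
    by (intro S_homI[OF S_homD(2)[OF f] Zs[OF f]]) (simp_all add: Zs_def)
qed

lemma ps:
  assumes f: "\<phi> \<in> hom S X Y"
  shows "ps \<phi> \<in> hom S (Zs \<phi>) Y"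
proof -
  have Y: "snd (snd \<phi>) = Y" using f by (simp add: hom_def[of S] S_simps)
  have "pn \<phi> (Suc n) \<bullet> bond (Zs \<phi>) n = bond Y n \<bullet> amap T (pn \<phi> n)" for n
    using wn_fact(1,2)[OF f, of n] fact_latch(3,6)[OF f f f f, of n] comp_ext[OF wn_fact(5)[OF f, of n], of "bn \<phi> n"]
    by (simp add: st_Suc Zs_def hom_def)
  then show ?thesis
    unfolding ps_def Y using fact_maps(2)[OF f]
    by (intro S_homI[OF Zs[OF f] S_homD(3)[OF f]]) (simp_all add: Zs_def)
qed

lemma lv_js: "lv (js \<phi>) = jn \<phi>" and lv_ps: "lv (ps \<phi>) = pn \<phi>"
  by (simp_all add: js_def ps_def)

lemma ps_js: "\<phi> \<in> hom S X Y \<Longrightarrow> ps \<phi> \<star> js \<phi> = \<phi>"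
  by (rule S_eqI[OF S_comp[OF js ps]]) (simp_all add: lv_js lv_ps fact_maps(3))

lemma pn_B: "\<phi> \<in> hom S X Y \<Longrightarrow> pn \<phi> n \<in> B"
  using F.fact_hom(2)[OF S_homD(4)] wn_fact(4) by (cases n) (auto simp: st_0 st_Suc)

text \<open>At level \<open>n + 1\<close> the map is a cobase change of \<open>T\<close> of the map
  at level \<open>n\<close>, followed by an element of \<open>A\<close>; the three closure
  hypotheses match these operations.\<close>

lemma jn_A:
  assumes f: "\<phi> \<in> hom S X Y" and TA: "amap T ` A \<subseteq> A"
    and comp: "\<And>i j x y z. i \<in> hom M x y \<Longrightarrow> j \<in> hom M y z \<Longrightarrow> i \<in> A \<Longrightarrow> j \<in> A \<Longrightarrow> j \<bullet> i \<in> A"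
    and po: "\<And>f g f' g'. pushout_square M f g f' g' \<Longrightarrow> f \<in> A \<Longrightarrow> f' \<in> A"
  shows "jn \<phi> n \<in> A"
proof (induction n)
  case 0
  then show ?case using F.fact_hom(1)[OF S_homD(4)[OF f]] by (simp add: st_0)
next
  case (Suc n)
  have "an \<phi> n \<in> A" using po[OF fact_latch(1)[OF f f f f]] Suc TA by blast
  then show ?case using comp[OF fact_latch(2)[OF f f f f] wn_fact(1)[OF f] _ wn_fact(3)[OF f]] by (simp add: st_Suc)
qed

text \<open>Compatibility with the structure maps and with \<open>u\<close> prescribes the lift on
  \<open>Pn \<phi> n\<close>, and \<open>l (wn \<phi> n) \<in> A\<close> extends it from there to
  level \<open>n + 1\<close>.\<close>

lemma js_lifts:
  assumes f: "\<phi> \<in> hom S X Y" and q: "\<psi> \<in> hom S E W"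
    and l: "\<And>n i. i \<in> A \<Longrightarrow> lifts_against M i (lv \<psi> n)"
  shows "lifts_against S (js \<phi>) \<psi>"
proof (rule S.liftsI[OF js[OF f] q])
  fix u v assume u: "u \<in> hom S X E" and v: "v \<in> hom S (Zs \<phi>) W" and s: "\<psi> \<star> u = v \<star> js \<phi>"
  note u' = S_homD[OF u] and v' = S_homD[OF v] and q' = S_homD[OF q]
  have vh: "lv v n \<in> hom M (Zn \<phi> n) (lev W n)" for n using v'(4)[of n] by (simp add: Zs_def)
  have vb: "lv v (Suc n) \<bullet> wb = bond W n \<bullet> amap T (lv v n)" if "wb = l (wn \<phi> n) \<bullet> bn \<phi> n" for n wb
    using v'(5)[of n] that by (simp add: Zs_def)
  have s': "lv \<psi> n \<bullet> lv u n = lv v n \<bullet> jn \<phi> n" for n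
    using arg_cong[OF s, where f = "\<lambda>\<phi>. lv \<phi> n"] by (simp add: lv_js)
  let ?P = "\<lambda>n h. h \<in> hom M (Zn \<phi> n) (lev E n) \<and> h \<bullet> jn \<phi> n = lv u n \<and> lv \<psi> n \<bullet> h = lv v n"
  let ?R = "\<lambda>n h h'. h' \<bullet> l (wn \<phi> n) \<bullet> bn \<phi> n = bond E n \<bullet> amap T h"
  \<comment> \<open>The levels cannot be chosen independently: \<open>?R\<close> says that
    consecutive lifts commute with the structure maps.\<close>
  have "\<exists>h. \<forall>n. ?P n (h n) \<and> ?R n (h n) (h (Suc n))"
  proof (rule dependent_nat_choice)
    have j0: "jn \<phi> 0 \<in> A" using F.fact_hom(1)[OF S_homD(4)[OF f]] by (simp add: st_0)
    show "\<exists>h. ?P 0 h"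
      by (rule liftsE[OF l[OF j0, of 0] fact_maps(1)[OF f] q'(4) u'(4) vh s'[of 0]]) blast
    fix h n assume h: "?P n h"
    then have hh: "h \<in> hom M (Zn \<phi> n) (lev E n)" by blast
    note j = fact_maps[OF f, of n] and L = fact_latch[OF f f f f, of n] and w = wn_fact[OF f, of n]
    note bX = spectrum_hom(2)[OF u'(2), of n] and bE = spectrum_hom(2)[OF u'(3), of n]
      and bW = spectrum_hom(2)[OF q'(3), of n]
    have "(bond E n \<bullet> amap T h) \<bullet> amap T (jn \<phi> n) = lv u (Suc n) \<bullet> bond X n"
      using T_comp[OF hh j(1)] h u'(5)[of n] T_hom[OF hh] T_hom[OF j(1)] bE by (simp add: hom_def)
    from pushout_univ[OF L(1) T_hom[OF j(1)] bX comp_hom[OF bE T_hom[OF hh]] u'(4) this]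
    obtain k where k: "k \<in> hom M (Pn \<phi> n) (lev E (Suc n))" "k \<bullet> bn \<phi> n = bond E n \<bullet> amap T h"
      "k \<bullet> an \<phi> n = lv u (Suc n)" unfolding Pn_def by blast
    have e: "lv \<psi> (Suc n) \<bullet> k = lv v (Suc n) \<bullet> l (wn \<phi> n)"
    proof (rule pushout_unique[OF L(1) T_hom[OF j(1)] bX, folded Pn_def])
      show "lv \<psi> (Suc n) \<bullet> k \<in> hom M (Pn \<phi> n) (lev W (Suc n))" by (rule comp_hom[OF q'(4) k(1)])
      show "lv v (Suc n) \<bullet> l (wn \<phi> n) \<in> hom M (Pn \<phi> n) (lev W (Suc n))" by (rule comp_hom[OF vh w(1)])
      have "(lv \<psi> (Suc n) \<bullet> k) \<bullet> bn \<phi> n = lv \<psi> (Suc n) \<bullet> bond E n \<bullet> amap T h"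
        using k(1,2) q'(4)[of "Suc n"] L(3) by (simp add: hom_def)
      also have "\<dots> = bond W n \<bullet> amap T (lv \<psi> n \<bullet> h)"
        using comp_ext[OF q'(5)[of n], of "amap T h"] T_comp[OF q'(4)[of n] hh] T_hom[OF hh]
          T_hom[OF q'(4)[of n]] bE bW q'(4)[of "Suc n"] by (simp add: hom_def)
      also have "\<dots> = (lv v (Suc n) \<bullet> l (wn \<phi> n)) \<bullet> bn \<phi> n"
        using h vb[of _ n] vh[of "Suc n"] w(1) L(3) by (simp add: hom_def)
      finally show "(lv \<psi> (Suc n) \<bullet> k) \<bullet> bn \<phi> n = (lv v (Suc n) \<bullet> l (wn \<phi> n)) \<bullet> bn \<phi> n" .
      have "(lv \<psi> (Suc n) \<bullet> k) \<bullet> an \<phi> n = lv \<psi> (Suc n) \<bullet> lv u (Suc n)"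
        using k(1,3) q'(4)[of "Suc n"] L(2) by (simp add: hom_def)
      also have "\<dots> = (lv v (Suc n) \<bullet> l (wn \<phi> n)) \<bullet> an \<phi> n"
        using s'[of "Suc n"] vh[of "Suc n"] w(1) L(2) by (simp add: hom_def st_Suc)
      finally show "(lv \<psi> (Suc n) \<bullet> k) \<bullet> an \<phi> n = (lv v (Suc n) \<bullet> l (wn \<phi> n)) \<bullet> an \<phi> n" .
    qed
    obtain h' where h': "h' \<in> hom M (Zn \<phi> (Suc n)) (lev E (Suc n))" "h' \<bullet> l (wn \<phi> n) = k"
      "lv \<psi> (Suc n) \<bullet> h' = lv v (Suc n)"
      by (rule liftsE[OF l[OF w(3), of "Suc n"] w(1) q'(4) k(1) vh e])
    have "h' \<bullet> jn \<phi> (Suc n) = lv u (Suc n)"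
      using comp_ext[OF h'(2), of "an \<phi> n"] h'(1) w(1) L(2) k(3) by (simp add: st_Suc hom_def)
    moreover have "?R n h h'"
      using comp_ext[OF h'(2), of "bn \<phi> n"] h'(1) w(1) L(3) k(2) by (simp add: hom_def)
    ultimately show "\<exists>h'. ?P (Suc n) h' \<and> ?R n h h'" using h' by blast
  qed
  then obtain h where h: "\<And>n. ?P n (h n)" "\<And>n. ?R n (h n) (h (Suc n))" by blast
  have hS: "(Zs \<phi>, h, E) \<in> hom S (Zs \<phi>) E"
    by (rule S_homI[OF Zs[OF f] u'(3)]) (use h in \<open>auto simp: Zs_def\<close>)
  have "(Zs \<phi>, h, E) \<star> js \<phi> = u"
    by (rule S_eqI[OF S_comp[OF js[OF f] hS] u]) (use h in \<open>simp add: lv_js\<close>)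
  moreover have "\<psi> \<star> (Zs \<phi>, h, E) = v"
    by (rule S_eqI[OF S_comp[OF hS q] v]) (use h in simp)
  ultimately show "\<exists>h. h \<in> hom S (Zs \<phi>) E \<and> h \<star> js \<phi> = u \<and> \<psi> \<star> h = v" using hS by blast
qed

section \<open>Functoriality of the levelwise factorization\<close>

definition "pq \<phi> \<psi> u n t = (THE q. q \<in> hom M (Pn \<phi> n) (Pn \<psi> n) \<and> q \<bullet> bn \<phi> n = bn \<psi> n \<bullet> amap T t \<and>
  q \<bullet> an \<phi> n = an \<psi> n \<bullet> lv u (Suc n))"

primrec en :: "('o, 'a) spt_map \<Rightarrow> ('o, 'a) spt_map \<Rightarrow> ('o, 'a) spt_map \<Rightarrow> ('o, 'a) spt_map \<Rightarrow> nat \<Rightarrow> 'a" where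
  "en \<phi> \<psi> u v 0 = e (lv \<phi> 0) (lv \<psi> 0) (lv u 0) (lv v 0)"
| "en \<phi> \<psi> u v (Suc n) = e (wn \<phi> n) (wn \<psi> n) (pq \<phi> \<psi> u n (en \<phi> \<psi> u v n)) (lv v (Suc n))"

context
  fixes \<phi> \<psi> u v X Y X' Y'
  assumes f: "\<phi> \<in> hom S X Y" and g: "\<psi> \<in> hom S X' Y'" and u: "u \<in> hom S X X'" and v: "v \<in> hom S Y Y'"
    and s: "\<psi> \<star> u = v \<star> \<phi>"
begin

lemma sq_level: "lv \<psi> n \<bullet> lv u n = lv v n \<bullet> lv \<phi> n"
  using arg_cong[OF s, where f = "\<lambda>\<phi>. lv \<phi> n"] by simp

lemma pq:
  assumes t: "t \<in> hom M (Zn \<phi> n) (Zn \<psi> n)" "t \<bullet> jn \<phi> n = jn \<psi> n \<bullet> lv u n" "pn \<psi> n \<bullet> t = lv v n \<bullet> pn \<phi> n"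
  shows "pq \<phi> \<psi> u n t \<in> hom M (Pn \<phi> n) (Pn \<psi> n)" "pq \<phi> \<psi> u n t \<bullet> bn \<phi> n = bn \<psi> n \<bullet> amap T t"
    "pq \<phi> \<psi> u n t \<bullet> an \<phi> n = an \<psi> n \<bullet> lv u (Suc n)"
    "wn \<psi> n \<bullet> pq \<phi> \<psi> u n t = lv v (Suc n) \<bullet> wn \<phi> n"
proof -
  note j = fact_maps[OF f, of n] and L = fact_latch[OF f f f f, of n]
  note j' = fact_maps[OF g, of n] and L' = fact_latch[OF g g g g, of n]
  note u' = S_homD[OF u] and v' = S_homD[OF v]
  note bX = spectrum_hom(2)[OF u'(2), of n] and bX' = spectrum_hom(2)[OF u'(3), of n]
    and bY = spectrum_hom(2)[OF v'(2), of n] and bY' = spectrum_hom(2)[OF v'(3), of n]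
  note Tt = T_hom[OF t(1)] and Tj = T_hom[OF j(1)] and Tj' = T_hom[OF j'(1)] and Tu = T_hom[OF u'(4)[of n]]
    and Tp = T_hom[OF j(2)] and Tp' = T_hom[OF j'(2)] and Tv = T_hom[OF v'(4)[of n]]
  have "(bn \<psi> n \<bullet> amap T t) \<bullet> amap T (jn \<phi> n) = bn \<psi> n \<bullet> amap T (t \<bullet> jn \<phi> n)"
    using T_comp[OF t(1) j(1)] Tt Tj L'(3) by (simp add: hom_def)
  also have "\<dots> = (bn \<psi> n \<bullet> amap T (jn \<psi> n)) \<bullet> amap T (lv u n)"
    using T_comp[OF j'(1) u'(4)[of n]] t(2) Tj' Tu L'(3) by (simp add: hom_def)
  also have "\<dots> = an \<psi> n \<bullet> bond X' n \<bullet> amap T (lv u n)"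
    using L'(2,4) Tu bX' by (simp add: hom_def)
  also have "\<dots> = (an \<psi> n \<bullet> lv u (Suc n)) \<bullet> bond X n"
    using u'(5)[of n] u'(4)[of "Suc n"] L'(2) bX by (simp add: hom_def)
  finally have c: "(bn \<psi> n \<bullet> amap T t) \<bullet> amap T (jn \<phi> n) = (an \<psi> n \<bullet> lv u (Suc n)) \<bullet> bond X n" .
  from theI'[OF pushout_univ[OF L(1) Tj bX comp_hom[OF L'(3) Tt] comp_hom[OF L'(2) u'(4)] this, folded Pn_def]]
  show q: "pq \<phi> \<psi> u n t \<in> hom M (Pn \<phi> n) (Pn \<psi> n)" "pq \<phi> \<psi> u n t \<bullet> bn \<phi> n = bn \<psi> n \<bullet> amap T t"
    "pq \<phi> \<psi> u n t \<bullet> an \<phi> n = an \<psi> n \<bullet> lv u (Suc n)"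
    unfolding pq_def by blast+
  show "wn \<psi> n \<bullet> pq \<phi> \<psi> u n t = lv v (Suc n) \<bullet> wn \<phi> n"
  proof (rule pushout_unique[OF L(1) Tj bX, folded Pn_def])
    show "wn \<psi> n \<bullet> pq \<phi> \<psi> u n t \<in> hom M (Pn \<phi> n) (lev Y' (Suc n))" by (rule comp_hom[OF L'(5) q(1)])
    show "lv v (Suc n) \<bullet> wn \<phi> n \<in> hom M (Pn \<phi> n) (lev Y' (Suc n))" by (rule comp_hom[OF v'(4) L(5)])
    have "(wn \<psi> n \<bullet> pq \<phi> \<psi> u n t) \<bullet> bn \<phi> n = (wn \<psi> n \<bullet> bn \<psi> n) \<bullet> amap T t"
      using q(1,2) L(3) L'(3,5) Tt by (simp add: hom_def)
    also have "\<dots> = bond Y' n \<bullet> amap T (pn \<psi> n \<bullet> t)"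
      using L'(6) T_comp[OF j'(2) t(1)] bY' Tp' Tt by (simp add: hom_def)
    also have "\<dots> = (bond Y' n \<bullet> amap T (lv v n)) \<bullet> amap T (pn \<phi> n)"
      using t(3) T_comp[OF v'(4)[of n] j(2)] bY' Tv Tp by (simp add: hom_def)
    also have "\<dots> = (lv v (Suc n) \<bullet> bond Y n) \<bullet> amap T (pn \<phi> n)" using v'(5)[of n] by simp
    also have "\<dots> = (lv v (Suc n) \<bullet> wn \<phi> n) \<bullet> bn \<phi> n"
      using L(3,5,6) v'(4)[of "Suc n"] bY Tp by (simp add: hom_def)
    finally show "(wn \<psi> n \<bullet> pq \<phi> \<psi> u n t) \<bullet> bn \<phi> n = (lv v (Suc n) \<bullet> wn \<phi> n) \<bullet> bn \<phi> n" .
    have "(wn \<psi> n \<bullet> pq \<phi> \<psi> u n t) \<bullet> an \<phi> n = (wn \<psi> n \<bullet> an \<psi> n) \<bullet> lv u (Suc n)"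
      using q(1,3) L(2) L'(2,5) u'(4)[of "Suc n"] by (simp add: hom_def)
    also have "\<dots> = (lv v (Suc n) \<bullet> wn \<phi> n) \<bullet> an \<phi> n"
      using L'(7) L(2,5,7) sq_level[of "Suc n"] v'(4)[of "Suc n"] by (simp add: hom_def)
    finally show "(wn \<psi> n \<bullet> pq \<phi> \<psi> u n t) \<bullet> an \<phi> n = (lv v (Suc n) \<bullet> wn \<phi> n) \<bullet> an \<phi> n" .
  qed
qed

lemma en_step:
  "en \<phi> \<psi> u v n \<in> hom M (Zn \<phi> n) (Zn \<psi> n) \<and> en \<phi> \<psi> u v n \<bullet> jn \<phi> n = jn \<psi> n \<bullet> lv u n \<and>
   pn \<psi> n \<bullet> en \<phi> \<psi> u v n = lv v n \<bullet> pn \<phi> n"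
proof (induction n)
  case 0
  have z: "m (lv \<phi> 0) = Zn \<phi> 0" "m (lv \<psi> 0) = Zn \<psi> 0"
    using F.fact_hom(4)[OF S_homD(4)[OF f, of 0]] F.fact_hom(4)[OF S_homD(4)[OF g, of 0]]
    by (auto simp: Zn_def st_0 hom_def)
  show ?case
    using F.mid[OF S_homD(4)[OF f, of 0] S_homD(4)[OF g, of 0] S_homD(4)[OF u, of 0]
        S_homD(4)[OF v, of 0] sq_level[of 0]] z
    by (simp add: st_0)
next
  case (Suc n)
  then have t: "en \<phi> \<psi> u v n \<in> hom M (Zn \<phi> n) (Zn \<psi> n)" "en \<phi> \<psi> u v n \<bullet> jn \<phi> n = jn \<psi> n \<bullet> lv u n"
    "pn \<psi> n \<bullet> en \<phi> \<psi> u v n = lv v n \<bullet> pn \<phi> n" by auto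
  note q = pq[OF t] and L = fact_latch[OF f f f f, of n] and L' = fact_latch[OF g g g g, of n]
  note w = wn_fact[OF f, of n] and w' = wn_fact[OF g, of n]
  let ?e = "en \<phi> \<psi> u v (Suc n)"
  have E: "?e \<in> hom M (Zn \<phi> (Suc n)) (Zn \<psi> (Suc n))" "?e \<bullet> l (wn \<phi> n) = l (wn \<psi> n) \<bullet> pq \<phi> \<psi> u n (en \<phi> \<psi> u v n)"
    "r (wn \<psi> n) \<bullet> ?e = lv v (Suc n) \<bullet> r (wn \<phi> n)"
    using F.mid[OF L(5) L'(5) q(1) S_homD(4)[OF v] q(4)] w(6) w'(6) by auto
  have "?e \<bullet> jn \<phi> (Suc n) = jn \<psi> (Suc n) \<bullet> lv u (Suc n)"
    using comp_ext[OF E(2), of "an \<phi> n"] E(1) w(1) w'(1) q(1,3) L(2) L'(2) S_homD(4)[OF u, of "Suc n"]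
    by (simp add: st_Suc hom_def)
  then show ?case using E by (simp add: st_Suc del: en.simps)
qed

lemma en:
  "en \<phi> \<psi> u v n \<in> hom M (Zn \<phi> n) (Zn \<psi> n)" "en \<phi> \<psi> u v n \<bullet> jn \<phi> n = jn \<psi> n \<bullet> lv u n"
  "pn \<psi> n \<bullet> en \<phi> \<psi> u v n = lv v n \<bullet> pn \<phi> n"
  using en_step[of n] by auto

lemma en_bond: "en \<phi> \<psi> u v (Suc n) \<bullet> l (wn \<phi> n) \<bullet> bn \<phi> n = (l (wn \<psi> n) \<bullet> bn \<psi> n) \<bullet> amap T (en \<phi> \<psi> u v n)"
proof -
  note q = pq[OF en, of n] and L = fact_latch[OF f f f f, of n] and L' = fact_latch[OF g g g g, of n]
  note w = wn_fact[OF f, of n] and w' = wn_fact[OF g, of n]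
  have E: "en \<phi> \<psi> u v (Suc n) \<bullet> l (wn \<phi> n) = l (wn \<psi> n) \<bullet> pq \<phi> \<psi> u n (en \<phi> \<psi> u v n)"
    using F.mid[OF L(5) L'(5) q(1) S_homD(4)[OF v] q(4)] by simp
  show ?thesis
    using comp_ext[OF E, of "bn \<phi> n"] en(1)[of "Suc n"] w(1) w'(1) q(1,2) L(3) L'(3) T_hom[OF en(1)[of n]]
    by (simp add: hom_def del: en.simps)
qed

lemma es: "(Zs \<phi>, en \<phi> \<psi> u v, Zs \<psi>) \<in> hom S (Zs \<phi>) (Zs \<psi>)"
  by (rule S_homI[OF Zs[OF f] Zs[OF g]]) (use en(1) en_bond in \<open>simp_all add: Zs_def del: en.simps\<close>)

end

lemma en_id:
  assumes f: "\<phi> \<in> hom S X Y"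
  shows "en \<phi> \<phi> (idn S X) (idn S Y) n = idn M (Zn \<phi> n)"
proof (induction n)
  case 0
  then show ?case
    using F.fact_hom(4,6)[OF S_homD(4)[OF f, of 0]] by (simp add: Zn_def st_0 hom_def)
next
  case (Suc n)
  note j = fact_maps[OF f, of n] and L = fact_latch[OF f f f f, of n] and w = wn_fact[OF f, of n]
  note f' = S_homD[OF f]
  note bX = spectrum_hom(2)[OF f'(2), of n]
  have o: "Zn \<phi> n \<in> ob M" "Pn \<phi> n \<in> ob M" "lev X (Suc n) \<in> ob M" "lev X n \<in> ob M" "lev Y n \<in> ob M"
    using hom_ob[OF j(1)] hom_ob[OF L(2)] hom_ob[OF j(2)] by auto
  have i: "idn S X \<in> hom S X X" "idn S Y \<in> hom S Y Y" using S_id f' by auto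
  have s: "\<phi> \<star> idn S X = idn S Y \<star> \<phi>" using f by (simp add: hom_def[of S])
  have t: "idn M (Zn \<phi> n) \<in> hom M (Zn \<phi> n) (Zn \<phi> n)" "idn M (Zn \<phi> n) \<bullet> jn \<phi> n = jn \<phi> n \<bullet> lv (idn S X) n"
    "pn \<phi> n \<bullet> idn M (Zn \<phi> n) = lv (idn S Y) n \<bullet> pn \<phi> n"
    using j o id_hom by (auto simp: hom_def)
  note q = pq[OF f f i s t]
  have "pq \<phi> \<phi> (idn S X) n (idn M (Zn \<phi> n)) = idn M (Pn \<phi> n)"
  proof (rule pushout_unique[OF L(1) T_hom[OF j(1)] bX, folded Pn_def, OF q(1) id_hom[OF o(2)]])
    show "pq \<phi> \<phi> (idn S X) n (idn M (Zn \<phi> n)) \<bullet> bn \<phi> n = idn M (Pn \<phi> n) \<bullet> bn \<phi> n"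
      using q(2) T_id[OF o(1)] L(3) by (simp add: hom_def)
    show "pq \<phi> \<phi> (idn S X) n (idn M (Zn \<phi> n)) \<bullet> an \<phi> n = idn M (Pn \<phi> n) \<bullet> an \<phi> n"
      using q(3) L(2) by (simp add: hom_def)
  qed
  then show ?case using Suc F.fact_hom(6)[OF L(5)] w(6) by simp
qed

lemma en_comp:
  assumes f: "\<phi> \<in> hom S X Y" and g: "\<psi> \<in> hom S X' Y'" and k: "\<chi> \<in> hom S X'' Y''"
    and u: "u \<in> hom S X X'" and v: "v \<in> hom S Y Y'" and u': "u' \<in> hom S X' X''" and v': "v' \<in> hom S Y' Y''"
    and s: "\<psi> \<star> u = v \<star> \<phi>" and s': "\<chi> \<star> u' = v' \<star> \<psi>"
  shows "en \<phi> \<chi> (u' \<star> u) (v' \<star> v) n = en \<psi> \<chi> u' v' n \<bullet> en \<phi> \<psi> u v n"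
proof (induction n)
  case 0
  show ?case
    using F.mid_comp[OF S_homD(4)[OF f] S_homD(4)[OF g] S_homD(4)[OF k] S_homD(4)[OF u] S_homD(4)[OF v]
        S_homD(4)[OF u'] S_homD(4)[OF v'] sq_level[OF f g u v s] sq_level[OF g k u' v' s']] by simp
next
  case (Suc n)
  have s'': "\<chi> \<star> u' \<star> u = (v' \<star> v) \<star> \<phi>"
    using f g k u v u' v' s S.comp_ext[OF s', of u] by (simp add: hom_def[of S])
  note U = S_comp[OF u u'] and V = S_comp[OF v v']
  note t1 = en[OF f g u v s, of n] and t2 = en[OF g k u' v' s', of n] and t3 = en[OF f k U V s'', of n]
  note q1 = pq[OF f g u v s t1] and q2 = pq[OF g k u' v' s' t2] and q3 = pq[OF f k U V s'' t3]
  note L = fact_latch[OF f f f f, of n] and L' = fact_latch[OF g g g g, of n] and L'' = fact_latch[OF k k k k, of n]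
  note j = fact_maps[OF f, of n] and bX = spectrum_hom(2)[OF S_homD(2)[OF f], of n]
  let ?q1 = "pq \<phi> \<psi> u n (en \<phi> \<psi> u v n)" and ?q2 = "pq \<psi> \<chi> u' n (en \<psi> \<chi> u' v' n)"
    and ?q3 = "pq \<phi> \<chi> (u' \<star> u) n (en \<phi> \<chi> (u' \<star> u) (v' \<star> v) n)"
  have "?q3 = ?q2 \<bullet> ?q1"
  proof (rule pushout_unique[OF L(1) T_hom[OF j(1)] bX, folded Pn_def, OF q3(1) comp_hom[OF q2(1) q1(1)]])
    show "?q3 \<bullet> bn \<phi> n = (?q2 \<bullet> ?q1) \<bullet> bn \<phi> n"
      using q3(2) q1(1,2) q2(1) comp_ext[OF q2(2), of "amap T (en \<phi> \<psi> u v n)"] Suc T_comp[OF t2(1) t1(1)]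
        L(3) L'(3) L''(3) T_hom[OF t1(1)] T_hom[OF t2(1)] by (simp add: hom_def)
    show "?q3 \<bullet> an \<phi> n = (?q2 \<bullet> ?q1) \<bullet> an \<phi> n"
      using q3(3) q1(1,3) q2(1) comp_ext[OF q2(3), of "lv u (Suc n)"] L(2) L'(2) L''(2)
        S_homD(4)[OF u, of "Suc n"] S_homD(4)[OF u', of "Suc n"] by (simp add: hom_def)
  qed
  then show ?case
    using F.mid_comp[OF L(5) L'(5) L''(5) q1(1) S_homD(4)[OF v] q2(1) S_homD(4)[OF v'] q1(4) q2(4)] by simp
qed

text \<open>The telescope of prespectra is functorial through functorial factorizations of maps of
  prespectra, so the locale is reproduced one level up. \<open>A'\<close> and \<open>B'\<close> stay
  open until the classes of the level structure are known to contain the factors.\<close>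

lemma S_ffact:
  assumes A': "\<And>\<phi> X Y. \<phi> \<in> hom S X Y \<Longrightarrow> js \<phi> \<in> A'" and B': "\<And>\<phi> X Y. \<phi> \<in> hom S X Y \<Longrightarrow> ps \<phi> \<in> B'"
  shows "ffact S A' B' Zs js ps (\<lambda>\<phi> \<psi> u v. (Zs \<phi>, en \<phi> \<psi> u v, Zs \<psi>))"
proof unfold_locales
  fix \<phi> assume "\<phi> \<in> arr S"
  then have f: "\<phi> \<in> hom S (src S \<phi>) (tgt S \<phi>)" by (rule S.hom_self)
  have "(Zs \<phi>, en \<phi> \<phi> (idn S (src S \<phi>)) (idn S (tgt S \<phi>)), Zs \<phi>) = idn S (Zs \<phi>)"
  proof -
    have s: "\<phi> \<star> idn S (src S \<phi>) = idn S (tgt S \<phi>) \<star> \<phi>" using f by (simp add: hom_def[of S])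
    show ?thesis
      by (rule S_eqI[OF es[OF f f S_id[OF S_homD(2)[OF f]] S_id[OF S_homD(3)[OF f]] s] S_id[OF Zs[OF f]]])
        (simp add: en_id[OF f], simp add: Zs_def)
  qed
  then show "js \<phi> \<in> A' \<and> ps \<phi> \<in> B' \<and> js \<phi> \<in> hom S (src S \<phi>) (Zs \<phi>) \<and> ps \<phi> \<in> hom S (Zs \<phi>) (tgt S \<phi>) \<and>
     ps \<phi> \<star> js \<phi> = \<phi> \<and> (Zs \<phi>, en \<phi> \<phi> (idn S (src S \<phi>)) (idn S (tgt S \<phi>)), Zs \<phi>) = idn S (Zs \<phi>)"
    using A'[OF f] B'[OF f] js[OF f] ps[OF f] ps_js[OF f] by blast
next
  fix \<phi> X Y \<psi> X' Y' u v
  assume f: "\<phi> \<in> hom S X Y" and g: "\<psi> \<in> hom S X' Y'" and u: "u \<in> hom S X X'" and v: "v \<in> hom S Y Y'"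
    and s: "\<psi> \<star> u = v \<star> \<phi>"
  let ?e = "(Zs \<phi>, en \<phi> \<psi> u v, Zs \<psi>)"
  note e = es[OF f g u v s]
  have "?e \<star> js \<phi> = js \<psi> \<star> u"
    by (rule S_eqI[OF S_comp[OF js[OF f] e] S_comp[OF u js[OF g]]]) (simp add: lv_js en(2)[OF f g u v s])
  moreover have "ps \<psi> \<star> ?e = v \<star> ps \<phi>"
    by (rule S_eqI[OF S_comp[OF e ps[OF g]] S_comp[OF ps[OF f] v]]) (simp add: lv_ps en(3)[OF f g u v s])
  ultimately show "?e \<in> hom S (Zs \<phi>) (Zs \<psi>) \<and> ?e \<star> js \<phi> = js \<psi> \<star> u \<and> ps \<psi> \<star> ?e = v \<star> ps \<phi>"
    using e by blast
  fix \<chi> X'' Y'' u' v'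
  assume k: "\<chi> \<in> hom S X'' Y''" and u': "u' \<in> hom S X' X''" and v': "v' \<in> hom S Y' Y''"
    and s': "\<chi> \<star> u' = v' \<star> \<psi>"
  have s'': "\<chi> \<star> u' \<star> u = (v' \<star> v) \<star> \<phi>"
    using f g k u v u' v' s S.comp_ext[OF s', of u] by (simp add: hom_def[of S])
  show "(Zs \<phi>, en \<phi> \<chi> (u' \<star> u) (v' \<star> v), Zs \<chi>) = (Zs \<psi>, en \<psi> \<chi> u' v', Zs \<chi>) \<star> ?e"
    by (rule S_eqI[OF es[OF f k S_comp[OF u u'] S_comp[OF v v'] s''] S_comp[OF e es[OF g k u' v' s']]])
      (simp add: en_comp[OF f g k u v u' v' s s'])
qed

end

section \<open>Lifting across the adjunction; terminal and initial prespectra\<close>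

context spt
begin

lemma S_fields: "ob S = ob (Spt M T)" "arr S = arr (Spt M T)" "src S = src (Spt M T)" "tgt S = tgt (Spt M T)"
  "idn S = idn (Spt M T)" "cmp S = cmp (Spt M T)"
  by (simp_all add: level_structure_def cat.extend_def)

lemma S_classes:
  "Fib S = {\<phi> \<in> arr S. \<forall>n. lv \<phi> n \<in> Fib M}" "Eqv S = {\<phi> \<in> arr S. \<forall>n. lv \<phi> n \<in> Eqv M}"
  "Cof S = {i \<in> arr S. \<forall>p\<in>Fib S \<inter> Eqv S. lifts_against S i p}"
proof -
  have "lifts_against (Spt M T) = lifts_against S"
    by (intro ext) (simp add: lifts_against_def hom_def S_fields)
  then show "Fib S = {\<phi> \<in> arr S. \<forall>n. lv \<phi> n \<in> Fib M}" "Eqv S = {\<phi> \<in> arr S. \<forall>n. lv \<phi> n \<in> Eqv M}"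
    "Cof S = {i \<in> arr S. \<forall>p\<in>Fib S \<inter> Eqv S. lifts_against S i p}"
    unfolding S_fields(2) by (simp_all add: level_structure_def cat.extend_def levelwise_in_def lv_def)
qed

lemma S_class_iff:
  assumes "\<phi> \<in> hom S X Y"
  shows "\<phi> \<in> Fib S \<longleftrightarrow> (\<forall>n. lv \<phi> n \<in> Fib M)" "\<phi> \<in> Eqv S \<longleftrightarrow> (\<forall>n. lv \<phi> n \<in> Eqv M)"
  using assms unfolding S_classes(1,2) by (auto simp: hom_def[of S])

lemma ev_retract: "retract_of S \<phi> \<psi> \<Longrightarrow> retract_of M (lv \<phi> n) (lv \<psi> n)"
  using functor_retract[OF ev, of \<phi> \<psi> n] by (simp add: ev_def)

lemma T_classes: "i \<in> Cof M \<Longrightarrow> amap T i \<in> Cof M" "i \<in> Cof M \<Longrightarrow> i \<in> Eqv M \<Longrightarrow> amap T i \<in> Eqv M"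
  using T_cof by (auto simp: preserves_cofibrations_def)

text \<open>Transpose the square, lift against \<open>p\<close>, and transpose the filler
  back.\<close>

lemma Om_lifts:
  assumes i: "i \<in> hom M a b" and p: "p \<in> hom M x y" and l: "lifts_against M (amap T i) p"
  shows "lifts_against M i (amap \<Omega> p)"
proof (rule liftsI[OF i Om_hom[OF p]])
  fix u v assume u: "u \<in> hom M a (omap \<Omega> x)" and v: "v \<in> hom M b (omap \<Omega> y)"
    and s: "amap \<Omega> p \<bullet> u = v \<bullet> i"
  have o: "a \<in> ob M" "b \<in> ob M" "x \<in> ob M" "y \<in> ob M" using i p hom_ob by auto
  let ?u = "\<epsilon> x \<bullet> amap T u" and ?v = "\<epsilon> y \<bullet> amap T v"
  note h = \<epsilon>_hom[OF o(3)] \<epsilon>_hom[OF o(4)] T_hom[OF u] T_hom[OF v] T_hom[OF i] T_hom[OF Om_hom[OF p]]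
  have u': "?u \<in> hom M (omap T a) x" and v': "?v \<in> hom M (omap T b) y"
    by (rule comp_hom[OF h(1,3)], rule comp_hom[OF h(2,4)])
  have "p \<bullet> ?u = \<epsilon> y \<bullet> amap T (amap \<Omega> p) \<bullet> amap T u"
    using comp_ext[OF \<epsilon>_nat[OF p, symmetric], of "amap T u"] h p by (simp add: hom_def)
  also have "\<dots> = ?v \<bullet> amap T i"
    using T_comp[OF Om_hom[OF p] u] T_comp[OF v i] s h by (simp add: hom_def)
  finally obtain k where k: "k \<in> hom M (omap T b) x" "k \<bullet> amap T i = ?u" "p \<bullet> k = ?v"
    by (rule liftsE[OF l T_hom[OF i] p u' v'])
  have "adjoint b k \<bullet> i = u"
    using adjoint_natural[OF o(2) k(1) i] k(2) adjoint_surj[OF o(1,3) u] by simp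
  moreover have "amap \<Omega> p \<bullet> adjoint b k = v"
  proof -
    have "amap \<Omega> p \<bullet> adjoint b k = adjoint b (p \<bullet> k)"
      unfolding adjoint_def using Om_comp[OF p k(1)] Om_hom[OF p] Om_hom[OF k(1)] \<eta>_hom[OF o(2)]
      by (simp add: hom_def)
    then show ?thesis using k(3) adjoint_surj[OF o(2,4) v] by simp
  qed
  ultimately show "\<exists>h. h \<in> hom M b (omap \<Omega> x) \<and> h \<bullet> i = u \<and> amap \<Omega> p \<bullet> h = v"
    using adjoint_hom[OF o(2) k(1)] by blast
qed

lemma Om_afib:
  assumes p: "p \<in> Fib M" "p \<in> Eqv M"
  shows "amap \<Omega> p \<in> Eqv M"
proof -
  note ph = hom_self[OF class_arr(3)[OF p(1)]]
  have "lifts_against M i (amap \<Omega> p)" if "i \<in> Cof M" for i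
    by (rule Om_lifts[OF hom_self[OF class_arr(1)[OF that]] ph lift_afib[OF T_classes(1)[OF that] p]])
  then show ?thesis using afib_iff[of "amap \<Omega> p"] Om_hom[OF ph] by (simp add: hom_def)
qed

text \<open>Lifting against a map to the terminal object is a pure extension problem, so it
  transposes to an extension problem for \<open>x\<close> without identifying \<Omega> of the
  terminal object.\<close>

lemma Om_fibrant:
  assumes x: "fibrant M x"
  shows "fibrant M (omap \<Omega> x)"
proof -
  have o: "x \<in> ob M" by (rule fibrant_ob[OF x])
  obtain t where t: "terminal M t" using terminal_ex by blast
  obtain f where f: "f \<in> hom M (omap \<Omega> x) t" using terminal_hom[OF t Om_ob[OF o]] by blast
  have "lifts_against M i f" if i: "i \<in> Cof M" "i \<in> Eqv M" for i
  proof -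
    note ih = hom_self[OF class_arr(1)[OF i(1)]]
    have oi: "src M i \<in> ob M" "tgt M i \<in> ob M" using ih hom_ob by auto
    show ?thesis
    proof (rule liftsI[OF ih f])
      fix u v assume u: "u \<in> hom M (src M i) (omap \<Omega> x)" and v: "v \<in> hom M (tgt M i) t"
      have u': "\<epsilon> x \<bullet> amap T u \<in> hom M (omap T (src M i)) x" by (rule comp_hom[OF \<epsilon>_hom[OF o] T_hom[OF u]])
      obtain k where k: "k \<in> hom M (omap T (tgt M i)) x" "k \<bullet> amap T i = \<epsilon> x \<bullet> amap T u"
        using fibrant_extend[OF x T_hom[OF ih] T_classes(1)[OF i(1)] T_classes(2)[OF i] u'] by blast
      have "adjoint (tgt M i) k \<bullet> i = u"
        using adjoint_natural[OF oi(2) k(1) ih] k(2) adjoint_surj[OF oi(1) o u] by simp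
      moreover note a = adjoint_hom[OF oi(2) k(1)]
      moreover have "f \<bullet> adjoint (tgt M i) k = v" by (rule terminal_unique[OF t comp_hom[OF f a] v])
      ultimately show "\<exists>h. h \<in> hom M (tgt M i) (omap \<Omega> x) \<and> h \<bullet> i = u \<and> f \<bullet> h = v" by blast
    qed
  qed
  then have "f \<in> Fib M" using fib_iff[of f] f by (auto simp: hom_def)
  then show ?thesis using fibrant_terminal[OF t f] by simp
qed

lemma S_terminal: "\<exists>t. terminal S t \<and> (\<forall>n. terminal M (lev t n))"
proof -
  obtain t where t: "terminal M t" using terminal_ex by blast
  have to: "t \<in> ob M" using t by (simp add: terminal_def)
  obtain b where b: "b \<in> hom M (omap T t) t" using terminal_hom[OF t T_ob[OF to]] by blast
  let ?t = "\<lparr>lev = \<lambda>_. t, bond = \<lambda>_. b\<rparr>"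
  have X: "is_prespectrum M T ?t" using to b by (simp add: is_prespectrum_def)
  have "\<exists>!f. f \<in> hom S Y ?t" if "Y \<in> ob S" for Y
  proof -
    have Y: "is_prespectrum M T Y" using that by (simp add: S_simps(1))
    obtain f where f: "\<And>n. f n \<in> hom M (lev Y n) t" using terminal_hom[OF t spectrum_hom(1)[OF Y]] by metis
    have "(Y, f, ?t) \<in> hom S Y ?t"
      by (rule S_homI[OF Y X])
        (simp_all add: f terminal_unique[OF t comp_hom[OF f spectrum_hom(2)[OF Y]] comp_hom[OF b T_hom[OF f]]])
    moreover have "\<phi> = \<psi>" if h: "\<phi> \<in> hom S Y ?t" "\<psi> \<in> hom S Y ?t" for \<phi> \<psi>
    proof (rule S_eqI[OF h])
      fix n show "lv \<phi> n = lv \<psi> n"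
        using terminal_unique[OF t] S_homD(4)[OF h(1), of n] S_homD(4)[OF h(2), of n] by simp
    qed
    ultimately show ?thesis by blast
  qed
  then have "terminal S ?t" using X by (simp add: terminal_def S_simps(1))
  then show ?thesis using t by (intro exI[of _ ?t]) simp
qed

text \<open>Transposes of maps out of \<open>T\<close> of an initial object start at the initial
  object; in \<open>S_initial\<close> this yields compatibility with the structure maps.\<close>

lemma T_initial: "initial M i \<Longrightarrow> f \<in> hom M (omap T i) y \<Longrightarrow> g \<in> hom M (omap T i) y \<Longrightarrow> f = g"
  using adjoint_inj adjoint_hom initial_unique by (metis initial_def)

lemma S_initial: "\<exists>t. initial S t \<and> (\<forall>n. initial M (lev t n))"
proof -
  obtain t where t: "initial M t" using initial_ex by blast
  have to: "t \<in> ob M" using t by (simp add: initial_def)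
  obtain b' where b': "b' \<in> hom M t (omap \<Omega> t)" using initial_hom[OF t Om_ob[OF to]] by blast
  define b where "b = \<epsilon> t \<bullet> amap T b'"
  have b: "b \<in> hom M (omap T t) t" unfolding b_def by (rule comp_hom[OF \<epsilon>_hom[OF to] T_hom[OF b']])
  let ?t = "\<lparr>lev = \<lambda>_. t, bond = \<lambda>_. b\<rparr>"
  have X: "is_prespectrum M T ?t" using to b by (simp add: is_prespectrum_def)
  have "\<exists>!f. f \<in> hom S ?t Y" if "Y \<in> ob S" for Y
  proof -
    have Y: "is_prespectrum M T Y" using that by (simp add: S_simps(1))
    obtain f where f: "\<And>n. f n \<in> hom M t (lev Y n)" using initial_hom[OF t spectrum_hom(1)[OF Y]] by metis
    have "(?t, f, Y) \<in> hom S ?t Y"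
      by (rule S_homI[OF X Y])
        (simp_all add: f T_initial[OF t comp_hom[OF f b] comp_hom[OF spectrum_hom(2)[OF Y] T_hom[OF f]]])
    moreover have "\<phi> = \<psi>" if h: "\<phi> \<in> hom S ?t Y" "\<psi> \<in> hom S ?t Y" for \<phi> \<psi>
    proof (rule S_eqI[OF h])
      fix n show "lv \<phi> n = lv \<psi> n"
        using initial_unique[OF t] S_homD(4)[OF h(1), of n] S_homD(4)[OF h(2), of n] by simp
    qed
    ultimately show ?thesis by blast
  qed
  then have "initial S ?t" using X by (simp add: initial_def S_simps(1))
  then show ?thesis using t by (intro exI[of _ ?t]) simp
qed

subsection \<open>The shifted loop functor\<close>

abbreviation "ab \<equiv> adjoint_bond M \<Omega> \<eta>"

lemma ab_adjoint: "ab X n = adjoint (lev X n) (bond X n)"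
  by (simp add: adjoint_bond_def adjoint_def)

lemma ab_hom: "is_prespectrum M T X \<Longrightarrow> ab X n \<in> hom M (lev X n) (omap \<Omega> (lev X (Suc n)))"
  unfolding ab_adjoint by (rule adjoint_hom[OF spectrum_hom])

lemma ab_nat:
  assumes f: "\<phi> \<in> hom S X Y"
  shows "ab Y n \<bullet> lv \<phi> n = amap \<Omega> (lv \<phi> (Suc n)) \<bullet> ab X n"
proof -
  note f' = S_homD[OF f]
  note bX = spectrum_hom[OF f'(2), of n] and bY = spectrum_hom[OF f'(3), of n]
  have "ab Y n \<bullet> lv \<phi> n = adjoint (lev X n) (lv \<phi> (Suc n) \<bullet> bond X n)"
    using adjoint_natural[OF bY f'(4)] f'(5)[of n] by (simp add: ab_adjoint)
  then show ?thesis
    using Om_comp[OF f'(4) bX(2)] Om_hom[OF bX(2)] Om_hom[OF f'(4)[of "Suc n"]] \<eta>_hom[OF bX(1)]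
    by (simp add: adjoint_def ab_adjoint hom_def)
qed

text \<open>The structure maps are defined by transposition so that the adjoint structure map of
  \<open>Th_ob X\<close> at \<open>n\<close> is strictly \<Omega> of that of \<open>X\<close> at
  \<open>n + 1\<close>; this is what makes \<open>Th_\<sigma>\<close> an equality.\<close>

definition Th_ob :: "('o, 'a) prespectrum \<Rightarrow> ('o, 'a) prespectrum" where
  "Th_ob X = \<lparr>lev = (\<lambda>n. omap \<Omega> (lev X (Suc n))),
    bond = (\<lambda>n. \<epsilon> (omap \<Omega> (lev X (Suc (Suc n)))) \<bullet> amap T (amap \<Omega> (ab X (Suc n))))\<rparr>"

definition Th :: "(('o, 'a) prespectrum, ('o, 'a) spt_map, ('o, 'a) prespectrum, ('o, 'a) spt_map) ftr" where
  "Th = \<lparr>omap = Th_ob, amap = (\<lambda>\<phi>. (Th_ob (fst \<phi>), \<lambda>n. amap \<Omega> (lv \<phi> (Suc n)), Th_ob (snd (snd \<phi>))))\<rparr>"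

definition \<sigma> :: "('o, 'a) prespectrum \<Rightarrow> ('o, 'a) spt_map" where
  "\<sigma> X = (X, ab X, Th_ob X)"

lemma Th_simps: "lev (omap Th X) n = omap \<Omega> (lev X (Suc n))" "lv (amap Th \<phi>) n = amap \<Omega> (lv \<phi> (Suc n))"
  "lv (\<sigma> X) = ab X" "omap Th X = Th_ob X"
  by (simp_all add: Th_def Th_ob_def \<sigma>_def)

lemma Th_spectrum:
  assumes X: "is_prespectrum M T X"
  shows "is_prespectrum M T (Th_ob X)" "bond (Th_ob X) n = ab X (Suc n) \<bullet> \<epsilon> (lev X (Suc n))"
proof -
  note o = spectrum_hom(1)[OF X]
  show "bond (Th_ob X) n = ab X (Suc n) \<bullet> \<epsilon> (lev X (Suc n))"
    using \<epsilon>_nat[OF ab_hom[OF X, of "Suc n"]] by (simp add: Th_ob_def)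
  have "\<epsilon> (omap \<Omega> (lev X (Suc (Suc n)))) \<bullet> amap T (amap \<Omega> (ab X (Suc n)))
      \<in> hom M (omap T (omap \<Omega> (lev X (Suc n)))) (omap \<Omega> (lev X (Suc (Suc n))))" for n
    by (rule comp_hom[OF \<epsilon>_hom[OF Om_ob[OF o]] T_hom[OF Om_hom[OF ab_hom[OF X]]]])
  then show "is_prespectrum M T (Th_ob X)" using Om_ob[OF o] by (simp add: is_prespectrum_def Th_ob_def)
qed

lemma Th_map:
  assumes f: "\<phi> \<in> hom S X Y"
  shows "amap Th \<phi> \<in> hom S (Th_ob X) (Th_ob Y)"
proof -
  note f' = S_homD[OF f]
  have XY: "fst \<phi> = X" "snd (snd \<phi>) = Y" using f by (simp_all add: hom_def[of S] S_simps(3,4))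
  have "amap \<Omega> (lv \<phi> (Suc (Suc n))) \<bullet> bond (Th_ob X) n = bond (Th_ob Y) n \<bullet> amap T (amap \<Omega> (lv \<phi> (Suc n)))" for n
  proof -
    note h = f'(4)[of "Suc n"] Om_hom[OF f'(4)[of "Suc (Suc n)"]] ab_hom[OF f'(2), of "Suc n"] ab_hom[OF f'(3), of "Suc n"]
      \<epsilon>_hom[OF spectrum_hom(1)[OF f'(2), of "Suc n"]] \<epsilon>_hom[OF spectrum_hom(1)[OF f'(3), of "Suc n"]]
      T_hom[OF Om_hom[OF f'(4)[of "Suc n"]]]
    have "amap \<Omega> (lv \<phi> (Suc (Suc n))) \<bullet> bond (Th_ob X) n = ab Y (Suc n) \<bullet> lv \<phi> (Suc n) \<bullet> \<epsilon> (lev X (Suc n))"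
      using comp_ext[OF ab_nat[OF f, of "Suc n", symmetric], of "\<epsilon> (lev X (Suc n))"] h
      by (simp add: Th_spectrum(2)[OF f'(2)] hom_def)
    also have "\<dots> = bond (Th_ob Y) n \<bullet> amap T (amap \<Omega> (lv \<phi> (Suc n)))"
      using \<epsilon>_nat[OF f'(4)[of "Suc n"]] h by (simp add: Th_spectrum(2)[OF f'(3)] hom_def)
    finally show ?thesis .
  qed
  then have "(Th_ob X, \<lambda>n. amap \<Omega> (lv \<phi> (Suc n)), Th_ob Y) \<in> hom S (Th_ob X) (Th_ob Y)"
    using Om_hom[OF f'(4)]
    by (intro S_homI[OF Th_spectrum(1)[OF f'(2)] Th_spectrum(1)[OF f'(3)]]) (simp_all add: Th_ob_def)
  then show ?thesis using XY by (simp add: Th_def)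
qed

lemma Th_functor: "is_functor S S Th"
  unfolding is_functor_def
proof (intro conjI ballI impI)
  show "category S" "category S" by (rule S_category)+
  show "omap Th X \<in> ob S" if "X \<in> ob S" for X
    using Th_spectrum(1) that by (simp add: S_simps(1) Th_simps)
  show "amap Th \<phi> \<in> hom S (omap Th (src S \<phi>)) (omap Th (tgt S \<phi>))" if "\<phi> \<in> arr S" for \<phi>
    using Th_map[OF S.hom_self[OF that]] by (simp add: Th_simps)
  show "amap Th (idn S X) = idn S (omap Th X)" if "X \<in> ob S" for X
  proof -
    have X: "is_prespectrum M T X" using that by (simp add: S_simps(1))
    show ?thesis
      unfolding Th_simps(4)
      by (rule S_eqI[OF Th_map[OF S_id[OF X]] S_id[OF Th_spectrum(1)[OF X]]])
        (simp add: Th_simps(1,2) Om_id spectrum_hom(1)[OF X] flip: Th_simps(4))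
  qed
  fix \<phi> \<psi> assume "\<phi> \<in> arr S" "\<psi> \<in> arr S" "tgt S \<phi> = src S \<psi>"
  then have f: "\<phi> \<in> hom S (src S \<phi>) (src S \<psi>)" and g: "\<psi> \<in> hom S (src S \<psi>) (tgt S \<psi>)" by (auto simp: hom_def)
  show "amap Th (\<psi> \<star> \<phi>) = amap Th \<psi> \<star> amap Th \<phi>"
    by (rule S_eqI[OF Th_map[OF S_comp[OF f g]] S_comp[OF Th_map[OF f] Th_map[OF g]]])
      (simp add: Th_simps(2) Om_comp[OF S_homD(4)[OF g] S_homD(4)[OF f]])
qed

lemma \<sigma>_hom:
  assumes X: "is_prespectrum M T X"
  shows "\<sigma> X \<in> hom S X (Th_ob X)"
  unfolding \<sigma>_def
proof (rule S_homI[OF X Th_spectrum(1)[OF X]])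
  show "ab X n \<in> hom M (lev X n) (lev (Th_ob X) n)" for n using ab_hom[OF X] by (simp add: Th_ob_def)
  fix n
  note h = \<epsilon>_hom[OF spectrum_hom(1)[OF X, of "Suc n"]] T_hom[OF ab_hom[OF X, of n]] ab_hom[OF X, of "Suc n"]
  have "\<epsilon> (lev X (Suc n)) \<bullet> amap T (ab X n) = bond X n"
    unfolding ab_adjoint by (rule adjoint_inverse[OF spectrum_hom[OF X]])
  then show "ab X (Suc n) \<bullet> bond X n = bond (Th_ob X) n \<bullet> amap T (ab X n)"
    using h by (simp add: Th_spectrum(2)[OF X] hom_def)
qed

lemma \<sigma>_nat: "nat_trans S S id_ftr Th \<sigma>"
  unfolding nat_trans_def
proof (intro conjI ballI)
  show "\<sigma> X \<in> hom S (omap id_ftr X) (omap Th X)" if "X \<in> ob S" for X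
    using \<sigma>_hom that by (simp add: S_simps(1) Th_simps id_ftr_def)
  fix \<phi> assume "\<phi> \<in> arr S"
  then have f: "\<phi> \<in> hom S (src S \<phi>) (tgt S \<phi>)" by (rule S.hom_self)
  note f' = S_homD[OF f]
  show "\<sigma> (tgt S \<phi>) \<star> amap id_ftr \<phi> = amap Th \<phi> \<star> \<sigma> (src S \<phi>)"
    unfolding id_ftr_def ftr.simps
    by (rule S_eqI[OF S_comp[OF f \<sigma>_hom[OF f'(3)]] S_comp[OF \<sigma>_hom[OF f'(2)] Th_map[OF f]]])
      (simp add: Th_simps(2,3) ab_nat[OF f])
qed

lemma Th_\<sigma>:
  assumes X: "is_prespectrum M T X"
  shows "amap Th (\<sigma> X) = \<sigma> (omap Th X)"
  unfolding Th_simps(4)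
proof (rule S_eqI[OF Th_map[OF \<sigma>_hom[OF X]] \<sigma>_hom[OF Th_spectrum(1)[OF X]]])
  fix n
  note o = spectrum_hom(1)[OF X]
  have "ab (Th_ob X) n = amap \<Omega> (ab X (Suc n))"
    unfolding ab_adjoint[of "Th_ob X"]
    using adjoint_surj[OF Om_ob[OF o] Om_ob[OF o] Om_hom[OF ab_hom[OF X, of "Suc n"]]] by (simp add: Th_ob_def)
  then show "lv (amap Th (\<sigma> X)) n = lv (\<sigma> (Th_ob X)) n" by (simp add: Th_simps(2,3))
qed

end

section \<open>The level model structure satisfies the hypotheses of the stabilization\<close>

locale spt_model = spt M U T \<Omega> \<eta> \<epsilon>
    + C: spt_ffact M U T \<Omega> \<eta> \<epsilon> "Cof M" "Fib M \<inter> Eqv M" m l r e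
    + A: spt_ffact M U T \<Omega> \<eta> \<epsilon> "Cof M \<inter> Eqv M" "Fib M" m' l' r' e'
  for M :: "('o, 'a, 'z) mcat_scheme" and U :: "'u itself" and T \<Omega> :: "('o, 'a, 'o, 'a) ftr"
    and \<eta> \<epsilon> :: "'o \<Rightarrow> 'a" and m l r e m' l' r' e' +
  assumes homotopical: "seq_colimits_of_cofibrations_homotopical M"
    and sends: "sends_seq_colimits_to_hocolims M \<Omega>"
begin

notation comp (infixr "\<bullet>" 65)
notation scomp (infixr "\<star>" 65)

lemma C_factor:
  assumes f: "\<phi> \<in> hom S X Y"
  shows "C.js \<phi> \<in> Cof S" "C.ps \<phi> \<in> Fib S \<inter> Eqv S" "lv (C.js \<phi>) n \<in> Cof M"
proof -
  have "lifts_against S (C.js \<phi>) p" if p: "p \<in> Fib S \<inter> Eqv S" for p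
  proof -
    have ph: "p \<in> hom S (src S p) (tgt S p)" using p by (auto simp: S_classes(1) hom_def)
    show ?thesis
      by (rule C.js_lifts[OF f ph lift_afib]) (use p in \<open>auto simp: S_classes(1,2)\<close>)
  qed
  then show "C.js \<phi> \<in> Cof S" using C.js[OF f] unfolding S_classes(3) by (auto simp: hom_def)
  show "C.ps \<phi> \<in> Fib S \<inter> Eqv S"
    using S_class_iff[OF C.ps[OF f]] C.pn_B[OF f] by (simp add: C.lv_ps)
  show "lv (C.js \<phi>) n \<in> Cof M"
    unfolding C.lv_js by (rule C.jn_A[OF f]) (auto intro: T_classes cof_comp cof_pushout)
qed

lemma A_factor:
  assumes f: "\<phi> \<in> hom S X Y"
  shows "A.js \<phi> \<in> Cof S \<inter> Eqv S" "A.ps \<phi> \<in> Fib S" "p \<in> Fib S \<Longrightarrow> lifts_against S (A.js \<phi>) p"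
proof -
  show L: "lifts_against S (A.js \<phi>) p" if p: "p \<in> Fib S" for p
  proof -
    have ph: "p \<in> hom S (src S p) (tgt S p)" using p by (auto simp: S_classes(1) hom_def)
    show ?thesis
      by (rule A.js_lifts[OF f ph lift_acof]) (use p in \<open>auto simp: S_classes(1,2)\<close>)
  qed
  have "jn \<in> Cof M \<inter> Eqv M" if "jn = A.jn \<phi> n" for n jn
    unfolding that by (rule A.jn_A[OF f])
      (auto intro: T_classes cof_comp cof_pushout eqv_comp acof_pushout)
  then have "A.js \<phi> \<in> Eqv S" using S_class_iff(2)[OF A.js[OF f]] by (simp add: A.lv_js)
  then show "A.js \<phi> \<in> Cof S \<inter> Eqv S" using L A.js[OF f] unfolding S_classes(3) by (auto simp: hom_def)
  show "A.ps \<phi> \<in> Fib S" using S_class_iff(1)[OF A.ps[OF f]] A.pn_B[OF f] by (simp add: A.lv_ps)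
qed

lemma S_eqv_two_out_of_three: "two_out_of_three S (Eqv S)"
  unfolding two_out_of_three_def
proof (intro ballI impI)
  fix \<phi> \<psi> assume "\<phi> \<in> arr S" "\<psi> \<in> arr S" "tgt S \<phi> = src S \<psi>"
  then have f: "\<phi> \<in> hom S (src S \<phi>) (src S \<psi>)" and g: "\<psi> \<in> hom S (src S \<psi>) (tgt S \<psi>)" by (auto simp: hom_def)
  note f' = S_homD(4)[OF f] and g' = S_homD(4)[OF g]
  show "(\<phi> \<in> Eqv S \<and> \<psi> \<in> Eqv S \<longrightarrow> \<psi> \<star> \<phi> \<in> Eqv S) \<and> (\<phi> \<in> Eqv S \<and> \<psi> \<star> \<phi> \<in> Eqv S \<longrightarrow> \<psi> \<in> Eqv S) \<and>
    (\<psi> \<in> Eqv S \<and> \<psi> \<star> \<phi> \<in> Eqv S \<longrightarrow> \<phi> \<in> Eqv S)"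
    unfolding S_class_iff(2)[OF f] S_class_iff(2)[OF g] S_class_iff(2)[OF S_comp[OF f g]] lv_simps(2)
    using eqv_comp[OF f' g'] eqv_cancel_right[OF f' g'] eqv_cancel_left[OF f' g'] by blast
qed

text \<open>The definition of \<open>Cof S\<close> gives lifts against acyclic fibrations only. In
  the factorization of \<open>i\<close>, the factor \<open>A.js i\<close> lifts against all
  fibrations by construction and \<open>A.ps i\<close> is an acyclic fibration by two-out-of-three;
  so \<open>i\<close> lifts against \<open>A.ps i\<close> and inherits the lifting property of
  \<open>A.js i\<close>.\<close>

lemma S_acof_lift:
  assumes i: "i \<in> Cof S" "i \<in> Eqv S" and p: "p \<in> Fib S"
  shows "lifts_against S i p"
proof -
  have f: "i \<in> hom S (src S i) (tgt S i)" using i by (simp add: S_classes(2) hom_def)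
  note j = A.js[OF f] and q = A.ps[OF f]
  have "A.ps i \<in> Eqv S"
    using two_out_of_threeD(2)[OF S_eqv_two_out_of_three j q] A_factor(1)[OF f] A.ps_js[OF f] i by simp
  then have "lifts_against S i (A.ps i)" using i(1) A_factor(2)[OF f] unfolding S_classes(3) by blast
  then have "lifts_against S (A.ps i \<star> A.js i) p"
    using S.lifts_factor_left[OF j q _ _ A_factor(3)[OF f p]] p A.ps_js[OF f] by (simp add: S_classes(1))
  then show ?thesis using A.ps_js[OF f] by simp
qed

lemma S_model: "model_category U S"
  unfolding model_category_def
proof (intro conjI ballI)
  show "bicomplete U S" by (rule S_bicomplete)
  show "Cof S \<subseteq> arr S" "Eqv S \<subseteq> arr S" "Fib S \<subseteq> arr S" unfolding S_classes by auto
  show "two_out_of_three S (Eqv S)" by (rule S_eqv_two_out_of_three)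
  show "closed_under_retracts S (Eqv S)" "closed_under_retracts S (Fib S)"
  proof -
    have "\<phi> \<in> Eqv S" if "\<psi> \<in> Eqv S" and r: "retract_of S \<phi> \<psi>" for \<phi> \<psi>
    proof -
      have "\<phi> \<in> arr S" using r by (simp add: retract_of_def)
      then show ?thesis using that retract_classes(2)[OF ev_retract[OF r]] by (simp add: S_classes(2))
    qed
    moreover have "\<phi> \<in> Fib S" if "\<psi> \<in> Fib S" and r: "retract_of S \<phi> \<psi>" for \<phi> \<psi>
    proof -
      have "\<phi> \<in> arr S" using r by (simp add: retract_of_def)
      then show ?thesis using that retract_classes(3)[OF ev_retract[OF r]] by (simp add: S_classes(1))
    qed
    ultimately show "closed_under_retracts S (Eqv S)" "closed_under_retracts S (Fib S)"
      unfolding closed_under_retracts_def by blast+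
  qed
  show "closed_under_retracts S (Cof S)"
    unfolding closed_under_retracts_def
  proof (intro allI impI)
    fix \<phi> \<psi> assume a: "\<psi> \<in> Cof S \<and> retract_of S \<phi> \<psi>"
    have "lifts_against S \<phi> p" if "p \<in> Fib S \<inter> Eqv S" for p
      using S.lifts_retract_left[of \<phi> \<psi> p] a that unfolding S_classes(3) by (simp add: S_classes(1))
    moreover have "\<phi> \<in> arr S" using a by (simp add: retract_of_def)
    ultimately show "\<phi> \<in> Cof S" unfolding S_classes(3) by blast
  qed
  show "lifts_against S i p" if "i \<in> Cof S \<inter> Eqv S" "p \<in> Fib S" for i p using S_acof_lift that by blast
  show "lifts_against S i p" if "i \<in> Cof S" "p \<in> Fib S \<inter> Eqv S" for i p
    using that unfolding S_classes(3) by blast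
  fix \<phi> assume "\<phi> \<in> arr S"
  then have f: "\<phi> \<in> hom S (src S \<phi>) (tgt S \<phi>)" by (rule S.hom_self)
  show "factors_as S (Cof S \<inter> Eqv S) (Fib S) \<phi>"
    by (rule factors_asI[OF A.js[OF f] A.ps[OF f] A_factor(1,2)[OF f] A.ps_js[OF f] f])
  show "factors_as S (Cof S) (Fib S \<inter> Eqv S) \<phi>"
    by (rule factors_asI[OF C.js[OF f] C.ps[OF f] C_factor(1,2)[OF f] C.ps_js[OF f] f])
qed

sublocale S: model_cat S U
  by (rule model_cat_intro[OF S_model uncountable])

text \<open>By the retract argument a cofibration is a retract of its constructed factor
  \<open>C.js i\<close>, which is a cofibration at each level. This turns a sequence of cofibrations
  of prespectra into such sequences in \<open>M\<close>.\<close>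

lemma cof_level:
  assumes i: "i \<in> Cof S"
  shows "lv i n \<in> Cof M"
proof -
  have f: "i \<in> hom S (src S i) (tgt S i)" using i unfolding S_classes(3) by (simp add: hom_def)
  have "lifts_against S i (C.ps i)" using i C_factor(2)[OF f] unfolding S_classes(3) by blast
  then have "retract_of S i (C.js i)"
    using S.retract_left[OF C.js[OF f] C.ps[OF f]] C.ps_js[OF f] by simp
  then show ?thesis using ev_retract[of i "C.js i" n] retract_classes(1) C_factor(3)[OF f] by blast
qed

lemma S_fibrant: "is_prespectrum M T X \<Longrightarrow> fibrant S X \<longleftrightarrow> (\<forall>n. fibrant M (lev X n))"
proof -
  assume X: "is_prespectrum M T X"
  obtain t where t: "terminal S t" "\<And>n. terminal M (lev t n)" using S_terminal by blast
  have "X \<in> ob S" using X by (simp add: S_simps(1))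
  then obtain f where f: "f \<in> hom S X t" using S.terminal_hom[OF t(1)] by blast
  show ?thesis
    using S.fibrant_terminal[OF t(1) f] S_class_iff(1)[OF f] fibrant_terminal[OF t(2) S_homD(4)[OF f]] by simp
qed

lemma S_cofibrant: "cofibrant S X \<Longrightarrow> cofibrant M (lev X n)"
proof -
  assume X: "cofibrant S X"
  obtain t where t: "initial S t" "\<And>n. initial M (lev t n)" using S_initial by blast
  have "X \<in> ob S" using X by (simp add: cofibrant_def)
  then obtain f where f: "f \<in> hom S t X" using S.initial_hom[OF t(1)] by blast
  have "f \<in> Cof S" using S.cofibrant_initial[OF t(1) f] X by simp
  then show ?thesis using cofibrant_initial[OF t(2) S_homD(4)[OF f]] cof_level by blast
qed

lemma cof_seq_level: "cof_seq S X s \<Longrightarrow> cof_seq M (\<lambda>i. lev (X i) n) (\<lambda>i. lv (s i) n)"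
  using seq_level cof_level by (simp add: cof_seq_def)

lemma levelwise_eqv_level:
  assumes "levelwise_eqv S X s Y t f"
  shows "levelwise_eqv M (\<lambda>i. lev (X i) n) (\<lambda>i. lv (s i) n) (\<lambda>i. lev (Y i) n) (\<lambda>i. lv (t i) n) (\<lambda>i. lv (f i) n)"
  using assms seq_map_level by (auto simp: levelwise_eqv_def S_classes(2))

lemma S_homotopical: "seq_colimits_of_cofibrations_homotopical S"
  unfolding seq_colimits_of_cofibrations_homotopical_def
proof (intro allI impI, elim conjE)
  fix X s Y t f c \<iota> d \<kappa> h
  assume X: "cof_seq S X s" and Y: "cof_seq S Y t" and f: "levelwise_eqv S X s Y t f"
    and c: "seq_colimit S X s c \<iota>" and d: "seq_colimit S Y t d \<kappa>"
    and h: "h \<in> hom S c d" and e: "\<forall>i. h \<star> \<iota> i = \<kappa> i \<star> f i"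
  have "lv h n \<in> Eqv M" for n
  proof (rule homotopical[unfolded seq_colimits_of_cofibrations_homotopical_def, rule_format], intro conjI)
    show "cof_seq M (\<lambda>i. lev (X i) n) (\<lambda>i. lv (s i) n)" "cof_seq M (\<lambda>i. lev (Y i) n) (\<lambda>i. lv (t i) n)"
      using X Y cof_seq_level by auto
    show "levelwise_eqv M (\<lambda>i. lev (X i) n) (\<lambda>i. lv (s i) n) (\<lambda>i. lev (Y i) n) (\<lambda>i. lv (t i) n) (\<lambda>i. lv (f i) n)"
      by (rule levelwise_eqv_level[OF f])
    show "seq_colimit M (\<lambda>i. lev (X i) n) (\<lambda>i. lv (s i) n) (lev c n) (\<lambda>i. lv (\<iota> i) n)"
      "seq_colimit M (\<lambda>i. lev (Y i) n) (\<lambda>i. lv (t i) n) (lev d n) (\<lambda>i. lv (\<kappa> i) n)"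
      using seq_colimit_level c d X Y by (auto simp: cof_seq_def)
    show "lv h n \<in> hom M (lev c n) (lev d n)" by (rule S_homD(4)[OF h])
    show "\<forall>i. lv h n \<bullet> lv (\<iota> i) n = lv (\<kappa> i) n \<bullet> lv (f i) n"
    proof
      fix i show "lv h n \<bullet> lv (\<iota> i) n = lv (\<kappa> i) n \<bullet> lv (f i) n"
        using arg_cong[OF e[rule_format, of i], where f = "\<lambda>\<phi>. lv \<phi> n"] by simp
    qed
  qed
  then show "h \<in> Eqv S" using S_class_iff(2)[OF h] by simp
qed

lemma S_sends: "sends_seq_colimits_to_hocolims S Th"
  unfolding sends_seq_colimits_to_hocolims_def
proof (intro allI impI, elim conjE)
  fix X s c \<iota> F u p Z \<zeta> z
  assume X: "cof_seq S X s" and c: "seq_colimit S X s c \<iota>" and F: "is_seq S F u"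
    and Ff: "\<forall>i. fibrant S (F i)" and p: "levelwise_eqv S X s F u p" and Z: "fibrant S Z"
    and co: "seq_cocone S F u Z \<zeta>" and z: "z \<in> hom S c Z" "z \<in> Eqv S" and e: "\<forall>i. z \<star> \<iota> i = \<zeta> i \<star> p i"
  have Fo: "is_prespectrum M T (F i)" and uh: "u i \<in> hom S (F i) (F (Suc i))" for i
    using F by (auto simp: is_seq_def S_simps(1))
  have Zo: "is_prespectrum M T Z" and \<zeta>h: "\<zeta> i \<in> hom S (F i) Z" and \<zeta>s: "\<zeta> (Suc i) \<star> u i = \<zeta> i" for i
    using co by (auto simp: seq_cocone_def S_simps(1))
  have lvl: "seq_hocolim M (\<lambda>i. omap \<Omega> (lev (F i) n)) (\<lambda>i. amap \<Omega> (lv (u i) n)) (omap \<Omega> (lev Z n))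
      (\<lambda>i. amap \<Omega> (lv (\<zeta> i) n))" for n
  proof (rule sends[unfolded sends_seq_colimits_to_hocolims_def, rule_format], intro conjI)
    show "cof_seq M (\<lambda>i. lev (X i) n) (\<lambda>i. lv (s i) n)" by (rule cof_seq_level[OF X])
    show "seq_colimit M (\<lambda>i. lev (X i) n) (\<lambda>i. lv (s i) n) (lev c n) (\<lambda>i. lv (\<iota> i) n)"
      using seq_colimit_level c X by (auto simp: cof_seq_def)
    show "is_seq M (\<lambda>i. lev (F i) n) (\<lambda>i. lv (u i) n)" by (rule seq_level[OF F])
    show "\<forall>i. fibrant M (lev (F i) n)" using Ff S_fibrant[OF Fo] by blast
    show "levelwise_eqv M (\<lambda>i. lev (X i) n) (\<lambda>i. lv (s i) n) (\<lambda>i. lev (F i) n) (\<lambda>i. lv (u i) n) (\<lambda>i. lv (p i) n)"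
      by (rule levelwise_eqv_level[OF p])
    show "fibrant M (lev Z n)" using Z S_fibrant[OF Zo] by blast
    show "seq_cocone M (\<lambda>i. lev (F i) n) (\<lambda>i. lv (u i) n) (lev Z n) (\<lambda>i. lv (\<zeta> i) n)"
      by (rule seq_cocone_level[OF co])
    show "lv z n \<in> hom M (lev c n) (lev Z n)" by (rule S_homD(4)[OF z(1)])
    show "lv z n \<in> Eqv M" using z S_class_iff(2)[OF z(1)] by simp
    show "\<forall>i. lv z n \<bullet> lv (\<iota> i) n = lv (\<zeta> i) n \<bullet> lv (p i) n"
    proof
      fix i show "lv z n \<bullet> lv (\<iota> i) n = lv (\<zeta> i) n \<bullet> lv (p i) n"
        using arg_cong[OF e[rule_format, of i], where f = "\<lambda>\<phi>. lv \<phi> n"] by simp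
    qed
  qed
  show "seq_hocolim S (\<lambda>i. omap Th (F i)) (\<lambda>i. amap Th (u i)) (omap Th Z) (\<lambda>i. amap Th (\<zeta> i))"
    unfolding seq_hocolim_def
  proof (intro conjI allI impI, goal_cases)
    case 1
    have "F i \<in> ob S" for i using F by (simp add: is_seq_def)
    then show ?case
      unfolding is_seq_def using functor_ob[OF Th_functor] functor_hom[OF Th_functor uh] by blast
  next
    case 2
    have "amap Th (\<zeta> (Suc i)) \<star> amap Th (u i) = amap Th (\<zeta> i)" for i
      using functor_comp[OF Th_functor \<zeta>h[of "Suc i"] uh[of i]] \<zeta>s[of i] by simp
    moreover have "Z \<in> ob S" using co by (simp add: seq_cocone_def)
    ultimately show ?case
      unfolding seq_cocone_def using functor_ob[OF Th_functor] functor_hom[OF Th_functor \<zeta>h] by blast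
  next
    case (3 Y y f d \<kappa> h)
    then have Y: "cofibrant S (Y 0)" "cof_seq S Y y" and f: "levelwise_eqv S Y y (\<lambda>i. omap Th (F i)) (\<lambda>i. amap Th (u i)) f"
      and d: "seq_colimit S Y y d \<kappa>" and h: "h \<in> hom S d (omap Th Z)"
      and he: "\<And>i. h \<star> \<kappa> i = amap Th (\<zeta> i) \<star> f i" by auto
    have "lv h n \<in> Eqv M" for n
    \<comment> \<open>Level \<open>n\<close> of \<open>Th\<close> is \<Omega> of level
      \<open>n + 1\<close>, hence the index \<open>Suc n\<close>.\<close>
    proof (rule lvl[of "Suc n", unfolded seq_hocolim_def, THEN conjunct2, THEN conjunct2, rule_format], intro conjI)
      show "cofibrant M (lev (Y 0) n)" by (rule S_cofibrant[OF Y(1)])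
      show "cof_seq M (\<lambda>i. lev (Y i) n) (\<lambda>i. lv (y i) n)" by (rule cof_seq_level[OF Y(2)])
      show "levelwise_eqv M (\<lambda>i. lev (Y i) n) (\<lambda>i. lv (y i) n) (\<lambda>i. omap \<Omega> (lev (F i) (Suc n)))
          (\<lambda>i. amap \<Omega> (lv (u i) (Suc n))) (\<lambda>i. lv (f i) n)"
        using levelwise_eqv_level[OF f, of n] by (simp add: Th_simps(1,2))
      show "seq_colimit M (\<lambda>i. lev (Y i) n) (\<lambda>i. lv (y i) n) (lev d n) (\<lambda>i. lv (\<kappa> i) n)"
        using seq_colimit_level d Y by (auto simp: cof_seq_def)
      show "lv h n \<in> hom M (lev d n) (omap \<Omega> (lev Z (Suc n)))"
        using S_homD(4)[OF h, of n] by (simp add: Th_simps(1))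
      show "\<forall>i. lv h n \<bullet> lv (\<kappa> i) n = amap \<Omega> (lv (\<zeta> i) (Suc n)) \<bullet> lv (f i) n"
      proof
        fix i show "lv h n \<bullet> lv (\<kappa> i) n = amap \<Omega> (lv (\<zeta> i) (Suc n)) \<bullet> lv (f i) n"
          using arg_cong[OF he[of i], where f = "\<lambda>\<phi>. lv \<phi> n"] by (simp add: Th_simps(2))
      qed
    qed
    then show ?case using S_class_iff(2)[OF h] by simp
  qed
qed

lemma S_stab:
  "stab S U C.Zs C.js C.ps (\<lambda>\<phi> \<psi> u v. (C.Zs \<phi>, C.en \<phi> \<psi> u v, C.Zs \<psi>))
     A.Zs A.js A.ps (\<lambda>\<phi> \<psi> u v. (A.Zs \<phi>, A.en \<phi> \<psi> u v, A.Zs \<psi>)) Th \<sigma>"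
proof -
  interpret c: ffact S "Cof S" "Fib S \<inter> Eqv S" C.Zs C.js C.ps "\<lambda>\<phi> \<psi> u v. (C.Zs \<phi>, C.en \<phi> \<psi> u v, C.Zs \<psi>)"
    by (rule C.S_ffact[OF C_factor(1,2)])
  interpret a: ffact S "Cof S \<inter> Eqv S" "Fib S" A.Zs A.js A.ps "\<lambda>\<phi> \<psi> u v. (A.Zs \<phi>, A.en \<phi> \<psi> u v, A.Zs \<psi>)"
    by (rule A.S_ffact[OF A_factor(1,2)])
  show ?thesis
  proof unfold_locales
    show "seq_colimits_of_cofibrations_homotopical S" by (rule S_homotopical)
    show "is_functor S S Th" by (rule Th_functor)
    show "nat_trans S S id_ftr Th \<sigma>" by (rule \<sigma>_nat)
    show "amap Th (\<sigma> X) = \<sigma> (omap Th X)" if "X \<in> ob S" for X using Th_\<sigma> that by (simp add: S_simps(1))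
    show "sends_seq_colimits_to_hocolims S Th" by (rule S_sends)
    show "fibrant S (omap Th X)" if X: "fibrant S X" for X
    proof -
      have Xo: "is_prespectrum M T X" using S.fibrant_ob[OF X] by (simp add: S_simps(1))
      have "is_prespectrum M T (omap Th X)" using Th_spectrum(1)[OF Xo] by (simp add: Th_simps(4))
      then show ?thesis using S_fibrant[OF Xo] S_fibrant[of "omap Th X"] X Om_fibrant by (simp add: Th_simps(1))
    qed
    show "amap Th p \<in> Eqv S" if p: "p \<in> Fib S" "p \<in> Eqv S" for p
    proof -
      have ph: "p \<in> hom S (src S p) (tgt S p)" using p by (simp add: S_classes(1) hom_def)
      show ?thesis
        using S_class_iff(2)[OF Th_map[OF ph]] S_class_iff[OF ph] p Om_afib by (simp add: Th_simps(2))
    qed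
  qed
qed

end

theorem theorem6p19:
  fixes M :: "('o, 'a) mcat"
    and T \<Omega> :: "('o, 'a, 'o, 'a) ftr"
    and \<eta> \<epsilon> :: "'o \<Rightarrow> 'a"
  assumes "uncountable (UNIV :: 'u set)"
    and "model_category TYPE('u) M"
    and "has_functorial_factorizations M"
    and "seq_colimits_of_cofibrations_homotopical M"
    and "Quillen_adjunction M M T \<Omega> \<eta> \<epsilon>"
    and "sends_seq_colimits_to_hocolims M \<Omega>"
  shows "\<exists>(W :: ('o, 'a) spt_map set) (L :: (('o, 'a) prespectrum, ('o, 'a) spt_map) mcat).
    left_Bousfield_localization TYPE('u) TYPE('p) TYPE('q) (level_structure M T) W L id_ftr \<and>
    presents_Omega_spectra M T \<Omega> \<eta> L"
proof -
  interpret model_cat M "TYPE('u)" by (rule model_cat_intro[OF assms(2,1)])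
  obtain m l r e where c: "ffact M (Cof M) (Fib M \<inter> Eqv M) m l r e"
    using ffact_ex[OF category] assms(3) unfolding has_functorial_factorizations_def by blast
  obtain m' l' r' e' where a: "ffact M (Cof M \<inter> Eqv M) (Fib M) m' l' r' e'"
    using ffact_ex[OF category] assms(3) unfolding has_functorial_factorizations_def by blast
  interpret spt M "TYPE('u)" T \<Omega> \<eta> \<epsilon>
    by unfold_locales (use assms(5) in \<open>auto simp: Quillen_adjunction_def\<close>)
  interpret C: spt_ffact M "TYPE('u)" T \<Omega> \<eta> \<epsilon> "Cof M" "Fib M \<inter> Eqv M" m l r e
    by (intro spt_ffact.intro c spt_axioms)
  interpret A: spt_ffact M "TYPE('u)" T \<Omega> \<eta> \<epsilon> "Cof M \<inter> Eqv M" "Fib M" m' l' r' e'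
    by (intro spt_ffact.intro a spt_axioms)
  interpret spt_model M "TYPE('u)" T \<Omega> \<eta> \<epsilon> m l r e m' l' r' e'
    by unfold_locales (use assms in auto)
  interpret St: stab S "TYPE('u)" C.Zs C.js C.ps "\<lambda>\<phi> \<psi> u v. (C.Zs \<phi>, C.en \<phi> \<psi> u v, C.Zs \<psi>)"
     A.Zs A.js A.ps "\<lambda>\<phi> \<psi> u v. (A.Zs \<phi>, A.en \<phi> \<psi> u v, A.Zs \<psi>)" Th \<sigma>
    by (rule S_stab)
  have loc: "left_Bousfield_localization TYPE('u) TYPE('p) TYPE('q) S St.EqL St.Loc id_ftr"
    unfolding left_Bousfield_localization_def
  proof (intro conjI allI impI)
    show "St.EqL \<subseteq> arr S" by (auto simp: St.EqL_def)
    show "coSpitzweck TYPE('u) St.Loc" by (rule St.coSpitzweck_Loc)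
    show "left_Quillen TYPE('u) S St.Loc id_ftr" by (rule St.Loc_left_Quillen)
    show "amap id_ftr ` St.EqL \<subseteq> Eqv St.Loc" by (simp add: id_ftr_def)
    fix P :: "('p, 'q) mcat" and F
    assume F: "coSpitzweck TYPE('u) P \<and> left_Quillen TYPE('u) S P F \<and> amap F ` St.EqL \<subseteq> Eqv P"
    then have "left_Quillen TYPE('u) St.Loc P F" using St.Loc_Quillen_factor by blast
    then show "\<exists>G. left_Quillen TYPE('u) St.Loc P G \<and> same_functor S (comp_ftr G id_ftr) F \<and>
        (\<forall>G'. left_Quillen TYPE('u) St.Loc P G' \<and> same_functor S (comp_ftr G' id_ftr) F \<longrightarrow>
           same_functor St.Loc G' G)"
      \<comment> \<open>The localization functor is the identity on objects and arrows, so
        \<open>F\<close> is the only possible factor.\<close>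
      by (intro exI[of _ F]) (auto simp: same_functor_def comp_ftr_def id_ftr_def)
  qed
  \<comment> \<open>\<open>\<sigma> X\<close> consists of the adjoint structure maps, so its being a
    level equivalence is the condition on \<Omega>-spectra; outside prespectra both sides are
    false.\<close>
  have local: "St.local X \<longleftrightarrow> fibrant S X \<and> is_Omega_spectrum M T \<Omega> \<eta> X" for X
  proof (cases "is_prespectrum M T X")
    case True
    then show ?thesis
      using S_class_iff(2)[OF \<sigma>_hom[OF True]] by (simp add: St.local_def is_Omega_spectrum_def Th_simps(3))
  next
    case False
    then show ?thesis using S.fibrant_ob by (auto simp: St.local_def S_simps(1))
  qed
  have "cat.truncate St.Loc = Spt M T"
    using S_fields unfolding cat.truncate_def St.Loc_simps by simp
  moreover have "{X. fibrant St.Loc X} = {X. fibrant S X \<and> is_Omega_spectrum M T \<Omega> \<eta> X}"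
    using St.fibrant_Loc local by simp
  moreover have "{X. St.local X} = {X. fibrant S X \<and> is_Omega_spectrum M T \<Omega> \<eta> X}" using local by simp
  then have "equivalence_of_categories (full_subcategory (Ho S) {X. fibrant S X \<and> is_Omega_spectrum M T \<Omega> \<eta> X})
      (Ho St.Loc) (Ho_comparison St.Loc)"
    using St.Loc_Ho by simp
  ultimately have "presents_Omega_spectra M T \<Omega> \<eta> St.Loc"
    unfolding presents_Omega_spectra_def Let_def by blast
  with loc show ?thesis by blast
qed

end
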